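(* Let $R=\bigoplus_{i\ge0}R_i$ be a Noetherian positively graded ring with $R_0$ a field and $\mathfrak m_R=\bigoplus_{i>0}R_i$ (not assumed Cohen--Macaulay). Assume that $R$ is generically Gorenstein, that $\omega_R$ contains a torsion-free homogeneous element of degree $-a_R$, and that $\operatorname{tr}_R(\omega_R)$ contains an $R$-regular sequence $\theta_1,\theta_2\in R_{\operatorname{indeg}_R(\mathfrak m_R)}$. If $\dim_{R_0}([\omega_R]_{-a_R})=1$, then $R$ is quasi-Gorenstein.
   Context: All rings are commutative. The graded canonical module is $\omega_R={}^*\mathrm{Hom}_R({}^*\mathrm H^{d}_{\mathfrak m_R}(R),E_R)$, where $d=\dim R$, ${}^*\mathrm H^d_{\mathfrak m_R}(R)$ is graded local cohomology and $E_R$ is the graded injective envelope of $R_0=R/\mathfrak m_R$. The $a$-invariant is $a_R=-\min\{i\in\mathbb Z:[\omega_R]_i\neq 0\}$. $\operatorname{tr}_R(\omega_R)$ is the sum of the images of all graded $R$-homomorphisms (of arbitrary degree) $\omega_R\to R$. $\operatorname{indeg}_R(\mathfrak m_R)=\min\{i:[\mathfrak m_R]_i\neq0\}$. $R$ is generically Gorenstein if $R_{\mathfrak p}$ is Gorenstein for every $\mathfrak p\in\operatorname{Ass}(R)$. An element $x$ of an $R$-module is torsion-free if $rx=0$ with $r\in R$ implies $r=0$. $R$ is quasi-Gorenstein if $\omega_R\cong R$ as graded $R$-modules up to degree shift. *)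

theory Defs
  imports
    "HOL-Algebra.Ring_Divisibility"
    "HOL-Algebra.Ideal_Product"
    "HOL-Library.Extended_Nat"
    "Jordan_Normal_Form.Missing_VectorSpace"
begin

section \<open>Graded rings and graded modules\<close>

text \<open>All gradings are indexed by \<^typ>\<open>int\<close>; a non-negatively graded ring has zero pieces in
  negative degrees.\<close>

record 'a graded_ring = "'a ring" +
  rgrade :: "int \<Rightarrow> 'a set"

record ('a, 'b) graded_module = "('a, 'b) module" +
  grade :: "int \<Rightarrow> 'b set"

definition homogeneous_decomposition ::
    "('b, 'c) ring_scheme \<Rightarrow> (int \<Rightarrow> 'b set) \<Rightarrow> (int \<Rightarrow> 'b) \<Rightarrow> 'b \<Rightarrow> bool" where
  "homogeneous_decomposition M gr f x \<longleftrightarrow>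
     (\<forall>i. f i \<in> gr i) \<and> finite {i. f i \<noteq> \<zero>\<^bsub>M\<^esub>} \<and>
     x = (\<Oplus>\<^bsub>M\<^esub> i \<in> {i. f i \<noteq> \<zero>\<^bsub>M\<^esub>}. f i)"

definition internal_direct_sum :: "('b, 'c) ring_scheme \<Rightarrow> (int \<Rightarrow> 'b set) \<Rightarrow> bool" where
  "internal_direct_sum M gr \<longleftrightarrow>
     (\<forall>i. additive_subgroup (gr i) M) \<and>
     (\<forall>x \<in> carrier M. \<exists>!f. homogeneous_decomposition M gr f x)"

locale nonneg_graded_ring = cring R for R :: "'a graded_ring" (structure) +
  assumes direct_sum: "internal_direct_sum R (rgrade R)"
    and mult_degree: "\<lbrakk>x \<in> rgrade R i; y \<in> rgrade R j\<rbrakk> \<Longrightarrow> x \<otimes> y \<in> rgrade R (i + j)"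
    and negative_degree: "i < 0 \<Longrightarrow> rgrade R i = {\<zero>}"

locale graded_module = module R M
  for R :: "'a graded_ring" and M :: "('a, 'b) graded_module" (structure) +
  assumes direct_sum: "internal_direct_sum M (grade M)"
    and smult_degree: "\<lbrakk>r \<in> rgrade R i; x \<in> grade M j\<rbrakk> \<Longrightarrow> r \<odot>\<^bsub>M\<^esub> x \<in> grade M (i + j)"

definition irrelevant_ideal :: "'a graded_ring \<Rightarrow> 'a set" where
  "irrelevant_ideal R =
     {x. \<exists>f. homogeneous_decomposition R (rgrade R) f x \<and> (\<forall>i \<le> 0. f i = \<zero>\<^bsub>R\<^esub>)}"

definition initial_degree :: "('b, 'c) ring_scheme \<Rightarrow> (int \<Rightarrow> 'b set) \<Rightarrow> int" where
  "initial_degree M gr = (LEAST i. gr i \<noteq> {\<zero>\<^bsub>M\<^esub>})"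

definition self_module :: "('a, 'c) ring_scheme \<Rightarrow> ('a, 'a) module" where
  "self_module R = \<lparr>carrier = carrier R, monoid.mult = monoid.mult R,
     one = \<one>\<^bsub>R\<^esub>, ring.zero = \<zero>\<^bsub>R\<^esub>, ring.add = ring.add R,
     smult = monoid.mult R\<rparr>"

definition graded_self :: "'a graded_ring \<Rightarrow> ('a, 'a) graded_module" where
  "graded_self R = \<lparr>carrier = carrier R, monoid.mult = monoid.mult R,
     one = \<one>\<^bsub>R\<^esub>, ring.zero = \<zero>\<^bsub>R\<^esub>, ring.add = ring.add R,
     smult = monoid.mult R, grade = rgrade R\<rparr>"

text \<open>The fields \<^const>\<open>monoid.mult\<close> and \<^const>\<open>one\<close>, which modules inherit from rings, carry no
  meaning for modules and are filled with arbitrary values below.\<close>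

definition graded_restrict :: "('a, 'b) graded_module \<Rightarrow> 'b set \<Rightarrow> ('a, 'b) graded_module" where
  "graded_restrict M U = M\<lparr>carrier := U, grade := (\<lambda>i. grade M i \<inter> U)\<rparr>"

definition graded_quotient :: "('a, 'b) graded_module \<Rightarrow> 'b set \<Rightarrow> ('a, 'b set) graded_module" where
  "graded_quotient M N = \<lparr>carrier = a_rcosets\<^bsub>M\<^esub> N, monoid.mult = (\<lambda>_ _. N), one = N, ring.zero = N,
     ring.add = set_add M, smult = (\<lambda>r X. \<Union>x\<in>X. N +>\<^bsub>M\<^esub> (r \<odot>\<^bsub>M\<^esub> x)),
     grade = (\<lambda>i. {N +>\<^bsub>M\<^esub> x | x. x \<in> grade M i})\<rparr>"

definition graded_submodule :: "'a graded_ring \<Rightarrow> 'b set \<Rightarrow> ('a, 'b) graded_module \<Rightarrow> bool" where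
  "graded_submodule R U M \<longleftrightarrow> submodule R U M \<and>
     (\<forall>x \<in> U. \<forall>f. homogeneous_decomposition M (grade M) f x \<longrightarrow> (\<forall>i. f i \<in> U))"

section \<open>Graded homomorphisms\<close>

definition hom_of_degree ::
    "'a graded_ring \<Rightarrow> ('a, 'b) graded_module \<Rightarrow> ('a, 'c) graded_module \<Rightarrow> int \<Rightarrow> ('b \<Rightarrow> 'c) set" where
  "hom_of_degree R M N n = {f \<in> module_hom R M N. \<forall>i. f ` grade M i \<subseteq> grade N (i + n)}"

text \<open>The elements of *Hom are the finite sums of homogeneous homomorphisms, made extensional so
  that equality of homomorphisms is equality of functions.\<close>

definition graded_Hom ::
    "'a graded_ring \<Rightarrow> ('a, 'b) graded_module \<Rightarrow> ('a, 'c) graded_module \<Rightarrow>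
     ('a, 'b \<Rightarrow> 'c) graded_module" where
  "graded_Hom R M N = \<lparr>
     carrier = {f. \<exists>I F. finite I \<and> (\<forall>n \<in> I. F n \<in> hom_of_degree R M N n) \<and>
                   f = (\<lambda>x \<in> carrier M. \<Oplus>\<^bsub>N\<^esub> n \<in> I. F n x)},
     monoid.mult = (\<lambda>_ _. \<lambda>x \<in> carrier M. \<zero>\<^bsub>N\<^esub>),
     one = (\<lambda>x \<in> carrier M. \<zero>\<^bsub>N\<^esub>),
     ring.zero = (\<lambda>x \<in> carrier M. \<zero>\<^bsub>N\<^esub>),
     ring.add = (\<lambda>f g. \<lambda>x \<in> carrier M. f x \<oplus>\<^bsub>N\<^esub> g x),
     smult = (\<lambda>r f. \<lambda>x \<in> carrier M. r \<odot>\<^bsub>N\<^esub> f x),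
     grade = (\<lambda>n. hom_of_degree R M N n \<inter> extensional (carrier M))\<rparr>"

section \<open>Injective modules, resolutions and envelopes\<close>

text \<open>Injectivity is the usual lifting property. HOL cannot quantify over modules on all types, so
  the test modules have their carriers in the type of the ring elements. Since the inclusions of
  (homogeneous) ideals into the (shifted) ring are among these tests, Baer's criterion shows that
  this is the lifting property for all modules.\<close>

definition injective_module ::
    "('a, 'c) ring_scheme \<Rightarrow> ('a, 'b) module \<Rightarrow> bool" where
  "injective_module R E \<longleftrightarrow> module R E \<and>
     (\<forall>(A :: ('a, 'a) module) (B :: ('a, 'a) module) f g.
        module R A \<and> module R B \<and> f \<in> module_hom R A B \<and> inj_on f (carrier A) \<and>
        g \<in> module_hom R A E \<longrightarrow>
        (\<exists>h \<in> module_hom R B E. \<forall>x \<in> carrier A. h (f x) = g x))"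

definition graded_injective :: "'a graded_ring \<Rightarrow> ('a, 'b) graded_module \<Rightarrow> bool" where
  "graded_injective R E \<longleftrightarrow> graded_module R E \<and>
     (\<forall>(A :: ('a, 'a) graded_module) (B :: ('a, 'a) graded_module) f g.
        graded_module R A \<and> graded_module R B \<and>
        f \<in> hom_of_degree R A B 0 \<and> inj_on f (carrier A) \<and> g \<in> hom_of_degree R A E 0 \<longrightarrow>
        (\<exists>h \<in> hom_of_degree R B E 0. \<forall>x \<in> carrier A. h (f x) = g x))"

definition exact_coresolution ::
    "('a, 'r) ring_scheme \<Rightarrow> ('a, 'b, 's) module_scheme \<Rightarrow> (nat \<Rightarrow> ('a, 'c, 't) module_scheme) \<Rightarrow>
     ('b \<Rightarrow> 'c) \<Rightarrow> (nat \<Rightarrow> 'c \<Rightarrow> 'c) \<Rightarrow> bool" where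
  "exact_coresolution R M I \<epsilon> \<delta> \<longleftrightarrow>
     \<epsilon> \<in> module_hom R M (I 0) \<and> inj_on \<epsilon> (carrier M) \<and>
     (\<forall>n. \<delta> n \<in> module_hom R (I n) (I (Suc n))) \<and>
     \<epsilon> ` carrier M = a_kernel (I 0) (I (Suc 0)) (\<delta> 0) \<and>
     (\<forall>n. \<delta> n ` carrier (I n) = a_kernel (I (Suc n)) (I (Suc (Suc n))) (\<delta> (Suc n)))"

definition graded_injective_resolution ::
    "'a graded_ring \<Rightarrow> ('a, 'b) graded_module \<Rightarrow> (nat \<Rightarrow> ('a, 'c) graded_module) \<Rightarrow>
     ('b \<Rightarrow> 'c) \<Rightarrow> (nat \<Rightarrow> 'c \<Rightarrow> 'c) \<Rightarrow> bool" where
  "graded_injective_resolution R M I \<epsilon> \<delta> \<longleftrightarrow>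
     (\<forall>n. graded_injective R (I n)) \<and> exact_coresolution R M I \<epsilon> \<delta> \<and>
     \<epsilon> \<in> hom_of_degree R M (I 0) 0 \<and> (\<forall>n. \<delta> n \<in> hom_of_degree R (I n) (I (Suc n)) 0)"

definition graded_injective_envelope ::
    "'a graded_ring \<Rightarrow> ('a, 'b) graded_module \<Rightarrow> ('a, 'c) graded_module \<Rightarrow> ('b \<Rightarrow> 'c) \<Rightarrow> bool" where
  "graded_injective_envelope R N E \<iota> \<longleftrightarrow>
     graded_injective R E \<and> \<iota> \<in> hom_of_degree R N E 0 \<and> inj_on \<iota> (carrier N) \<and>
     (\<forall>U. graded_submodule R U E \<and> U \<noteq> {\<zero>\<^bsub>E\<^esub>} \<longrightarrow> U \<inter> \<iota> ` carrier N \<noteq> {\<zero>\<^bsub>E\<^esub>})"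

section \<open>Graded local cohomology and the graded canonical module\<close>

definition krull_dim :: "('a, 'c) ring_scheme \<Rightarrow> enat" where
  "krull_dim R = (SUP n \<in> {n. \<exists>p :: nat \<Rightarrow> 'a set.
     (\<forall>i \<le> n. primeideal (p i) R) \<and> (\<forall>i < n. p i \<subset> p (Suc i))}. enat n)"

definition torsion_part ::
    "('a, 'r) ring_scheme \<Rightarrow> 'a set \<Rightarrow> ('a, 'b, 's) module_scheme \<Rightarrow> 'b set" where
  "torsion_part R J M =
     {x \<in> carrier M. \<exists>k. \<forall>r \<in> (ideal_prod R J ^^ k) (carrier R). r \<odot>\<^bsub>M\<^esub> x = \<zero>\<^bsub>M\<^esub>}"

text \<open>The \<open>i\<close>-th right derived functor of the torsion functor of the irrelevant ideal, computed on
  a graded injective resolution \<open>(I, \<delta>)\<close>.\<close>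

definition graded_local_cohomology ::
    "'a graded_ring \<Rightarrow> (nat \<Rightarrow> ('a, 'c) graded_module) \<Rightarrow> (nat \<Rightarrow> 'c \<Rightarrow> 'c) \<Rightarrow> nat \<Rightarrow>
     ('a, 'c set) graded_module" where
  "graded_local_cohomology R I \<delta> i =
     (let \<Gamma> = (\<lambda>j. torsion_part R (irrelevant_ideal R) (I j));
          cocycles = {x \<in> \<Gamma> i. \<delta> i x = \<zero>\<^bsub>I (Suc i)\<^esub>};
          coboundaries = (case i of 0 \<Rightarrow> {\<zero>\<^bsub>I 0\<^esub>} | Suc j \<Rightarrow> \<delta> j ` \<Gamma> j)
      in graded_quotient (graded_restrict (I i) cocycles) coboundaries)"

text \<open>The resolution \<open>(I, \<delta>)\<close> of \<open>R\<close> and the envelope \<open>E\<close> of the residue field are parameters; the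
  graded module obtained is independent of their choice up to isomorphism of degree 0.\<close>

definition graded_canonical_module ::
    "'a graded_ring \<Rightarrow> (nat \<Rightarrow> ('a, 'c) graded_module) \<Rightarrow> (nat \<Rightarrow> 'c \<Rightarrow> 'c) \<Rightarrow>
     ('a, 'e) graded_module \<Rightarrow> ('a, 'c set \<Rightarrow> 'e) graded_module" where
  "graded_canonical_module R I \<delta> E =
     graded_Hom R (graded_local_cohomology R I \<delta> (the_enat (krull_dim R))) E"

definition residue_module :: "'a graded_ring \<Rightarrow> ('a, 'a set) graded_module" where
  "residue_module R = graded_quotient (graded_self R) (irrelevant_ideal R)"

definition a_invariant :: "('a, 'b) graded_module \<Rightarrow> int" where
  "a_invariant \<omega> = - initial_degree \<omega> (grade \<omega>)"

definition trace_ideal :: "'a graded_ring \<Rightarrow> ('a, 'b) graded_module \<Rightarrow> 'a set" where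
  "trace_ideal R M = Idl\<^bsub>R\<^esub> (\<Union>n. \<Union>f \<in> hom_of_degree R M (graded_self R) n. f ` carrier M)"

definition torsion_free_element ::
    "('a, 'r) ring_scheme \<Rightarrow> ('a, 'b, 's) module_scheme \<Rightarrow> 'b \<Rightarrow> bool" where
  "torsion_free_element R M x \<longleftrightarrow> x \<in> carrier M \<and>
     (\<forall>r \<in> carrier R. r \<odot>\<^bsub>M\<^esub> x = \<zero>\<^bsub>M\<^esub> \<longrightarrow> r = \<zero>\<^bsub>R\<^esub>)"

text \<open>The inverse of a bijective homomorphism of degree \<open>n\<close> is automatically homogeneous of degree
  \<open>-n\<close>.\<close>

definition isomorphic_up_to_shift ::
    "'a graded_ring \<Rightarrow> ('a, 'b) graded_module \<Rightarrow> ('a, 'c) graded_module \<Rightarrow> bool" where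
  "isomorphic_up_to_shift R M N \<longleftrightarrow>
     (\<exists>n. \<exists>f \<in> hom_of_degree R M N n. bij_betw f (carrier M) (carrier N))"

definition quasi_gorenstein :: "'a graded_ring \<Rightarrow> ('a, 'b) graded_module \<Rightarrow> bool" where
  "quasi_gorenstein R \<omega> \<longleftrightarrow> isomorphic_up_to_shift R \<omega> (graded_self R)"

definition regular_sequence :: "('a, 'r) ring_scheme \<Rightarrow> 'a list \<Rightarrow> bool" where
  "regular_sequence R xs \<longleftrightarrow> set xs \<subseteq> carrier R \<and> Idl\<^bsub>R\<^esub> (set xs) \<noteq> carrier R \<and>
     (\<forall>i < length xs. \<forall>r \<in> carrier R.
        (xs ! i) \<otimes>\<^bsub>R\<^esub> r \<in> Idl\<^bsub>R\<^esub> (set (take i xs)) \<longrightarrow> r \<in> Idl\<^bsub>R\<^esub> (set (take i xs)))"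

section \<open>Localization and Gorenstein local rings\<close>

definition fraction :: "('a, 'r) ring_scheme \<Rightarrow> 'a set \<Rightarrow> 'a \<Rightarrow> 'a \<Rightarrow> ('a \<times> 'a) set" where
  "fraction R S r s = {(r', s'). r' \<in> carrier R \<and> s' \<in> S \<and>
     (\<exists>t \<in> S. t \<otimes>\<^bsub>R\<^esub> (s' \<otimes>\<^bsub>R\<^esub> r) = t \<otimes>\<^bsub>R\<^esub> (s \<otimes>\<^bsub>R\<^esub> r'))}"

definition localization :: "('a, 'r) ring_scheme \<Rightarrow> 'a set \<Rightarrow> ('a \<times> 'a) set ring" where
  "localization R S = \<lparr>
     carrier = {fraction R S r s | r s. r \<in> carrier R \<and> s \<in> S},
     monoid.mult = (\<lambda>X Y. \<Union>(r, s) \<in> X. \<Union>(r', s') \<in> Y. fraction R S (r \<otimes>\<^bsub>R\<^esub> r') (s \<otimes>\<^bsub>R\<^esub> s')),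
     one = fraction R S \<one>\<^bsub>R\<^esub> \<one>\<^bsub>R\<^esub>,
     ring.zero = fraction R S \<zero>\<^bsub>R\<^esub> \<one>\<^bsub>R\<^esub>,
     ring.add = (\<lambda>X Y. \<Union>(r, s) \<in> X. \<Union>(r', s') \<in> Y.
       fraction R S (s' \<otimes>\<^bsub>R\<^esub> r \<oplus>\<^bsub>R\<^esub> s \<otimes>\<^bsub>R\<^esub> r') (s \<otimes>\<^bsub>R\<^esub> s'))\<rparr>"

definition associated_primes :: "('a, 'r) ring_scheme \<Rightarrow> 'a set set" where
  "associated_primes R =
     {p. primeideal p R \<and>
         (\<exists>x \<in> carrier R. p = {r \<in> carrier R. r \<otimes>\<^bsub>R\<^esub> x = \<zero>\<^bsub>R\<^esub>})}"

text \<open>A Noetherian local ring is Gorenstein if it has finite injective dimension over itself. The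
  type argument is the type carrying the injective modules of the finite resolution; a statement
  that assumes the property for a free type variable \<open>'g\<close> covers resolutions on every type.\<close>

definition finite_injective_dimension ::
    "'g itself \<Rightarrow> ('a, 'r) ring_scheme \<Rightarrow> ('a, 'b) module \<Rightarrow> bool" where
  "finite_injective_dimension (_ :: 'g itself) A M \<longleftrightarrow>
     (\<exists>(I :: nat \<Rightarrow> ('a, 'g) module) \<epsilon> \<delta> n.
        (\<forall>k. injective_module A (I k)) \<and> exact_coresolution A M I \<epsilon> \<delta> \<and>
        (\<forall>k > n. carrier (I k) = {\<zero>\<^bsub>I k\<^esub>}))"

definition gorenstein_local_ring :: "'g itself \<Rightarrow> ('a, 'r) ring_scheme \<Rightarrow> bool" where
  "gorenstein_local_ring U A \<longleftrightarrow>
     cring A \<and> noetherian_ring A \<and> (\<exists>!m. maximalideal m A) \<and>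
     finite_injective_dimension U A (self_module A)"

definition generically_gorenstein :: "'g itself \<Rightarrow> ('a, 'r) ring_scheme \<Rightarrow> bool" where
  "generically_gorenstein U R \<longleftrightarrow>
     (\<forall>p \<in> associated_primes R. gorenstein_local_ring U (localization R (carrier R - p)))"

end

theory Submission
  imports Defs
begin

text \<open>Over a homogeneous system of parameters \<open>x\<close> the top local cohomology consists of fractions
  \<open>r / x\<^bsup>n\<^esup>\<close>, so an element of \<open>\<omega>\<close> is determined by its values in the socle of \<open>E\<close> on such
  fractions, and nonzero homogeneous polynomials in \<open>x\<close> act injectively on \<open>\<omega>\<close>. Let \<open>\<tau>\<close> be the given torsion-free element.
  Counting dimensions over the degree zero part shows that every \<open>w \<in> \<omega>\<close> satisfies \<open>P w = r \<tau>\<close> for some \<open>P\<close>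
  acting injectively, so \<open>f(w) \<tau> = f(\<tau>) w\<close> for all \<open>f : \<omega> \<rightarrow> R\<close>; in particular \<open>f(\<tau>) = 0\<close> only if
  \<open>f = 0\<close>.

  Let \<open>b\<close> be the initial degree of the maximal ideal and write an element of degree \<open>b\<close> of the trace as
  a sum of values \<open>f(y) \<noteq> 0\<close>. Since \<open>y\<close> has degree at least that of \<open>\<tau>\<close>, the nonzero element \<open>f(\<tau>)\<close> has
  degree at most \<open>b\<close>, hence \<open>0\<close> or \<open>b\<close>. In degree \<open>0\<close> it is a unit and \<open>f\<close> is an isomorphism.
  Otherwise all \<open>y\<close> are multiples of \<open>\<tau>\<close>, so \<open>\<theta>\<^sub>i = g\<^sub>i(\<tau>)\<close> for homomorphisms \<open>g\<^sub>i\<close>. From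
  \<open>\<theta>\<^sub>2 g\<^sub>1(w) = \<theta>\<^sub>1 g\<^sub>2(w)\<close> regularity gives \<open>g\<^sub>1(w) = \<theta>\<^sub>1 h\<close>, whence \<open>w = h \<tau>\<close> and \<open>\<omega> = R \<tau> \<cong> R\<close>.\<close>

section \<open>Homogeneous components\<close>

text \<open>The resolution and the envelope are arbitrary, so no formula for the top local
  cohomology is available: fractions \<open>r / x^n\<close> have to be produced from the resolution
  itself. This is why torsion is taken for one parameter at a time; each parameter contributes one
  connecting homomorphism, and graded injectivity supplies the division by powers of the next
  parameter.

  The count rests on this picture. Over the polynomial ring \<open>A\<close> in the parameters,
  \<open>R\<close> is a finite module and \<open>\<omega>\<close> is the dual of \<open>R\<close>
  into a shift of \<open>A\<close>, so both have the same rank. If \<open>G\<close> is a maximal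
  \<open>A\<close>-independent set of generators of \<open>R\<close>, an element of
  \<open>\<omega>\<close> is fixed by its values on the fractions \<open>g / x^n\<close> with
  \<open>g\<close> in \<open>G\<close>, which is one copy of \<open>A\<close> worth of linear
  conditions for each \<open>g\<close>. Since \<open>\<tau>\<close> is torsion-free, the elements
  \<open>g \<tau>\<close> already fill as many copies of \<open>A\<close> inside
  \<open>\<omega>\<close>, and \<open>A w\<close> would be one copy too many. In some degree there
  are then more elements than conditions, and the resulting relation is
  \<open>P w = r \<tau>\<close> with \<open>P\<close> nonzero. Only monomials are counted;
  degreewise shifts are absorbed because their number grows polynomially.\<close>

definition hcomp :: "('b, 'c) ring_scheme \<Rightarrow> (int \<Rightarrow> 'b set) \<Rightarrow> int \<Rightarrow> 'b \<Rightarrow> 'b" where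
  "hcomp M gr i x = (THE f. homogeneous_decomposition M gr f x) i"

text \<open>Components involve only the additive group, so the ring and all graded modules over it
  share this theory.\<close>

locale graded_group = abelian_group M for M :: "('b, 'c) ring_scheme" (structure) +
  fixes gr :: "int \<Rightarrow> 'b set"
  assumes internal_direct_sum: "internal_direct_sum M gr"
begin

lemma additive_subgroup_gr: "additive_subgroup (gr i) M"
  using internal_direct_sum by (simp add: internal_direct_sum_def)

lemma gr_carrier: "x \<in> gr i \<Longrightarrow> x \<in> carrier M"
  using additive_subgroup.a_subset[OF additive_subgroup_gr] by blast

lemma zero_gr [simp]: "\<zero> \<in> gr i"
  by (rule additive_subgroup.zero_closed[OF additive_subgroup_gr])

lemma add_gr: "x \<in> gr i \<Longrightarrow> y \<in> gr i \<Longrightarrow> x \<oplus> y \<in> gr i"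
  by (rule additive_subgroup.a_closed[OF additive_subgroup_gr])

lemma neg_gr: "x \<in> gr i \<Longrightarrow> \<ominus> x \<in> gr i"
  by (rule additive_subgroup.a_inv_closed[OF additive_subgroup_gr])

lemma hcomp_decomposition:
  assumes "x \<in> carrier M"
  shows "homogeneous_decomposition M gr (\<lambda>i. hcomp M gr i x) x"
proof -
  have "\<exists>!f. homogeneous_decomposition M gr f x"
    using internal_direct_sum assms by (simp add: internal_direct_sum_def)
  from theI'[OF this] show ?thesis by (simp add: hcomp_def)
qed

lemma decomposition_unique:
  assumes "x \<in> carrier M" "homogeneous_decomposition M gr f x"
  shows "f i = hcomp M gr i x"
proof -
  have "\<exists>!f. homogeneous_decomposition M gr f x"
    using internal_direct_sum assms by (simp add: internal_direct_sum_def)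
  with assms(2) hcomp_decomposition[OF assms(1)] have "f = (\<lambda>i. hcomp M gr i x)" by blast
  then show ?thesis by simp
qed

lemma hcomp_gr: "x \<in> carrier M \<Longrightarrow> hcomp M gr i x \<in> gr i"
  using hcomp_decomposition by (simp add: homogeneous_decomposition_def)

lemma hcomp_closed [simp]: "x \<in> carrier M \<Longrightarrow> hcomp M gr i x \<in> carrier M"
  using hcomp_gr gr_carrier by blast

lemma finite_support_hcomp: "x \<in> carrier M \<Longrightarrow> finite {i. hcomp M gr i x \<noteq> \<zero>}"
  using hcomp_decomposition by (simp add: homogeneous_decomposition_def)

lemma finsum_hcomp:
  assumes "x \<in> carrier M" "finite A" "{i. hcomp M gr i x \<noteq> \<zero>} \<subseteq> A"
  shows "(\<Oplus>i\<in>A. hcomp M gr i x) = x"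
proof -
  have "x = (\<Oplus>i\<in>{i. hcomp M gr i x \<noteq> \<zero>}. hcomp M gr i x)"
    using hcomp_decomposition[OF assms(1)] by (simp add: homogeneous_decomposition_def)
  also have "\<dots> = (\<Oplus>i\<in>A. hcomp M gr i x)"
    using assms by (intro add.finprod_mono_neutral_cong_left) auto
  finally show ?thesis by simp
qed

lemma hcomp_finsum:
  assumes "finite A" "\<And>i. i \<in> A \<Longrightarrow> f i \<in> gr i"
  shows "hcomp M gr i (\<Oplus>i\<in>A. f i) = (if i \<in> A then f i else \<zero>)"
proof -
  let ?f = "\<lambda>i. if i \<in> A then f i else \<zero>"
  have c: "f \<in> A \<rightarrow> carrier M" using assms gr_carrier by auto
  have "(\<Oplus>i\<in>A. f i) = (\<Oplus>i\<in>{i. ?f i \<noteq> \<zero>}. ?f i)"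
    using assms c by (intro add.finprod_mono_neutral_cong_right) auto
  then have "homogeneous_decomposition M gr ?f (\<Oplus>i\<in>A. f i)"
    using assms by (auto simp: homogeneous_decomposition_def intro: finite_subset[of _ A])
  from decomposition_unique[OF _ this, of i] c show ?thesis by auto
qed

lemma hcomp_of_gr: "x \<in> gr i \<Longrightarrow> hcomp M gr j x = (if j = i then x else \<zero>)"
  using hcomp_finsum[of "{i}" "\<lambda>_. x" j] gr_carrier[of x i] by simp

lemma hcomp_zero [simp]: "hcomp M gr j \<zero> = \<zero>"
  using hcomp_of_gr[of \<zero> j] by simp

lemma hcomp_add:
  assumes "x \<in> carrier M" "y \<in> carrier M"
  shows "hcomp M gr i (x \<oplus> y) = hcomp M gr i x \<oplus> hcomp M gr i y"
proof -
  let ?A = "{i. hcomp M gr i x \<noteq> \<zero>} \<union> {i. hcomp M gr i y \<noteq> \<zero>}"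
  have fin: "finite ?A" using assms finite_support_hcomp by blast
  have "x \<oplus> y = (\<Oplus>i\<in>?A. hcomp M gr i x) \<oplus> (\<Oplus>i\<in>?A. hcomp M gr i y)"
    using fin assms by (subst (1 2) finsum_hcomp) auto
  also have "\<dots> = (\<Oplus>i\<in>?A. hcomp M gr i x \<oplus> hcomp M gr i y)"
    using assms by (subst finsum_addf) auto
  finally have "hcomp M gr i (x \<oplus> y) =
      (if i \<in> ?A then hcomp M gr i x \<oplus> hcomp M gr i y else \<zero>)"
    using hcomp_finsum[OF fin, of "\<lambda>i. hcomp M gr i x \<oplus> hcomp M gr i y" i] assms
    by (simp add: add_gr hcomp_gr)
  then show ?thesis by auto
qed

lemma hcomp_neg:
  assumes "x \<in> carrier M"
  shows "hcomp M gr i (\<ominus> x) = \<ominus> hcomp M gr i x"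
proof -
  have "hcomp M gr i x \<oplus> hcomp M gr i (\<ominus> x) = \<zero>"
    using hcomp_add[of x "\<ominus> x" i] assms by (simp add: r_neg)
  then show ?thesis using assms by (metis minus_equality hcomp_closed a_inv_closed a_comm)
qed

text \<open>The step adds a component of the given \<open>x\<close>, not an arbitrary homogeneous
  element, so facts known only about the components of \<open>x\<close> (such as membership in an
  ideal) remain usable.\<close>

lemma graded_induct [consumes 1, case_names zero add]:
  assumes x: "x \<in> carrier M" and zero: "P \<zero>"
    and add: "\<And>i y. \<lbrakk>y \<in> carrier M; P y\<rbrakk> \<Longrightarrow> P (hcomp M gr i x \<oplus> y)"
  shows "P x"
proof -
  have "finite A \<Longrightarrow> P (\<Oplus>i\<in>A. hcomp M gr i x)" for A
    by (induction A rule: finite_induct) (use x zero add in auto)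
  from this[OF finite_support_hcomp[OF x]] finsum_hcomp[OF x finite_support_hcomp[OF x]]
  show ?thesis by simp
qed

end

text \<open>A map of degree \<open>n\<close> carries a decomposition to a decomposition. Only
  additivity is asked, because both multiplication by a homogeneous scalar and evaluation
  \<open>r \<mapsto> r y\<close> at a homogeneous \<open>y\<close> are to be instances.\<close>

lemma hcomp_hom:
  assumes "graded_group M gr" "graded_group N gs"
    and h: "h \<in> carrier M \<rightarrow> carrier N"
    and add: "\<And>x y. x \<in> carrier M \<Longrightarrow> y \<in> carrier M \<Longrightarrow> h (x \<oplus>\<^bsub>M\<^esub> y) = h x \<oplus>\<^bsub>N\<^esub> h y"
    and deg: "\<And>i. h ` gr i \<subseteq> gs (i + n)"
    and x: "x \<in> carrier M"
  shows "hcomp N gs (i + n) (h x) = h (hcomp M gr i x)"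
proof -
  interpret M: graded_group M gr by fact
  interpret N: graded_group N gs by fact
  have h0: "h \<zero>\<^bsub>M\<^esub> = \<zero>\<^bsub>N\<^esub>"
  proof -
    have "h \<zero>\<^bsub>M\<^esub> \<oplus>\<^bsub>N\<^esub> h \<zero>\<^bsub>M\<^esub> = h \<zero>\<^bsub>M\<^esub>" using add[of "\<zero>\<^bsub>M\<^esub>" "\<zero>\<^bsub>M\<^esub>"] by simp
    then show ?thesis using h by (metis M.zero_closed N.add.l_cancel_one' PiE)
  qed
  let ?P = "\<lambda>y. y \<in> carrier M \<and> hcomp N gs (i + n) (h y) = h (hcomp M gr i y)"
  have "?P x"
  proof (rule M.graded_induct[OF x, of ?P])
    show "?P \<zero>\<^bsub>M\<^esub>" by (simp add: h0)
    fix j y assume y: "y \<in> carrier M" "?P y"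
    let ?z = "hcomp M gr j x"
    have z: "?z \<in> gr j" "?z \<in> carrier M" using x M.hcomp_gr by auto
    have hz: "h ?z \<in> gs (j + n)" using z deg by blast
    have "hcomp N gs (i + n) (h ?z) = h (hcomp M gr i ?z)"
      using N.hcomp_of_gr[OF hz] M.hcomp_of_gr[OF z(1)] h0 by auto
    moreover have "h ?z \<in> carrier N" "h y \<in> carrier N" using h z y by auto
    ultimately show "?P (?z \<oplus>\<^bsub>M\<^esub> y)"
      using y z by (simp add: add N.hcomp_add M.hcomp_add)
  qed
  then show ?thesis by simp
qed

sublocale nonneg_graded_ring \<subseteq> RG: graded_group R "rgrade R"
  by (rule graded_group.intro) (use direct_sum abelian_group_axioms in \<open>simp_all add: graded_group_axioms_def\<close>)

sublocale graded_module \<subseteq> MG: graded_group M "grade M"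
  by (rule graded_group.intro) (use direct_sum M.abelian_group_axioms in \<open>simp_all add: graded_group_axioms_def\<close>)

context nonneg_graded_ring
begin

lemma hcomp_mult:
  assumes "x \<in> rgrade R i" "y \<in> carrier R"
  shows "hcomp R (rgrade R) (j + i) (x \<otimes> y) = x \<otimes> hcomp R (rgrade R) j y"
proof -
  have "x \<in> carrier R" using assms RG.gr_carrier by blast
  then show ?thesis
    using hcomp_hom[OF RG.graded_group_axioms RG.graded_group_axioms, of "\<lambda>y. x \<otimes> y" i y j]
    using assms mult_degree[OF assms(1)] by (force simp: r_distr add.commute)
qed

lemma hcomp_negative: "x \<in> carrier R \<Longrightarrow> i < 0 \<Longrightarrow> hcomp R (rgrade R) i x = \<zero>"
  using RG.hcomp_gr negative_degree by blast

end

context graded_module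
begin

lemma hcomp_smult:
  assumes "r \<in> carrier R" "r \<in> rgrade R i" "y \<in> carrier M"
  shows "hcomp M (grade M) (j + i) (r \<odot>\<^bsub>M\<^esub> y) = r \<odot>\<^bsub>M\<^esub> hcomp M (grade M) j y"
proof -
  show ?thesis
    using hcomp_hom[OF MG.graded_group_axioms MG.graded_group_axioms, of "\<lambda>y. r \<odot>\<^bsub>M\<^esub> y" i y j]
    using assms smult_degree[OF assms(2)] by (force simp: smult_r_distr add.commute)
qed

lemma hcomp_smult_element:
  assumes R: "graded_group R (rgrade R)" and "r \<in> carrier R" "y \<in> grade M i"
  shows "hcomp M (grade M) (j + i) (r \<odot>\<^bsub>M\<^esub> y) = hcomp R (rgrade R) j r \<odot>\<^bsub>M\<^esub> y"
proof -
  have "y \<in> carrier M" using assms MG.gr_carrier by blast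
  then show ?thesis
    using hcomp_hom[OF R MG.graded_group_axioms, of "\<lambda>r. r \<odot>\<^bsub>M\<^esub> y" i r j]
    using assms smult_degree[OF _ assms(3)] by (force simp: smult_l_distr)
qed

end

section \<open>Linear algebra over the degree zero part\<close>

locale graded_algebra = nonneg_graded_ring R + noetherian_ring R for R (structure) +
  assumes field_R0: "field (R\<lparr>carrier := rgrade R 0\<rparr>)"
begin

abbreviation K where "K \<equiv> rgrade R 0"

abbreviation hc where "hc i x \<equiv> hcomp R (rgrade R) i x"

lemma K_carrier: "c \<in> K \<Longrightarrow> c \<in> carrier R"
  by (rule RG.gr_carrier)

lemma one_K: "\<one> \<in> K"
proof -
  interpret F: field "R\<lparr>carrier := rgrade R 0\<rparr>" by (rule field_R0)
  show ?thesis using F.one_closed by simp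
qed

lemma one_neq_zero: "\<one> \<noteq> \<zero>"
proof -
  interpret F: field "R\<lparr>carrier := rgrade R 0\<rparr>" by (rule field_R0)
  show ?thesis using F.one_not_zero by simp
qed

lemma mult_K: "a \<in> K \<Longrightarrow> b \<in> K \<Longrightarrow> a \<otimes> b \<in> K"
  using mult_degree[of a 0 b 0] by simp

lemmas zero_K = RG.zero_gr[of 0] and add_K = RG.add_gr[of _ 0] and neg_K = RG.neg_gr[of _ 0]

lemma minus_K: "a \<in> K \<Longrightarrow> b \<in> K \<Longrightarrow> a \<ominus> b \<in> K"
  by (simp add: a_minus_def add_K neg_K)

lemma inverse_K:
  assumes "c \<in> K" "c \<noteq> \<zero>"
  obtains c' where "c' \<in> K" "c \<otimes> c' = \<one>"
proof -
  interpret F: field "R\<lparr>carrier := rgrade R 0\<rparr>" by (rule field_R0)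
  have "c \<in> Units (R\<lparr>carrier := rgrade R 0\<rparr>)" using assms F.field_Units by simp
  then show ?thesis using that by (auto simp: Units_def)
qed

lemma finsum_K: "(\<And>a. a \<in> A \<Longrightarrow> f a \<in> K) \<Longrightarrow> (\<Oplus>a\<in>A. f a) \<in> K"
proof (cases "finite A")
  case True
  assume "\<And>a. a \<in> A \<Longrightarrow> f a \<in> K"
  with True show ?thesis
  proof (induction A rule: finite_induct)
    case (insert a A)
    then have "f \<in> A \<rightarrow> carrier R" "f a \<in> carrier R" using K_carrier by auto
    with insert show ?case by (simp add: add_K)
  qed (simp add: zero_K)
qed (simp add: zero_K)

lemma smult_K: "c \<in> K \<Longrightarrow> x \<in> rgrade R i \<Longrightarrow> c \<otimes> x \<in> rgrade R i"
  using mult_degree[of c 0 x i] by simp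

text \<open>Gaussian elimination, one equation at a time: an equation with some nonzero coefficient
  costs one unknown, one with all coefficients zero costs nothing.\<close>

lemma linear_system_nontrivial_solution:
  assumes "finite B" "finite A" "card B < card A"
    and "\<And>a b. a \<in> A \<Longrightarrow> b \<in> B \<Longrightarrow> \<kappa> a b \<in> K"
  shows "\<exists>c. (\<forall>a\<in>A. c a \<in> K) \<and> (\<exists>a\<in>A. c a \<noteq> \<zero>) \<and> (\<forall>b\<in>B. (\<Oplus>a\<in>A. c a \<otimes> \<kappa> a b) = \<zero>)"
  using assms
proof (induction B arbitrary: A \<kappa> rule: finite_induct)
  case empty
  then have "A \<noteq> {}" by auto
  then show ?case by (intro exI[of _ "\<lambda>_. \<one>"]) (auto simp: one_K one_neq_zero)
next
  case (insert b B)
  note \<kappa> = insert.prems(3)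
  have \<kappa>C: "\<kappa> a b' \<in> carrier R" if "a \<in> A" "b' \<in> insert b B" for a b'
    using \<kappa>[OF that] K_carrier by blast
  show ?case
  proof (cases "\<forall>a\<in>A. \<kappa> a b = \<zero>")
    case True
    from insert.IH[of A \<kappa>] insert.prems insert.hyps
    obtain c where c: "\<forall>a\<in>A. c a \<in> K" "\<exists>a\<in>A. c a \<noteq> \<zero>"
        "\<forall>b\<in>B. (\<Oplus>a\<in>A. c a \<otimes> \<kappa> a b) = \<zero>" by auto
    have "(\<Oplus>a\<in>A. c a \<otimes> \<kappa> a b) = (\<Oplus>a\<in>A. \<zero>)"
      using True c(1) K_carrier by (intro finsum_cong') auto
    with c show ?thesis by auto
  next
    case False
    then obtain a0 where a0: "a0 \<in> A" "\<kappa> a0 b \<noteq> \<zero>" by auto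
    then obtain p where p: "p \<in> K" "\<kappa> a0 b \<otimes> p = \<one>"
      using inverse_K[of "\<kappa> a0 b"] \<kappa> by auto
    have pC: "p \<in> carrier R" using p K_carrier by blast
    define A' where "A' = A - {a0}"
    have A: "A = insert a0 A'" "finite A'" "a0 \<notin> A'" "card B < card A'"
      using a0 insert.prems insert.hyps by (auto simp: A'_def)
    \<comment> \<open>The system left after solving equation \<open>b\<close> for the unknown
      \<open>a0\<close>; \<open>p\<close> is the inverse of the pivot, and
      \<open>\<ominus> s \<otimes> p\<close> below is the resulting value of that unknown.\<close>
    define \<kappa>' where "\<kappa>' a b' = \<kappa> a b' \<ominus> \<kappa> a b \<otimes> p \<otimes> \<kappa> a0 b'" for a b'
    have "\<kappa>' a b' \<in> K" if "a \<in> A'" "b' \<in> B" for a b'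
      using that a0 p \<kappa> A unfolding \<kappa>'_def by (intro minus_K mult_K) auto
    from insert.IH[OF A(2,4), of \<kappa>', OF this] obtain c where
      c: "\<forall>a\<in>A'. c a \<in> K" "\<exists>a\<in>A'. c a \<noteq> \<zero>" "\<forall>b\<in>B. (\<Oplus>a\<in>A'. c a \<otimes> \<kappa>' a b) = \<zero>"
      by blast
    have cC: "c a \<in> carrier R" if "a \<in> A'" for a using c(1) that K_carrier by blast
    define s where "s = (\<Oplus>a\<in>A'. c a \<otimes> \<kappa> a b)"
    have sK: "s \<in> K" unfolding s_def using c(1) \<kappa> A by (intro finsum_K mult_K) auto
    have sC: "s \<in> carrier R" using sK K_carrier by blast
    define c' where "c' a = (if a = a0 then \<ominus> s \<otimes> p else c a)" for a
    have c'A': "c' a = c a" if "a \<in> A'" for a using that A by (auto simp: c'_def)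
    have sum: "(\<Oplus>a\<in>A. c' a \<otimes> \<kappa> a b') = (\<ominus> s \<otimes> p) \<otimes> \<kappa> a0 b' \<oplus> (\<Oplus>a\<in>A'. c a \<otimes> \<kappa> a b')"
      if "b' \<in> insert b B" for b'
    proof -
      have 1: "(\<lambda>a. c' a \<otimes> \<kappa> a b') \<in> A' \<rightarrow> carrier R" using \<kappa>C[OF _ that] cC c'A' A by auto
      have 2: "c' a0 \<otimes> \<kappa> a0 b' \<in> carrier R" using \<kappa>C[OF _ that] a0 sC pC by (simp add: c'_def)
      have 3: "(\<Oplus>a\<in>A'. c' a \<otimes> \<kappa> a b') = (\<Oplus>a\<in>A'. c a \<otimes> \<kappa> a b')"
        using \<kappa>C[OF _ that] cC c'A' A by (intro finsum_cong') auto
      show ?thesis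
        unfolding A(1) by (subst finsum_insert[OF A(2,3) 1 2]) (simp only: 3, simp add: c'_def)
    qed
    have "(\<Oplus>a\<in>A. c' a \<otimes> \<kappa> a b') = \<zero>" if b': "b' \<in> insert b B" for b'
    proof (cases "b' = b")
      case True
      have "(\<ominus> s \<otimes> p) \<otimes> \<kappa> a0 b = \<ominus> (s \<otimes> (\<kappa> a0 b \<otimes> p))"
        proof -
        have k: "\<kappa> a0 b \<in> carrier R" using \<kappa>C a0 by auto
        have "\<ominus> s \<otimes> p \<otimes> \<kappa> a0 b = \<ominus> s \<otimes> (\<kappa> a0 b \<otimes> p)"
          using k sC pC by (simp add: m_assoc m_comm[of p])
        then show ?thesis using k sC pC by (simp add: l_minus)
      qed
      then show ?thesis using sum[OF b'] True p(2) sC by (simp add: s_def[symmetric] l_neg)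
    next
      case False
      then have bB: "b' \<in> B" using b' by simp
      let ?q = "p \<otimes> \<kappa> a0 b'"
      have qC: "?q \<in> carrier R" "\<ominus> ?q \<in> carrier R" using pC \<kappa>C a0 b' by auto
      have "\<zero> = (\<Oplus>a\<in>A'. c a \<otimes> \<kappa>' a b')" using c(3) bB by simp
      also have "\<dots> = (\<Oplus>a\<in>A'. c a \<otimes> \<kappa> a b' \<oplus> c a \<otimes> \<kappa> a b \<otimes> (\<ominus> ?q))"
      proof (rule finsum_cong')
        fix a assume a: "a \<in> A'"
        have C: "c a \<in> carrier R" "\<kappa> a b \<in> carrier R" "\<kappa> a b' \<in> carrier R" "\<kappa> a0 b' \<in> carrier R"
          using \<kappa>C cC a A b' by auto
        show "c a \<otimes> \<kappa>' a b' = c a \<otimes> \<kappa> a b' \<oplus> c a \<otimes> \<kappa> a b \<otimes> (\<ominus> ?q)"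
          using C pC by (simp add: \<kappa>'_def a_minus_def r_distr r_minus m_assoc)
      qed (use qC \<kappa>C cC A b' in auto)
      also have "\<dots> = (\<Oplus>a\<in>A'. c a \<otimes> \<kappa> a b') \<oplus> (\<Oplus>a\<in>A'. c a \<otimes> \<kappa> a b \<otimes> (\<ominus> ?q))"
        using qC \<kappa>C cC A b' by (intro finsum_addf) auto
      also have "(\<Oplus>a\<in>A'. c a \<otimes> \<kappa> a b \<otimes> (\<ominus> ?q)) = s \<otimes> (\<ominus> ?q)"
        unfolding s_def using qC \<kappa>C cC A by (intro finsum_ldistr[symmetric]) auto
      also have "s \<otimes> (\<ominus> ?q) = (\<ominus> s \<otimes> p) \<otimes> \<kappa> a0 b'"
        using sC pC \<kappa>C a0 b' by (simp add: l_minus r_minus m_assoc)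
      finally have z: "\<zero> = (\<Oplus>a\<in>A'. c a \<otimes> \<kappa> a b') \<oplus> (\<ominus> s \<otimes> p) \<otimes> \<kappa> a0 b'" .
      have "(\<lambda>a. c a \<otimes> \<kappa> a b') \<in> A' \<rightarrow> carrier R" using \<kappa>C cC A b' by auto
      then have "(\<Oplus>a\<in>A'. c a \<otimes> \<kappa> a b') \<in> carrier R" by simp
      moreover have "(\<ominus> s \<otimes> p) \<otimes> \<kappa> a0 b' \<in> carrier R" using sC pC \<kappa>C a0 b' by simp
      ultimately show ?thesis using sum[OF b'] z by (metis a_comm)
    qed
    moreover have "\<forall>a\<in>A. c' a \<in> K" using c(1) sK p(1) A by (auto simp: c'_def intro: mult_K neg_K)
    moreover have "\<exists>a\<in>A. c' a \<noteq> \<zero>" using c(2) c'A' A by auto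
    ultimately show ?thesis by blast
  qed
qed

section \<open>Linear spans over the degree zero field\<close>

inductive_set kspan for S where
  zero: "\<zero> \<in> kspan S"
| add: "\<lbrakk>s \<in> S; c \<in> K; y \<in> kspan S\<rbrakk> \<Longrightarrow> c \<otimes> s \<oplus> y \<in> kspan S"

lemma kspan_carrier:
  assumes "S \<subseteq> carrier R" "y \<in> kspan S" shows "y \<in> carrier R"
  using assms(2) by (induction rule: kspan.induct) (use assms(1) K_carrier in auto)

lemma kspan_add:
  assumes "S \<subseteq> carrier R" "z \<in> kspan S" "y \<in> kspan S"
  shows "y \<oplus> z \<in> kspan S"
  using assms(3)
proof (induction rule: kspan.induct)
  case zero
  then show ?case using kspan_carrier assms by simp
next
  case (add s c y)
  have "c \<otimes> s \<in> carrier R" "y \<in> carrier R" "z \<in> carrier R"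
    using add assms kspan_carrier K_carrier by auto
  then show ?case using kspan.add[OF add(1,2,4)] by (simp add: a_assoc)
qed

lemma kspan_mult:
  assumes S: "S \<subseteq> carrier R" and x: "x \<in> carrier R"
    and m: "\<And>s. s \<in> S \<Longrightarrow> x \<otimes> s \<in> T" and y: "y \<in> kspan S"
  shows "x \<otimes> y \<in> kspan T"
  using y
proof (induction rule: kspan.induct)
  case zero
  then show ?case using x kspan.zero by simp
next
  case (add s c y)
  have C: "c \<in> carrier R" "s \<in> carrier R" "y \<in> carrier R"
    using add S kspan_carrier K_carrier by auto
  then have "x \<otimes> (c \<otimes> s \<oplus> y) = c \<otimes> (x \<otimes> s) \<oplus> x \<otimes> y"
    using x by (simp add: r_distr m_lcomm)
  then show ?case using kspan.add[OF m[OF add(1)] add(2,4)] by simp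
qed

lemma kspan_mono:
  assumes "S \<subseteq> T" "y \<in> kspan S" shows "y \<in> kspan T"
  using assms(2) by (induction rule: kspan.induct) (use assms(1) in \<open>auto intro: kspan.intros\<close>)

lemma kspan_base: "S \<subseteq> carrier R \<Longrightarrow> s \<in> S \<Longrightarrow> s \<in> kspan S"
  using kspan.add[OF _ one_K kspan.zero, of s S] by auto

text \<open>The coefficients are indexed by \<open>A\<close> and not by the values, so
  \<open>v\<close> need not be injective.\<close>

lemma kspan_finsum:
  assumes "finite A" "v \<in> A \<rightarrow> carrier R" "y \<in> kspan (v ` A)"
  obtains \<kappa> where "\<And>a. \<kappa> a \<in> K" "y = (\<Oplus>a\<in>A. \<kappa> a \<otimes> v a)"
proof -
  have "\<exists>\<kappa>. (\<forall>a. \<kappa> a \<in> K) \<and> y = (\<Oplus>a\<in>A. \<kappa> a \<otimes> v a)"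
    using assms(3)
  proof (induction rule: kspan.induct)
    case zero
    have "(\<Oplus>a\<in>A. \<zero> \<otimes> v a) = (\<Oplus>a\<in>A. \<zero>)" using assms by (intro finsum_cong') (auto simp: Pi_iff)
    then show ?case by (intro exI[of _ "\<lambda>_. \<zero>"]) (simp add: zero_K)
  next
    case (add s c y)
    then obtain \<kappa> a where \<kappa>: "\<forall>a. \<kappa> a \<in> K" "y = (\<Oplus>a\<in>A. \<kappa> a \<otimes> v a)" and a: "a \<in> A" "s = v a"
      by auto
    have \<kappa>C: "\<kappa> a \<in> carrier R" for a using \<kappa> K_carrier by auto
    have cC: "c \<in> carrier R" using add K_carrier by auto
    have C: "v a' \<in> carrier R" if "a' \<in> A" for a' using assms that by auto
    let ?d = "\<lambda>a'. if a' = a then c \<otimes> v a' else \<zero>"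
    have "(\<Oplus>a'\<in>A. ?d a') = c \<otimes> v a"
      using assms cC a add.finprod_singleton[of a A "\<lambda>a'. c \<otimes> v a'"] by (simp add: eq_commute Pi_iff)
    then have "c \<otimes> s \<oplus> y = (\<Oplus>a'\<in>A. ?d a') \<oplus> (\<Oplus>a\<in>A. \<kappa> a \<otimes> v a)"
      using a \<kappa> by simp
    also have "\<dots> = (\<Oplus>a'\<in>A. ?d a' \<oplus> \<kappa> a' \<otimes> v a')"
      using C cC \<kappa>C by (intro finsum_addf[symmetric]) auto
    also have "\<dots> = (\<Oplus>a'\<in>A. (\<kappa>(a := c \<oplus> \<kappa> a)) a' \<otimes> v a')"
      using C cC \<kappa>C by (intro finsum_cong') (auto simp: l_distr)
    finally show ?case using \<kappa> add by (intro exI[of _ "\<kappa>(a := c \<oplus> \<kappa> a)"]) (auto intro: add_K)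
  qed
  then show thesis using that by blast
qed

text \<open>Writing each \<open>v a\<close> in terms of the \<open>u b\<close> turns a linear
  relation into a homogeneous system with fewer equations than unknowns.\<close>

lemma kspan_dependent:
  assumes B: "finite B" "u \<in> B \<rightarrow> carrier R" and A: "finite A" and card: "card B < card A"
    and v: "\<And>a. a \<in> A \<Longrightarrow> v a \<in> kspan (u ` B)"
  obtains c where "\<And>a. a \<in> A \<Longrightarrow> c a \<in> K" "\<exists>a\<in>A. c a \<noteq> \<zero>" "(\<Oplus>a\<in>A. c a \<otimes> v a) = \<zero>"
proof -
  have "\<exists>\<kappa>. (\<forall>b. \<kappa> b \<in> K) \<and> v a = (\<Oplus>b\<in>B. \<kappa> b \<otimes> u b)" if "a \<in> A" for a
    using kspan_finsum[OF B v[OF that]] by metis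
  then obtain \<kappa> where \<kappa>: "\<And>a b. a \<in> A \<Longrightarrow> \<kappa> a b \<in> K"
      "\<And>a. a \<in> A \<Longrightarrow> v a = (\<Oplus>b\<in>B. \<kappa> a b \<otimes> u b)" by metis
  from linear_system_nontrivial_solution[of B A \<kappa>, OF B(1) A card \<kappa>(1)] obtain c where
    c: "\<forall>a\<in>A. c a \<in> K" "\<exists>a\<in>A. c a \<noteq> \<zero>" "\<forall>b\<in>B. (\<Oplus>a\<in>A. c a \<otimes> \<kappa> a b) = \<zero>" by blast
  have C: "c a \<in> carrier R" "\<kappa> a b \<in> carrier R" if "a \<in> A" for a b
    using c(1) \<kappa>(1) that K_carrier by auto
  have uC: "u b \<in> carrier R" if "b \<in> B" for b using B that by auto
  have "(\<Oplus>a\<in>A. c a \<otimes> v a) = (\<Oplus>a\<in>A. \<Oplus>b\<in>B. c a \<otimes> \<kappa> a b \<otimes> u b)"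
  proof (rule finsum_cong')
    fix a assume a: "a \<in> A"
    have "c a \<otimes> v a = (\<Oplus>b\<in>B. c a \<otimes> (\<kappa> a b \<otimes> u b))"
      unfolding \<kappa>(2)[OF a] using C[OF a] uC B by (intro finsum_rdistr) auto
    also have "\<dots> = (\<Oplus>b\<in>B. c a \<otimes> \<kappa> a b \<otimes> u b)"
      using C[OF a] uC by (intro finsum_cong') (auto simp: m_assoc)
    finally show "c a \<otimes> v a = (\<Oplus>b\<in>B. c a \<otimes> \<kappa> a b \<otimes> u b)" .
  qed (use C uC in \<open>auto intro!: finsum_closed\<close>)
  also have "\<dots> = (\<Oplus>b\<in>B. \<Oplus>a\<in>A. c a \<otimes> \<kappa> a b \<otimes> u b)"
    using A B C uC by (intro finsum_finsum_swap) auto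
  also have "\<dots> = (\<Oplus>b\<in>B. \<zero>)"
  proof (rule finsum_cong')
    fix b assume b: "b \<in> B"
    have "(\<Oplus>a\<in>A. c a \<otimes> \<kappa> a b \<otimes> u b) = (\<Oplus>a\<in>A. c a \<otimes> \<kappa> a b) \<otimes> u b"
      using C uC b A by (intro finsum_ldistr[symmetric]) auto
    then show "(\<Oplus>a\<in>A. c a \<otimes> \<kappa> a b \<otimes> u b) = \<zero>" using c(3) b uC by simp
  qed auto
  finally have "(\<Oplus>a\<in>A. c a \<otimes> v a) = \<zero>" by simp
  then show thesis using that c by blast
qed

section \<open>Homogeneous ideals\<close>

text \<open>\<open>Idl S\<close> is given as the least ideal above \<open>S\<close>, so the proof
  exhibits an ideal: \<open>T\<close> holds the elements whose addition preserves \<open>P\<close>,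
  and \<open>T'\<close> those all of whose multiples lie in \<open>T\<close>. The latter contains
  \<open>S\<close>, hence \<open>Idl S\<close>, and at the end \<open>y\<close> is added to
  \<open>\<zero>\<close>.\<close>

lemma genideal_induct [consumes 2, case_names zero add]:
  assumes S: "S \<subseteq> carrier R" and y: "y \<in> Idl S"
    and zero: "P \<zero>"
    and add: "\<And>r s y. \<lbrakk>r \<in> carrier R; s \<in> S; y \<in> Idl S; P y\<rbrakk> \<Longrightarrow> P (r \<otimes> s \<oplus> y)"
  shows "P y"
proof -
  define T where "T = {y \<in> carrier R. y \<in> Idl S \<and> (\<forall>z \<in> Idl S. P z \<longrightarrow> P (y \<oplus> z))}"
  interpret J: ideal "Idl S" R by (rule genideal_ideal[OF S])
  define T' where "T' = {y \<in> carrier R. \<forall>r\<in>carrier R. r \<otimes> y \<in> T}"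
  have T_add: "a \<oplus> b \<in> T" if "a \<in> T" "b \<in> T" for a b
  proof -
    have "P (a \<oplus> b \<oplus> z)" if z: "z \<in> Idl S" "P z" for z
    proof -
      have "b \<oplus> z \<in> Idl S" "P (b \<oplus> z)" using \<open>b \<in> T\<close> z by (auto simp: T_def)
      then have "P (a \<oplus> (b \<oplus> z))" using \<open>a \<in> T\<close> by (auto simp: T_def)
      then show ?thesis using \<open>a \<in> T\<close> \<open>b \<in> T\<close> z J.Icarr by (simp add: T_def a_assoc)
    qed
    then show ?thesis using that by (auto simp: T_def)
  qed
  have zT: "\<zero> \<in> T" using J.Icarr by (auto simp: T_def)
  have T'_mult: "r \<otimes> y \<in> T'" if "y \<in> T'" "r \<in> carrier R" for r y
    using that by (auto simp: T'_def m_assoc[symmetric])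
  have "ideal T' R"
  proof (rule idealI[OF ring_axioms])
    show "subgroup T' (add_monoid R)"
    proof (rule add.subgroupI)
      show "T' \<subseteq> carrier R" by (auto simp: T'_def)
      show "T' \<noteq> {}" using zT by (auto simp: T'_def intro!: exI[of _ \<zero>])
      fix a assume a: "a \<in> T'"
      then have "a \<in> carrier R" by (simp add: T'_def)
      then have "\<ominus> a = (\<ominus> \<one>) \<otimes> a" by (simp add: l_minus)
      then show "\<ominus> a \<in> T'" using T'_mult[OF a, of "\<ominus> \<one>"] by simp
      fix b assume b: "b \<in> T'"
      then show "a \<oplus> b \<in> T'" using a T_add by (auto simp: T'_def r_distr)
    qed
    show "x \<otimes> a \<in> T'" if "a \<in> T'" "x \<in> carrier R" for a x using T'_mult that .
    show "a \<otimes> x \<in> T'" if "a \<in> T'" "x \<in> carrier R" for a x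
      using T'_mult[OF that] that by (simp add: m_comm T'_def)
  qed
  moreover have "S \<subseteq> T'"
    using S add genideal_self[OF S] J.I_l_closed by (auto simp: T'_def T_def)
  ultimately have "Idl S \<subseteq> T'" by (rule genideal_minimal)
  then have "y \<in> T'" using y by blast
  then have "\<one> \<otimes> y \<in> T" and yC: "y \<in> carrier R" unfolding T'_def by blast+
  then have "y \<in> T" by simp
  then have "P (y \<oplus> \<zero>)" using J.zero_closed zero unfolding T_def by blast
  then show ?thesis using yC by simp
qed

lemma genideal_image_finsum:
  assumes "finite A" "x \<in> A \<rightarrow> carrier R" "y \<in> Idl (x ` A)"
  obtains r where "\<And>a. r a \<in> carrier R" "y = (\<Oplus>a\<in>A. r a \<otimes> x a)"
proof -
  have S: "x ` A \<subseteq> carrier R" using assms by auto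
  have "\<exists>r. (\<forall>a. r a \<in> carrier R) \<and> y = (\<Oplus>a\<in>A. r a \<otimes> x a)"
  proof (rule genideal_induct[OF S assms(3)])
    have "(\<Oplus>a\<in>A. \<zero> \<otimes> x a) = (\<Oplus>a\<in>A. \<zero>)" using assms by (intro finsum_cong') (auto simp: Pi_iff)
    then show "\<exists>r. (\<forall>a. r a \<in> carrier R) \<and> \<zero> = (\<Oplus>a\<in>A. r a \<otimes> x a)"
      by (intro exI[of _ "\<lambda>_. \<zero>"]) simp
    fix c s y assume c: "c \<in> carrier R" and "s \<in> x ` A"
      and "\<exists>r. (\<forall>a. r a \<in> carrier R) \<and> y = (\<Oplus>a\<in>A. r a \<otimes> x a)"
    then obtain r a where r: "\<And>a. r a \<in> carrier R" "y = (\<Oplus>a\<in>A. r a \<otimes> x a)"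
      and a: "a \<in> A" "s = x a" by auto
    have C: "x a' \<in> carrier R" if "a' \<in> A" for a' using assms that by auto
    let ?d = "\<lambda>a'. if a' = a then c \<otimes> x a' else \<zero>"
    have "(\<Oplus>a'\<in>A. ?d a') = c \<otimes> x a"
      using assms c a add.finprod_singleton[of a A "\<lambda>a'. c \<otimes> x a'"] by (simp add: eq_commute Pi_iff)
    then have "c \<otimes> s \<oplus> y = (\<Oplus>a'\<in>A. ?d a') \<oplus> (\<Oplus>a\<in>A. r a \<otimes> x a)" using a r by simp
    also have "\<dots> = (\<Oplus>a'\<in>A. ?d a' \<oplus> r a' \<otimes> x a')"
      using C c r by (intro finsum_addf[symmetric]) auto
    also have "\<dots> = (\<Oplus>a'\<in>A. (r(a := c \<oplus> r a)) a' \<otimes> x a')"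
      using C c r by (intro finsum_cong') (auto simp: l_distr)
    finally show "\<exists>r. (\<forall>a. r a \<in> carrier R) \<and> c \<otimes> s \<oplus> y = (\<Oplus>a\<in>A. r a \<otimes> x a)"
      using r c by (intro exI[of _ "r(a := c \<oplus> r a)"]) auto
  qed
  then show thesis using that by blast
qed

definition hideal :: "'a set \<Rightarrow> bool" where
  "hideal J \<longleftrightarrow> ideal J R \<and> (\<forall>x\<in>J. \<forall>i. hc i x \<in> J)"

lemma hc_mult: "x \<in> rgrade R i \<Longrightarrow> y \<in> carrier R \<Longrightarrow> hc j (x \<otimes> y) = x \<otimes> hc (j - i) y"
  using hcomp_mult[of x i y "j - i"] by simp

lemma hc_finsum:
  assumes "finite A" "f \<in> A \<rightarrow> carrier R"
  shows "hc i (\<Oplus>a\<in>A. f a) = (\<Oplus>a\<in>A. hc i (f a))"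
  using assms
proof (induction A rule: finite_induct)
  case (insert a A)
  then have 1: "f \<in> A \<rightarrow> carrier R" "f a \<in> carrier R" by auto
  then have 2: "(\<lambda>a. hc i (f a)) \<in> A \<rightarrow> carrier R" "hc i (f a) \<in> carrier R"
    by (auto simp: Pi_iff)
  show ?case using insert 1 2
    by (simp add: RG.hcomp_add del: RG.hcomp_closed)
qed simp

text \<open>Taking the component of degree \<open>i\<close> of any representation of
  \<open>y\<close> replaces each coefficient by its component of degree
  \<open>i - D a\<close>.\<close>

lemma genideal_homogeneous_finsum:
  assumes A: "finite A" and x: "\<And>a. a \<in> A \<Longrightarrow> x a \<in> rgrade R (D a)"
    and y: "y \<in> Idl (x ` A)" "y \<in> rgrade R i"
  obtains r where "\<And>a. r a \<in> rgrade R (i - D a)" "y = (\<Oplus>a\<in>A. r a \<otimes> x a)"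
proof -
  have xC: "x \<in> A \<rightarrow> carrier R" using x RG.gr_carrier by blast
  from genideal_image_finsum[OF A xC y(1)] obtain r where
    r: "\<And>a. r a \<in> carrier R" "y = (\<Oplus>a\<in>A. r a \<otimes> x a)" by blast
  have "y = hc i y" using y(2) RG.hcomp_of_gr by simp
  also have "\<dots> = (\<Oplus>a\<in>A. hc i (r a \<otimes> x a))"
    unfolding r(2) using A xC r by (intro hc_finsum) auto
  also have "\<dots> = (\<Oplus>a\<in>A. hc (i - D a) (r a) \<otimes> x a)"
  proof (rule finsum_cong')
    fix a assume a: "a \<in> A"
    have "hc i (r a \<otimes> x a) = hc i (x a \<otimes> r a)" using r xC a by (simp add: m_comm Pi_iff)
    also have "\<dots> = hc (i - D a) (r a) \<otimes> x a"
      using hc_mult[OF x[OF a] r(1)] r xC a by (simp add: m_comm Pi_iff)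
    finally show "hc i (r a \<otimes> x a) = hc (i - D a) (r a) \<otimes> x a" .
  qed (use r xC in auto)
  finally show thesis using that[of "\<lambda>a. hc (i - D a) (r a)"] r RG.hcomp_gr by blast
qed

lemma irrelevant_ideal_iff:
  "x \<in> irrelevant_ideal R \<longleftrightarrow> x \<in> carrier R \<and> hc 0 x = \<zero>"
proof
  assume "x \<in> irrelevant_ideal R"
  then obtain f where f: "homogeneous_decomposition R (rgrade R) f x" "\<forall>i\<le>0. f i = \<zero>"
    by (auto simp: irrelevant_ideal_def)
  have "f i \<in> carrier R" for i using f RG.gr_carrier by (auto simp: homogeneous_decomposition_def)
  then have "x \<in> carrier R" using f by (auto simp: homogeneous_decomposition_def)
  with RG.decomposition_unique[OF this f(1), of 0] f show "x \<in> carrier R \<and> hc 0 x = \<zero>" by simp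
next
  assume x: "x \<in> carrier R \<and> hc 0 x = \<zero>"
  then show "x \<in> irrelevant_ideal R"
    unfolding irrelevant_ideal_def using RG.hcomp_decomposition[of x] hcomp_negative[of x]
    by (auto simp: order_le_less)
qed

text \<open>Without negative degrees only degree 0 components contribute to degree 0 of a product.
  So the projection to \<open>K\<close> is a ring homomorphism, and the irrelevant ideal is prime as
  its kernel.\<close>

lemma hc_zero_mult:
  assumes "x \<in> carrier R" "y \<in> carrier R"
  shows "hc 0 (x \<otimes> y) = hc 0 x \<otimes> hc 0 y"
  using assms(1)
proof (induction rule: RG.graded_induct)
  case (add i z)
  have C: "hc i x \<in> carrier R" "z \<in> carrier R" using assms add by auto
  have gr: "hc i x \<in> rgrade R i" using assms RG.hcomp_gr by auto
  have "hc 0 (hc i x \<otimes> y) = hc 0 (hc i x) \<otimes> hc 0 y"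
  proof (cases "i = 0")
    case True
    then show ?thesis using hc_mult[OF gr assms(2), of 0] RG.hcomp_of_gr[OF gr] by simp
  next
    case False
    have "hc 0 (hc i x \<otimes> y) = \<zero>"
    proof (cases "i < 0")
      case True
      then show ?thesis using hcomp_negative assms by simp
    next
      case False
      then show ?thesis
        using hc_mult[OF gr assms(2), of 0] hcomp_negative[OF assms(2), of "- i"] \<open>i \<noteq> 0\<close> C by simp
    qed
    then show ?thesis using RG.hcomp_of_gr[OF gr] False assms by simp
  qed
  then show ?case using C assms add by (simp add: l_distr RG.hcomp_add)
qed (use assms in simp)

lemma irrelevant_primeideal: "primeideal (irrelevant_ideal R) R"
proof -
  have sub: "irrelevant_ideal R \<subseteq> carrier R" using irrelevant_ideal_iff by auto
  have id: "ideal (irrelevant_ideal R) R"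
  proof (rule idealI[OF ring_axioms])
    show "subgroup (irrelevant_ideal R) (add_monoid R)"
    proof (rule add.subgroupI)
      have "\<zero> \<in> irrelevant_ideal R" by (simp add: irrelevant_ideal_iff)
      then show "irrelevant_ideal R \<noteq> {}" by blast
    qed (auto simp: irrelevant_ideal_iff RG.hcomp_add RG.hcomp_neg)
  qed (auto simp: irrelevant_ideal_iff hc_zero_mult)
  show ?thesis
  proof (rule primeidealI[OF id cring_axioms])
    show "carrier R \<noteq> irrelevant_ideal R"
      using RG.hcomp_of_gr[OF one_K, of 0] one_neq_zero irrelevant_ideal_iff[of \<one>] by auto
    fix a b assume ab: "a \<in> carrier R" "b \<in> carrier R" "a \<otimes> b \<in> irrelevant_ideal R"
    show "a \<in> irrelevant_ideal R \<or> b \<in> irrelevant_ideal R"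
    proof (rule disjCI)
      assume "b \<notin> irrelevant_ideal R"
      then have "hc 0 b \<noteq> \<zero>" using ab irrelevant_ideal_iff by auto
      then obtain c where c: "c \<in> K" "hc 0 b \<otimes> c = \<one>"
        using inverse_K[of "hc 0 b"] ab RG.hcomp_gr by metis
      have C: "c \<in> carrier R" "hc 0 a \<in> carrier R" "hc 0 b \<in> carrier R" using c K_carrier ab by auto
      have "hc 0 a \<otimes> hc 0 b = \<zero>" using ab irrelevant_ideal_iff hc_zero_mult by auto
      then have "hc 0 a \<otimes> (hc 0 b \<otimes> c) = \<zero>" using C by (simp add: m_assoc[symmetric])
      then show "a \<in> irrelevant_ideal R" using c C ab irrelevant_ideal_iff by auto
    qed
  qed
qed

lemma irrelevant_hideal: "hideal (irrelevant_ideal R)"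
  unfolding hideal_def using primeideal.axioms(1)[OF irrelevant_primeideal]
proof (intro conjI ballI allI)
  fix x i assume "x \<in> irrelevant_ideal R"
  then show "hc i x \<in> irrelevant_ideal R"
    using RG.hcomp_gr[of x i] RG.hcomp_of_gr[of "hc i x" i 0]
    by (auto simp: irrelevant_ideal_iff split: if_splits)
qed

lemma grade_irrelevant: "x \<in> rgrade R i \<Longrightarrow> i \<noteq> 0 \<Longrightarrow> x \<in> irrelevant_ideal R"
  using RG.gr_carrier RG.hcomp_of_gr[of x i 0] by (auto simp: irrelevant_ideal_iff)

text \<open>The components of finitely many generators generate. They are stored in pairs with their
  degrees, and zero components are dropped, since only a nonzero element determines its
  degree.\<close>

lemma hideal_generators:
  assumes "hideal J"
  obtains y D and n :: nat where "\<And>j. j < n \<Longrightarrow> y j \<in> rgrade R (D j) \<and> y j \<noteq> \<zero>" "J = Idl (y ` {..<n})"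
proof -
  interpret J: ideal J R using assms by (simp add: hideal_def)
  obtain A where A: "A \<subseteq> carrier R" "finite A" "J = Idl A" using finetely_gen[OF J.is_ideal] by auto
  define P where "P = {(hc i a, i) | i a. a \<in> A \<and> hc i a \<noteq> \<zero>}"
  have "P = (\<Union>a\<in>A. (\<lambda>i. (hc i a, i)) ` {i. hc i a \<noteq> \<zero>})" by (auto simp: P_def)
  then have "finite P" using A RG.finite_support_hcomp by auto
  then obtain n :: nat and e where e: "P = e ` {i. i < n}"
    using finite_imp_nat_seg_image_inj_on by blast
  have PJ: "fst ` P \<subseteq> J"
  proof -
    have "A \<subseteq> J" using A genideal_self by auto
    then show ?thesis using assms by (auto simp: P_def hideal_def)
  qed
  have PC: "fst ` P \<subseteq> carrier R" using PJ J.Icarr by auto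
  interpret JP: ideal "Idl (fst ` P)" R by (rule genideal_ideal[OF PC])
  have "A \<subseteq> Idl (fst ` P)"
  proof
    fix a assume a: "a \<in> A"
    then have aC: "a \<in> carrier R" using A by auto
    have mem: "hc i a \<in> Idl (fst ` P)" for i
    proof (cases "hc i a = \<zero>")
      case False
      then have "hc i a \<in> fst ` P" using a by (auto simp: P_def intro!: image_eqI[of _ fst "(hc i a, i)"])
      then show ?thesis using genideal_self[OF PC] by auto
    qed simp
    show "a \<in> Idl (fst ` P)"
      using aC by (induction rule: RG.graded_induct) (auto intro: mem JP.a_closed)
  qed
  then have "J \<subseteq> Idl (fst ` P)" using A JP.is_ideal genideal_minimal by auto
  moreover have "Idl (fst ` P) \<subseteq> J" using genideal_minimal[OF J.is_ideal PJ] .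
  ultimately have "J = Idl (fst ` P)" by auto
  moreover have "fst ` P = (\<lambda>j. fst (e j)) ` {..<n}" using e by (auto simp: image_image lessThan_def)
  moreover have "fst (e j) \<in> rgrade R (snd (e j)) \<and> fst (e j) \<noteq> \<zero>" if "j < n" for j
  proof -
    have "e j \<in> P" using e that by auto
    then show ?thesis using A RG.hcomp_gr by (auto simp: P_def)
  qed
  ultimately show thesis using that[of n "\<lambda>j. fst (e j)" "\<lambda>j. snd (e j)"] by auto
qed

end

section \<open>Monomials\<close>

text \<open>Exponent vectors of length \<open>t\<close> are functions vanishing from \<open>t\<close> on.\<close>

definition exps :: "nat \<Rightarrow> (nat \<Rightarrow> nat) set" where
  "exps t = {b. \<forall>j\<ge>t. b j = 0}"

definition box :: "nat \<Rightarrow> nat \<Rightarrow> (nat \<Rightarrow> nat) set" where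
  "box t m = {b \<in> exps t. \<forall>j<t. b j \<le> m}"

definition wdeg :: "(nat \<Rightarrow> nat) \<Rightarrow> nat \<Rightarrow> (nat \<Rightarrow> nat) \<Rightarrow> nat" where
  "wdeg D t b = (\<Sum>j<t. b j * D j)"

lemma box_0: "box 0 m = {\<lambda>_. 0}"
  by (auto simp: box_def exps_def)

lemma box_Suc: "box (Suc t) m = (\<Union>e\<in>{..m}. (\<lambda>b. b(t := e)) ` box t m)"
proof (intro equalityI subsetI)
  fix b assume b: "b \<in> box (Suc t) m"
  then have "b = (b(t := 0))(t := b t)" "b(t := 0) \<in> box t m" "b t \<in> {..m}"
    by (auto simp: box_def exps_def)
  then show "b \<in> (\<Union>e\<in>{..m}. (\<lambda>b. b(t := e)) ` box t m)" by blast
qed (auto simp: box_def exps_def)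

lemma inj_on_fun_upd_box: "inj_on (\<lambda>b. b(t := e)) (box t m)"
proof (rule inj_onI)
  fix b b' assume b: "b \<in> box t m" "b' \<in> box t m" and eq: "b(t := e) = b'(t := e)"
  show "b = b'"
  proof
    fix j show "b j = b' j"
      using fun_cong[OF eq, of j] b by (cases "j = t") (auto simp: box_def exps_def)
  qed
qed

lemma finite_box: "finite (box t m)"
  by (induction t) (simp_all add: box_0 box_Suc)

lemma card_box: "card (box t m) = (m + 1) ^ t"
proof (induction t)
  case (Suc t)
  have "card (box (Suc t) m) = (\<Sum>e\<le>m. card ((\<lambda>b. b(t := e)) ` box t m))"
    unfolding box_Suc
  proof (rule card_UN_disjoint)
    show "\<forall>i\<in>{..m}. \<forall>j\<in>{..m}. i \<noteq> j \<longrightarrow>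
      (\<lambda>b. b(t := i)) ` box t m \<inter> (\<lambda>b. b(t := j)) ` box t m = {}"
      by (auto dest: fun_cong[of _ _ t])
  qed (simp_all add: finite_box)
  also have "\<dots> = (m + 1) ^ Suc t" using Suc by (simp add: card_image inj_on_fun_upd_box)
  finally show ?case .
qed (simp add: box_0)

text \<open>Positive weights bound every exponent by the weighted degree; all polynomial growth
  estimates come from this.\<close>

lemma wdeg_le_box:
  assumes "\<forall>j<t. 0 < D j" "b \<in> exps t" "wdeg D t b \<le> M"
  shows "b \<in> box t M"
proof -
  have "b j \<le> M" if "j < t" for j
  proof -
    have "0 < D j" using assms that by blast
    then have "b j \<le> b j * D j" by (cases "D j") auto
    also have "\<dots> \<le> wdeg D t b" unfolding wdeg_def using that by (intro member_le_sum) auto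
    finally show ?thesis using assms by simp
  qed
  then show ?thesis using assms by (simp add: box_def)
qed

lemma finite_wdeg:
  assumes "\<forall>j<t. 0 < D j"
  shows "finite {b \<in> exps t. wdeg D t b \<le> M}" "finite {b \<in> exps t. wdeg D t b = M}"
proof -
  have "{b \<in> exps t. wdeg D t b \<le> M} \<subseteq> box t M" using wdeg_le_box[OF assms] by auto
  then show "finite {b \<in> exps t. wdeg D t b \<le> M}" using finite_box finite_subset by blast
  then show "finite {b \<in> exps t. wdeg D t b = M}" by (rule rev_finite_subset) auto
qed

lemma card_wdeg:
  assumes "\<forall>j<t. 0 < D j"
  shows "card {b \<in> exps t. wdeg D t b \<le> M} \<le> (M + 1) ^ t"
proof -
  have "{b \<in> exps t. wdeg D t b \<le> M} \<subseteq> box t M" using wdeg_le_box[OF assms] by auto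
  from card_mono[OF finite_box this] show ?thesis by (simp add: card_box)
qed

lemma wdeg_add: "wdeg D t (\<lambda>j. b j + b' j) = wdeg D t b + wdeg D t b'"
  by (simp add: wdeg_def sum.distrib algebra_simps)

lemma wdeg_upd: "j < t \<Longrightarrow> wdeg D t (b(j := Suc (b j))) = D j + wdeg D t b"
proof -
  assume j: "j < t"
  have "wdeg D t (b(j := Suc (b j))) = (\<Sum>i<t. b i * D i + (if i = j then D j else 0))"
    unfolding wdeg_def by (intro sum.cong) auto
  then show ?thesis using j by (simp add: sum.distrib wdeg_def)
qed

context graded_algebra
begin

section \<open>Monomials in homogeneous elements and the spanning sets they give\<close>

primrec mon :: "(nat \<Rightarrow> 'a) \<Rightarrow> nat \<Rightarrow> (nat \<Rightarrow> nat) \<Rightarrow> 'a" where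
  "mon x 0 b = \<one>"
| "mon x (Suc t) b = x t [^] b t \<otimes> mon x t b"

lemma mon_closed: "(\<And>j. j < t \<Longrightarrow> x j \<in> carrier R) \<Longrightarrow> mon x t b \<in> carrier R"
  by (induction t) auto

lemma mon_cong: "(\<And>j. j < t \<Longrightarrow> b j = b' j) \<Longrightarrow> mon x t b = mon x t b'"
  by (induction t) auto

lemma mon_zero: "mon x t (\<lambda>_. 0) = \<one>"
  by (induction t) auto

lemma mon_add:
  "(\<And>j. j < t \<Longrightarrow> x j \<in> carrier R) \<Longrightarrow>
    mon x t (\<lambda>j. b j + b' j) = mon x t b \<otimes> mon x t b'"
proof (induction t)
  case (Suc t)
  then have "mon x t b \<in> carrier R" "mon x t b' \<in> carrier R" "x t \<in> carrier R"
    by (auto intro: mon_closed)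
  with Suc show ?case by (simp add: nat_pow_mult[symmetric] m_ac)
qed simp

lemma mon_upd:
  "\<lbrakk>\<And>j. j < t \<Longrightarrow> x j \<in> carrier R; j < t\<rbrakk> \<Longrightarrow> mon x t (b(j := Suc (b j))) = x j \<otimes> mon x t b"
proof (induction t)
  case (Suc t)
  then have C: "mon x t b \<in> carrier R" "x t \<in> carrier R" "x j \<in> carrier R"
    by (auto intro: mon_closed)
  show ?case
  proof (cases "j = t")
    case True
    have e: "mon x t (b(t := Suc (b t))) = mon x t b" by (rule mon_cong) simp
    have "mon x (Suc t) (b(t := Suc (b t))) = x t [^] Suc (b t) \<otimes> mon x t b"
      by (simp only: mon.simps fun_upd_same e)
    also have "\<dots> = x t \<otimes> mon x (Suc t) b" using C by (simp add: m_ac)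
    finally show ?thesis by (simp only: True)
  next
    case False
    then show ?thesis using Suc C by (simp add: m_lcomm)
  qed
qed simp

definition hsys :: "(nat \<Rightarrow> 'a) \<Rightarrow> (nat \<Rightarrow> nat) \<Rightarrow> nat \<Rightarrow> bool" where
  "hsys x D t \<longleftrightarrow> (\<forall>j<t. x j \<in> rgrade R (int (D j)) \<and> 0 < D j)"

lemma hsys_carrier: "hsys x D t \<Longrightarrow> j < t \<Longrightarrow> x j \<in> carrier R"
  using RG.gr_carrier by (auto simp: hsys_def)

lemma hsys_pos: "hsys x D t \<Longrightarrow> \<forall>j<t. 0 < D j"
  by (auto simp: hsys_def)

lemma pow_grade: "y \<in> rgrade R i \<Longrightarrow> y [^] (n::nat) \<in> rgrade R (int n * i)"
proof (induction n)
  case (Suc n)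
  then show ?case using mult_degree[of "y [^] n" "int n * i" y i] by (simp add: algebra_simps)
qed (simp add: one_K)

lemma mon_grade: "hsys x D t \<Longrightarrow> mon x t b \<in> rgrade R (int (wdeg D t b))"
proof (induction t)
  case (Suc t)
  then have IH: "mon x t b \<in> rgrade R (int (wdeg D t b))" by (auto simp: hsys_def)
  have "x t [^] b t \<in> rgrade R (int (b t) * int (D t))"
    using Suc.prems by (intro pow_grade) (auto simp: hsys_def)
  from mult_degree[OF this IH] show ?case by (simp add: wdeg_def algebra_simps)
qed (simp add: wdeg_def one_K)

text \<open>A graded form of Nakayama's lemma: from degree \<open>N\<close> on an element is a
  combination of the \<open>x j\<close> with coefficients of smaller degree, to which the induction
  applies. So spanning sets of the finitely many degrees below \<open>N\<close> generate
  \<open>R\<close> over the polynomials in \<open>x\<close>.\<close>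

lemma kspan_monomials:
  assumes x: "hsys x D t" and N: "\<And>e. N \<le> e \<Longrightarrow> rgrade R (int e) \<subseteq> Idl (x ` {..<t})"
    and G: "\<And>e. e < N \<Longrightarrow> G e \<subseteq> rgrade R (int e) \<and> rgrade R (int e) \<subseteq> kspan (G e)"
    and r: "r \<in> rgrade R (int e)"
  shows "r \<in> kspan {mon x t b \<otimes> g | b g f. b \<in> exps t \<and> f < N \<and> g \<in> G f \<and> wdeg D t b + f = e}"
  using r
proof (induction e arbitrary: r rule: less_induct)
  case (less e)
  let ?S = "\<lambda>e. {mon x t b \<otimes> g | b g f. b \<in> exps t \<and> f < N \<and> g \<in> G f \<and> wdeg D t b + f = e}"
  have xC: "\<And>j. j < t \<Longrightarrow> x j \<in> carrier R" using hsys_carrier[OF x] .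
  have monC: "mon x t b \<in> carrier R" for b using mon_closed xC by blast
  have GC: "g \<in> carrier R" if "f < N" "g \<in> G f" for f g using G[OF that(1)] that(2) RG.gr_carrier by blast
  have SC: "?S e \<subseteq> carrier R" for e using monC GC by auto
  show ?case
  proof (cases "e < N")
    case True
    have "G e \<subseteq> ?S e"
    proof
      fix g assume g: "g \<in> G e"
      have "mon x t (\<lambda>_. 0) \<otimes> g = g" using GC[OF True g] by (simp add: mon_zero)
      moreover have "(\<lambda>_. 0) \<in> exps t" "wdeg D t (\<lambda>_. 0) = 0" by (auto simp: exps_def wdeg_def)
      ultimately show "g \<in> ?S e" using g True
        by (intro CollectI exI[of _ "\<lambda>_. 0"] exI[of _ g] exI[of _ e]) simp
    qed
    then show ?thesis using G[OF True] less.prems kspan_mono by blast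
  next
    case False
    have gen: "r \<in> Idl (x ` {..<t})" using N[of e] False less.prems by auto
    have xg: "\<And>j. j \<in> {..<t} \<Longrightarrow> x j \<in> rgrade R (int (D j))" using x by (auto simp: hsys_def)
    obtain q where q: "\<And>j. q j \<in> rgrade R (int e - int (D j))" "r = (\<Oplus>j\<in>{..<t}. q j \<otimes> x j)"
      using genideal_homogeneous_finsum[OF finite_lessThan xg gen less.prems] by metis
    have qC: "q j \<in> carrier R" for j using q(1) RG.gr_carrier by blast
    have step: "q j \<otimes> x j \<in> kspan (?S e)" if j: "j < t" for j
    proof (cases "D j \<le> e")
      case False
      then have "q j = \<zero>" using q(1)[of j] negative_degree by auto
      then show ?thesis using xC[OF j] kspan.zero by simp
    next
      case True
      have "q j \<in> kspan (?S (e - D j))"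
        using less.IH[of "e - D j" "q j"] x j q(1)[of j] True by (auto simp: hsys_def of_nat_diff)
      moreover have "x j \<otimes> s \<in> ?S e" if s: "s \<in> ?S (e - D j)" for s
      proof -
        obtain b g f where b: "s = mon x t b \<otimes> g" "b \<in> exps t" "f < N" "g \<in> G f"
          "wdeg D t b + f = e - D j" using s by auto
        have "x j \<otimes> s = mon x t (b(j := Suc (b j))) \<otimes> g"
          using mon_upd[of t x j b, OF xC j] xC[OF j] monC GC[OF b(3,4)] b(1) by (simp add: m_assoc)
        moreover have "b(j := Suc (b j)) \<in> exps t" using b j by (auto simp: exps_def)
        moreover have "wdeg D t (b(j := Suc (b j))) + f = e" using wdeg_upd[OF j] b True by simp
        ultimately show ?thesis using b by blast
      qed
      ultimately have "x j \<otimes> q j \<in> kspan (?S e)" using kspan_mult[OF SC xC[OF j]] by blast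
      then show ?thesis using m_comm xC[OF j] qC by simp
    qed
    have "(\<Oplus>j\<in>A. q j \<otimes> x j) \<in> kspan (?S e)" if "finite A" "A \<subseteq> {..<t}" for A
      using that
    proof (induction A rule: finite_induct)
      case (insert j A)
      then have "(\<lambda>j. q j \<otimes> x j) \<in> A \<rightarrow> carrier R" "q j \<otimes> x j \<in> carrier R" using qC xC by auto
      with insert show ?case using kspan_add[OF SC _ step[of j]] by simp
    qed (simp add: kspan.zero)
    then show ?thesis using q(2) by auto
  qed
qed

lemma irrelevant_generators:
  obtains y D n where "hsys y D n" "irrelevant_ideal R = Idl (y ` {..<n})"
proof -
  obtain y D and n :: nat where y: "\<And>j. j < n \<Longrightarrow> y j \<in> rgrade R (D j) \<and> y j \<noteq> \<zero>"
      "irrelevant_ideal R = Idl (y ` {..<n})"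
    using hideal_generators[OF irrelevant_hideal] by metis
  have "y j \<in> rgrade R (int (nat (D j))) \<and> 0 < nat (D j)" if j: "j < n" for j
  proof -
    have "y ` {..<n} \<subseteq> carrier R" using y RG.gr_carrier by blast
    then have "y j \<in> irrelevant_ideal R" using genideal_self y(2) j by blast
    then have "D j \<noteq> 0" using y(1)[OF j] RG.hcomp_of_gr[of "y j" "D j" 0]
      by (auto simp: irrelevant_ideal_iff)
    moreover have "\<not> D j < 0" using y(1)[OF j] negative_degree by auto
    ultimately show ?thesis using y(1)[OF j] by simp
  qed
  then have "hsys y (\<lambda>j. nat (D j)) n" by (simp add: hsys_def)
  then show thesis using that y(2) by blast
qed

text \<open>The case \<open>N = 1\<close> with the single module generator \<open>\<one>\<close>:
  homogeneous generators of the irrelevant ideal generate \<open>R\<close> as an algebra over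
  \<open>K\<close>.\<close>

lemma monomial_spanning:
  obtains y D n where "hsys y D n" "irrelevant_ideal R = Idl (y ` {..<n})"
    "\<And>e. rgrade R (int e) \<subseteq> kspan (mon y n ` {b \<in> exps n. wdeg D n b = e})"
proof -
  obtain y D n where y: "hsys y D n" "irrelevant_ideal R = Idl (y ` {..<n})"
    using irrelevant_generators .
  have monC: "mon y n b \<in> carrier R" for b using mon_closed hsys_carrier[OF y(1)] by blast
  have N: "rgrade R (int e) \<subseteq> Idl (y ` {..<n})" if "1 \<le> e" for e
    using grade_irrelevant[of _ "int e"] y(2) that by auto
  have "K \<subseteq> kspan {\<one>}"
  proof
    fix c assume "c \<in> K"
    then have "c \<otimes> \<one> \<oplus> \<zero> \<in> kspan {\<one>}" by (intro kspan.intros) auto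
    then show "c \<in> kspan {\<one>}" using \<open>c \<in> K\<close> K_carrier by simp
  qed
  then have G: "\<And>e::nat. e < 1 \<Longrightarrow> {\<one>} \<subseteq> rgrade R (int e) \<and> rgrade R (int e) \<subseteq> kspan {\<one>}"
    using one_K by simp
  have "rgrade R (int e) \<subseteq> kspan (mon y n ` {b \<in> exps n. wdeg D n b = e})" for e
  proof
    fix r assume "r \<in> rgrade R (int e)"
    from kspan_monomials[of y D n 1 "\<lambda>_. {\<one>}", OF y(1) N G this]
    show "r \<in> kspan (mon y n ` {b \<in> exps n. wdeg D n b = e})"
      by (rule kspan_mono[rotated]) (use monC in auto)
  qed
  then show thesis using that y by blast
qed

lemma kspan_smult:
  assumes S: "S \<subseteq> carrier R" and c: "c \<in> K" and y: "y \<in> kspan S"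
  shows "c \<otimes> y \<in> kspan S"
  using y
proof (induction rule: kspan.induct)
  case zero
  then show ?case using c K_carrier kspan.zero by simp
next
  case (add s d y)
  have C: "c \<in> carrier R" "d \<in> carrier R" "s \<in> carrier R" "y \<in> carrier R"
    using add S c K_carrier kspan_carrier[OF S] by auto
  have "c \<otimes> (d \<otimes> s \<oplus> y) = (c \<otimes> d) \<otimes> s \<oplus> c \<otimes> y" using C by (simp add: r_distr m_assoc)
  then show ?case using kspan.add[OF add(1) mult_K[OF c add(2)] add.IH] by simp
qed

text \<open>A module generator carries its degree as second component, since a degree cannot be read
  off from an element that happens to be zero.\<close>

definition gmons :: "nat \<Rightarrow> (nat \<Rightarrow> nat) \<Rightarrow> ('a \<times> nat) set \<Rightarrow> nat \<Rightarrow> ((nat \<Rightarrow> nat) \<times> ('a \<times> nat)) set" where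
  "gmons t D G e = {(b, g). b \<in> exps t \<and> g \<in> G \<and> wdeg D t b + snd g = e}"

definition gmon :: "(nat \<Rightarrow> 'a) \<Rightarrow> nat \<Rightarrow> (nat \<Rightarrow> nat) \<times> ('a \<times> nat) \<Rightarrow> 'a" where
  "gmon x t = (\<lambda>(b, g). mon x t b \<otimes> fst g)"

lemma finite_gmons:
  assumes "\<forall>j<t. 0 < D j" "finite G"
  shows "finite (gmons t D G e)"
proof -
  have "gmons t D G e \<subseteq> {b \<in> exps t. wdeg D t b \<le> e} \<times> G" by (auto simp: gmons_def)
  then show ?thesis using finite_wdeg(1)[OF assms(1)] assms(2) by (auto intro: finite_subset)
qed

text \<open>Finite generation of \<open>R\<close> over the polynomials in \<open>x\<close>. In the
  degrees below \<open>N\<close> the monomials in the algebra generators \<open>y\<close> serve as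
  finite spanning sets.\<close>

lemma gmon_spanning:
  assumes x: "hsys x D t" and N: "\<And>e. N \<le> e \<Longrightarrow> rgrade R (int e) \<subseteq> Idl (x ` {..<t})"
  obtains G where "finite G" "\<And>g. g \<in> G \<Longrightarrow> fst g \<in> rgrade R (int (snd g))"
    "\<And>e. rgrade R (int e) \<subseteq> kspan (gmon x t ` gmons t D G e)"
proof -
  obtain y D' n where y: "hsys y D' n" "\<And>e. rgrade R (int e) \<subseteq> kspan (mon y n ` {b \<in> exps n. wdeg D' n b = e})"
    using monomial_spanning by metis
  define H where "H e = mon y n ` {b \<in> exps n. wdeg D' n b = e}" for e
  have H: "finite (H e)" "H e \<subseteq> rgrade R (int e)" for e
    using finite_wdeg(2)[OF hsys_pos[OF y(1)]] mon_grade[OF y(1)] by (auto simp: H_def)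
  define G where "G = (\<Union>f\<in>{..<N}. (\<lambda>g. (g, f)) ` H f)"
  have "finite G" using H by (simp add: G_def)
  moreover have "fst g \<in> rgrade R (int (snd g))" if "g \<in> G" for g
    using that by (auto simp: G_def dest: subsetD[OF H(2)])
  moreover have "rgrade R (int e) \<subseteq> kspan (gmon x t ` gmons t D G e)" for e
  proof
    fix r assume r: "r \<in> rgrade R (int e)"
    have HG: "\<And>e. e < N \<Longrightarrow> H e \<subseteq> rgrade R (int e) \<and> rgrade R (int e) \<subseteq> kspan (H e)"
      using H y(2) by (simp add: H_def)
    have sub: "{mon x t b \<otimes> g | b g f. b \<in> exps t \<and> f < N \<and> g \<in> H f \<and> wdeg D t b + f = e}
        \<subseteq> gmon x t ` gmons t D G e"
    proof clarify
      fix b g f assume "b \<in> exps t" "f < N" "g \<in> H f" "e = wdeg D t b + f"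
      then have "(b, (g, f)) \<in> gmons t D G (wdeg D t b + f)" by (auto simp: gmons_def G_def)
      then show "mon x t b \<otimes> g \<in> gmon x t ` gmons t D G (wdeg D t b + f)"
        by (force simp: gmon_def)
    qed
    show "r \<in> kspan (gmon x t ` gmons t D G e)"
      by (rule kspan_mono[OF sub kspan_monomials[of x D t N H, OF x N HG r]])
  qed
  ultimately show thesis using that by blast
qed

section \<open>The Krull dimension is finite\<close>

text \<open>Elements \<open>s\<close> picked between consecutive primes of a chain are algebraically independent
  over \<open>K\<close>.\<close>

lemma prime_chain_independent_step:
  fixes m :: nat
  assumes p: "primeideal p R" and q: "ideal q R" "p \<subseteq> q" and s: "s \<in> q" "s \<notin> p"
    and Q: "\<And>e. e \<le> m \<Longrightarrow> Q e \<in> carrier R" "\<And>e. e \<le> m \<Longrightarrow> Q e \<in> q \<Longrightarrow> Q e = \<zero>"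
    and sum: "(\<Oplus>e\<in>{..m}. s [^] e \<otimes> Q e) \<in> p"
  shows "\<forall>e\<le>m. Q e = \<zero>"
  using Q sum
proof (induction m arbitrary: Q)
  case 0
  then show ?case using q by auto
next
  case (Suc m)
  interpret p: primeideal p R by (rule p)
  interpret q: ideal q R by (rule q)
  have sC: "s \<in> carrier R" using s q.Icarr by auto
  let ?T = "\<Oplus>e\<in>{..m}. s [^] e \<otimes> Q (Suc e)"
  have TC: "?T \<in> carrier R" using sC Suc.prems by (intro finsum_closed) auto
  have "(\<Oplus>e\<in>{..Suc m}. s [^] e \<otimes> Q e) = (\<Oplus>e\<in>{..m}. s [^] Suc e \<otimes> Q (Suc e)) \<oplus> s [^] (0::nat) \<otimes> Q 0"
    using sC Suc.prems by (intro finsum_Suc2) auto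
  also have "(\<Oplus>e\<in>{..m}. s [^] Suc e \<otimes> Q (Suc e)) = (\<Oplus>e\<in>{..m}. s \<otimes> (s [^] e \<otimes> Q (Suc e)))"
    using sC Suc.prems by (intro finsum_cong') (auto simp: m_ac)
  also have "\<dots> = s \<otimes> ?T" using sC Suc.prems by (intro finsum_rdistr[symmetric]) auto
  finally have eq: "(\<Oplus>e\<in>{..Suc m}. s [^] e \<otimes> Q e) = s \<otimes> ?T \<oplus> Q 0"
    using Suc.prems by simp
  \<comment> \<open>Modulo \<open>q\<close> only the constant term survives, so it vanishes; then
    \<open>s\<close> can be cancelled modulo the prime \<open>p\<close>, and the degree in
    \<open>s\<close> drops.\<close>
  have "s \<otimes> ?T \<in> q" using s TC by (simp add: q.I_r_closed)
  moreover have "s \<otimes> ?T \<oplus> Q 0 \<in> q" using eq Suc.prems(3) q by auto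
  ultimately have "\<ominus> (s \<otimes> ?T) \<oplus> (s \<otimes> ?T \<oplus> Q 0) \<in> q"
    using additive_subgroup.a_closed[OF q.additive_subgroup_axioms]
      additive_subgroup.a_inv_closed[OF q.additive_subgroup_axioms] by blast
  moreover have "\<ominus> (s \<otimes> ?T) \<oplus> (s \<otimes> ?T \<oplus> Q 0) = Q 0"
    using Suc.prems(1)[of 0] m_closed[OF sC TC] by (simp add: r_neg1)
  ultimately have "Q 0 \<in> q" by simp
  then have Q0: "Q 0 = \<zero>" using Suc.prems by simp
  then have "s \<otimes> ?T \<in> p" using eq Suc.prems(3) sC TC by simp
  then have "?T \<in> p" using p.I_prime[OF sC TC] s by auto
  then have "\<forall>e\<le>m. Q (Suc e) = \<zero>" using Suc.prems by (intro Suc.IH) auto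
  then show ?case using Q0 by (metis Suc_le_mono not0_implies_Suc)
qed

text \<open>The chain is read from the top. A nonzero constant is a unit and lies in no prime;
  passing from \<open>p (n - t)\<close> to the next smaller prime adjoins \<open>s t\<close> as a
  new variable. The coefficients of its powers are polynomials in the earlier elements, and the
  induction hypothesis says that such a polynomial in \<open>p (n - t)\<close> has only zero
  coefficients.\<close>

lemma prime_chain_independent:
  assumes p: "\<And>i. i \<le> n \<Longrightarrow> primeideal (p i) R"
    and s: "\<And>i. i < n \<Longrightarrow> p (n - Suc i) \<subseteq> p (n - i) \<and> s i \<in> p (n - i) \<and> s i \<notin> p (n - Suc i)"
    and t: "t \<le> n" and c: "\<And>b. b \<in> box t m \<Longrightarrow> c b \<in> K"
    and sum: "(\<Oplus>b\<in>box t m. c b \<otimes> mon s t b) \<in> p (n - t)"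
  shows "\<forall>b\<in>box t m. c b = \<zero>"
  using t c sum
proof (induction t arbitrary: c)
  case 0
  interpret p: primeideal "p n" R using p by simp
  have cK: "c (\<lambda>_. 0) \<in> K" using 0 by (simp add: box_0)
  then have cC: "c (\<lambda>_. 0) \<in> carrier R" using K_carrier by blast
  then have cp: "c (\<lambda>_. 0) \<in> p n" using 0 by (simp add: box_0)
  have "c (\<lambda>_. 0) = \<zero>"
  proof (rule ccontr)
    assume "c (\<lambda>_. 0) \<noteq> \<zero>"
    then obtain d where "d \<in> K" "c (\<lambda>_. 0) \<otimes> d = \<one>" using inverse_K cK by metis
    then have "\<one> \<in> p n" using p.I_r_closed[OF cp, of d] K_carrier by simp
    then show False using p.one_imp_carrier p.I_notcarr by simp
  qed
  then show ?case by (simp add: box_0)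
next
  case (Suc t)
  have st: "p (n - Suc t) \<subseteq> p (n - t)" "s t \<in> p (n - t)" "s t \<notin> p (n - Suc t)"
    using s[of t] Suc.prems by auto
  have pid: "ideal (p i) R" if "i \<le> n" for i using p[OF that] by (rule primeideal.axioms)
  have sC: "s j \<in> carrier R" if "j < n" for j
    using s[OF that] ideal.Icarr[OF pid, of "n - j"] by auto
  have mC: "mon s t b \<in> carrier R" for b using mon_closed[of t s b] sC Suc.prems(1) by auto
  have stC: "s t \<in> carrier R" using sC Suc.prems(1) by auto
  have upd: "b(t := e) \<in> box (Suc t) m" if "b \<in> box t m" "e \<le> m" for b e
    using that by (auto simp: box_Suc)
  have cK: "c (b(t := e)) \<in> K" if "b \<in> box t m" "e \<le> m" for b e
    using Suc.prems(2) upd that by auto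
  then have cC: "c (b(t := e)) \<in> carrier R" if "b \<in> box t m" "e \<le> m" for b e
    using K_carrier that by auto
  define Q where "Q e = (\<Oplus>b\<in>box t m. c (b(t := e)) \<otimes> mon s t b)" for e
  have QC: "Q e \<in> carrier R" if "e \<le> m" for e
    unfolding Q_def using cC mC that by (intro finsum_closed) auto
  have "(\<Oplus>b\<in>box (Suc t) m. c b \<otimes> mon s (Suc t) b) =
      (\<Oplus>e\<in>{..m}. \<Oplus>b\<in>(\<lambda>b. b(t := e)) ` box t m. c b \<otimes> mon s (Suc t) b)"
    unfolding box_Suc
  proof (rule add.finprod_UN_disjoint)
    show "pairwise (\<lambda>i j. disjnt ((\<lambda>b. b(t := i)) ` box t m) ((\<lambda>b. b(t := j)) ` box t m)) {..m}"
      by (auto simp: pairwise_def disjnt_def dest: fun_cong[of _ _ t])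
  qed (use finite_box cC mC stC in auto)
  also have "\<dots> = (\<Oplus>e\<in>{..m}. s t [^] e \<otimes> Q e)"
  proof (rule finsum_cong')
    fix e assume e: "e \<in> {..m}"
    have mm: "mon s t (b(t := e)) = mon s t b" for b by (rule mon_cong) simp
    have "(\<Oplus>b\<in>(\<lambda>b. b(t := e)) ` box t m. c b \<otimes> mon s (Suc t) b) =
        (\<Oplus>b\<in>box t m. c (b(t := e)) \<otimes> mon s (Suc t) (b(t := e)))"
      using e cC mC stC inj_on_fun_upd_box by (intro finsum_reindex) auto
    also have "\<dots> = (\<Oplus>b\<in>box t m. s t [^] e \<otimes> (c (b(t := e)) \<otimes> mon s t b))"
      using e cC mC stC mm by (intro finsum_cong') (auto simp: m_lcomm)
    also have "\<dots> = s t [^] e \<otimes> Q e"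
      unfolding Q_def using e cC mC stC finite_box by (intro finsum_rdistr[symmetric]) auto
    finally show "(\<Oplus>b\<in>(\<lambda>b. b(t := e)) ` box t m. c b \<otimes> mon s (Suc t) b) = s t [^] e \<otimes> Q e" .
  qed (use QC stC in auto)
  finally have sum: "(\<Oplus>e\<in>{..m}. s t [^] e \<otimes> Q e) \<in> p (n - Suc t)" using Suc.prems(3) by simp
  have IH: "\<forall>b\<in>box t m. c (b(t := e)) = \<zero>" if "e \<le> m" "Q e \<in> p (n - t)" for e
  proof (rule Suc.IH)
    show "c (b(t := e)) \<in> K" if "b \<in> box t m" for b using cK[OF that \<open>e \<le> m\<close>] .
    show "(\<Oplus>b\<in>box t m. c (b(t := e)) \<otimes> mon s t b) \<in> p (n - t)" using that(2) by (simp only: Q_def)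
  qed (use Suc.prems in simp)
  have Q0: "Q e = \<zero>" if "e \<le> m" "Q e \<in> p (n - t)" for e
  proof -
    have "Q e = (\<Oplus>b\<in>box t m. \<zero>)"
      unfolding Q_def using IH[OF that] mC by (intro finsum_cong') auto
    then show ?thesis by simp
  qed
  have "\<forall>e\<le>m. Q e = \<zero>"
    using prime_chain_independent_step[of "p (n - Suc t)" "p (n - t)" "s t" m Q] p pid st QC Q0 sum by auto
  then have "Q e \<in> p (n - t)" if "e \<le> m" for e
    using that additive_subgroup.zero_closed[OF ideal.axioms(1)[OF pid, of "n - t"]] by simp
  then show ?case using IH by (auto simp: box_Suc)
qed

text \<open>The bound is the number \<open>N\<close> of algebra generators. A chain of length
  \<open>n\<close> gives \<open>n\<close> independent elements, and their \<open>(m + 1)^n\<close>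
  monomials with exponents up to \<open>m\<close> are independent in a space whose dimension is of
  order \<open>m^N\<close>.\<close>

lemma prime_chain_bounded:
  obtains N where "\<And>n p. \<lbrakk>\<forall>i\<le>n. primeideal (p i) R; \<forall>i<n. p i \<subset> p (Suc i)\<rbrakk> \<Longrightarrow> n \<le> N"
proof -
  obtain y D N where y: "hsys y D N" "\<And>e. rgrade R (int e) \<subseteq> kspan (mon y N ` {b \<in> exps N. wdeg D N b = e})"
    using monomial_spanning by metis
  have yC: "\<And>j. j < N \<Longrightarrow> y j \<in> carrier R" using hsys_carrier[OF y(1)] .
  have monC: "mon y N b \<in> carrier R" for b using mon_closed yC by blast
  define W where "W e = {b \<in> exps N. wdeg D N b \<le> e}" for e
  \<comment> \<open>A multiplicative filtration of \<open>R\<close> by degree at most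
    \<open>e\<close>. Single degrees would not do, since the primes of the chain and the elements
    picked from them need not be homogeneous.\<close>
  define F where "F e = kspan (mon y N ` W e)" for e
  have WC: "mon y N ` W e \<subseteq> carrier R" for e using monC by auto
  have F_carrier: "r \<in> carrier R" if "r \<in> F e" for r e
    using kspan_carrier[OF WC] that by (auto simp: F_def)
  have F_mono: "F e \<subseteq> F e'" if "e \<le> e'" for e e'
  proof -
    have "mon y N ` W e \<subseteq> mon y N ` W e'" using that by (auto simp: W_def)
    then show ?thesis unfolding F_def using kspan_mono by blast
  qed
  have F_add: "r \<oplus> r' \<in> F e" if "r \<in> F e" "r' \<in> F e" for r r' e
    using that kspan_add[OF WC] by (simp add: F_def)
  have F_ex: "\<exists>e. r \<in> F e" if r: "r \<in> carrier R" for r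
    using r
  proof (induction rule: RG.graded_induct)
    case zero
    then show ?case by (auto simp: F_def intro: kspan.zero)
  next
    case (add i z)
    then obtain e where e: "z \<in> F e" by auto
    have "hc i r \<in> F (nat i)"
    proof (cases "i < 0")
      case True
      then show ?thesis using hcomp_negative[OF r True] by (simp add: F_def kspan.zero)
    next
      case False
      then have "hc i r \<in> kspan (mon y N ` {b \<in> exps N. wdeg D N b = nat i})"
        using y(2)[of "nat i"] RG.hcomp_gr[OF r, of i] by auto
      then show ?thesis unfolding F_def by (rule kspan_mono[rotated]) (auto simp: W_def)
    qed
    then have "hc i r \<oplus> z \<in> F (max (nat i) e)"
      using F_mono[of "nat i" "max (nat i) e"] F_mono[of e "max (nat i) e"] e by (intro F_add) auto
    then show ?case by blast
  qed
  have F_mult: "r \<otimes> r' \<in> F (e + e')" if r: "r \<in> F e" and r': "r' \<in> F e'" for r r' e e'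
  proof -
    have mm: "mon y N b \<otimes> r' \<in> F (e + e')" if "b \<in> W e" for b
      unfolding F_def
    proof (rule kspan_mult[OF WC monC _ r'[unfolded F_def]])
      fix s assume "s \<in> mon y N ` W e'"
      then obtain b' where b': "b' \<in> W e'" "s = mon y N b'" by auto
      have "mon y N b \<otimes> s = mon y N (\<lambda>j. b j + b' j)" using mon_add[OF yC] b' by simp
      moreover have "(\<lambda>j. b j + b' j) \<in> W (e + e')"
        using that b' by (auto simp: W_def exps_def wdeg_add)
      ultimately show "mon y N b \<otimes> s \<in> mon y N ` W (e + e')" by blast
    qed
    have r'C: "r' \<in> carrier R" using F_carrier r' by blast
    show ?thesis using r[unfolded F_def]
    proof (induction rule: kspan.induct)
      case zero
      then show ?case using r'C by (simp add: F_def kspan.zero)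
    next
      case (add s c z)
      have sC: "s \<in> carrier R" "c \<in> carrier R" "z \<in> carrier R"
        using add WC K_carrier kspan_carrier[OF WC add(3)] by auto
      have "s \<otimes> r' \<in> F (e + e')" using mm add by auto
      then have "c \<otimes> (s \<otimes> r') \<in> F (e + e')"
        unfolding F_def using kspan_smult[OF WC add(2)] by simp
      then show ?case using add.IH F_add sC r'C by (simp add: l_distr m_assoc)
    qed
  qed
  have F_pow: "r [^] k \<in> F (k * e)" if "r \<in> F e" for r e and k :: nat
  proof (induction k)
    case 0
    have "mon y N (\<lambda>_. 0) \<in> mon y N ` W 0" by (auto simp: W_def exps_def wdeg_def)
    then have "\<one> \<in> F 0" unfolding F_def mon_zero by (rule kspan_base[OF WC])
    then show ?case by simp
  next
    case (Suc k)
    from F_mult[OF this that] show ?case by (simp add: add.commute)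
  qed
  have "n \<le> N" if p: "\<forall>i\<le>n. primeideal (p i) R" "\<forall>i<n. p i \<subset> p (Suc i)" for n p
  proof (rule ccontr)
    assume n: "\<not> n \<le> N"
    have "\<exists>s. \<forall>i<n. p (n - Suc i) \<subseteq> p (n - i) \<and> s i \<in> p (n - i) \<and> s i \<notin> p (n - Suc i)"
    proof -
      have "\<exists>s. i < n \<longrightarrow> p (n - Suc i) \<subseteq> p (n - i) \<and> s \<in> p (n - i) \<and> s \<notin> p (n - Suc i)" for i
      proof (cases "i < n")
        case True
        then have "p (n - Suc i) \<subset> p (n - i)" using p(2)[rule_format, of "n - Suc i"] by (simp add: Suc_diff_Suc)
        then show ?thesis by auto
      qed auto
      then show ?thesis by metis
    qed
    then obtain s where s: "\<And>i. i < n \<Longrightarrow> p (n - Suc i) \<subseteq> p (n - i) \<and> s i \<in> p (n - i) \<and> s i \<notin> p (n - Suc i)"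
      by blast
    have pid: "ideal (p i) R" if "i \<le> n" for i using p(1) that primeideal.axioms(1) by blast
    have sC: "s i \<in> carrier R" if "i < n" for i using s[OF that] ideal.Icarr[OF pid, of "n - i"] by auto
    have "\<exists>e. \<forall>i<n. s i \<in> F e"
    proof -
      have "\<exists>e. i < n \<longrightarrow> s i \<in> F e" for i using F_ex sC by blast
      then obtain e where e: "\<And>i. i < n \<Longrightarrow> s i \<in> F (e i)" by metis
      have "s i \<in> F (\<Sum>i<n. e i)" if "i < n" for i
        using e[OF that] F_mono[of "e i" "\<Sum>i<n. e i"] member_le_sum[of i "{..<n}" e] that by auto
      then show ?thesis by blast
    qed
    then obtain e where e: "\<And>i. i < n \<Longrightarrow> s i \<in> F e" by blast
    have mF: "mon s t b \<in> F (t * (m * e))" if "t \<le> n" "b \<in> exps n" "\<forall>j<n. b j \<le> m" for t b m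
      using that(1)
    proof (induction t)
      case 0
      then show ?case using F_pow[of \<zero> 0 0] by (simp add: F_def kspan.zero)
    next
      case (Suc t)
      have "s t [^] b t \<in> F (b t * e)" using Suc.prems by (intro F_pow e) auto
      moreover have "b t * e \<le> m * e" using that Suc.prems by simp
      ultimately have "s t [^] b t \<in> F (m * e)" using F_mono by blast
      from F_mult[OF this Suc.IH] Suc.prems show ?case by simp
    qed
    \<comment> \<open>Chosen so that \<open>(n m e + 1)^N \<le> (n e + 1)^N (m + 1)^N = m (m + 1)^N
      < (m + 1)^(N + 1)\<close>.\<close>
    define m where "m = (n * e + 1) ^ N"
    have card: "card (W (n * (m * e))) < card (box n m)"
    proof -
      have "card (W (n * (m * e))) \<le> (n * (m * e) + 1) ^ N"
        unfolding W_def by (rule card_wdeg[OF hsys_pos[OF y(1)]])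
      also have "\<dots> \<le> ((n * e + 1) * (m + 1)) ^ N" by (intro power_mono) (auto simp: algebra_simps)
      also have "\<dots> = m * (m + 1) ^ N" by (simp only: power_mult_distrib m_def[symmetric])
      also have "\<dots> < (m + 1) * (m + 1) ^ N" by simp
      also have "\<dots> \<le> (m + 1) ^ n" using power_increasing[of "Suc N" n "m + 1"] n by simp
      finally show ?thesis by (simp add: card_box)
    qed
    have finW: "finite (W (n * (m * e)))"
      unfolding W_def by (rule finite_wdeg(1)[OF hsys_pos[OF y(1)]])
    have u: "mon y N \<in> W (n * (m * e)) \<rightarrow> carrier R" using monC by auto
    have v: "\<And>b. b \<in> box n m \<Longrightarrow> mon s n b \<in> kspan (mon y N ` W (n * (m * e)))"
      using mF[of n] by (auto simp: box_def F_def)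
    obtain c where c: "\<And>b. b \<in> box n m \<Longrightarrow> c b \<in> K" "\<exists>b\<in>box n m. c b \<noteq> \<zero>"
        "(\<Oplus>b\<in>box n m. c b \<otimes> mon s n b) = \<zero>"
      using kspan_dependent[of _ "mon y N" _ "mon s n", OF finW u finite_box card v] by blast
    have "\<zero> \<in> p (n - n)" using additive_subgroup.zero_closed[OF ideal.axioms(1)[OF pid, of 0]] by simp
    then have "(\<Oplus>b\<in>box n m. c b \<otimes> mon s n b) \<in> p (n - n)" using c(3) by simp
    from prime_chain_independent[of n p s n m c, OF _ s _ c(1) this] p(1)
    have "\<forall>b\<in>box n m. c b = \<zero>" by blast
    then show False using c(2) by auto
  qed
  then show thesis using that by blast
qed

text \<open>Finiteness makes \<open>the_enat (krull_dim R)\<close>, the cohomological degree in the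
  definition of the canonical module, meaningful. The bound on chains is kept because it yields
  exactly \<open>d\<close> parameters.\<close>

lemma krull_dim_finite:
  obtains d where "krull_dim R = enat d"
    "\<And>n p. \<lbrakk>\<forall>i\<le>n. primeideal (p i) R; \<forall>i<n. p i \<subset> p (Suc i)\<rbrakk> \<Longrightarrow> n \<le> d"
proof -
  obtain N where N: "\<And>n p. \<lbrakk>\<forall>i\<le>n. primeideal (p i) R; \<forall>i<n. p i \<subset> p (Suc i)\<rbrakk> \<Longrightarrow> n \<le> N"
    using prime_chain_bounded by metis
  have "krull_dim R \<le> enat N" unfolding krull_dim_def using N by (intro SUP_least) auto
  then obtain d where d: "krull_dim R = enat d" by (cases "krull_dim R") auto
  have "n \<le> d" if "\<forall>i\<le>n. primeideal (p i) R" "\<forall>i<n. p i \<subset> p (Suc i)" for n p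
  proof -
    have "enat n \<le> krull_dim R" unfolding krull_dim_def using that by (intro SUP_upper) auto
    then show ?thesis using d by simp
  qed
  then show thesis using that d by blast
qed

section \<open>Homogeneous systems of parameters\<close>

lemma hideal_ideal: "hideal J \<Longrightarrow> ideal J R"
  by (simp add: hideal_def)

section \<open>Maximal elements, principal extensions and tests on homogeneous elements\<close>

lemma noetherian_maximal:
  assumes "S \<noteq> {}" "\<And>J. J \<in> S \<Longrightarrow> ideal J R"
  shows "\<exists>M\<in>S. \<forall>J\<in>S. M \<subseteq> J \<longrightarrow> J = M"
proof (rule subset_Zorn_nonempty[OF assms(1)])
  fix C assume C: "C \<noteq> {}" "subset.chain S C"
  then have "subset.chain {I. ideal I R} C" using assms(2) by (auto simp: subset.chain_def)
  then have "\<Union>C \<in> C" by (rule ideal_chain_is_trivial[OF C(1)])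
  then show "\<Union>C \<in> S" using C(2) by (auto simp: subset.chain_def)
qed

definition add_elem :: "'a set \<Rightarrow> 'a \<Rightarrow> 'a set" where
  "add_elem J a = {j \<oplus> r \<otimes> a | j r. j \<in> J \<and> r \<in> carrier R}"

lemma add_elem_ideal:
  assumes J: "ideal J R" and a: "a \<in> carrier R"
  shows "ideal (add_elem J a) R" "J \<subseteq> add_elem J a" "a \<in> add_elem J a"
proof -
  interpret J: ideal J R by (rule J)
  show "J \<subseteq> add_elem J a"
  proof
    fix j assume "j \<in> J"
    then have "j = j \<oplus> \<zero> \<otimes> a" using a J.Icarr by simp
    then show "j \<in> add_elem J a" using \<open>j \<in> J\<close> unfolding add_elem_def by blast
  qed
  have "a = \<zero> \<oplus> \<one> \<otimes> a" using a by simp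
  then show "a \<in> add_elem J a" unfolding add_elem_def using J.zero_closed by blast
  show "ideal (add_elem J a) R"
  proof (rule idealI[OF ring_axioms])
    show "subgroup (add_elem J a) (add_monoid R)"
    proof (rule add.subgroupI)
      show "add_elem J a \<subseteq> carrier R" using a J.Icarr by (auto simp: add_elem_def)
      show "add_elem J a \<noteq> {}" using \<open>a \<in> add_elem J a\<close> by auto
      fix x assume "x \<in> add_elem J a"
      then obtain j r where x: "x = j \<oplus> r \<otimes> a" "j \<in> J" "r \<in> carrier R" by (auto simp: add_elem_def)
      have "\<ominus> x = \<ominus> j \<oplus> (\<ominus> r) \<otimes> a" using x a J.Icarr by (simp add: minus_add l_minus)
      then show "\<ominus> x \<in> add_elem J a" using x J.a_inv_closed unfolding add_elem_def by blast
      fix y assume "y \<in> add_elem J a"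
      then obtain j' r' where y: "y = j' \<oplus> r' \<otimes> a" "j' \<in> J" "r' \<in> carrier R" by (auto simp: add_elem_def)
      have jc: "j \<in> carrier R" "j' \<in> carrier R" using x y J.Icarr by auto
      have "x \<oplus> y = (j \<oplus> j') \<oplus> (r \<oplus> r') \<otimes> a"
        using x(1,3) y(1,3) jc a by (simp add: l_distr a_ac)
      then show "x \<oplus> y \<in> add_elem J a"
        using x y additive_subgroup.a_closed[OF J.additive_subgroup_axioms, of j j']
        unfolding add_elem_def by blast
    qed
    fix x y assume "x \<in> add_elem J a" and y: "y \<in> carrier R"
    then obtain j r where x: "x = j \<oplus> r \<otimes> a" "j \<in> J" "r \<in> carrier R" by (auto simp: add_elem_def)
    have jc: "j \<in> carrier R" using x J.Icarr by auto
    have e: "y \<otimes> x = y \<otimes> j \<oplus> (y \<otimes> r) \<otimes> a" using x(1,3) jc y a by (simp add: r_distr m_assoc)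
    then show "y \<otimes> x \<in> add_elem J a" using x y J.I_l_closed[of j y] unfolding add_elem_def by blast
    then show "x \<otimes> y \<in> add_elem J a" using x jc y a by (simp add: m_comm)
  qed
qed

lemma add_elem_hideal:
  assumes J: "hideal J" and a: "a \<in> rgrade R e"
  shows "hideal (add_elem J a)"
  unfolding hideal_def
proof (intro conjI ballI allI)
  have aC: "a \<in> carrier R" using a RG.gr_carrier by auto
  show "ideal (add_elem J a) R" using add_elem_ideal(1)[OF hideal_ideal[OF J] aC] .
  fix x i assume "x \<in> add_elem J a"
  then obtain j r where x: "x = j \<oplus> r \<otimes> a" "j \<in> J" "r \<in> carrier R" by (auto simp: add_elem_def)
  have jc: "j \<in> carrier R" using x ideal.Icarr[OF hideal_ideal[OF J]] by auto
  have "hc i (r \<otimes> a) = hc (i - e) r \<otimes> a" using hc_mult[OF a x(3), of i] x aC by (simp add: m_comm)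
  then have "hc i x = hc i j \<oplus> hc (i - e) r \<otimes> a" using x jc aC by (simp add: RG.hcomp_add)
  moreover have "hc i j \<in> J" using J x by (simp add: hideal_def)
  moreover have "hc (i - e) r \<in> carrier R" using x by simp
  ultimately show "hc i x \<in> add_elem J a" unfolding add_elem_def by blast
qed

text \<open>Primality of a homogeneous ideal can be tested on homogeneous elements: compare the lowest
  components outside the ideal.\<close>

lemma lowest_component_mult:
  assumes x: "x \<in> carrier R" "\<And>i'. i' < i \<Longrightarrow> hc i' x = \<zero>"
    and y: "y \<in> carrier R" "\<And>j'. j' < j \<Longrightarrow> hc j' y = \<zero>"
  shows "hc (i + j) (x \<otimes> y) = hc i x \<otimes> hc j y"
proof -
  define A where "A = insert j {k. hc k y \<noteq> \<zero>}"
  have A: "finite A" using RG.finite_support_hcomp[OF y(1)] by (simp add: A_def)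
  have "x \<otimes> y = x \<otimes> (\<Oplus>k\<in>A. hc k y)"
    by (subst RG.finsum_hcomp[OF y(1) A]) (auto simp: A_def)
  also have "\<dots> = (\<Oplus>k\<in>A. x \<otimes> hc k y)" using A x y by (intro finsum_rdistr) auto
  finally have "hc (i + j) (x \<otimes> y) = hc (i + j) (\<Oplus>k\<in>A. x \<otimes> hc k y)" by simp
  also have "\<dots> = (\<Oplus>k\<in>A. hc (i + j) (x \<otimes> hc k y))" using A x y by (intro hc_finsum) auto
  also have "\<dots> = (\<Oplus>k\<in>A. if j = k then hc i x \<otimes> hc k y else \<zero>)"
  proof (rule finsum_cong')
    fix k assume "k \<in> A"
    have "hc (i + j) (x \<otimes> hc k y) = hc (i + j - k) x \<otimes> hc k y"
      using hc_mult[OF RG.hcomp_gr[OF y(1)] x(1)] x y by (simp add: m_comm)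
    moreover have "hc (i + j - k) x = \<zero>" if "k > j" using x(2)[of "i + j - k"] that by simp
    moreover have "hc k y = \<zero>" if "k < j" using y(2) that .
    ultimately show "hc (i + j) (x \<otimes> hc k y) = (if j = k then hc i x \<otimes> hc k y else \<zero>)"
      using x(1) y(1) by (cases k j rule: linorder_cases) auto
  qed (use x y in auto)
  also have "\<dots> = hc i x \<otimes> hc j y"
    using A x y by (intro add.finprod_singleton) (auto simp: A_def)
  finally show ?thesis .
qed

text \<open>Below the least degree \<open>i\<close> whose component lies outside \<open>J\<close>
  all components lie in \<open>J\<close>; subtracting them changes \<open>x\<close> only modulo
  \<open>J\<close>.\<close>

lemma lowest_component_outside:
  assumes J: "hideal J" and x: "x \<in> carrier R" "x \<notin> J"
  obtains x' i where "x' \<in> carrier R" "x \<ominus> x' \<in> J" "hc i x' \<notin> J" "\<And>i'. i' < i \<Longrightarrow> hc i' x' = \<zero>"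
proof -
  interpret J: ideal J R by (rule hideal_ideal[OF J])
  define B where "B = {i. hc i x \<notin> J}"
  have B: "finite B"
    using RG.finite_support_hcomp[OF x(1)] by (rule finite_subset[rotated]) (auto simp: B_def)
  have sumJ: "(\<Oplus>i\<in>A. hc i x) \<in> J" if "finite A" "A \<inter> B = {}" for A
    using that
  proof (induction A rule: finite_induct)
    case (insert i A)
    then have "hc i x \<in> J" "(\<Oplus>i\<in>A. hc i x) \<in> J" by (auto simp: B_def)
    then have "hc i x \<oplus> (\<Oplus>i\<in>A. hc i x) \<in> J"
      by (rule additive_subgroup.a_closed[OF J.additive_subgroup_axioms])
    then show ?case using insert x by simp
  qed simp
  have "B \<noteq> {}"
  proof
    assume "B = {}"
    then have "x \<in> J"
      using sumJ[OF RG.finite_support_hcomp[OF x(1)]] RG.finsum_hcomp[OF x(1) RG.finite_support_hcomp[OF x(1)]]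
      by simp
    then show False using x by simp
  qed
  define i where "i = Min B"
  define A where "A = {k. hc k x \<noteq> \<zero>} \<inter> {..<i}"
  have A: "finite A" using RG.finite_support_hcomp[OF x(1)] by (simp add: A_def)
  have disj: "A \<inter> B = {}"
    using Min_le[OF B] by (fastforce simp: A_def i_def)
  define s where "s = (\<Oplus>k\<in>A. hc k x)"
  have sJ: "s \<in> J" unfolding s_def by (rule sumJ[OF A disj])
  have sC: "s \<in> carrier R" using sJ J.Icarr by auto
  have hs: "hc k s = (if k \<in> A then hc k x else \<zero>)" for k
    unfolding s_def using A RG.hcomp_gr[OF x(1)] by (intro RG.hcomp_finsum) auto
  define x' where "x' = x \<ominus> s"
  have hx': "hc k x' = hc k x \<ominus> hc k s" for k
    using x(1) sC by (simp add: x'_def a_minus_def RG.hcomp_add RG.hcomp_neg)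
  show thesis
  proof (rule that[of x' i])
    show x'C: "x' \<in> carrier R" using x sC by (simp add: x'_def)
    have "x \<ominus> x' = s" using x sC unfolding x'_def a_minus_def by (simp add: minus_add r_neg2)
    then show "x \<ominus> x' \<in> J" using sJ by simp
    have "i \<in> B" using Min_in[OF B \<open>B \<noteq> {}\<close>] by (simp add: i_def)
    then show "hc i x' \<notin> J" using x hx'[of i] hs[of i] by (simp add: A_def B_def a_minus_def)
    fix k assume k: "k < i"
    show "hc k x' = \<zero>"
    proof (cases "k \<in> A")
      case True
      then show ?thesis using hx'[of k] hs[of k] x by (simp add: a_minus_def r_neg)
    next
      case False
      then have "hc k x = \<zero>" using k by (simp add: A_def)
      then show ?thesis using hx'[of k] hs[of k] False by (simp add: a_minus_def)
    qed
  qed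
qed

lemma homogeneous_prime_test:
  assumes J: "hideal J" and proper: "J \<noteq> carrier R"
    and test: "\<And>a b i j. \<lbrakk>a \<in> rgrade R i; b \<in> rgrade R j; a \<otimes> b \<in> J\<rbrakk> \<Longrightarrow> a \<in> J \<or> b \<in> J"
  shows "primeideal J R"
proof (rule primeidealI[OF hideal_ideal[OF J] cring_axioms])
  interpret J: ideal J R by (rule hideal_ideal[OF J])
  show "carrier R \<noteq> J" using proper by simp
  fix x y assume xy: "x \<in> carrier R" "y \<in> carrier R" "x \<otimes> y \<in> J"
  show "x \<in> J \<or> y \<in> J"
  proof (rule ccontr)
    assume neg: "\<not> (x \<in> J \<or> y \<in> J)"
    obtain x' i where x': "x' \<in> carrier R" "x \<ominus> x' \<in> J" "hc i x' \<notin> J" "\<And>i'. i' < i \<Longrightarrow> hc i' x' = \<zero>"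
      using lowest_component_outside[OF J xy(1)] neg by blast
    obtain y' j where y': "y' \<in> carrier R" "y \<ominus> y' \<in> J" "hc j y' \<notin> J" "\<And>j'. j' < j \<Longrightarrow> hc j' y' = \<zero>"
      using lowest_component_outside[OF J xy(2)] neg by blast
    have 1: "(x \<ominus> x') \<otimes> y' \<in> J" using J.I_r_closed[OF x'(2) y'(1)] .
    have 2: "x \<otimes> (y \<ominus> y') \<in> J" using J.I_l_closed[OF y'(2) xy(1)] .
    have "x' \<otimes> y' = x \<otimes> y \<ominus> (x \<otimes> (y \<ominus> y') \<oplus> (x \<ominus> x') \<otimes> y')"
      using xy x'(1) y'(1) by algebra
    moreover have "x \<otimes> y \<ominus> (x \<otimes> (y \<ominus> y') \<oplus> (x \<ominus> x') \<otimes> y') \<in> J"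
      unfolding a_minus_def[of R "x \<otimes> y"] using xy(3) 1 2
      by (intro additive_subgroup.a_closed[OF J.additive_subgroup_axioms] J.a_inv_closed)
    ultimately have "x' \<otimes> y' \<in> J" by simp
    then have "hc (i + j) (x' \<otimes> y') \<in> J" using J by (simp add: hideal_def)
    then have "hc i x' \<otimes> hc j y' \<in> J" using lowest_component_mult[OF x'(1,4) y'(1,4)] by simp
    then show False using test[OF RG.hcomp_gr[OF x'(1)] RG.hcomp_gr[OF y'(1)]] x'(3) y'(3) by blast
  qed
qed

section \<open>Finite covers by homogeneous primes\<close>

definition hprime :: "'a set \<Rightarrow> bool" where
  "hprime p \<longleftrightarrow> primeideal p R \<and> hideal p"

text \<open>A finite set of homogeneous primes that includes the minimal primes of \<open>J\<close>;
  the last clause says that its intersection is the radical of \<open>J\<close>. Redundant members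
  are allowed, so that covers can be united.\<close>

definition hprime_cover :: "'a set \<Rightarrow> 'a set set \<Rightarrow> bool" where
  "hprime_cover J P \<longleftrightarrow> finite P \<and> (\<forall>p\<in>P. hprime p \<and> J \<subseteq> p) \<and>
     (\<forall>q. primeideal q R \<and> J \<subseteq> q \<longrightarrow> (\<exists>p\<in>P. p \<subseteq> q)) \<and>
     (\<forall>x\<in>carrier R. (\<forall>p\<in>P. x \<in> p) \<longrightarrow> (\<exists>k::nat. x [^] k \<in> J))"

text \<open>As \<open>a b \<in> J\<close>, a prime above \<open>J\<close> contains \<open>a\<close>
  or \<open>b\<close>, and a power of \<open>x\<close> in \<open>J + (a)\<close> times a power of
  \<open>x\<close> in \<open>J + (b)\<close> lies in \<open>J\<close>.\<close>

lemma hprime_cover_product: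
  assumes J: "hideal J" and a: "a \<in> rgrade R i" and b: "b \<in> rgrade R j" and ab: "a \<otimes> b \<in> J"
    and P: "hprime_cover (add_elem J a) P" and Q: "hprime_cover (add_elem J b) Q"
  shows "hprime_cover J (P \<union> Q)"
proof -
  interpret J: ideal J R by (rule hideal_ideal[OF J])
  have C: "a \<in> carrier R" "b \<in> carrier R" using a b RG.gr_carrier by auto
  note Ja = add_elem_ideal[OF J.is_ideal C(1)] and Jb = add_elem_ideal[OF J.is_ideal C(2)]
  show ?thesis
    unfolding hprime_cover_def
  proof (intro conjI allI impI ballI)
    show "finite (P \<union> Q)" using P Q by (auto simp: hprime_cover_def)
    fix p assume "p \<in> P \<union> Q"
    moreover have "\<forall>p\<in>P. hprime p \<and> add_elem J a \<subseteq> p" "\<forall>p\<in>Q. hprime p \<and> add_elem J b \<subseteq> p"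
      using P Q by (simp_all add: hprime_cover_def)
    ultimately have "hprime p \<and> J \<subseteq> p" using Ja(2) Jb(2) by fast
    then show "hprime p" "J \<subseteq> p" by simp_all
  next
    fix q assume q: "primeideal q R \<and> J \<subseteq> q"
    interpret q: primeideal q R using q by simp
    have sub: "add_elem J c \<subseteq> q" if "c \<in> q" for c
    proof
      fix z assume "z \<in> add_elem J c"
      then obtain j r where z: "z = j \<oplus> r \<otimes> c" "j \<in> J" "r \<in> carrier R" by (auto simp: add_elem_def)
      then have "j \<in> q" "r \<otimes> c \<in> q" using q q.I_l_closed[OF that, of r] by auto
      then show "z \<in> q" unfolding z(1) by (rule additive_subgroup.a_closed[OF q.additive_subgroup_axioms])
    qed
    have "a \<in> q \<or> b \<in> q" using q.I_prime[OF C] ab q by blast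
    then show "\<exists>p\<in>P \<union> Q. p \<subseteq> q"
    proof
      assume "a \<in> q"
      then have "add_elem J a \<subseteq> q" by (rule sub)
      then show ?thesis using P q unfolding hprime_cover_def by blast
    next
      assume "b \<in> q"
      then have "add_elem J b \<subseteq> q" by (rule sub)
      then show ?thesis using Q q unfolding hprime_cover_def by blast
    qed
  next
    fix x assume x: "x \<in> carrier R" "\<forall>p\<in>P \<union> Q. x \<in> p"
    obtain k :: nat where "x [^] k \<in> add_elem J a" using P x unfolding hprime_cover_def by blast
    then obtain u r where u: "x [^] k = u \<oplus> r \<otimes> a" "u \<in> J" "r \<in> carrier R" by (auto simp: add_elem_def)
    obtain l :: nat where "x [^] l \<in> add_elem J b" using Q x unfolding hprime_cover_def by blast
    then obtain v s where v: "x [^] l = v \<oplus> s \<otimes> b" "v \<in> J" "s \<in> carrier R" by (auto simp: add_elem_def)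
    have uv: "u \<in> carrier R" "v \<in> carrier R" using u v J.Icarr by auto
    have "x [^] (k + l) = (u \<oplus> r \<otimes> a) \<otimes> (v \<oplus> s \<otimes> b)" using u v x by (simp add: nat_pow_mult[symmetric])
    also have "\<dots> = (v \<oplus> s \<otimes> b) \<otimes> u \<oplus> (r \<otimes> a \<otimes> v \<oplus> r \<otimes> s \<otimes> (a \<otimes> b))"
      using uv u(3) v(3) C by algebra
    also have "\<dots> \<in> J"
    proof -
      have "(v \<oplus> s \<otimes> b) \<otimes> u \<in> J" "r \<otimes> a \<otimes> v \<in> J" "r \<otimes> s \<otimes> (a \<otimes> b) \<in> J"
        using J.I_l_closed[OF u(2), of "v \<oplus> s \<otimes> b"] J.I_l_closed[OF v(2), of "r \<otimes> a"]
          J.I_l_closed[OF ab, of "r \<otimes> s"] uv u(3) v(3) C by simp_all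
      then show ?thesis by (intro additive_subgroup.a_closed[OF J.additive_subgroup_axioms])
    qed
    finally show "\<exists>k::nat. x [^] k \<in> J" by blast
  qed
qed

text \<open>Noetherian induction: a maximal homogeneous ideal without a cover is proper and not
  prime, so it contains a product of two homogeneous elements outside it, and the covers of the two
  larger ideals combine.\<close>

lemma hprime_cover_exists:
  assumes "hideal J"
  shows "\<exists>P. hprime_cover J P"
proof (rule ccontr)
  assume "\<nexists>P. hprime_cover J P"
  then have ne: "{J. hideal J \<and> (\<nexists>P. hprime_cover J P)} \<noteq> {}" (is "?S \<noteq> _") using assms by auto
  have id: "\<And>J. J \<in> ?S \<Longrightarrow> ideal J R" using hideal_ideal by blast
  have "\<exists>M\<in>?S. \<forall>J\<in>?S. M \<subseteq> J \<longrightarrow> J = M" by (rule noetherian_maximal[OF ne]) (rule id)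
  then obtain M where MS: "M \<in> ?S" and max': "\<forall>J\<in>?S. M \<subseteq> J \<longrightarrow> J = M" by (elim bexE)
  have M: "hideal M" "\<nexists>P. hprime_cover M P"
    and max: "\<And>J. hideal J \<Longrightarrow> \<nexists>P. hprime_cover J P \<Longrightarrow> M \<subseteq> J \<Longrightarrow> J = M"
    using MS max'[rule_format] by simp_all
  interpret M: ideal M R by (rule hideal_ideal[OF M(1)])
  have proper: "M \<noteq> carrier R"
  proof
    assume e: "M = carrier R"
    have "hprime_cover M {}"
      unfolding hprime_cover_def
    proof (intro conjI allI impI ballI)
      fix q assume q: "primeideal q R \<and> M \<subseteq> q"
      interpret q: primeideal q R using q by simp
      show "\<exists>p\<in>{}. p \<subseteq> q" using q e q.I_notcarr q.a_subset by auto
    qed (auto simp: e)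
    then show False using M(2) by blast
  qed
  have "\<not> primeideal M R"
  proof
    assume p: "primeideal M R"
    have "hprime_cover M {M}"
      unfolding hprime_cover_def
    proof (intro conjI allI impI ballI)
      fix x assume "x \<in> carrier R" "\<forall>p\<in>{M}. x \<in> p"
      then have "x [^] (1::nat) \<in> M" by simp
      then show "\<exists>k::nat. x [^] k \<in> M" by blast
    qed (use p M(1) in \<open>auto simp: hprime_def\<close>)
    then show False using M(2) by blast
  qed
  then obtain a b i j where ab: "a \<in> rgrade R i" "b \<in> rgrade R j" "a \<otimes> b \<in> M" "a \<notin> M" "b \<notin> M"
    using homogeneous_prime_test[OF M(1) proper] by blast
  have "\<exists>P. hprime_cover (add_elem M c) P" if c: "c \<in> rgrade R k" "c \<notin> M" for c k
  proof (rule ccontr)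
    assume "\<nexists>P. hprime_cover (add_elem M c) P"
    then have "add_elem M c = M"
      using max[OF add_elem_hideal[OF M(1) c(1)]] add_elem_ideal(2)[OF M.is_ideal RG.gr_carrier[OF c(1)]] by blast
    then show False using add_elem_ideal(3)[OF M.is_ideal RG.gr_carrier[OF c(1)]] c(2) by blast
  qed
  then show False using hprime_cover_product[OF M(1) ab(1,2,3)] ab M(2) by blast
qed

section \<open>Homogeneous prime avoidance\<close>

lemma hideal_le_irrelevant:
  assumes J: "hideal J" "\<one> \<notin> J"
  shows "J \<subseteq> irrelevant_ideal R"
proof
  interpret J: ideal J R by (rule hideal_ideal[OF J(1)])
  fix x assume x: "x \<in> J"
  have h: "hc 0 x \<in> J" "x \<in> carrier R" using x J J.Icarr by (auto simp: hideal_def)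
  have "hc 0 x = \<zero>"
  proof (rule ccontr)
    assume "hc 0 x \<noteq> \<zero>"
    then obtain c where "c \<in> K" "hc 0 x \<otimes> c = \<one>" using inverse_K RG.hcomp_gr[OF h(2)] by metis
    then show False using J.I_r_closed[OF h(1), of c] K_carrier J(2) by auto
  qed
  then show "x \<in> irrelevant_ideal R" using h by (simp add: irrelevant_ideal_iff)
qed

lemma hprime_le_irrelevant: "hprime p \<Longrightarrow> p \<subseteq> irrelevant_ideal R"
  using hideal_le_irrelevant[of p] ideal.one_imp_carrier[of p R] primeideal.I_notcarr[of p R]
  unfolding hprime_def hideal_def by blast

lemma homogeneous_outside:
  assumes p: "hideal p" and x: "x \<in> carrier R" "x \<notin> p"
  obtains i where "hc i x \<notin> p"
proof -
  interpret p: ideal p R by (rule hideal_ideal[OF p])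
  have "x \<in> p" if "\<And>i. hc i x \<in> p"
    using x(1)
    by (induction rule: RG.graded_induct)
      (auto intro: that additive_subgroup.a_closed[OF p.additive_subgroup_axioms])
  then show thesis using that x(2) by blast
qed

lemma pow_mem:
  fixes n :: nat
  shows "ideal p R \<Longrightarrow> y \<in> p \<Longrightarrow> 0 < n \<Longrightarrow> y [^] n \<in> p"
  by (cases n) (simp_all add: ideal.I_l_closed ideal.Icarr)

lemma primeideal_pow:
  fixes n :: nat
  assumes p: "primeideal p R" and y: "y \<in> carrier R" "y \<notin> p"
  shows "y [^] n \<notin> p"
proof (induction n)
  case 0
  then show ?case using p ideal.one_imp_carrier[of p R] primeideal.I_notcarr[of p R] primeideal.axioms(1)[OF p] by auto
next
  case (Suc n)
  then show ?case using primeideal.I_prime[OF p, of "y [^] n" y] y by auto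
qed

text \<open>The usual induction adds two elements, which here must have equal degree. The irrelevant
  ideal has to be excluded, since it contains everything of positive degree. A prime contained in
  another one may be dropped; without inclusions, a product of elements of the other primes stays
  outside \<open>p\<close>.\<close>

lemma homogeneous_prime_avoidance:
  assumes "finite P" "\<And>p. p \<in> P \<Longrightarrow> hprime p \<and> p \<noteq> irrelevant_ideal R"
  shows "\<exists>y e. 0 < e \<and> y \<in> rgrade R (int e) \<and> (\<forall>p\<in>P. y \<notin> p)"
  using assms
proof (induction "card P" arbitrary: P rule: less_induct)
  case less
  note P = less.prems
  have IH: "\<exists>y e. 0 < e \<and> y \<in> rgrade R (int e) \<and> (\<forall>q\<in>P - {p}. y \<notin> q)" if "p \<in> P" for p
    using less.hyps[OF card_Diff1_less[OF P(1) that]] P by auto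
  have pos: "\<exists>z e. 0 < e \<and> z \<in> rgrade R (int e) \<and> z \<in> q \<and> z \<notin> p"
    if q: "hideal q" "q \<subseteq> irrelevant_ideal R" and p: "hideal p" and n: "\<not> q \<subseteq> p" for p q
  proof -
    obtain x where x: "x \<in> q" "x \<notin> p" using n by auto
    then have xC: "x \<in> carrier R" using ideal.Icarr[OF hideal_ideal[OF q(1)]] by auto
    obtain i where i: "hc i x \<notin> p" using homogeneous_outside[OF p xC x(2)] .
    have "hc i x \<noteq> \<zero>" using i additive_subgroup.zero_closed[OF ideal.axioms(1)[OF hideal_ideal[OF p]]] by auto
    moreover have "hc 0 x = \<zero>" using x(1) q(2) irrelevant_ideal_iff by blast
    ultimately have "i > 0" using hcomp_negative[OF xC, of i] by (cases i "0::int" rule: linorder_cases) auto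
    moreover have "hc i x \<in> q" using q(1) x by (simp add: hideal_def)
    ultimately show ?thesis using i RG.hcomp_gr[OF xC, of i] by (intro exI[of _ "hc i x"] exI[of _ "nat i"]) simp
  qed
  show ?case
  proof (cases "P = {}")
    case True
    then show ?thesis by (intro exI[of _ \<zero>] exI[of _ 1]) auto
  next
    case False
    show ?thesis
    proof (cases "\<exists>p\<in>P. \<exists>q\<in>P. p \<noteq> q \<and> p \<subseteq> q")
      case True
      then obtain p q where pq: "p \<in> P" "q \<in> P" "p \<noteq> q" "p \<subseteq> q" by auto
      then show ?thesis using IH[OF pq(1)] by blast
    next
      case False
      obtain p where p: "p \<in> P" using \<open>P \<noteq> {}\<close> by auto
      have hp: "hideal p" "primeideal p R" "p \<noteq> irrelevant_ideal R" using P p by (auto simp: hprime_def)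
      have pid: "ideal q R" "primeideal q R" if "q \<in> P" for q using P(2)[OF that] by (auto simp: hprime_def hideal_def)
      obtain y e where y: "0 < e" "y \<in> rgrade R (int e)" "\<forall>q\<in>P - {p}. y \<notin> q" using IH[OF p] by auto
      show ?thesis
      proof (cases "y \<in> p")
        case False
        then show ?thesis using y by blast
      next
        case True
        have "\<exists>z f. 0 < f \<and> z \<in> rgrade R (int f) \<and> z \<notin> p \<and> (\<forall>q\<in>Q. z \<in> q)"
          if "finite Q" "Q \<subseteq> P - {p}" for Q
          using that
        proof (induction Q rule: finite_induct)
          case empty
          have "\<not> irrelevant_ideal R \<subseteq> p" using hp(3) hprime_le_irrelevant P(2)[OF p] by auto
          from pos[OF irrelevant_hideal _ hp(1) this] show ?case by auto
        next
          case (insert q Q)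
          then obtain z f where z: "0 < f" "z \<in> rgrade R (int f)" "z \<notin> p" "\<forall>q\<in>Q. z \<in> q" by auto
          have q: "q \<in> P" "q \<noteq> p" using insert by auto
          then have "\<not> q \<subseteq> p" using False p by blast
          then obtain z' f' where z': "0 < f'" "z' \<in> rgrade R (int f')" "z' \<in> q" "z' \<notin> p"
            using pos[of q p] P(2)[OF q(1)] hprime_le_irrelevant hp(1) by (auto simp: hprime_def)
          have C: "z \<in> carrier R" "z' \<in> carrier R" using z z' RG.gr_carrier by auto
          have "z \<otimes> z' \<notin> p" using primeideal.I_prime[OF hp(2) C] z z' by auto
          moreover have "z \<otimes> z' \<in> q'" if "q' \<in> insert q Q" for q'
          proof -
            have "ideal q' R" using that insert.prems pid by auto
            then show ?thesis using that z(4) z'(3) C ideal.I_l_closed ideal.I_r_closed by (cases "q' = q") fastforce+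
          qed
          moreover have "z \<otimes> z' \<in> rgrade R (int (f + f'))" using mult_degree[OF z(2) z'(2)] by simp
          ultimately show ?case using z(1) by (intro exI[of _ "z \<otimes> z'"] exI[of _ "f + f'"]) auto
        qed
        from this[of "P - {p}"] P(1) obtain z f where
          z: "0 < f" "z \<in> rgrade R (int f)" "z \<notin> p" "\<forall>q\<in>P - {p}. z \<in> q" by auto
        have C: "z \<in> carrier R" "y \<in> carrier R" using z y RG.gr_carrier by auto
        \<comment> \<open>Each summand is raised to the degree of the other one, so that both powers
          have degree \<open>e * f\<close>.\<close>
        define w where "w = y [^] f \<oplus> z [^] e"
        have wg: "w \<in> rgrade R (int (e * f))"
          unfolding w_def using pow_grade[OF y(2), of f] pow_grade[OF z(2), of e]
          by (intro RG.add_gr) (simp_all add: mult.commute)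
        have out: "u \<oplus> v \<notin> q \<and> v \<oplus> u \<notin> q"
          if "ideal q R" "u \<in> q" "v \<notin> q" "v \<in> carrier R" for u v q
        proof -
          interpret q: ideal q R by fact
          have uC: "u \<in> carrier R" using that q.Icarr by auto
          have "u \<oplus> v \<notin> q"
          proof
            assume "u \<oplus> v \<in> q"
            with q.a_inv_closed[OF that(2)] have "\<ominus> u \<oplus> (u \<oplus> v) \<in> q"
              by (rule additive_subgroup.a_closed[OF q.additive_subgroup_axioms])
            then show False using that uC by (simp add: r_neg1)
          qed
          then show ?thesis using uC that by (simp add: a_comm)
        qed
        have "w \<notin> q" if q: "q \<in> P" for q
        proof (cases "q = p")
          case True
          then show ?thesis unfolding w_def
            using out[OF pid(1)[OF p] pow_mem[OF pid(1)[OF p] \<open>y \<in> p\<close> z(1)] primeideal_pow[OF hp(2) C(1) z(3)]] C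
            by simp
        next
          case False
          then have "z \<in> q" "y \<notin> q" using z y q by auto
          then show ?thesis unfolding w_def
            using out[OF pid(1)[OF q] pow_mem[OF pid(1)[OF q] \<open>z \<in> q\<close> y(1)] primeideal_pow[OF pid(2)[OF q] C(2)]] C
            by simp
        qed
        then show ?thesis using wg z(1) y(1) by (intro exI[of _ w] exI[of _ "e * f"]) auto
      qed
    qed
  qed
qed

section \<open>Ideals containing all large degrees, and the choice of parameters\<close>

lemma mon_mem:
  assumes J: "ideal J R" and y: "\<And>j. j < n \<Longrightarrow> y j \<in> carrier R"
    and j: "j < n" "y j [^] k \<in> J" "k \<le> b j"
  shows "mon y n b \<in> J"
  using y j(1)
proof (induction n)
  case (Suc n)
  interpret J: ideal J R by (rule J)
  have C: "mon y n b \<in> carrier R" "y n \<in> carrier R" using Suc.prems mon_closed by auto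
  show ?case
  proof (cases "j = n")
    case True
    have "y n [^] b n = y n [^] (b n - k) \<otimes> y n [^] k" using C j True by (simp add: nat_pow_mult)
    then have "y n [^] b n \<in> J" using J.I_l_closed[OF j(2), of "y n [^] (b n - k)"] C True by simp
    then show ?thesis using J.I_r_closed C by simp
  next
    case False
    then have "mon y n b \<in> J" using Suc by simp
    then show ?thesis using J.I_l_closed[of "mon y n b" "y n [^] b n"] C by simp
  qed
qed simp

lemma system_primary:
  assumes x: "hsys x D t" and N: "\<And>e. N \<le> e \<Longrightarrow> rgrade R (int e) \<subseteq> Idl (x ` {..<t})"
    and J: "ideal J R" and pow: "\<And>j. j < t \<Longrightarrow> \<exists>k::nat. x j [^] k \<in> J"
  shows "\<exists>M. \<forall>e\<ge>M. rgrade R (int e) \<subseteq> J"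
proof -
  interpret J: ideal J R by (rule J)
  have xC: "x j \<in> carrier R" if "j < t" for j using hsys_carrier[OF x that] .
  from gmon_spanning[of x D t N, OF x N] obtain G where G: "finite G"
    and GR: "\<And>g. g \<in> G \<Longrightarrow> fst g \<in> rgrade R (int (snd g))"
    and span: "\<And>e. rgrade R (int e) \<subseteq> kspan (gmon x t ` gmons t D G e)" by blast
  obtain k :: "nat \<Rightarrow> nat" where k: "\<And>j. j < t \<Longrightarrow> x j [^] k j \<in> J" using pow by metis
  \<comment> \<open>If all exponents satisfied \<open>b j < k j\<close>, the degree of
    \<open>mon x t b\<close> times a generator would be at most \<open>M - 1\<close>.\<close>
  define M where "M = (\<Sum>j<t. k j * D j) + (\<Sum>g\<in>G. snd g) + 1"
  have "rgrade R (int e) \<subseteq> J" if e: "M \<le> e" for e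
  proof
    fix r assume "r \<in> rgrade R (int e)"
    then have "r \<in> kspan (gmon x t ` gmons t D G e)" using span by blast
    then show "r \<in> J"
    proof (induction rule: kspan.induct)
      case (add s c z)
      then obtain b g where b: "s = mon x t b \<otimes> fst g" "g \<in> G" "wdeg D t b + snd g = e"
        by (auto simp: gmon_def gmons_def)
      have "\<exists>j<t. k j \<le> b j"
      proof (rule ccontr)
        assume "\<not> (\<exists>j<t. k j \<le> b j)"
        then have "wdeg D t b \<le> (\<Sum>j<t. k j * D j)"
          unfolding wdeg_def by (intro sum_mono) (auto simp: not_le less_imp_le)
        moreover have "snd g \<le> (\<Sum>g\<in>G. snd g)" using b(2) G by (intro member_le_sum) auto
        ultimately show False using e b by (simp add: M_def)
      qed
      then obtain j where "j < t" "k j \<le> b j" by auto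
      then have "mon x t b \<in> J" using mon_mem[of J t x j "k j" b] J xC k by blast
      then have "s \<in> J" unfolding b(1) using J.I_r_closed RG.gr_carrier[OF GR[OF b(2)]] by blast
      then have "c \<otimes> s \<in> J" using J.I_l_closed add K_carrier by auto
      then show ?case using add by (intro additive_subgroup.a_closed[OF J.additive_subgroup_axioms])
    qed simp
  qed
  then show ?thesis by blast
qed

text \<open>Generators of the irrelevant ideal play the part of the parameters; they generate
  everything from degree 1 on.\<close>

lemma irrelevant_primary:
  assumes J: "ideal J R" and pow: "\<And>x. x \<in> irrelevant_ideal R \<Longrightarrow> \<exists>k::nat. x [^] k \<in> J"
  shows "\<exists>M. \<forall>e\<ge>M. rgrade R (int e) \<subseteq> J"
proof -
  obtain y D n where y: "hsys y D n" "irrelevant_ideal R = Idl (y ` {..<n})"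
    using irrelevant_generators .
  have "y ` {..<n} \<subseteq> Idl (y ` {..<n})" using hsys_carrier[OF y(1)] by (intro genideal_self) auto
  then have "\<exists>k::nat. y j [^] k \<in> J" if "j < n" for j using pow y(2) that by auto
  moreover have "rgrade R (int e) \<subseteq> Idl (y ` {..<n})" if "1 \<le> e" for e
    using grade_irrelevant[of _ "int e"] y(2) that by auto
  ultimately show ?thesis using system_primary[OF y(1) _ J, of 1] by blast
qed

lemma primeideal_above_irrelevant:
  assumes q: "primeideal q R" and le: "irrelevant_ideal R \<subseteq> q"
  shows "q = irrelevant_ideal R"
proof
  interpret q: primeideal q R by (rule q)
  show "q \<subseteq> irrelevant_ideal R"
  proof
    fix x assume x: "x \<in> q"
    then have xC: "x \<in> carrier R" by (rule q.Icarr)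
    show "x \<in> irrelevant_ideal R"
    proof (rule ccontr)
      assume "x \<notin> irrelevant_ideal R"
      then have n: "hc 0 x \<noteq> \<zero>" using xC irrelevant_ideal_iff by auto
      have "hc 0 (hc 0 x) = hc 0 x" using RG.hcomp_of_gr[OF RG.hcomp_gr[OF xC, of 0], of 0] by simp
      then have "hc 0 (x \<ominus> hc 0 x) = \<zero>"
        using xC by (simp add: a_minus_def RG.hcomp_add RG.hcomp_neg r_neg)
      then have "x \<ominus> hc 0 x \<in> q" using le xC irrelevant_ideal_iff[of "x \<ominus> hc 0 x"] by auto
      then have "x \<oplus> \<ominus> (x \<ominus> hc 0 x) \<in> q"
        using x by (intro additive_subgroup.a_closed[OF q.additive_subgroup_axioms] q.a_inv_closed)
      then have h: "hc 0 x \<in> q" using xC by (simp add: a_minus_def minus_add r_neg2)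
      obtain c where "c \<in> K" "hc 0 x \<otimes> c = \<one>" using inverse_K n RG.hcomp_gr[OF xC] by metis
      then have "\<one> \<in> q" using q.I_r_closed[OF h, of c] K_carrier by auto
      then show False using q.one_imp_carrier q.I_notcarr by auto
    qed
  qed
qed (rule le)

text \<open>Induction on the bound \<open>n\<close> for chains of primes above \<open>J\<close>. A
  homogeneous \<open>y\<close> outside every prime of a cover, except the irrelevant ideal, lowers
  this bound by one when it is added to \<open>J\<close>.\<close>

lemma parameters_modulo:
  assumes "hideal J"
    "\<And>k p. \<lbrakk>\<forall>i\<le>k. primeideal (p i) R; \<forall>i<k. p i \<subset> p (Suc i); J \<subseteq> p 0\<rbrakk> \<Longrightarrow> k \<le> n"
  shows "\<exists>x D N. hsys x D n \<and> (\<forall>e\<ge>N. rgrade R (int e) \<subseteq> Idl (J \<union> x ` {..<n}))"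
  using assms
proof (induction n arbitrary: J)
  case 0
  note J = 0(1) and chain = 0(2)
  obtain P where P: "hprime_cover J P" using hprime_cover_exists[OF J] by blast
  \<comment> \<open>No chain of length 1 exists above \<open>J\<close>, so the irrelevant ideal is
    the only possible member of the cover, and each of its elements has a power in
    \<open>J\<close>.\<close>
  have "p = irrelevant_ideal R" if p: "p \<in> P" for p
  proof (rule ccontr)
    assume ne: "p \<noteq> irrelevant_ideal R"
    have hp: "hprime p" "J \<subseteq> p" using P p by (auto simp: hprime_cover_def)
    have "p \<subset> irrelevant_ideal R" using ne hprime_le_irrelevant[OF hp(1)] by auto
    then have "(1::nat) \<le> 0"
      using hp irrelevant_primeideal
      by (intro chain[of 1 "\<lambda>i. if i = 0 then p else irrelevant_ideal R"]) (simp_all add: hprime_def)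
    then show False by simp
  qed
  then have "\<exists>k::nat. x [^] k \<in> J" if "x \<in> irrelevant_ideal R" for x
    using P that irrelevant_ideal_iff[of x] unfolding hprime_cover_def by blast
  from irrelevant_primary[OF hideal_ideal[OF J] this] obtain N where
    "\<forall>e\<ge>N. rgrade R (int e) \<subseteq> J" by blast
  moreover have "J \<subseteq> Idl J" using genideal_self ideal.Icarr[OF hideal_ideal[OF J]] by blast
  ultimately show ?case by (intro exI[of _ "\<lambda>_. \<zero>"] exI[of _ "\<lambda>_. 0"] exI[of _ N]) (auto simp: hsys_def)
next
  case (Suc n)
  note J = Suc.prems(1) and chain = Suc.prems(2)
  interpret J: ideal J R by (rule hideal_ideal[OF J])
  obtain P where P: "hprime_cover J P" using hprime_cover_exists[OF J] by blast
  obtain y e where y: "0 < e" "y \<in> rgrade R (int e)" "\<forall>p\<in>P - {irrelevant_ideal R}. y \<notin> p"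
    using homogeneous_prime_avoidance[of "P - {irrelevant_ideal R}"] P by (auto simp: hprime_cover_def)
  have yC: "y \<in> carrier R" using y RG.gr_carrier by auto
  note Jy = add_elem_ideal[OF J.is_ideal yC]
  have "k \<le> n" if p: "\<forall>i\<le>k. primeideal (p i) R" "\<forall>i<k. p i \<subset> p (Suc i)" "add_elem J y \<subseteq> p 0" for k p
  proof (rule ccontr)
    assume k: "\<not> k \<le> n"
    have p0: "primeideal (p 0) R" "J \<subseteq> p 0" "y \<in> p 0" using p Jy by auto
    then obtain q where q: "q \<in> P" "q \<subseteq> p 0" using P unfolding hprime_cover_def by blast
    show False
    proof (cases "q = irrelevant_ideal R")
      case True
      \<comment> \<open>Here \<open>p 0\<close> and \<open>p 1\<close> would both be the irrelevant
        ideal, above which there is no larger prime.\<close>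
      have "p 0 \<subset> p 1" using p(2) k by auto
      moreover have "p 0 = irrelevant_ideal R" using primeideal_above_irrelevant[OF p0(1)] q True by simp
      moreover have "p 1 = irrelevant_ideal R"
        using primeideal_above_irrelevant[of "p 1"] p(1) k calculation by auto
      ultimately show False by simp
    next
      case False
      then have "q \<subset> p 0" using q y(3) p0 by auto
      have qP: "primeideal q R" "J \<subseteq> q" using P q(1) unfolding hprime_cover_def hprime_def by blast+
      \<comment> \<open>As \<open>y\<close> lies in \<open>p 0\<close> but not in \<open>q\<close>,
        prepending \<open>q\<close> prolongs the chain, and the longer chain is still above
        \<open>J\<close>.\<close>
      have "Suc k \<le> Suc n"
      proof (rule chain[of "Suc k" "\<lambda>i. if i = 0 then q else p (i - 1)"])
        show "\<forall>i<Suc k. (if i = 0 then q else p (i - 1)) \<subset> (if Suc i = 0 then q else p (Suc i - 1))"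
        proof (intro allI impI)
          fix i assume "i < Suc k"
          then show "(if i = 0 then q else p (i - 1)) \<subset> (if Suc i = 0 then q else p (Suc i - 1))"
            using p(2) \<open>q \<subset> p 0\<close> by (cases i) simp_all
        qed
      qed (use p(1) qP in auto)
      then show False using k by simp
    qed
  qed
  then have "\<exists>x D N. hsys x D n \<and> (\<forall>e\<ge>N. rgrade R (int e) \<subseteq> Idl (add_elem J y \<union> x ` {..<n}))"
    by (rule Suc.IH[OF add_elem_hideal[OF J y(2)]])
  then obtain x D N where
    x: "hsys x D n" "\<forall>e\<ge>N. rgrade R (int e) \<subseteq> Idl (add_elem J y \<union> x ` {..<n})" by (elim exE conjE)
  let ?x = "x(n := y)" and ?D = "D(n := e)"
  have h: "hsys ?x ?D (Suc n)" using x y by (auto simp: hsys_def)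
  let ?I = "Idl (J \<union> ?x ` {..<Suc n})"
  have SC: "J \<union> ?x ` {..<Suc n} \<subseteq> carrier R"
  proof
    fix z assume "z \<in> J \<union> ?x ` {..<Suc n}"
    then show "z \<in> carrier R" using hsys_carrier[OF h] J.Icarr by blast
  qed
  interpret I: ideal ?I R by (rule genideal_ideal[OF SC])
  note self = genideal_self[OF SC]
  have "add_elem J y \<subseteq> ?I"
  proof
    fix z assume "z \<in> add_elem J y"
    then obtain j r where z: "z = j \<oplus> r \<otimes> y" "j \<in> J" "r \<in> carrier R" by (auto simp: add_elem_def)
    have "y \<in> ?I" "j \<in> ?I" using self z by auto
    then show "z \<in> ?I" unfolding z(1) using I.I_l_closed[OF \<open>y \<in> ?I\<close> z(3)]
      by (intro additive_subgroup.a_closed[OF I.additive_subgroup_axioms])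
  qed
  moreover have "x ` {..<n} \<subseteq> ?I"
  proof
    fix z assume "z \<in> x ` {..<n}"
    then obtain j where "z = x j" "j < n" by auto
    then have "z \<in> ?x ` {..<Suc n}" by (intro image_eqI[of _ _ j]) auto
    then show "z \<in> ?I" using self by blast
  qed
  ultimately have "Idl (add_elem J y \<union> x ` {..<n}) \<subseteq> ?I" by (intro genideal_minimal I.is_ideal) auto
  then show ?case using h x(2) by blast
qed

lemma parameters:
  assumes "\<And>k p. \<lbrakk>\<forall>i\<le>k. primeideal (p i) R; \<forall>i<k. p i \<subset> p (Suc i)\<rbrakk> \<Longrightarrow> k \<le> d"
  obtains x D N where "hsys x D d" "\<And>e. N \<le> e \<Longrightarrow> rgrade R (int e) \<subseteq> Idl (x ` {..<d})"
proof -
  have "hideal {\<zero>}" using zeroideal by (simp add: hideal_def)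
  then have "\<exists>x D N. hsys x D d \<and> (\<forall>e\<ge>N. rgrade R (int e) \<subseteq> Idl ({\<zero>} \<union> x ` {..<d}))"
    by (rule parameters_modulo) (rule assms)
  then obtain x D N where
    x: "hsys x D d" "\<forall>e\<ge>N. rgrade R (int e) \<subseteq> Idl ({\<zero>} \<union> x ` {..<d})" by (elim exE conjE)
  have C: "x ` {..<d} \<subseteq> carrier R" using hsys_carrier[OF x(1)] by auto
  interpret I: ideal "Idl (x ` {..<d})" R by (rule genideal_ideal[OF C])
  have "Idl ({\<zero>} \<union> x ` {..<d}) \<subseteq> Idl (x ` {..<d})"
    using genideal_self[OF C] by (intro genideal_minimal I.is_ideal) auto
  then show thesis using that x by blast
qed

end

section \<open>Divisibility in graded injective modules\<close>

lemma finsum_substructure: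
  assumes M: "abelian_group M" and N: "abelian_group N"
    and sub: "carrier N \<subseteq> carrier M" "ring.zero N = ring.zero M" "ring.add N = ring.add M"
    and f: "f \<in> A \<rightarrow> carrier N"
  shows "finsum N f A = finsum M f A"
proof -
  interpret M: abelian_group M by (rule M)
  interpret N: abelian_group N by (rule N)
  show ?thesis
  proof (cases "finite A")
    case True
    then show ?thesis using f
    proof (induction A rule: finite_induct)
      case (insert a A)
      have "f \<in> A \<rightarrow> carrier N" "f a \<in> carrier N" "f \<in> A \<rightarrow> carrier M" "f a \<in> carrier M"
        using insert.prems sub(1) by auto
      with insert show ?case by (simp add: sub)
    qed (simp add: sub)
  qed (simp add: sub)
qed

text \<open>A candidate \<open>h\<close> for the components replaces the search for unique
  decompositions: uniqueness holds because \<open>h\<close> recovers the summands of every finite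
  homogeneous sum.\<close>

lemma internal_direct_sumI:
  assumes N: "abelian_group N" and sub: "\<And>i. additive_subgroup (gr i) N"
    and h: "\<And>x i. x \<in> carrier N \<Longrightarrow> h i x \<in> gr i"
      "\<And>x. x \<in> carrier N \<Longrightarrow> finite {i. h i x \<noteq> \<zero>\<^bsub>N\<^esub>}"
      "\<And>x. x \<in> carrier N \<Longrightarrow> (\<Oplus>\<^bsub>N\<^esub>i\<in>{i. h i x \<noteq> \<zero>\<^bsub>N\<^esub>}. h i x) = x"
    and unique: "\<And>A f i. \<lbrakk>finite A; \<And>i. f i \<in> gr i\<rbrakk> \<Longrightarrow>
      h i (\<Oplus>\<^bsub>N\<^esub>i\<in>A. f i) = (if i \<in> A then f i else \<zero>\<^bsub>N\<^esub>)"
  shows "internal_direct_sum N gr"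
  unfolding internal_direct_sum_def
proof (intro conjI allI ballI)
  fix x assume x: "x \<in> carrier N"
  show "\<exists>!f. homogeneous_decomposition N gr f x"
  proof (rule ex1I)
    show "homogeneous_decomposition N gr (\<lambda>i. h i x) x"
      using h x by (simp add: homogeneous_decomposition_def)
    fix f assume f: "homogeneous_decomposition N gr f x"
    show "f = (\<lambda>i. h i x)"
    proof
      fix i
      show "f i = h i x"
        using unique[of "{i. f i \<noteq> \<zero>\<^bsub>N\<^esub>}" f i] f
        by (auto simp: homogeneous_decomposition_def)
    qed
  qed
qed (rule sub)

text \<open>A homogeneous ideal with shifted grading. Its carrier lies in the type of the ring, as
  the test modules of \<open>graded_injective\<close> require.\<close>

definition ideal_module :: "'a graded_ring \<Rightarrow> 'a set \<Rightarrow> int \<Rightarrow> ('a, 'a) graded_module" where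
  "ideal_module R b s = \<lparr>carrier = b, monoid.mult = monoid.mult R, one = \<one>\<^bsub>R\<^esub>,
     ring.zero = \<zero>\<^bsub>R\<^esub>, ring.add = ring.add R, smult = monoid.mult R,
     grade = (\<lambda>i. rgrade R (i + s) \<inter> b)\<rparr>"

context graded_algebra
begin

lemma ideal_module_graded:
  assumes b: "hideal b"
  shows "graded_module R (ideal_module R b s)"
proof -
  interpret b: ideal b R by (rule hideal_ideal[OF b])
  let ?N = "ideal_module R b s"
  have ab: "abelian_group ?N"
  proof (rule abelian_groupI)
    fix x assume x: "x \<in> carrier ?N"
    then show "\<exists>y\<in>carrier ?N. y \<oplus>\<^bsub>?N\<^esub> x = \<zero>\<^bsub>?N\<^esub>"
      using b.Icarr b.a_inv_closed by (auto simp: ideal_module_def l_neg intro!: bexI[of _ "\<ominus> x"])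
  qed (auto simp: ideal_module_def b.Icarr a_ac additive_subgroup.a_closed[OF b.additive_subgroup_axioms])
  have mod: "module R ?N"
    by (rule moduleI[OF cring_axioms ab])
      (auto simp: ideal_module_def b.Icarr b.I_l_closed l_distr r_distr m_assoc)
  have fs: "finsum ?N f A = finsum R f A" if "f \<in> A \<rightarrow> b" for f :: "int \<Rightarrow> 'a" and A :: "int set"
    using that b.a_subset by (intro finsum_substructure[OF abelian_group_axioms ab]) (auto simp: ideal_module_def)
  interpret N: abelian_group ?N by (rule ab)
  have inv: "\<ominus>\<^bsub>?N\<^esub> x = \<ominus> x" if "x \<in> b" for x
    using that b.Icarr b.a_inv_closed
    by (intro N.minus_equality) (auto simp: ideal_module_def l_neg)
  have "internal_direct_sum ?N (grade ?N)"
  proof (rule internal_direct_sumI[OF ab, where h = "\<lambda>i x. hc (i + s) x"])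
    fix i
    have "subgroup (grade ?N i) (add_monoid ?N)"
    proof (rule N.add.subgroupI)
      have "\<zero> \<in> grade ?N i" by (simp add: ideal_module_def)
      then show "grade ?N i \<noteq> {}" by blast
      show "\<ominus>\<^bsub>?N\<^esub> x \<in> grade ?N i" if "x \<in> grade ?N i" for x
      proof -
        have "x \<in> b" "x \<in> rgrade R (i + s)" using that by (auto simp: ideal_module_def)
        then show ?thesis unfolding inv[OF \<open>x \<in> b\<close>] using RG.neg_gr b.a_inv_closed
          by (simp add: ideal_module_def)
      qed
      show "x \<oplus>\<^bsub>?N\<^esub> y \<in> grade ?N i" if "x \<in> grade ?N i" "y \<in> grade ?N i" for x y
        using that RG.add_gr additive_subgroup.a_closed[OF b.additive_subgroup_axioms]
        by (auto simp: ideal_module_def)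
    qed (auto simp: ideal_module_def)
    then show "additive_subgroup (grade ?N i) ?N" by (rule additive_subgroupI)
  next
    fix x assume "x \<in> carrier ?N"
    then have x: "x \<in> b" "x \<in> carrier R" using b.Icarr by (auto simp: ideal_module_def)
    have hb: "hc i x \<in> b" for i using b x by (simp add: hideal_def)
    show "hc (i + s) x \<in> grade ?N i" for i
      using hb RG.hcomp_gr[OF x(2)] by (simp add: ideal_module_def)
    have z: "\<zero>\<^bsub>?N\<^esub> = \<zero>" by (simp add: ideal_module_def)
    have im: "{i. hc i x \<noteq> \<zero>} = (\<lambda>i. i + s) ` {i. hc (i + s) x \<noteq> \<zero>}"
      by (auto simp: image_iff intro!: exI[of _ "_ - s"])
    have fin: "finite {i. hc i x \<noteq> \<zero>}" using RG.finite_support_hcomp[OF x(2)] .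
    then show "finite {i. hc (i + s) x \<noteq> \<zero>\<^bsub>?N\<^esub>}"
      unfolding im z by (rule finite_imageD) (simp add: inj_on_def)
    have "x = (\<Oplus>i\<in>{i. hc i x \<noteq> \<zero>}. hc i x)" using RG.finsum_hcomp[OF x(2) fin] by simp
    also have "\<dots> = (\<Oplus>i\<in>{i. hc (i + s) x \<noteq> \<zero>}. hc (i + s) x)"
      unfolding im using x by (intro finsum_reindex) (auto simp: inj_on_def)
    finally show "(\<Oplus>\<^bsub>?N\<^esub>i\<in>{i. hc (i + s) x \<noteq> \<zero>\<^bsub>?N\<^esub>}. hc (i + s) x) = x"
      unfolding z using hb by (subst fs) auto
  next
    fix A :: "int set" and f :: "int \<Rightarrow> 'a" and i assume A: "finite A" and f: "\<And>i. f i \<in> grade ?N i"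
    have fb: "f i \<in> b" "f i \<in> rgrade R (i + s)" for i using f[of i] by (auto simp: ideal_module_def)
    have fC: "f i \<in> carrier R" for i using fb b.Icarr by auto
    have "(\<Oplus>\<^bsub>?N\<^esub>i\<in>A. f i) = (\<Oplus>i\<in>A. f i)" using fb by (intro fs) auto
    also have "\<dots> = (\<Oplus>i\<in>(\<lambda>i. i + s) ` A. f (i - s))"
      using fC by (subst finsum_reindex) (auto simp: inj_on_def)
    finally have "hc (i + s) (\<Oplus>\<^bsub>?N\<^esub>i\<in>A. f i) = hc (i + s) (\<Oplus>i\<in>(\<lambda>i. i + s) ` A. f (i - s))" by simp
    also have "\<dots> = (if i + s \<in> (\<lambda>i. i + s) ` A then f (i + s - s) else \<zero>)"
      using A fb(2)[of "_ - s"] by (intro RG.hcomp_finsum) auto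
    finally show "hc (i + s) (\<Oplus>\<^bsub>?N\<^esub>i\<in>A. f i) = (if i \<in> A then f i else \<zero>\<^bsub>?N\<^esub>)"
      by (auto simp: ideal_module_def)
  qed
  then show ?thesis
    using mod mult_degree b.I_l_closed RG.gr_carrier
    unfolding graded_module_def graded_module_axioms_def
    by (auto simp: ideal_module_def algebra_simps)
qed

lemma annihilator_hideal:
  assumes E: "graded_module R E" and v: "v \<in> grade E e"
  shows "hideal {r \<in> carrier R. r \<odot>\<^bsub>E\<^esub> v = \<zero>\<^bsub>E\<^esub>}"
proof -
  interpret E: graded_module R E by (rule E)
  have vC: "v \<in> carrier E" using v E.MG.gr_carrier by auto
  let ?a = "{r \<in> carrier R. r \<odot>\<^bsub>E\<^esub> v = \<zero>\<^bsub>E\<^esub>}"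
  have "ideal ?a R"
  proof (rule idealI[OF ring_axioms])
    show "subgroup ?a (add_monoid R)"
    proof (rule add.subgroupI)
      have "\<zero> \<in> ?a" using vC by simp
      then show "?a \<noteq> {}" by blast
    qed (use vC in \<open>auto simp: E.smult_l_minus E.smult_l_distr\<close>)
    fix a x assume a: "a \<in> ?a" and x: "x \<in> carrier R"
    then show "x \<otimes> a \<in> ?a" using vC by (simp add: E.smult_assoc1)
    then show "a \<otimes> x \<in> ?a" using a x by (simp add: m_comm)
  qed
  moreover have "hc i r \<in> ?a" if r: "r \<in> ?a" for r i
    using E.hcomp_smult_element[OF RG.graded_group_axioms _ v, of r i] r by simp
  ultimately show ?thesis by (simp add: hideal_def)
qed

text \<open>The ideals \<open>a : y^k\<close> ascend with \<open>k\<close>, so the chain becomes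
  stationary in a Noetherian ring.\<close>

lemma colon_stable:
  assumes a: "ideal a R" and y: "y \<in> carrier R"
  obtains k :: nat where "\<And>(n::nat) r. \<lbrakk>r \<in> carrier R; y [^] (k + n) \<otimes> r \<in> a\<rbrakk> \<Longrightarrow> y [^] k \<otimes> r \<in> a"
proof -
  interpret a: ideal a R by (rule a)
  define c where "c k = {r \<in> carrier R. y [^] (k::nat) \<otimes> r \<in> a}" for k
  have mono: "c k \<subseteq> c (k + n)" for k n
  proof
    fix r assume r: "r \<in> c k"
    then have "y [^] n \<otimes> (y [^] k \<otimes> r) \<in> a" using y by (auto simp: c_def a.I_l_closed)
    then have "y [^] (k + n) \<otimes> r \<in> a"
      using r y by (simp add: c_def m_assoc[symmetric] nat_pow_mult add.commute)
    then show "r \<in> c (k + n)" using r by (simp add: c_def)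
  qed
  have id: "ideal (c k) R" for k
  proof (rule idealI[OF ring_axioms])
    show "subgroup (c k) (add_monoid R)"
    proof (rule add.subgroupI)
      have "\<zero> \<in> c k" using y by (simp add: c_def)
      then show "c k \<noteq> {}" by blast
    qed (use y additive_subgroup.a_closed[OF a.additive_subgroup_axioms] a.a_inv_closed
        in \<open>auto simp: c_def r_minus r_distr\<close>)
    fix r x assume r: "r \<in> c k" and x: "x \<in> carrier R"
    then have "x \<otimes> (y [^] k \<otimes> r) \<in> a" by (simp add: c_def a.I_l_closed)
    then show "x \<otimes> r \<in> c k" using r x y by (simp add: c_def m_lcomm)
    then show "r \<otimes> x \<in> c k" using r x by (simp add: c_def m_comm)
  qed
  have "subset.chain {I. ideal I R} (range c)"
    unfolding subset.chain_def
  proof (intro conjI ballI)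
    fix C C' assume "C \<in> range c" "C' \<in> range c"
    then obtain k l where kl: "C = c k" "C' = c l" by auto
    have "c k \<subseteq> c l \<or> c l \<subseteq> c k"
      using mono[of k "l - k"] mono[of l "k - l"] by (cases "k \<le> l") auto
    then show "(\<subset>)\<^sup>=\<^sup>= C C' \<or> (\<subset>)\<^sup>=\<^sup>= C' C" using kl by auto
  qed (use id in auto)
  then have "\<Union>(range c) \<in> range c" using ideal_chain_is_trivial by blast
  then obtain k where "\<Union>(range c) = c k" by auto
  then have "c (k + n) \<subseteq> c k" for n by auto
  then show thesis using that[of k] by (auto simp: c_def)
qed

text \<open>The divisor \<open>u\<close> arises by extending \<open>a + (y\<^bsup>k+n\<^esup>) \<rightarrow> E\<close>, \<open>q + r y\<^bsup>k+n\<^esup> \<mapsto> r y\<^bsup>k\<^esup> v\<close>, to \<open>R\<close>, where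
  \<open>a\<close> is the annihilator of \<open>v\<close> and \<open>k\<close> makes the colon ideals \<open>a : y\<^bsup>k\<^esup>\<close> stable.\<close>

lemma graded_injective_divide:
  assumes inj: "graded_injective R E" and v: "v \<in> grade E e" and y: "y \<in> rgrade R D"
  shows "\<exists>u\<in>grade E (e - int n * D).
    (\<forall>r\<in>carrier R. r \<odot>\<^bsub>E\<^esub> v = \<zero>\<^bsub>E\<^esub> \<longrightarrow> r \<odot>\<^bsub>E\<^esub> u = \<zero>\<^bsub>E\<^esub>) \<and>
    (\<exists>k::nat. y [^] (k + n) \<odot>\<^bsub>E\<^esub> u = y [^] k \<odot>\<^bsub>E\<^esub> v)"
proof -
  have E: "graded_module R E" using inj by (simp add: graded_injective_def)
  interpret E: graded_module R E by (rule E)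
  have vC: "v \<in> carrier E" using v E.MG.gr_carrier by auto
  have yC: "y \<in> carrier R" using y RG.gr_carrier by auto
  define a where "a = {r \<in> carrier R. r \<odot>\<^bsub>E\<^esub> v = \<zero>\<^bsub>E\<^esub>}"
  have ah: "hideal a" unfolding a_def by (rule annihilator_hideal[OF E v])
  interpret a: ideal a R by (rule hideal_ideal[OF ah])
  obtain k :: nat where k: "\<And>r. \<lbrakk>r \<in> carrier R; y [^] (k + n) \<otimes> r \<in> a\<rbrakk> \<Longrightarrow> y [^] k \<otimes> r \<in> a"
    using colon_stable[OF a.is_ideal yC] by metis
  define Y where "Y = y [^] (k + n)"
  define b where "b = add_elem a Y"
  have YC: "Y \<in> carrier R" using yC by (simp add: Y_def)
  have Yg: "Y \<in> rgrade R (int (k + n) * D)" unfolding Y_def by (rule pow_grade[OF y])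
  have bh: "hideal b" unfolding b_def by (rule add_elem_hideal[OF ah Yg])
  interpret b: ideal b R by (rule hideal_ideal[OF bh])
  have ab: "a \<subseteq> b" and Yb: "Y \<in> b" unfolding b_def using add_elem_ideal[OF a.is_ideal YC] by auto
  have yk: "y [^] k \<in> carrier R" using yC by simp
  define P where "P s f \<longleftrightarrow> (\<exists>q r. q \<in> a \<and> r \<in> carrier R \<and> s = q \<oplus> r \<otimes> Y \<and> f = (y [^] k \<otimes> r) \<odot>\<^bsub>E\<^esub> v)" for s f
  \<comment> \<open>Well-definedness of the map on \<open>b\<close>: two representations differ by
    \<open>Y (r - r') \<in> a\<close>, and stability of the colon ideals replaces
    \<open>Y = y^(k + n)\<close> by \<open>y^k\<close> here.\<close>
  have P_unique: "f = f'" if P1: "P s f" and P2: "P s f'" for s f f'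
  proof -
    obtain q r where q: "q \<in> a" "r \<in> carrier R" "s = q \<oplus> r \<otimes> Y" "f = (y [^] k \<otimes> r) \<odot>\<^bsub>E\<^esub> v"
      using P1 by (auto simp: P_def)
    obtain q' r' where q': "q' \<in> a" "r' \<in> carrier R" "s = q' \<oplus> r' \<otimes> Y" "f' = (y [^] k \<otimes> r') \<odot>\<^bsub>E\<^esub> v"
      using P2 by (auto simp: P_def)
    have qC: "q \<in> carrier R" "q' \<in> carrier R" using q q' a.Icarr by auto
    have eq: "q \<oplus> r \<otimes> Y = q' \<oplus> r' \<otimes> Y" using q(3) q'(3) by simp
    have "Y \<otimes> (r \<ominus> r') = (q \<oplus> r \<otimes> Y) \<ominus> (q' \<oplus> r' \<otimes> Y) \<oplus> (q' \<ominus> q)"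
      using qC q(2) q'(2) YC by algebra
    also have "\<dots> = q' \<ominus> q" unfolding eq using qC q'(2) YC by algebra
    also have "\<dots> \<in> a"
      unfolding a_minus_def using q(1) q'(1)
      by (intro additive_subgroup.a_closed[OF a.additive_subgroup_axioms] a.a_inv_closed)
    finally have "y [^] k \<otimes> (r \<ominus> r') \<in> a" using k[of "r \<ominus> r'"] q q' by (simp add: Y_def)
    then have "(y [^] k \<otimes> (r \<ominus> r')) \<odot>\<^bsub>E\<^esub> v = \<zero>\<^bsub>E\<^esub>" unfolding a_def by blast
    moreover have "y [^] k \<otimes> r = y [^] k \<otimes> (r \<ominus> r') \<oplus> y [^] k \<otimes> r'"
      using yk q(2) q'(2) by (simp add: r_distr[symmetric] a_minus_def a_assoc l_neg)
    ultimately show "f = f'" unfolding q(4) q'(4) using yk q(2) q'(2) vC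
      by (simp add: E.smult_l_distr)
  qed
  define g where "g s = (SOME f. P s f)" for s
  have g: "g (q \<oplus> r \<otimes> Y) = (y [^] k \<otimes> r) \<odot>\<^bsub>E\<^esub> v" if "q \<in> a" "r \<in> carrier R" for q r
  proof -
    have 1: "P (q \<oplus> r \<otimes> Y) ((y [^] k \<otimes> r) \<odot>\<^bsub>E\<^esub> v)" using that by (auto simp: P_def)
    then have "P (q \<oplus> r \<otimes> Y) (g (q \<oplus> r \<otimes> Y))" unfolding g_def by (rule someI)
    then show ?thesis using 1 P_unique by blast
  qed
  \<comment> \<open>This shift puts \<open>\<one>\<close> in degree \<open>e - n D\<close>, the
    degree wanted for \<open>u = h \<one>\<close>, and makes \<open>g\<close> a map of degree
    0.\<close>
  define s where "s = int n * D - e"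
  let ?A = "ideal_module R b s" and ?B = "ideal_module R (carrier R) s"
  have Bh: "hideal (carrier R)" by (simp add: hideal_def oneideal)
  have A: "graded_module R ?A" "graded_module R ?B" using ideal_module_graded bh Bh by auto
  have incl: "(\<lambda>x. x) \<in> hom_of_degree R ?A ?B 0"
    using b.a_subset by (auto simp: hom_of_degree_def module_hom_def ideal_module_def)
  have b_ex: "\<exists>q r. q \<in> a \<and> r \<in> carrier R \<and> x = q \<oplus> r \<otimes> Y" if "x \<in> b" for x
    using that unfolding b_def add_elem_def by blast
  have ghom: "g \<in> module_hom R ?A E"
    unfolding module_hom_def
  proof (intro CollectI conjI allI impI)
    show "g \<in> carrier ?A \<rightarrow> carrier E"
    proof
      fix x assume "x \<in> carrier ?A"
      then obtain q r where q: "q \<in> a" "r \<in> carrier R" "x = q \<oplus> r \<otimes> Y"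
        using b_ex[of x] by (auto simp: ideal_module_def)
      show "g x \<in> carrier E" unfolding q(3) g[OF q(1,2)] using q yk vC by simp
    qed
    fix x x' assume "x \<in> carrier ?A \<and> x' \<in> carrier ?A"
    then obtain q r q' r' where q: "q \<in> a" "r \<in> carrier R" "x = q \<oplus> r \<otimes> Y"
      and q': "q' \<in> a" "r' \<in> carrier R" "x' = q' \<oplus> r' \<otimes> Y"
      using b_ex[of x] b_ex[of x'] by (auto simp: ideal_module_def)
    have qC: "q \<in> carrier R" "q' \<in> carrier R" using q q' a.Icarr by auto
    have "x \<oplus> x' = (q \<oplus> q') \<oplus> (r \<oplus> r') \<otimes> Y" unfolding q(3) q'(3)
      using qC q(2) q'(2) YC by (simp add: l_distr a_ac)
    moreover have "q \<oplus> q' \<in> a" using additive_subgroup.a_closed[OF a.additive_subgroup_axioms q(1) q'(1)] .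
    moreover have "y [^] k \<otimes> (r \<oplus> r') = y [^] k \<otimes> r \<oplus> y [^] k \<otimes> r'" using yk q(2) q'(2) by (simp add: r_distr)
    ultimately have "g (x \<oplus> x') = g x \<oplus>\<^bsub>E\<^esub> g x'"
      using g q q' yk vC by (simp add: E.smult_l_distr)
    then show "g (x \<oplus>\<^bsub>?A\<^esub> x') = g x \<oplus>\<^bsub>E\<^esub> g x'" by (simp add: ideal_module_def)
  next
    fix c x assume "c \<in> carrier R \<and> x \<in> carrier ?A"
    then obtain q r where q: "q \<in> a" "r \<in> carrier R" "x = q \<oplus> r \<otimes> Y" and c: "c \<in> carrier R"
      using b_ex[of x] by (auto simp: ideal_module_def)
    have qC: "q \<in> carrier R" using q a.Icarr by auto
    have "c \<otimes> x = c \<otimes> q \<oplus> (c \<otimes> r) \<otimes> Y" unfolding q(3) using qC q(2) YC c by (simp add: r_distr m_assoc)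
    then have "g (c \<otimes> x) = (y [^] k \<otimes> (c \<otimes> r)) \<odot>\<^bsub>E\<^esub> v"
      using g[OF a.I_l_closed[OF q(1) c], of "c \<otimes> r"] q(2) c by simp
    also have "y [^] k \<otimes> (c \<otimes> r) = c \<otimes> (y [^] k \<otimes> r)" using yk q(2) c by (simp add: m_lcomm)
    also have "(c \<otimes> (y [^] k \<otimes> r)) \<odot>\<^bsub>E\<^esub> v = c \<odot>\<^bsub>E\<^esub> g x"
      unfolding q(3) g[OF q(1,2)] using q(2) c yk vC by (intro E.smult_assoc1) auto
    finally have "g (c \<otimes> x) = c \<odot>\<^bsub>E\<^esub> g x" .
    then show "g (c \<odot>\<^bsub>?A\<^esub> x) = c \<odot>\<^bsub>E\<^esub> g x" by (simp add: ideal_module_def)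
  qed
  have gdeg: "g x \<in> grade E j" if x: "x \<in> rgrade R (j + s)" "x \<in> b" for x j
  proof -
    obtain q r where q: "q \<in> a" "r \<in> carrier R" "x = q \<oplus> r \<otimes> Y" using b_ex[OF x(2)] by auto
    have qC: "q \<in> carrier R" using q a.Icarr by auto
    let ?l = "j + s - int (k + n) * D"
    have "x = hc (j + s) (q \<oplus> r \<otimes> Y)" using RG.hcomp_of_gr[OF x(1)] q(3) by simp
    also have "\<dots> = hc (j + s) q \<oplus> hc ?l r \<otimes> Y"
      using qC q(2) YC hc_mult[OF Yg q(2), of "j + s"] by (simp add: RG.hcomp_add m_comm)
    finally have xe: "x = hc (j + s) q \<oplus> hc ?l r \<otimes> Y" .
    have "hc (j + s) q \<in> a" using ah q(1) by (simp add: hideal_def)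
    then have gx: "g x = (y [^] k \<otimes> hc ?l r) \<odot>\<^bsub>E\<^esub> v" using g[of "hc (j + s) q" "hc ?l r"] xe q(2) by simp
    have "y [^] k \<otimes> hc ?l r \<in> rgrade R (int k * D + ?l)"
      using mult_degree[OF pow_grade[OF y] RG.hcomp_gr[OF q(2)]] .
    from E.smult_degree[OF this v] show ?thesis unfolding gx by (simp add: s_def algebra_simps)
  qed
  have "g \<in> hom_of_degree R ?A E 0"
    using ghom gdeg by (auto simp: hom_of_degree_def ideal_module_def)
  then have "graded_module R ?A \<and> graded_module R ?B \<and> (\<lambda>x. x) \<in> hom_of_degree R ?A ?B 0 \<and>
      inj_on (\<lambda>x. x) (carrier ?A) \<and> g \<in> hom_of_degree R ?A E 0"
    using A incl by simp
  then obtain h where h: "h \<in> hom_of_degree R ?B E 0" "\<forall>x\<in>carrier ?A. h x = g x"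
    using inj unfolding graded_injective_def by meson
  have hb: "h x = g x" if "x \<in> b" for x using h(2) that by (simp add: ideal_module_def)
  have hlin: "h (r \<otimes> x) = r \<odot>\<^bsub>E\<^esub> h x" if "r \<in> carrier R" "x \<in> carrier R" for r x
    using h(1) that by (auto simp: hom_of_degree_def module_hom_def ideal_module_def)
  define u where "u = h \<one>"
  have hr: "h r = r \<odot>\<^bsub>E\<^esub> u" if "r \<in> carrier R" for r using hlin[OF that one_closed] that by (simp add: u_def)
  have "\<one> \<in> grade ?B (- s)" using one_K by (simp add: ideal_module_def)
  then have ug: "u \<in> grade E (e - int n * D)"
    using h(1) by (force simp: u_def hom_of_degree_def s_def)
  moreover have "r \<odot>\<^bsub>E\<^esub> u = \<zero>\<^bsub>E\<^esub>" if r: "r \<in> carrier R" "r \<odot>\<^bsub>E\<^esub> v = \<zero>\<^bsub>E\<^esub>" for r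
  proof -
    have ra: "r \<in> a" unfolding a_def using r by blast
    then have "h r = g (r \<oplus> \<zero> \<otimes> Y)" using hb[of r] subsetD[OF ab ra] r YC by simp
    also have "\<dots> = \<zero>\<^bsub>E\<^esub>" using g[OF ra zero_closed] yk vC by simp
    finally show ?thesis using hr r by simp
  qed
  moreover have "Y \<odot>\<^bsub>E\<^esub> u = y [^] k \<odot>\<^bsub>E\<^esub> v"
  proof -
    have "Y \<odot>\<^bsub>E\<^esub> u = g (\<zero> \<oplus> \<one> \<otimes> Y)" using hr[OF YC] hb[OF Yb] YC by simp
    also have "\<dots> = y [^] k \<odot>\<^bsub>E\<^esub> v" using g[OF a.zero_closed one_closed] yk by simp
    finally show ?thesis .
  qed
  ultimately show ?thesis unfolding Y_def by blast
qed

end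

section \<open>Iterated torsion of an injective resolution\<close>

locale torsion_tower = graded_algebra R for R :: "'a graded_ring" (structure) +
  fixes I :: "nat \<Rightarrow> ('a, 'i) graded_module" and \<epsilon> :: "'a \<Rightarrow> 'i" and \<delta> :: "nat \<Rightarrow> 'i \<Rightarrow> 'i"
    and x :: "nat \<Rightarrow> 'a" and D :: "nat \<Rightarrow> nat" and d :: nat
  assumes resolution: "graded_injective_resolution R (graded_self R) I \<epsilon> \<delta>"
    and system: "hsys x D d"
begin

lemma injective: "graded_injective R (I j)"
  using resolution by (simp add: graded_injective_resolution_def)

lemma graded_module_I: "graded_module R (I j)"
  using injective by (simp add: graded_injective_def)

end

sublocale torsion_tower \<subseteq> I: graded_module R "I j" for j
  by (rule graded_module_I)

context torsion_tower
begin

section \<open>The maps of the resolution: linearity, degrees and exactness\<close>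

abbreviation smI where "smI j r v \<equiv> r \<odot>\<^bsub>I j\<^esub> v"
abbreviation ci where "ci j i v \<equiv> hcomp (I j) (grade (I j)) i v"

lemma \<delta>_hom: "\<delta> j \<in> hom_of_degree R (I j) (I (Suc j)) 0"
  using resolution by (simp add: graded_injective_resolution_def)

lemma \<delta>_closed: "v \<in> carrier (I j) \<Longrightarrow> \<delta> j v \<in> carrier (I (Suc j))"
  using \<delta>_hom[of j] by (auto simp: hom_of_degree_def module_hom_def Pi_iff)

lemma \<delta>_add: "\<lbrakk>v \<in> carrier (I j); w \<in> carrier (I j)\<rbrakk> \<Longrightarrow> \<delta> j (v \<oplus>\<^bsub>I j\<^esub> w) = \<delta> j v \<oplus>\<^bsub>I (Suc j)\<^esub> \<delta> j w"
  using \<delta>_hom by (auto simp: hom_of_degree_def module_hom_def)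

lemma \<delta>_smult: "\<lbrakk>r \<in> carrier R; v \<in> carrier (I j)\<rbrakk> \<Longrightarrow> \<delta> j (smI j r v) = smI (Suc j) r (\<delta> j v)"
  using \<delta>_hom by (auto simp: hom_of_degree_def module_hom_def)

lemma \<delta>_zero: "\<delta> j \<zero>\<^bsub>I j\<^esub> = \<zero>\<^bsub>I (Suc j)\<^esub>"
  using \<delta>_smult[of \<zero> "\<zero>\<^bsub>I j\<^esub>" j] \<delta>_closed[of "\<zero>\<^bsub>I j\<^esub>" j] by simp

lemma \<delta>_neg:
  assumes "v \<in> carrier (I j)" shows "\<delta> j (\<ominus>\<^bsub>I j\<^esub> v) = \<ominus>\<^bsub>I (Suc j)\<^esub> \<delta> j v"
  using \<delta>_smult[of "\<ominus> \<one>" v j] assms \<delta>_closed[OF assms] by (simp add: I.smult_l_minus)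

lemma \<delta>_grade: "v \<in> grade (I j) i \<Longrightarrow> \<delta> j v \<in> grade (I (Suc j)) i"
  using \<delta>_hom[of j] by (auto simp: hom_of_degree_def)

lemma exact: "exact_coresolution R (graded_self R) I \<epsilon> \<delta>"
  using resolution by (simp add: graded_injective_resolution_def)

lemma \<epsilon>_closed: "r \<in> carrier R \<Longrightarrow> \<epsilon> r \<in> carrier (I 0)"
  using exact by (auto simp: exact_coresolution_def module_hom_def graded_self_def)

lemma \<epsilon>_add: "\<lbrakk>r \<in> carrier R; s \<in> carrier R\<rbrakk> \<Longrightarrow> \<epsilon> (r \<oplus> s) = \<epsilon> r \<oplus>\<^bsub>I 0\<^esub> \<epsilon> s"
  using exact by (auto simp: exact_coresolution_def module_hom_def graded_self_def)

lemma \<epsilon>_smult: "\<lbrakk>r \<in> carrier R; s \<in> carrier R\<rbrakk> \<Longrightarrow> \<epsilon> (r \<otimes> s) = smI 0 r (\<epsilon> s)"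
  using exact by (auto simp: exact_coresolution_def module_hom_def graded_self_def)

lemma \<epsilon>_grade: "r \<in> rgrade R i \<Longrightarrow> \<epsilon> r \<in> grade (I 0) i"
proof -
  have "\<epsilon> \<in> hom_of_degree R (graded_self R) (I 0) 0"
    using resolution by (simp add: graded_injective_resolution_def)
  then show "r \<in> rgrade R i \<Longrightarrow> ?thesis" by (auto simp: hom_of_degree_def graded_self_def)
qed

lemma \<epsilon>_zero: "\<epsilon> \<zero> = \<zero>\<^bsub>I 0\<^esub>"
  using \<epsilon>_smult[of \<zero> \<zero>] \<epsilon>_closed[of \<zero>] by simp

lemma kernel_0: "v \<in> carrier (I 0) \<Longrightarrow> \<delta> 0 v = \<zero>\<^bsub>I 1\<^esub> \<longleftrightarrow> v \<in> \<epsilon> ` carrier R"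
  using exact by (auto simp: exact_coresolution_def a_kernel_def kernel_def graded_self_def)

lemma kernel_Suc: "v \<in> carrier (I (Suc j)) \<Longrightarrow>
    \<delta> (Suc j) v = \<zero>\<^bsub>I (Suc (Suc j))\<^esub> \<longleftrightarrow> v \<in> \<delta> j ` carrier (I j)"
  using exact by (auto simp: exact_coresolution_def a_kernel_def kernel_def)

lemma \<delta>\<delta>: "v \<in> carrier (I j) \<Longrightarrow> \<delta> (Suc j) (\<delta> j v) = \<zero>\<^bsub>I (Suc (Suc j))\<^esub>"
  using kernel_Suc[OF \<delta>_closed] by blast

text \<open>Iterated torsion with respect to \<open>x 0, ..., x (t - 1)\<close>; for
  \<open>t = d\<close> it becomes the torsion of the irrelevant ideal. One exponent per parameter
  suffices, as there are finitely many parameters.\<close>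

definition J :: "nat \<Rightarrow> nat \<Rightarrow> 'i set" where
  "J t j = {v \<in> carrier (I j). \<forall>i<t. \<exists>k::nat. smI j (x i [^] k) v = \<zero>\<^bsub>I j\<^esub>}"

lemma J_carrier: "v \<in> J t j \<Longrightarrow> v \<in> carrier (I j)"
  by (simp add: J_def)

lemma J_0: "J 0 j = carrier (I j)"
  by (simp add: J_def)

lemma J_Suc: "v \<in> J (Suc t) j \<longleftrightarrow> v \<in> J t j \<and> (\<exists>k::nat. smI j (x t [^] k) v = \<zero>\<^bsub>I j\<^esub>)"
  by (auto simp: J_def less_Suc_eq)

lemma x_carrier: "i < d \<Longrightarrow> x i \<in> carrier R"
  by (rule hsys_carrier[OF system])

lemma x_grade: "i < d \<Longrightarrow> x i \<in> rgrade R (int (D i))"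
  using system by (simp add: hsys_def)

lemma pow_kill_mono:
  assumes "y \<in> carrier R" "v \<in> carrier (I j)" "smI j (y [^] (k::nat)) v = \<zero>\<^bsub>I j\<^esub>" "k \<le> l"
  shows "smI j (y [^] (l::nat)) v = \<zero>\<^bsub>I j\<^esub>"
proof -
  have "y [^] l = y [^] (l - k) \<otimes> y [^] k" using assms by (simp add: nat_pow_mult)
  then show ?thesis using assms by (simp add: I.smult_assoc1)
qed

lemma J_add:
  assumes t: "t \<le> d" and v: "v \<in> J t j" and w: "w \<in> J t j"
  shows "v \<oplus>\<^bsub>I j\<^esub> w \<in> J t j"
proof -
  have C: "v \<in> carrier (I j)" "w \<in> carrier (I j)" using v w by (auto simp: J_def)
  have "\<exists>k::nat. smI j (x i [^] k) (v \<oplus>\<^bsub>I j\<^esub> w) = \<zero>\<^bsub>I j\<^esub>" if i: "i < t" for i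
  proof -
    have xi: "x i \<in> carrier R" using x_carrier i t by simp
    obtain k :: nat where k: "smI j (x i [^] k) v = \<zero>\<^bsub>I j\<^esub>" using v i by (auto simp: J_def)
    obtain l :: nat where l: "smI j (x i [^] l) w = \<zero>\<^bsub>I j\<^esub>" using w i by (auto simp: J_def)
    have "smI j (x i [^] max k l) v = \<zero>\<^bsub>I j\<^esub>" "smI j (x i [^] max k l) w = \<zero>\<^bsub>I j\<^esub>"
      using pow_kill_mono[OF xi C(1) k, of "max k l"] pow_kill_mono[OF xi C(2) l, of "max k l"] by auto
    then have "smI j (x i [^] max k l) (v \<oplus>\<^bsub>I j\<^esub> w) = \<zero>\<^bsub>I j\<^esub>" using C xi by (simp add: I.smult_r_distr)
    then show ?thesis by blast
  qed
  then show ?thesis using C by (simp add: J_def)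
qed

lemma J_smult:
  assumes t: "t \<le> d" and v: "v \<in> J t j" and r: "r \<in> carrier R"
  shows "smI j r v \<in> J t j"
proof -
  have C: "v \<in> carrier (I j)" using v by (auto simp: J_def)
  have "\<exists>k::nat. smI j (x i [^] k) (smI j r v) = \<zero>\<^bsub>I j\<^esub>" if i: "i < t" for i
  proof -
    have xi: "x i \<in> carrier R" using x_carrier i t by simp
    obtain k :: nat where k: "smI j (x i [^] k) v = \<zero>\<^bsub>I j\<^esub>" using v i by (auto simp: J_def)
    have "smI j (x i [^] k) (smI j r v) = smI j r (smI j (x i [^] k) v)"
      using C xi r by (simp add: I.smult_assoc1[symmetric] m_comm)
    then show ?thesis using k r by auto
  qed
  then show ?thesis using C r by (simp add: J_def)
qed

lemma J_neg: "t \<le> d \<Longrightarrow> v \<in> J t j \<Longrightarrow> \<ominus>\<^bsub>I j\<^esub> v \<in> J t j"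
  using J_smult[of t v j "\<ominus> \<one>"] J_carrier[of v t j] by (simp add: I.smult_l_minus)

lemma J_zero: "t \<le> d \<Longrightarrow> \<zero>\<^bsub>I j\<^esub> \<in> J t j"
  using x_carrier by (auto simp: J_def intro!: exI[of _ 0])

lemma J_component:
  assumes t: "t \<le> d" and v: "v \<in> J t j"
  shows "ci j i v \<in> J t j"
proof -
  have C: "v \<in> carrier (I j)" using v by (auto simp: J_def)
  have "\<exists>k::nat. smI j (x l [^] k) (ci j i v) = \<zero>\<^bsub>I j\<^esub>" if l: "l < t" for l
  proof -
    obtain k :: nat where k: "smI j (x l [^] k) v = \<zero>\<^bsub>I j\<^esub>" using v l by (auto simp: J_def)
    have xl: "x l [^] k \<in> rgrade R (int k * int (D l))" using pow_grade x_grade l t by simp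
    have "smI j (x l [^] k) (ci j i v) = ci j (i + int k * int (D l)) (smI j (x l [^] k) v)"
      using I.hcomp_smult[OF RG.gr_carrier[OF xl] xl C, of i] by simp
    then show ?thesis using k by auto
  qed
  then show ?thesis using C by (simp add: J_def)
qed

lemma J_\<delta>:
  assumes t: "t \<le> d" and v: "v \<in> J t j"
  shows "\<delta> j v \<in> J t (Suc j)"
proof -
  have C: "v \<in> carrier (I j)" using v by (auto simp: J_def)
  have "\<exists>k::nat. smI (Suc j) (x l [^] k) (\<delta> j v) = \<zero>\<^bsub>I (Suc j)\<^esub>" if l: "l < t" for l
  proof -
    obtain k :: nat where k: "smI j (x l [^] k) v = \<zero>\<^bsub>I j\<^esub>" using v l by (auto simp: J_def)
    have "smI (Suc j) (x l [^] k) (\<delta> j v) = \<delta> j (smI j (x l [^] k) v)"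
      using C x_carrier l t by (simp add: \<delta>_smult)
    then show ?thesis using k \<delta>_zero by auto
  qed
  then show ?thesis using C \<delta>_closed by (simp add: J_def)
qed

text \<open>\<open>J t j\<close> modulo \<open>J (Suc t) j\<close> is divisible by
  \<open>x t\<close>, hence is the localization of \<open>J t j\<close> at \<open>x t\<close>. The
  quotient \<open>u\<close> stays in \<open>J t j\<close> because everything that kills
  \<open>v\<close> kills \<open>u\<close>, and the error \<open>w\<close> is killed by the power
  \<open>k\<close> that the division supplies.\<close>

lemma J_divide_homogeneous:
  assumes t: "t < d" and v: "v \<in> J t j" "v \<in> grade (I j) e"
  shows "\<exists>u w. u \<in> J t j \<and> u \<in> grade (I j) (e - int n * int (D t)) \<and> w \<in> J (Suc t) j \<and>
    smI j (x t [^] n) u = v \<oplus>\<^bsub>I j\<^esub> w"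
proof -
  have xt: "x t \<in> carrier R" using x_carrier t by simp
  have vC: "v \<in> carrier (I j)" using v J_carrier by blast
  obtain u k where u: "u \<in> grade (I j) (e - int n * int (D t))"
    "\<forall>r\<in>carrier R. smI j r v = \<zero>\<^bsub>I j\<^esub> \<longrightarrow> smI j r u = \<zero>\<^bsub>I j\<^esub>"
    "smI j (x t [^] (k + n)) u = smI j (x t [^] k) v"
    using graded_injective_divide[OF injective v(2) x_grade[OF t], of n] by blast
  have uC: "u \<in> carrier (I j)" using u(1) I.MG.gr_carrier by blast
  have uJ: "u \<in> J t j"
  proof -
    have "\<exists>k::nat. smI j (x i [^] k) u = \<zero>\<^bsub>I j\<^esub>" if i: "i < t" for i
    proof -
      obtain k :: nat where "smI j (x i [^] k) v = \<zero>\<^bsub>I j\<^esub>" using v(1) i by (auto simp: J_def)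
      moreover have "x i [^] k \<in> carrier R" using x_carrier i t by simp
      ultimately show ?thesis using u(2) by blast
    qed
    then show ?thesis using uC by (simp add: J_def)
  qed
  define w where "w = smI j (x t [^] n) u \<ominus>\<^bsub>I j\<^esub> v"
  have xu: "smI j (x t [^] n) u \<in> carrier (I j)" using uC xt by simp
  have wJ: "w \<in> J t j"
    unfolding w_def a_minus_def using t uJ v(1) xt by (intro J_add J_smult J_neg) auto
  have "smI j (x t [^] k) w = smI j (x t [^] (k + n)) u \<ominus>\<^bsub>I j\<^esub> smI j (x t [^] k) v"
    unfolding w_def a_minus_def using xu uC vC xt
    by (simp add: I.smult_r_distr I.smult_r_minus I.smult_assoc1[symmetric] nat_pow_mult)
  also have "\<dots> = \<zero>\<^bsub>I j\<^esub>" using u(3) vC xt by (simp add: a_minus_def I.M.r_neg)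
  finally have "w \<in> J (Suc t) j" using wJ J_Suc by blast
  moreover have "smI j (x t [^] n) u = v \<oplus>\<^bsub>I j\<^esub> w"
    unfolding w_def a_minus_def using xu vC
    by (simp add: I.M.a_comm[of v] I.M.a_assoc I.M.l_neg)
  ultimately show ?thesis using u(1) uJ by blast
qed

lemma J_divide:
  assumes t: "t < d" and v: "v \<in> J t j"
  shows "\<exists>u w. u \<in> J t j \<and> w \<in> J (Suc t) j \<and> smI j (x t [^] (n::nat)) u = v \<oplus>\<^bsub>I j\<^esub> w"
  using J_carrier[OF v]
proof (induction rule: I.MG.graded_induct)
  case zero
  then show ?case
    using J_zero[of t j] J_zero[of "Suc t" j] x_carrier[OF t] t
    by (intro exI[of _ "\<zero>\<^bsub>I j\<^esub>"]) simp
next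
  case (add i z)
  have t': "t \<le> d" "Suc t \<le> d" and xt: "x t [^] n \<in> carrier R" using t x_carrier by auto
  obtain u w where u: "u \<in> J t j" "w \<in> J (Suc t) j" "smI j (x t [^] n) u = z \<oplus>\<^bsub>I j\<^esub> w"
    using add.IH by auto
  obtain u' w' where u': "u' \<in> J t j" "w' \<in> J (Suc t) j" "smI j (x t [^] n) u' = ci j i v \<oplus>\<^bsub>I j\<^esub> w'"
    using J_divide_homogeneous[OF t J_component[OF t'(1) v] I.MG.hcomp_gr[OF J_carrier[OF v]], where n = n] by blast
  have C: "u \<in> carrier (I j)" "w \<in> carrier (I j)" "u' \<in> carrier (I j)" "w' \<in> carrier (I j)"
    "ci j i v \<in> carrier (I j)" "z \<in> carrier (I j)"
    using u u' J_carrier J_carrier[OF v] add.hyps by auto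
  have "smI j (x t [^] n) (u' \<oplus>\<^bsub>I j\<^esub> u) = (ci j i v \<oplus>\<^bsub>I j\<^esub> w') \<oplus>\<^bsub>I j\<^esub> (z \<oplus>\<^bsub>I j\<^esub> w)"
    using C xt u(3) u'(3) by (simp add: I.smult_r_distr)
  also have "\<dots> = (ci j i v \<oplus>\<^bsub>I j\<^esub> z) \<oplus>\<^bsub>I j\<^esub> (w' \<oplus>\<^bsub>I j\<^esub> w)" using C by (simp add: I.M.a_ac)
  finally show ?case using J_add[OF t'(1) u'(1) u(1)] J_add[OF t'(2) u'(2) u(2)] by blast
qed

text \<open>The cohomology of \<open>J t\<close> vanishes above degree \<open>t\<close>. A preimage
  \<open>y\<close> found with the torsion condition for one parameter less is corrected by a
  coboundary \<open>\<delta> u'\<close> until it becomes \<open>x t\<close>-torsion. The correction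
  needs a multiple of \<open>y\<close> to be a coboundary itself, which uses exactness one degree
  lower and explains \<open>t \<le> j\<close>.\<close>

lemma J_exact:
  assumes "t \<le> d" "t \<le> j" "z \<in> J t (Suc j)" "\<delta> (Suc j) z = \<zero>\<^bsub>I (Suc (Suc j))\<^esub>"
  shows "\<exists>y\<in>J t j. \<delta> j y = z"
  using assms
proof (induction t arbitrary: j z)
  case 0
  then show ?case using kernel_Suc[of z j] by (auto simp: J_0)
next
  case (Suc t)
  then obtain j' where j: "j = Suc j'" "t \<le> j'" by (cases j) auto
  have t: "t < d" "t \<le> d" "Suc t \<le> d" using Suc.prems by auto
  have xt: "x t \<in> carrier R" using x_carrier t by simp
  obtain y where y: "y \<in> J t j" "\<delta> j y = z" using Suc.IH[of j z] Suc.prems J_Suc by auto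
  have yC: "y \<in> carrier (I j)" using y J_carrier by blast
  obtain n :: nat where n: "smI (Suc j) (x t [^] n) z = \<zero>\<^bsub>I (Suc j)\<^esub>" using Suc.prems(3) J_Suc by auto
  have "\<delta> j (smI j (x t [^] n) y) = \<zero>\<^bsub>I (Suc j)\<^esub>" using n y yC xt by (simp add: \<delta>_smult)
  moreover have "smI j (x t [^] n) y \<in> J t j" using J_smult[OF t(2) y(1)] xt by simp
  ultimately obtain u where u: "u \<in> J t j'" "\<delta> j' u = smI j (x t [^] n) y"
    using Suc.IH[OF t(2) j(2), of "smI j (x t [^] n) y"] j(1) by auto
  obtain u' w where u': "u' \<in> J t j'" "w \<in> J (Suc t) j'" "smI j' (x t [^] n) u' = u \<oplus>\<^bsub>I j'\<^esub> w"
    using J_divide[OF t(1) u(1), of n] by blast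
  have C: "u \<in> carrier (I j')" "u' \<in> carrier (I j')" "w \<in> carrier (I j')"
    using u u' J_carrier by auto
  define y' where "y' = y \<ominus>\<^bsub>I j\<^esub> \<delta> j' u'"
  have du: "\<delta> j' u' \<in> carrier (I j)" "\<delta> j' w \<in> carrier (I j)" using \<delta>_closed C j by auto
  have y'J: "y' \<in> J t j"
    unfolding y'_def a_minus_def using J_add[OF t(2) y(1)] J_neg[OF t(2)] J_\<delta>[OF t(2) u'(1)] j by simp
  have "smI j (x t [^] n) (\<delta> j' u') = smI j (x t [^] n) y \<oplus>\<^bsub>I j\<^esub> \<delta> j' w"
    using \<delta>_smult[of "x t [^] n" u' j'] \<delta>_add[of u j' w] C xt u u' j by simp
  then have "smI j (x t [^] n) y' = \<ominus>\<^bsub>I j\<^esub> \<delta> j' w"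
    unfolding y'_def a_minus_def using yC du xt
    by (simp add: I.smult_r_distr I.smult_r_minus I.M.minus_add I.M.r_neg1 I.M.r_neg2)
  moreover have "\<ominus>\<^bsub>I j\<^esub> \<delta> j' w \<in> J (Suc t) j" using J_neg[OF t(3)] J_\<delta>[OF t(3) u'(2)] j by simp
  ultimately obtain m :: nat where "smI j (x t [^] m) (smI j (x t [^] n) y') = \<zero>\<^bsub>I j\<^esub>"
    using J_Suc by auto
  then have "smI j (x t [^] (m + n)) y' = \<zero>\<^bsub>I j\<^esub>"
    using J_carrier[OF y'J] xt by (simp add: I.smult_assoc1[symmetric] nat_pow_mult)
  then have "y' \<in> J (Suc t) j" using y'J J_Suc by blast
  moreover have "\<delta> j y' = z"
    unfolding y'_def a_minus_def using yC du y(2) \<delta>\<delta>[OF C(2)] j \<delta>_closed[OF yC]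
    by (simp add: \<delta>_add \<delta>_neg)
  ultimately show ?case by blast
qed

section \<open>Fractions as cohomology classes\<close>

definition Z :: "nat \<Rightarrow> 'i set" where
  "Z t = {z \<in> J t t. \<delta> t z = \<zero>\<^bsub>I (Suc t)\<^esub>}"

text \<open>Cocycles and coboundaries are taken on the diagonal only, with \<open>t\<close>
  parameters in cohomological degree \<open>t\<close>, where the classes are fractions. Nothing
  precedes degree 0, hence the separate value there.\<close>

definition B :: "nat \<Rightarrow> 'i set" where
  "B t = (case t of 0 \<Rightarrow> {\<zero>\<^bsub>I 0\<^esub>} | Suc s \<Rightarrow> \<delta> s ` J t s)"

text \<open>\<open>Rel t n r z\<close> says that the cocycle \<open>z\<close> represents the fraction
  \<open>r / (x 0\<^bsup>n 0\<^esup> \<cdots> x (t - 1)\<^bsup>n (t - 1)\<^esup>)\<close> in the cohomology of \<open>J t\<close> in degree \<open>t\<close>. Passing from \<open>t\<close> to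
  \<open>t + 1\<close> is the connecting homomorphism of \<open>0 \<rightarrow> J (t + 1) \<rightarrow> J t \<rightarrow> J t localized at x t \<rightarrow> 0\<close>.\<close>

primrec Rel :: "nat \<Rightarrow> (nat \<Rightarrow> nat) \<Rightarrow> 'a \<Rightarrow> 'i \<Rightarrow> bool" where
  "Rel 0 n r z \<longleftrightarrow> z = \<epsilon> r"
| "Rel (Suc t) n r z \<longleftrightarrow> (\<exists>h y v. Rel t n r h \<and> y \<in> J t t \<and> v \<in> J (Suc t) t \<and>
     smI t (x t [^] n t) y = h \<oplus>\<^bsub>I t\<^esub> v \<and> z = \<delta> t y)"

text \<open>Multiplying \<open>z = \<delta> y\<close> by the power of \<open>x t\<close> gives
  \<open>\<delta> h + \<delta> v = \<delta> v\<close>, which is \<open>x t\<close>-torsion; thus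
  \<open>z\<close> acquires the torsion condition for the new parameter.\<close>

lemma Rel_cocycle:
  "\<lbrakk>t \<le> d; r \<in> carrier R; Rel t n r z\<rbrakk> \<Longrightarrow> z \<in> Z t"
proof (induction t arbitrary: z)
  case 0
  then show ?case using kernel_0[of "\<epsilon> r"] \<epsilon>_closed by (auto simp: Z_def J_0)
next
  case (Suc t)
  then have t: "t < d" "t \<le> d" "Suc t \<le> d" by auto
  have xt: "x t \<in> carrier R" using x_carrier t by simp
  obtain h y v where h: "Rel t n r h" "y \<in> J t t" "v \<in> J (Suc t) t"
    "smI t (x t [^] n t) y = h \<oplus>\<^bsub>I t\<^esub> v" "z = \<delta> t y" using Suc.prems by auto
  have hZ: "h \<in> Z t" using Suc.IH[OF t(2) Suc.prems(2) h(1)] .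
  have C: "y \<in> carrier (I t)" "v \<in> carrier (I t)" "h \<in> carrier (I t)"
    using h hZ J_carrier by (auto simp: Z_def)
  have "smI (Suc t) (x t [^] n t) z = \<delta> t v"
    using h(4,5) C xt hZ \<delta>_add[OF C(3,2)] \<delta>_smult[of "x t [^] n t" y t] \<delta>_closed[OF C(2)]
    by (simp add: Z_def)
  moreover have "\<delta> t v \<in> J (Suc t) (Suc t)" using J_\<delta>[OF t(3) h(3)] .
  ultimately obtain m :: nat where "smI (Suc t) (x t [^] m) (smI (Suc t) (x t [^] n t) z) = \<zero>\<^bsub>I (Suc t)\<^esub>"
    using J_Suc by auto
  moreover have zC: "z \<in> carrier (I (Suc t))" using h(5) \<delta>_closed C by simp
  ultimately have "smI (Suc t) (x t [^] (m + n t)) z = \<zero>\<^bsub>I (Suc t)\<^esub>"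
    using xt by (simp add: I.smult_assoc1[symmetric] nat_pow_mult)
  moreover have "z \<in> J t (Suc t)" using J_\<delta>[OF t(2) h(2)] h(5) by simp
  ultimately have "z \<in> J (Suc t) (Suc t)" using J_Suc by blast
  then show ?case using h(5) \<delta>\<delta>[OF C(1)] by (simp add: Z_def)
qed

lemma Rel_add:
  "\<lbrakk>t \<le> d; r \<in> carrier R; r' \<in> carrier R; Rel t n r z; Rel t n r' z'\<rbrakk> \<Longrightarrow>
    Rel t n (r \<oplus> r') (z \<oplus>\<^bsub>I t\<^esub> z')"
proof (induction t arbitrary: z z')
  case 0
  then show ?case by (simp add: \<epsilon>_add)
next
  case (Suc t)
  then have t: "t < d" "t \<le> d" "Suc t \<le> d" by auto
  have xt: "x t [^] n t \<in> carrier R" using x_carrier t by simp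
  obtain h y v where h: "Rel t n r h" "y \<in> J t t" "v \<in> J (Suc t) t"
    "smI t (x t [^] n t) y = h \<oplus>\<^bsub>I t\<^esub> v" "z = \<delta> t y" using Suc.prems by auto
  obtain h' y' v' where h': "Rel t n r' h'" "y' \<in> J t t" "v' \<in> J (Suc t) t"
    "smI t (x t [^] n t) y' = h' \<oplus>\<^bsub>I t\<^esub> v'" "z' = \<delta> t y'" using Suc.prems by auto
  have C: "y \<in> carrier (I t)" "v \<in> carrier (I t)" "h \<in> carrier (I t)"
    "y' \<in> carrier (I t)" "v' \<in> carrier (I t)" "h' \<in> carrier (I t)"
    using h h' J_carrier Rel_cocycle[OF t(2) _ h(1)] Rel_cocycle[OF t(2) _ h'(1)] Suc.prems
    by (auto simp: Z_def)
  have "smI t (x t [^] n t) (y \<oplus>\<^bsub>I t\<^esub> y') = (h \<oplus>\<^bsub>I t\<^esub> v) \<oplus>\<^bsub>I t\<^esub> (h' \<oplus>\<^bsub>I t\<^esub> v')"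
    using C xt h(4) h'(4) by (simp add: I.smult_r_distr)
  also have "\<dots> = (h \<oplus>\<^bsub>I t\<^esub> h') \<oplus>\<^bsub>I t\<^esub> (v \<oplus>\<^bsub>I t\<^esub> v')" using C by (simp add: I.M.a_ac)
  finally have "smI t (x t [^] n t) (y \<oplus>\<^bsub>I t\<^esub> y') = (h \<oplus>\<^bsub>I t\<^esub> h') \<oplus>\<^bsub>I t\<^esub> (v \<oplus>\<^bsub>I t\<^esub> v')" .
  moreover have "Rel t n (r \<oplus> r') (h \<oplus>\<^bsub>I t\<^esub> h')" using Suc.IH[OF t(2) Suc.prems(2,3) h(1) h'(1)] .
  moreover have "y \<oplus>\<^bsub>I t\<^esub> y' \<in> J t t" "v \<oplus>\<^bsub>I t\<^esub> v' \<in> J (Suc t) t" using J_add t h h' by auto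
  moreover have "z \<oplus>\<^bsub>I (Suc t)\<^esub> z' = \<delta> t (y \<oplus>\<^bsub>I t\<^esub> y')" using h h' C \<delta>_add by simp
  ultimately show ?case by auto
qed

lemma Rel_smult:
  "\<lbrakk>t \<le> d; s \<in> carrier R; r \<in> carrier R; Rel t n r z\<rbrakk> \<Longrightarrow> Rel t n (s \<otimes> r) (smI t s z)"
proof (induction t arbitrary: z)
  case 0
  then show ?case by (simp add: \<epsilon>_smult)
next
  case (Suc t)
  then have t: "t < d" "t \<le> d" "Suc t \<le> d" by auto
  have xt: "x t [^] n t \<in> carrier R" using x_carrier t by simp
  have s: "s \<in> carrier R" using Suc.prems by simp
  obtain h y v where h: "Rel t n r h" "y \<in> J t t" "v \<in> J (Suc t) t"
    "smI t (x t [^] n t) y = h \<oplus>\<^bsub>I t\<^esub> v" "z = \<delta> t y" using Suc.prems by auto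
  have C: "y \<in> carrier (I t)" "v \<in> carrier (I t)" "h \<in> carrier (I t)"
    using h J_carrier Rel_cocycle[OF t(2) _ h(1)] Suc.prems by (auto simp: Z_def)
  have "smI t (x t [^] n t) (smI t s y) = smI t s (smI t (x t [^] n t) y)"
    using C xt s by (simp add: I.smult_assoc1[symmetric] m_comm)
  also have "\<dots> = smI t s h \<oplus>\<^bsub>I t\<^esub> smI t s v" using C s h(4) by (simp add: I.smult_r_distr)
  finally have "smI t (x t [^] n t) (smI t s y) = smI t s h \<oplus>\<^bsub>I t\<^esub> smI t s v" .
  moreover have "Rel t n (s \<otimes> r) (smI t s h)" using Suc.IH[OF t(2) Suc.prems(2,3) h(1)] .
  moreover have "smI t s y \<in> J t t" "smI t s v \<in> J (Suc t) t" using J_smult t h s by auto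
  moreover have "smI (Suc t) s z = \<delta> t (smI t s y)" using h C \<delta>_smult s by simp
  ultimately show ?case by auto
qed

text \<open>The connecting homomorphism respects classes. If \<open>h = \<delta> u\<close>, then
  dividing \<open>u\<close> by the power of \<open>x t\<close> gives \<open>u'\<close>, and
  \<open>y - \<delta> u'\<close> is \<open>x t\<close>-torsion with the same image as
  \<open>y\<close>.\<close>

lemma coboundary_step:
  assumes t: "t < d" and h: "h \<in> B t" and y: "y \<in> J t t" and v: "v \<in> J (Suc t) t"
    and eq: "smI t (x t [^] (n::nat)) y = h \<oplus>\<^bsub>I t\<^esub> v"
  shows "\<delta> t y \<in> B (Suc t)"
proof -
  have t': "t \<le> d" "Suc t \<le> d" using t by auto
  have xt: "x t \<in> carrier R" using x_carrier t by simp
  have C: "y \<in> carrier (I t)" "v \<in> carrier (I t)" using y v J_carrier by auto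
  have "\<exists>y'\<in>J t t. \<delta> t y' = \<delta> t y \<and> smI t (x t [^] n) y' \<in> J (Suc t) t"
  proof (cases t)
    case 0
    then have "h = \<zero>\<^bsub>I t\<^esub>" using h by (simp add: B_def)
    then show ?thesis using eq C y v by auto
  next
    case (Suc s)
    then obtain u where u: "h = \<delta> s u" "u \<in> J t s" using h by (auto simp: B_def)
    obtain u' w where u': "u' \<in> J t s" "w \<in> J (Suc t) s" "smI s (x t [^] n) u' = u \<oplus>\<^bsub>I s\<^esub> w"
      using J_divide[OF t u(2), of n] by blast
    have uC: "u \<in> carrier (I s)" "u' \<in> carrier (I s)" "w \<in> carrier (I s)" using u u' J_carrier by auto
    have D: "\<delta> s u' \<in> carrier (I t)" "\<delta> s w \<in> carrier (I t)" "\<delta> s u \<in> carrier (I t)"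
      using \<delta>_closed uC Suc by auto
    define y' where "y' = y \<ominus>\<^bsub>I t\<^esub> \<delta> s u'"
    have y'J: "y' \<in> J t t"
      unfolding y'_def a_minus_def using J_add[OF t'(1) y] J_neg[OF t'(1)] J_\<delta>[OF t'(1) u'(1)] Suc by simp
    have "smI t (x t [^] n) (\<delta> s u') = \<delta> s u \<oplus>\<^bsub>I t\<^esub> \<delta> s w"
      using \<delta>_smult[of "x t [^] n" u' s] \<delta>_add[of u s w] uC xt u' Suc by simp
    then have "smI t (x t [^] n) y' = v \<oplus>\<^bsub>I t\<^esub> \<ominus>\<^bsub>I t\<^esub> \<delta> s w"
      unfolding y'_def a_minus_def using C D xt eq u(1)
      by (simp add: I.smult_r_distr I.smult_r_minus I.M.minus_add I.M.a_ac I.M.r_neg1 I.M.r_neg2)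
    also have "\<dots> \<in> J (Suc t) t"
      using J_add[OF t'(2) v] J_neg[OF t'(2)] J_\<delta>[OF t'(2) u'(2)] Suc by simp
    finally have "smI t (x t [^] n) y' \<in> J (Suc t) t" .
    moreover have "\<delta> t y' = \<delta> t y"
      unfolding y'_def a_minus_def using C D \<delta>\<delta>[OF uC(2)] Suc \<delta>_closed[OF C(1)]
      by (simp add: \<delta>_add \<delta>_neg)
    ultimately show ?thesis using y'J by blast
  qed
  then obtain y' where y': "y' \<in> J t t" "\<delta> t y' = \<delta> t y" "smI t (x t [^] n) y' \<in> J (Suc t) t" by auto
  obtain m :: nat where "smI t (x t [^] m) (smI t (x t [^] n) y') = \<zero>\<^bsub>I t\<^esub>" using y'(3) J_Suc by auto
  then have "smI t (x t [^] (m + n)) y' = \<zero>\<^bsub>I t\<^esub>"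
    using J_carrier[OF y'(1)] xt by (simp add: I.smult_assoc1[symmetric] nat_pow_mult)
  then have "y' \<in> J (Suc t) t" using y'(1) J_Suc by blast
  then show ?thesis using y'(2) by (auto simp: B_def intro!: image_eqI[of _ _ y'])
qed

text \<open>With additivity this shows that two representatives of one fraction differ by a
  coboundary.\<close>

lemma Rel_zero:
  "\<lbrakk>t \<le> d; Rel t n \<zero> z\<rbrakk> \<Longrightarrow> z \<in> B t"
proof (induction t arbitrary: z)
  case 0
  then show ?case by (simp add: B_def \<epsilon>_zero)
next
  case (Suc t)
  then obtain h y v where h: "Rel t n \<zero> h" "y \<in> J t t" "v \<in> J (Suc t) t"
    "smI t (x t [^] n t) y = h \<oplus>\<^bsub>I t\<^esub> v" "z = \<delta> t y" by auto
  then show ?case using coboundary_step[of t h y v "n t"] Suc by simp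
qed

text \<open>Division by parameters respects degrees, so a homogeneous numerator has a homogeneous
  representative of the degree of the fraction.\<close>

lemma Rel_exists_homogeneous:
  "\<lbrakk>t \<le> d; r \<in> rgrade R e\<rbrakk> \<Longrightarrow> \<exists>z\<in>grade (I t) (e - int (wdeg D t n)). Rel t n r z"
proof (induction t)
  case 0
  then show ?case using \<epsilon>_grade by (simp add: wdeg_def)
next
  case (Suc t)
  then have t: "t < d" "t \<le> d" by auto
  obtain h where h: "h \<in> grade (I t) (e - int (wdeg D t n))" "Rel t n r h" using Suc t by auto
  have "h \<in> J t t" using Rel_cocycle[OF t(2) RG.gr_carrier[OF Suc.prems(2)] h(2)] by (simp add: Z_def)
  from J_divide_homogeneous[OF t(1) this h(1), of "n t"] obtain u w where
    u: "u \<in> J t t" "u \<in> grade (I t) (e - int (wdeg D t n) - int (n t) * int (D t))"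
      "w \<in> J (Suc t) t" "smI t (x t [^] n t) u = h \<oplus>\<^bsub>I t\<^esub> w" by blast
  have "\<delta> t u \<in> grade (I (Suc t)) (e - int (wdeg D (Suc t) n))"
    using \<delta>_grade[OF u(2)] by (simp add: wdeg_def algebra_simps)
  moreover have "Rel (Suc t) n r (\<delta> t u)" using h(2) u by auto
  ultimately show ?case by blast
qed

lemma Rel_exists:
  "\<lbrakk>t \<le> d; r \<in> carrier R\<rbrakk> \<Longrightarrow> \<exists>z. Rel t n r z"
proof (induction t)
  case (Suc t)
  then have t: "t < d" "t \<le> d" by auto
  obtain h where h: "Rel t n r h" using Suc t by auto
  have "h \<in> J t t" using Rel_cocycle[OF t(2) Suc.prems(2) h] by (simp add: Z_def)
  from J_divide[OF t(1) this, of "n t"] show ?case using h by auto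
qed auto

lemma Rel_cong: "(\<And>i. i < t \<Longrightarrow> n i = m i) \<Longrightarrow> Rel t n r z = Rel t m r z"
  by (induction t arbitrary: z) auto

text \<open>The construction read backwards: exactness of \<open>J t\<close> above degree
  \<open>t\<close> gives a lift \<open>y\<close> of \<open>z\<close>, and a power of
  \<open>x t\<close> that kills \<open>z\<close> turns \<open>y\<close> into a cocycle of the
  previous stage.\<close>

lemma Rel_surjective:
  "\<lbrakk>t \<le> d; z \<in> Z t\<rbrakk> \<Longrightarrow> \<exists>n. \<exists>r\<in>carrier R. Rel t n r z"
proof (induction t arbitrary: z)
  case 0
  then show ?case using kernel_0[of z] by (auto simp: Z_def J_0)
next
  case (Suc t)
  then have t: "t < d" "t \<le> d" "Suc t \<le> d" by auto
  have xt: "x t \<in> carrier R" using x_carrier t by simp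
  have z: "z \<in> J t (Suc t)" "\<delta> (Suc t) z = \<zero>\<^bsub>I (Suc (Suc t))\<^esub>" using Suc.prems J_Suc by (auto simp: Z_def)
  obtain y where y: "y \<in> J t t" "\<delta> t y = z" using J_exact[OF t(2) _ z] by auto
  have yC: "y \<in> carrier (I t)" using y J_carrier by blast
  obtain m :: nat where m: "smI (Suc t) (x t [^] m) z = \<zero>\<^bsub>I (Suc t)\<^esub>" using Suc.prems J_Suc by (auto simp: Z_def)
  let ?h = "smI t (x t [^] m) y"
  have "?h \<in> Z t" using J_smult[OF t(2) y(1)] xt m y yC by (simp add: Z_def \<delta>_smult)
  then obtain n r where r: "r \<in> carrier R" "Rel t n r ?h" using Suc.IH t by blast
  have "Rel t (n(t := m)) r ?h" using r(2) Rel_cong[of t "n(t := m)" n] by simp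
  then have "Rel (Suc t) (n(t := m)) r z"
    unfolding Rel.simps fun_upd_same using y J_zero[OF t(3)] yC xt
    by (intro exI[of _ ?h] exI[of _ y] exI[of _ "\<zero>\<^bsub>I t\<^esub>"] conjI) simp_all
  then show ?case using r(1) by blast
qed

text \<open>Expanding a fraction by \<open>x j\<close> leaves it unchanged, and even the same
  cocycle \<open>z\<close> represents it.\<close>

lemma Rel_shift:
  "\<lbrakk>t \<le> d; j < t; r \<in> carrier R; Rel t n r z\<rbrakk> \<Longrightarrow> Rel t (n(j := Suc (n j))) (x j \<otimes> r) z"
proof (induction t arbitrary: z)
  case (Suc t)
  then have t: "t < d" "t \<le> d" "Suc t \<le> d" by auto
  have xt: "x t \<in> carrier R" using x_carrier t by simp
  obtain h y v where h: "Rel t n r h" "y \<in> J t t" "v \<in> J (Suc t) t"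
    "smI t (x t [^] n t) y = h \<oplus>\<^bsub>I t\<^esub> v" "z = \<delta> t y" using Suc.prems by auto
  have C: "y \<in> carrier (I t)" "v \<in> carrier (I t)" "h \<in> carrier (I t)"
    using h J_carrier Rel_cocycle[OF t(2) _ h(1)] Suc.prems by (auto simp: Z_def)
  show ?case
  proof (cases "j = t")
    case True
    have "Rel t (n(t := Suc (n t))) (x t \<otimes> r) (smI t (x t) h)"
      using Rel_smult[OF t(2) xt Suc.prems(3) h(1)] Rel_cong[of t "n(t := Suc (n t))" n] by simp
    moreover have "smI t (x t [^] Suc (n t)) y = smI t (x t) (smI t (x t [^] n t) y)"
      using C xt by (simp add: I.smult_assoc1[symmetric] m_comm)
    then have "smI t (x t [^] Suc (n t)) y = smI t (x t) h \<oplus>\<^bsub>I t\<^esub> smI t (x t) v"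
      using C xt h(4) by (simp add: I.smult_r_distr)
    moreover have "smI t (x t) v \<in> J (Suc t) t" using J_smult[OF t(3) h(3) xt] .
    ultimately have "Rel (Suc t) (n(t := Suc (n t))) (x t \<otimes> r) z"
      unfolding Rel.simps fun_upd_same using h(2,5) by blast
    then show ?thesis unfolding True .
  next
    case False
    have "Rel t (n(j := Suc (n j))) (x j \<otimes> r) h"
      by (rule Suc.IH[OF t(2) _ Suc.prems(3) h(1)]) (use Suc.prems(2) False in simp)
    moreover have "(n(j := Suc (n j))) t = n t" using False by simp
    ultimately show ?thesis unfolding Rel.simps using h(2-5) by metis
  qed
qed simp

text \<open>Without \<open>x j\<close> in the denominator, the element to be lifted lies in
  \<open>J j\<close> before localization, so its connecting image is a coboundary; the later stages
  preserve coboundaries.\<close>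

lemma Rel_vanish:
  "\<lbrakk>t \<le> d; j < t; n j = 0; r \<in> carrier R; Rel t n r z\<rbrakk> \<Longrightarrow> z \<in> B t"
proof (induction t arbitrary: z)
  case (Suc t)
  then have t: "t < d" "t \<le> d" "Suc t \<le> d" by auto
  obtain h y v where h: "Rel t n r h" "y \<in> J t t" "v \<in> J (Suc t) t"
    "smI t (x t [^] n t) y = h \<oplus>\<^bsub>I t\<^esub> v" "z = \<delta> t y" using Suc.prems by auto
  have hZ: "h \<in> Z t" using Rel_cocycle[OF t(2) _ h(1)] Suc.prems by simp
  have C: "y \<in> carrier (I t)" "v \<in> carrier (I t)" "h \<in> carrier (I t)"
    using h J_carrier hZ by (auto simp: Z_def)
  show ?case
  proof (cases "j = t")
    case True
    then have "y = h \<oplus>\<^bsub>I t\<^esub> v" using h(4) Suc.prems C by simp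
    then have "z = \<delta> t v" using h(5) \<delta>_add[OF C(3,2)] hZ \<delta>_closed[OF C(2)] by (simp add: Z_def)
    then show ?thesis using h(3) by (auto simp: B_def)
  next
    case False
    then have "h \<in> B t" using Suc.IH[OF t(2) _ Suc.prems(3,4) h(1)] Suc.prems(2) by simp
    then show ?thesis using coboundary_step[OF t(1) _ h(2,3,4)] h(5) by simp
  qed
qed simp

end

section \<open>Quotients and graded homomorphism modules\<close>

locale module_quotient = module R M for R (structure) and M :: "('a, 'b) graded_module" +
  fixes N :: "'b set"
  assumes N: "LinearCombinations.submodule R N M"
begin

lemma N_carrier: "z \<in> N \<Longrightarrow> z \<in> carrier M"
  using N by (auto simp: LinearCombinations.submodule_def)

lemma N_add: "z \<in> N \<Longrightarrow> z' \<in> N \<Longrightarrow> z \<oplus>\<^bsub>M\<^esub> z' \<in> N"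
  using N by (auto simp: LinearCombinations.submodule_def)

lemma N_zero: "\<zero>\<^bsub>M\<^esub> \<in> N"
  using N by (auto simp: LinearCombinations.submodule_def)

lemma N_smult: "r \<in> carrier R \<Longrightarrow> z \<in> N \<Longrightarrow> r \<odot>\<^bsub>M\<^esub> z \<in> N"
  using N by (auto simp: LinearCombinations.submodule_def)

lemma N_neg: "z \<in> N \<Longrightarrow> \<ominus>\<^bsub>M\<^esub> z \<in> N"
  using N_smult[of "\<ominus> \<one>" z] N_carrier[of z] by (simp add: smult_l_minus)

definition cl :: "'b \<Rightarrow> 'b set" where "cl z = N +>\<^bsub>M\<^esub> z"

lemma cl_iff: "u \<in> cl z \<longleftrightarrow> (\<exists>h\<in>N. u = h \<oplus>\<^bsub>M\<^esub> z)"
  by (auto simp: cl_def a_r_coset_def r_coset_def)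

lemma cl_mem:
  assumes "z \<in> carrier M"
  shows "u \<in> cl z \<longleftrightarrow> u \<in> carrier M \<and> u \<ominus>\<^bsub>M\<^esub> z \<in> N"
proof
  assume "u \<in> cl z"
  then obtain h where h: "h \<in> N" "u = h \<oplus>\<^bsub>M\<^esub> z" using cl_iff by blast
  then show "u \<in> carrier M \<and> u \<ominus>\<^bsub>M\<^esub> z \<in> N"
    using assms N_carrier[OF h(1)] by (simp add: a_minus_def M.a_assoc M.r_neg)
next
  assume u: "u \<in> carrier M \<and> u \<ominus>\<^bsub>M\<^esub> z \<in> N"
  then have "u = (u \<ominus>\<^bsub>M\<^esub> z) \<oplus>\<^bsub>M\<^esub> z" using assms by (simp add: a_minus_def M.a_assoc M.l_neg)
  then show "u \<in> cl z" using u cl_iff by blast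
qed

lemma cl_eq:
  assumes z: "z \<in> carrier M" and z': "z' \<in> carrier M" and diff: "z \<ominus>\<^bsub>M\<^esub> z' \<in> N"
  shows "cl z = cl z'"
proof -
  have "u \<ominus>\<^bsub>M\<^esub> z' = (u \<ominus>\<^bsub>M\<^esub> z) \<oplus>\<^bsub>M\<^esub> (z \<ominus>\<^bsub>M\<^esub> z')"
    "u \<ominus>\<^bsub>M\<^esub> z = (u \<ominus>\<^bsub>M\<^esub> z') \<oplus>\<^bsub>M\<^esub> \<ominus>\<^bsub>M\<^esub> (z \<ominus>\<^bsub>M\<^esub> z')" if "u \<in> carrier M" for u
    using that z z' by (simp_all add: a_minus_def M.a_assoc M.minus_add M.r_neg1 M.r_neg2 M.a_comm[of "\<ominus>\<^bsub>M\<^esub> z" z'])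
  then have "u \<ominus>\<^bsub>M\<^esub> z \<in> N \<longleftrightarrow> u \<ominus>\<^bsub>M\<^esub> z' \<in> N" if "u \<in> carrier M" for u
    using that N_add N_neg diff by metis
  then show ?thesis using cl_mem[OF z] cl_mem[OF z'] by auto
qed

lemma cl_zero: "z \<in> N \<Longrightarrow> cl z = N"
proof -
  assume z: "z \<in> N"
  have "cl z = cl \<zero>\<^bsub>M\<^esub>" using N_carrier[OF z] z by (intro cl_eq) (auto simp: a_minus_def intro!: N_add N_neg N_zero)
  also have "cl \<zero>\<^bsub>M\<^esub> = N" using N_carrier by (auto simp: cl_iff)
  finally show ?thesis .
qed

lemma set_add_cl:
  assumes z: "z \<in> carrier M" and z': "z' \<in> carrier M"
  shows "cl z <+>\<^bsub>M\<^esub> cl z' = cl (z \<oplus>\<^bsub>M\<^esub> z')"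
proof (intro equalityI subsetI)
  fix u assume "u \<in> cl z <+>\<^bsub>M\<^esub> cl z'"
  then obtain h h' where h: "h \<in> N" "h' \<in> N" "u = (h \<oplus>\<^bsub>M\<^esub> z) \<oplus>\<^bsub>M\<^esub> (h' \<oplus>\<^bsub>M\<^esub> z')"
    by (auto simp: set_add_def set_mult_def cl_iff)
  then have "u = (h \<oplus>\<^bsub>M\<^esub> h') \<oplus>\<^bsub>M\<^esub> (z \<oplus>\<^bsub>M\<^esub> z')" using z z' N_carrier by (simp add: M.a_ac)
  then show "u \<in> cl (z \<oplus>\<^bsub>M\<^esub> z')" using h N_add cl_iff by blast
next
  fix u assume "u \<in> cl (z \<oplus>\<^bsub>M\<^esub> z')"
  then obtain h where h: "h \<in> N" "u = h \<oplus>\<^bsub>M\<^esub> (z \<oplus>\<^bsub>M\<^esub> z')" using cl_iff by blast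
  then have "u = (h \<oplus>\<^bsub>M\<^esub> z) \<oplus>\<^bsub>M\<^esub> (\<zero>\<^bsub>M\<^esub> \<oplus>\<^bsub>M\<^esub> z')" using z z' N_carrier by (simp add: M.a_assoc)
  moreover have "h \<oplus>\<^bsub>M\<^esub> z \<in> cl z" "\<zero>\<^bsub>M\<^esub> \<oplus>\<^bsub>M\<^esub> z' \<in> cl z'" using h(1) N_zero cl_iff by blast+
  ultimately show "u \<in> cl z <+>\<^bsub>M\<^esub> cl z'" by (auto simp: set_add_def set_mult_def)
qed

lemma smult_cl:
  assumes z: "z \<in> carrier M" and r: "r \<in> carrier R"
  shows "(\<Union>u\<in>cl z. N +>\<^bsub>M\<^esub> (r \<odot>\<^bsub>M\<^esub> u)) = cl (r \<odot>\<^bsub>M\<^esub> z)"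
proof -
  have "cl (r \<odot>\<^bsub>M\<^esub> u) = cl (r \<odot>\<^bsub>M\<^esub> z)" if u: "u \<in> cl z" for u
  proof -
    obtain h where h: "h \<in> N" "u = h \<oplus>\<^bsub>M\<^esub> z" using u cl_iff by blast
    then have C: "h \<in> carrier M" using N_carrier by simp
    have "r \<odot>\<^bsub>M\<^esub> u \<ominus>\<^bsub>M\<^esub> r \<odot>\<^bsub>M\<^esub> z = r \<odot>\<^bsub>M\<^esub> h"
      using C z r h(2) by (simp add: smult_r_distr a_minus_def M.a_assoc M.r_neg)
    then show ?thesis using C z r h N_smult by (intro cl_eq) auto
  qed
  then have "(\<Union>u\<in>cl z. cl (r \<odot>\<^bsub>M\<^esub> u)) = (\<Union>u\<in>cl z. cl (r \<odot>\<^bsub>M\<^esub> z))" by (rule SUP_cong[OF refl])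
  also have "\<dots> = cl (r \<odot>\<^bsub>M\<^esub> z)"
  proof -
    have "z = \<zero>\<^bsub>M\<^esub> \<oplus>\<^bsub>M\<^esub> z" using z by simp
    then have "z \<in> cl z" using N_zero cl_iff by blast
    then show ?thesis by blast
  qed
  finally show ?thesis unfolding cl_def .
qed

lemma quotient_carrier: "carrier (graded_quotient M N) = cl ` carrier M"
  by (auto simp: graded_quotient_def A_RCOSETS_def RCOSETS_def cl_def a_r_coset_def)

lemma quotient_add: "z \<in> carrier M \<Longrightarrow> z' \<in> carrier M \<Longrightarrow>
    cl z \<oplus>\<^bsub>graded_quotient M N\<^esub> cl z' = cl (z \<oplus>\<^bsub>M\<^esub> z')"
  by (simp add: graded_quotient_def set_add_cl)

lemma quotient_smult: "z \<in> carrier M \<Longrightarrow> r \<in> carrier R \<Longrightarrow>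
    r \<odot>\<^bsub>graded_quotient M N\<^esub> cl z = cl (r \<odot>\<^bsub>M\<^esub> z)"
  by (simp add: graded_quotient_def smult_cl)

lemma quotient_grade: "grade (graded_quotient M N) i = cl ` grade M i"
  by (auto simp: graded_quotient_def cl_def)

end

text \<open>Of \<open>M\<close> only closure under its operations is asked, since homomorphisms take
  their values in \<open>N\<close> and inherit all module laws from there. So local cohomology can
  be inserted without a proof that it is a graded module.\<close>

locale graded_Hom_module = nonneg_graded_ring R + N: graded_module R N
  for R :: "'a graded_ring" (structure) and M :: "('a, 'b) graded_module" and N :: "('a, 'c) graded_module" +
  assumes M_add: "\<lbrakk>u \<in> carrier M; v \<in> carrier M\<rbrakk> \<Longrightarrow> u \<oplus>\<^bsub>M\<^esub> v \<in> carrier M"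
    and M_smult: "\<lbrakk>r \<in> carrier R; u \<in> carrier M\<rbrakk> \<Longrightarrow> r \<odot>\<^bsub>M\<^esub> u \<in> carrier M"
    and M_grade: "u \<in> grade M i \<Longrightarrow> u \<in> carrier M"
begin

abbreviation W where "W \<equiv> graded_Hom R M N"

lemma W_zero: "ring.zero W = (\<lambda>u\<in>carrier M. \<zero>\<^bsub>N\<^esub>)"
  by (simp add: graded_Hom_def)

lemma W_add: "f \<oplus>\<^bsub>W\<^esub> g = (\<lambda>u\<in>carrier M. f u \<oplus>\<^bsub>N\<^esub> g u)"
  by (simp add: graded_Hom_def)

lemma W_smult: "r \<odot>\<^bsub>W\<^esub> f = (\<lambda>u\<in>carrier M. r \<odot>\<^bsub>N\<^esub> f u)"
  by (simp add: graded_Hom_def)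

lemma W_grade: "grade W n = hom_of_degree R M N n \<inter> extensional (carrier M)"
  by (simp add: graded_Hom_def)

lemma hom_closed: "f \<in> module_hom R M N \<Longrightarrow> u \<in> carrier M \<Longrightarrow> f u \<in> carrier N"
  by (auto simp: module_hom_def)

lemma hom_degree_hom: "f \<in> hom_of_degree R M N n \<Longrightarrow> f \<in> module_hom R M N"
  by (simp add: hom_of_degree_def)

lemma module_hom_add:
  assumes "f \<in> module_hom R M N" "g \<in> module_hom R M N"
  shows "(\<lambda>u\<in>carrier M. f u \<oplus>\<^bsub>N\<^esub> g u) \<in> module_hom R M N"
  using assms M_add M_smult by (auto simp: module_hom_def N.smult_r_distr N.M.a_ac Pi_iff)

lemma module_hom_zero: "(\<lambda>u\<in>carrier M. \<zero>\<^bsub>N\<^esub>) \<in> module_hom R M N"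
  using M_add M_smult by (auto simp: module_hom_def)

lemma grade_add:
  assumes "f \<in> hom_of_degree R M N n" "g \<in> hom_of_degree R M N n"
  shows "(\<lambda>u\<in>carrier M. f u \<oplus>\<^bsub>N\<^esub> g u) \<in> grade W n"
proof -
  have "f u \<oplus>\<^bsub>N\<^esub> g u \<in> grade N (i + n)" if "u \<in> grade M i" for u i
  proof (rule N.MG.add_gr)
    show "f u \<in> grade N (i + n)" "g u \<in> grade N (i + n)"
      using assms that unfolding hom_of_degree_def by blast+
  qed
  then show ?thesis
    using module_hom_add[of f g] assms M_grade by (auto simp: W_grade hom_of_degree_def)
qed

lemma hom_degree_restrict:
  assumes "f \<in> hom_of_degree R M N n"
  shows "restrict f (carrier M) \<in> grade W n"
  using assms M_add M_smult M_grade by (auto simp: W_grade hom_of_degree_def module_hom_def)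

lemma zero_grade: "ring.zero W \<in> grade W n"
  unfolding W_zero W_grade using module_hom_zero M_grade by (auto simp: hom_of_degree_def)

lemma W_carrier_iff: "f \<in> carrier W \<longleftrightarrow> (\<exists>I F. finite I \<and> (\<forall>n\<in>I. F n \<in> hom_of_degree R M N n) \<and>
    f = (\<lambda>u\<in>carrier M. \<Oplus>\<^bsub>N\<^esub>n\<in>I. F n u))"
  by (simp add: graded_Hom_def)

lemma zero_carrier: "ring.zero W \<in> carrier W"
  unfolding W_carrier_iff W_zero by (intro exI[of _ "{}"]) simp

lemma add_homogeneous_carrier:
  assumes f: "f \<in> carrier W" and g: "g \<in> grade W n"
  shows "f \<oplus>\<^bsub>W\<^esub> g \<in> carrier W"
proof -
  obtain I F where F: "finite I" "\<And>n. n \<in> I \<Longrightarrow> F n \<in> hom_of_degree R M N n"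
    "f = (\<lambda>u\<in>carrier M. \<Oplus>\<^bsub>N\<^esub>n\<in>I. F n u)" using f by (auto simp: W_carrier_iff)
  have gh: "g \<in> hom_of_degree R M N n" using g by (simp add: W_grade)
  \<comment> \<open>The summand of degree \<open>n\<close> already present in \<open>f\<close>, or
    zero; \<open>g\<close> is merged with it, because there is one homomorphism for each
    degree.\<close>
  define F0 where "F0 = (if n \<in> I then F n else ring.zero W)"
  have F0: "F0 \<in> hom_of_degree R M N n" using F(2) zero_grade[of n] by (auto simp: F0_def W_grade)
  define F' where "F' m = (if m = n then (\<lambda>u\<in>carrier M. F0 u \<oplus>\<^bsub>N\<^esub> g u) else F m)" for m
  have F': "F' m \<in> hom_of_degree R M N m" if "m \<in> insert n I" for m
    using that F(2) grade_add[OF F0 gh] by (auto simp: F'_def W_grade)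
  have FC: "F m u \<in> carrier N" if "m \<in> I" "u \<in> carrier M" for m u
    using hom_closed[OF hom_degree_hom[OF F(2)]] that .
  have C: "F0 u \<in> carrier N" "g u \<in> carrier N" if "u \<in> carrier M" for u
    using hom_closed[OF hom_degree_hom] F0 gh that by auto
  have "(\<Oplus>\<^bsub>N\<^esub>m\<in>I. F m u) \<oplus>\<^bsub>N\<^esub> g u = (\<Oplus>\<^bsub>N\<^esub>m\<in>insert n I. F' m u)" if u: "u \<in> carrier M" for u
  proof -
    let ?S = "\<Oplus>\<^bsub>N\<^esub>m\<in>I - {n}. F m u"
    have 1: "(\<lambda>m. F m u) \<in> I - {n} \<rightarrow> carrier N" using FC u by auto
    have S: "?S \<in> carrier N" using 1 by simp
    have "(\<Oplus>\<^bsub>N\<^esub>m\<in>I. F m u) = F0 u \<oplus>\<^bsub>N\<^esub> ?S"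
    proof (cases "n \<in> I")
      case True
      then have "I = insert n (I - {n})" by auto
      then have "(\<Oplus>\<^bsub>N\<^esub>m\<in>I. F m u) = (\<Oplus>\<^bsub>N\<^esub>m\<in>insert n (I - {n}). F m u)" by simp
      also have "\<dots> = F n u \<oplus>\<^bsub>N\<^esub> ?S" using F(1) 1 FC[OF True u] by (intro N.M.finsum_insert) auto
      finally show ?thesis using True by (simp add: F0_def)
    next
      case False
      then show ?thesis using S u by (simp add: F0_def W_zero)
    qed
    moreover have "(\<Oplus>\<^bsub>N\<^esub>m\<in>insert n I. F' m u) = (F0 u \<oplus>\<^bsub>N\<^esub> g u) \<oplus>\<^bsub>N\<^esub> ?S"
    proof -
      have "(\<Oplus>\<^bsub>N\<^esub>m\<in>insert n I. F' m u) = (\<Oplus>\<^bsub>N\<^esub>m\<in>insert n (I - {n}). F' m u)" by (simp add: insert_Diff_if)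
      also have "\<dots> = F' n u \<oplus>\<^bsub>N\<^esub> (\<Oplus>\<^bsub>N\<^esub>m\<in>I - {n}. F' m u)"
        using F(1) FC C u by (intro N.M.finsum_insert) (auto simp: F'_def)
      also have "(\<Oplus>\<^bsub>N\<^esub>m\<in>I - {n}. F' m u) = ?S"
        using 1 by (intro N.M.finsum_cong') (auto simp: F'_def)
      finally show ?thesis using u by (simp add: F'_def)
    qed
    ultimately show ?thesis using C[OF u] S by (simp add: N.M.a_ac)
  qed
  then have "f \<oplus>\<^bsub>W\<^esub> g = (\<lambda>u\<in>carrier M. \<Oplus>\<^bsub>N\<^esub>m\<in>insert n I. F' m u)"
    unfolding W_add F(3) by (auto simp: restrict_def)
  moreover have "finite (insert n I)" "\<forall>m\<in>insert n I. F' m \<in> hom_of_degree R M N m"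
    using F(1) F' by auto
  ultimately show ?thesis
    unfolding W_carrier_iff by (intro exI[of _ "insert n I"] exI[of _ F'] conjI)
qed

lemma W_induct [consumes 1, case_names zero add]:
  assumes f: "f \<in> carrier W" and zero: "P (ring.zero W)"
    and add: "\<And>f g n. \<lbrakk>f \<in> carrier W; P f; g \<in> grade W n\<rbrakk> \<Longrightarrow> P (f \<oplus>\<^bsub>W\<^esub> g)"
  shows "P f"
proof -
  obtain I F where F: "finite I" "\<And>n. n \<in> I \<Longrightarrow> F n \<in> hom_of_degree R M N n"
    "f = (\<lambda>u\<in>carrier M. \<Oplus>\<^bsub>N\<^esub>n\<in>I. F n u)" using f by (auto simp: W_carrier_iff)
  have "(\<lambda>u\<in>carrier M. \<Oplus>\<^bsub>N\<^esub>n\<in>I. F n u) \<in> carrier W \<and> P (\<lambda>u\<in>carrier M. \<Oplus>\<^bsub>N\<^esub>n\<in>I. F n u)"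
    using F(1,2)
  proof (induction I rule: finite_induct)
    case empty
    then show ?case using zero zero_carrier unfolding W_zero by (simp only: N.M.finsum_empty)
  next
    case (insert n I)
    let ?f = "\<lambda>u\<in>carrier M. \<Oplus>\<^bsub>N\<^esub>n\<in>I. F n u" and ?g = "restrict (F n) (carrier M)"
    have g: "?g \<in> grade W n" using insert.prems by (intro hom_degree_restrict) auto
    have FC: "F m u \<in> carrier N" if "m \<in> insert n I" "u \<in> carrier M" for m u
      using hom_closed[OF hom_degree_hom[OF insert.prems[OF that(1)]]] that(2) .
    have "(\<Oplus>\<^bsub>N\<^esub>m\<in>insert n I. F m u) = (\<Oplus>\<^bsub>N\<^esub>m\<in>I. F m u) \<oplus>\<^bsub>N\<^esub> F n u" if u: "u \<in> carrier M" for u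
    proof -
      have 1: "(\<lambda>m. F m u) \<in> I \<rightarrow> carrier N" "F n u \<in> carrier N" using FC u by auto
      then show ?thesis using insert.hyps by (simp add: N.M.a_comm)
    qed
    then have "(\<lambda>u\<in>carrier M. \<Oplus>\<^bsub>N\<^esub>m\<in>insert n I. F m u) = ?f \<oplus>\<^bsub>W\<^esub> ?g"
      unfolding W_add by (auto simp: restrict_def)
    moreover have "?f \<in> carrier W \<and> P ?f" by (rule insert.IH) (use insert.prems in blast)
    ultimately show ?case using add_homogeneous_carrier[OF _ g] add[OF _ _ g] by simp
  qed
  then show ?thesis using F(3) by simp
qed

lemma grade_carrier:
  assumes "f \<in> grade W n" shows "f \<in> carrier W"
  unfolding W_carrier_iff
proof (intro exI conjI)
  show "finite {n}" by simp
  show "\<forall>m\<in>{n}. (\<lambda>_. f) m \<in> hom_of_degree R M N m" using assms by (simp add: W_grade)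
  have "f u \<in> carrier N" if "u \<in> carrier M" for u
    using assms that hom_closed[OF hom_degree_hom] by (auto simp: W_grade)
  then show "f = (\<lambda>u\<in>carrier M. \<Oplus>\<^bsub>N\<^esub>m\<in>{n}. (\<lambda>_. f) m u)"
    using assms by (auto simp: W_grade restrict_def extensional_def fun_eq_iff)
qed

lemma carrier_hom: "f \<in> carrier W \<Longrightarrow> f \<in> module_hom R M N \<and> f \<in> extensional (carrier M)"
proof (induction rule: W_induct)
  case zero
  then show ?case unfolding W_zero by (intro conjI module_hom_zero restrict_extensional)
next
  case (add f g n)
  have "f \<in> module_hom R M N" "g \<in> module_hom R M N"
    using add.IH add.hyps(2) hom_degree_hom[of g n] by (simp_all add: W_grade)
  then show ?case unfolding W_add by (intro conjI module_hom_add restrict_extensional)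
qed

lemma W_closed: "f \<in> carrier W \<Longrightarrow> u \<in> carrier M \<Longrightarrow> f u \<in> carrier N"
  using carrier_hom hom_closed by blast

lemma W_ext:
  assumes "f \<in> extensional (carrier M)" "g \<in> extensional (carrier M)" "\<And>u. u \<in> carrier M \<Longrightarrow> f u = g u"
  shows "f = g"
  using assms by (intro extensionalityI) auto

lemma W_add_apply: "u \<in> carrier M \<Longrightarrow> (f \<oplus>\<^bsub>W\<^esub> g) u = f u \<oplus>\<^bsub>N\<^esub> g u"
  by (simp add: W_add)

lemma W_smult_apply: "u \<in> carrier M \<Longrightarrow> (r \<odot>\<^bsub>W\<^esub> g) u = r \<odot>\<^bsub>N\<^esub> g u"
  by (simp add: W_smult)

lemma W_add_closed:
  assumes f: "f \<in> carrier W" and g: "g \<in> carrier W"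
  shows "f \<oplus>\<^bsub>W\<^esub> g \<in> carrier W"
  using g
proof (induction rule: W_induct)
  case zero
  have "f \<oplus>\<^bsub>W\<^esub> ring.zero W = f"
    using carrier_hom[OF f] W_closed[OF f]
    by (intro W_ext) (auto simp: W_add W_zero)
  then show ?case using f by simp
next
  case (add g h n)
  have "f \<oplus>\<^bsub>W\<^esub> (g \<oplus>\<^bsub>W\<^esub> h) = (f \<oplus>\<^bsub>W\<^esub> g) \<oplus>\<^bsub>W\<^esub> h"
    using W_closed[OF f] W_closed[OF add.hyps(1)] W_closed[OF grade_carrier[OF add.hyps(2)]]
    by (intro W_ext) (auto simp: W_add N.M.a_assoc)
  then show ?case using add_homogeneous_carrier[OF add.IH add.hyps(2)] by simp
qed

lemma W_smult_grade:
  assumes r: "r \<in> rgrade R i" and f: "f \<in> grade W n"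
  shows "r \<odot>\<^bsub>W\<^esub> f \<in> grade W (i + n)"
proof -
  have rC: "r \<in> carrier R" using r RG.gr_carrier by blast
  have fh: "f \<in> module_hom R M N" "\<And>j u. u \<in> grade M j \<Longrightarrow> f u \<in> grade N (j + n)"
    using f by (auto simp: W_grade hom_of_degree_def)
  have "r \<odot>\<^bsub>N\<^esub> f u \<in> grade N (j + (i + n))" if "u \<in> grade M j" for u j
    using N.smult_degree[OF r fh(2)[OF that]] by (simp add: algebra_simps)
  moreover have "r \<odot>\<^bsub>N\<^esub> (c \<odot>\<^bsub>N\<^esub> f u) = c \<odot>\<^bsub>N\<^esub> (r \<odot>\<^bsub>N\<^esub> f u)"
    if "c \<in> carrier R" "u \<in> carrier M" for c u
    using that rC hom_closed[OF fh(1)] by (simp add: N.smult_assoc1[symmetric] m_comm)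
  ultimately show ?thesis
    using fh(1) rC M_add M_smult M_grade
    by (auto simp: W_grade W_smult hom_of_degree_def module_hom_def N.smult_r_distr Pi_iff)
qed

text \<open>Membership means being a finite sum of homogeneous maps, so both the map and the scalar
  have to be split into components.\<close>

lemma W_smult_closed:
  assumes r: "r \<in> carrier R" and f: "f \<in> carrier W"
  shows "r \<odot>\<^bsub>W\<^esub> f \<in> carrier W"
  using f
proof (induction rule: W_induct)
  case zero
  have "r \<odot>\<^bsub>W\<^esub> ring.zero W = ring.zero W" using r by (intro W_ext) (auto simp: W_smult W_zero)
  then show ?case using zero_carrier by simp
next
  case (add f g n)
  have gC: "g \<in> carrier W" using grade_carrier[OF add.hyps(2)] .
  have "r \<odot>\<^bsub>W\<^esub> g \<in> carrier W"
    using r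
  proof (induction rule: RG.graded_induct)
    case zero
    have "\<zero> \<odot>\<^bsub>W\<^esub> g = ring.zero W" using W_closed[OF gC] by (intro W_ext) (auto simp: W_smult W_zero)
    then show ?case using zero_carrier by simp
  next
    case (add i y)
    have "(hcomp R (rgrade R) i r \<oplus> y) \<odot>\<^bsub>W\<^esub> g = hcomp R (rgrade R) i r \<odot>\<^bsub>W\<^esub> g \<oplus>\<^bsub>W\<^esub> y \<odot>\<^bsub>W\<^esub> g"
      using W_closed[OF gC] r add by (intro W_ext) (auto simp: W_smult W_add N.smult_l_distr)
    then show ?case
      using W_add_closed[OF grade_carrier[OF W_smult_grade[OF RG.hcomp_gr[OF r] \<open>g \<in> grade W n\<close>]] add.IH] by simp
  qed
  moreover have "r \<odot>\<^bsub>W\<^esub> (f \<oplus>\<^bsub>W\<^esub> g) = r \<odot>\<^bsub>W\<^esub> f \<oplus>\<^bsub>W\<^esub> r \<odot>\<^bsub>W\<^esub> g"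
    using W_closed[OF gC] W_closed[OF add.hyps(1)] r by (intro W_ext) (auto simp: W_smult W_add N.smult_r_distr)
  ultimately show ?case using W_add_closed add.IH by simp
qed

lemma module_W: "module R W"
proof (rule moduleI[OF cring_axioms])
  note cl = W_closed and ext = carrier_hom[THEN conjunct2]
  show "abelian_group W"
  proof (rule abelian_groupI)
    fix f assume f: "f \<in> carrier W"
    have "(\<ominus> \<one>) \<odot>\<^bsub>W\<^esub> f \<oplus>\<^bsub>W\<^esub> f = \<zero>\<^bsub>W\<^esub>"
      using cl[OF f] by (intro W_ext) (auto simp: W_smult W_add W_zero N.smult_l_minus N.M.l_neg)
    then show "\<exists>g\<in>carrier W. g \<oplus>\<^bsub>W\<^esub> f = \<zero>\<^bsub>W\<^esub>" using W_smult_closed[OF _ f] by blast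
    show "\<zero>\<^bsub>W\<^esub> \<oplus>\<^bsub>W\<^esub> f = f" using cl[OF f] ext[OF f] by (intro W_ext) (auto simp: W_add W_zero)
    fix g assume g: "g \<in> carrier W"
    show "f \<oplus>\<^bsub>W\<^esub> g = g \<oplus>\<^bsub>W\<^esub> f" using cl[OF f] cl[OF g] by (intro W_ext) (auto simp: W_add N.M.a_comm)
    fix h assume h: "h \<in> carrier W"
    show "f \<oplus>\<^bsub>W\<^esub> g \<oplus>\<^bsub>W\<^esub> h = f \<oplus>\<^bsub>W\<^esub> (g \<oplus>\<^bsub>W\<^esub> h)"
      using cl[OF f] cl[OF g] cl[OF h] by (intro W_ext) (auto simp: W_add N.M.a_assoc)
  qed (auto intro: W_add_closed zero_carrier)
  fix r s f assume r: "r \<in> carrier R" and s: "s \<in> carrier R" and f: "f \<in> carrier W"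
  show "(r \<oplus> s) \<odot>\<^bsub>W\<^esub> f = r \<odot>\<^bsub>W\<^esub> f \<oplus>\<^bsub>W\<^esub> s \<odot>\<^bsub>W\<^esub> f"
    using cl[OF f] r s by (intro W_ext) (auto simp: W_add W_smult N.smult_l_distr)
  show "(r \<otimes> s) \<odot>\<^bsub>W\<^esub> f = r \<odot>\<^bsub>W\<^esub> (s \<odot>\<^bsub>W\<^esub> f)"
    using cl[OF f] r s by (intro W_ext) (auto simp: W_smult N.smult_assoc1)
next
  fix r f g assume r: "r \<in> carrier R" and f: "f \<in> carrier W" and g: "g \<in> carrier W"
  show "r \<odot>\<^bsub>W\<^esub> (f \<oplus>\<^bsub>W\<^esub> g) = r \<odot>\<^bsub>W\<^esub> f \<oplus>\<^bsub>W\<^esub> r \<odot>\<^bsub>W\<^esub> g"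
    using W_closed[OF f] W_closed[OF g] r by (intro W_ext) (auto simp: W_add W_smult N.smult_r_distr)
next
  fix f assume f: "f \<in> carrier W"
  show "\<one> \<odot>\<^bsub>W\<^esub> f = f"
    using W_closed[OF f] carrier_hom[OF f] by (intro W_ext) (auto simp: W_smult)
qed (rule W_smult_closed)

lemma W_add_grade: "f \<in> grade W n \<Longrightarrow> g \<in> grade W n \<Longrightarrow> f \<oplus>\<^bsub>W\<^esub> g \<in> grade W n"
  using grade_add[of f n g] by (simp add: W_add W_grade)

end

section \<open>The graded canonical module\<close>

locale canonical_setup = torsion_tower R I \<epsilon> \<delta> x D d
  for R :: "'a graded_ring" (structure) and I :: "nat \<Rightarrow> ('a, 'i) graded_module" and \<epsilon> \<delta> x D d +
  fixes N0 :: nat and E :: "('a, 'e) graded_module" and \<iota> :: "'a set \<Rightarrow> 'e"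
    and \<omega> :: "('a, 'i set \<Rightarrow> 'e) graded_module"
  assumes primary: "\<And>e. N0 \<le> e \<Longrightarrow> rgrade R (int e) \<subseteq> Idl (x ` {..<d})"
    and dimension: "krull_dim R = enat d"
    and envelope: "graded_injective_envelope R (residue_module R) E \<iota>"
    and \<omega>_canonical: "\<omega> = graded_canonical_module R I \<delta> E"
begin

section \<open>Torsion of the irrelevant ideal as iterated torsion\<close>

abbreviation "\<mm> \<equiv> irrelevant_ideal R"

lemma ideal_power_low:
  "r \<in> (ideal_prod R \<mm> ^^ k) (carrier R) \<Longrightarrow> r \<in> carrier R \<and> (\<forall>i<int k. hc i r = \<zero>)"
proof (induction k arbitrary: r)
  case 0
  then show ?case using hcomp_negative by simp
next
  case (Suc k)
  then have "r \<in> ideal_prod R \<mm> ((ideal_prod R \<mm> ^^ k) (carrier R))" by simp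
  then show ?case
  proof (induction rule: ideal_prod.induct)
    case (prod u v)
    have u: "u \<in> carrier R" "hc 0 u = \<zero>" using prod irrelevant_ideal_iff by auto
    have v: "v \<in> carrier R" "\<And>i. i < int k \<Longrightarrow> hc i v = \<zero>" using Suc.IH[OF prod(2)] by auto
    have u': "hc i u = \<zero>" if "i < 1" for i
      using that u hcomp_negative[OF u(1), of i] by (cases "i = 0") auto
    have "hc i (u \<otimes> v) = \<zero>" if "i < int (Suc k)" for i
    proof -
      \<comment> \<open>\<open>u\<close> starts in degree 1 or later and \<open>v\<close> vanishes
        below degree \<open>k\<close>, so the formula for lowest components applies in degrees 1 and
        \<open>i - 1\<close>, where the second factor is zero.\<close>
      have "hc (1 + (i - 1)) (u \<otimes> v) = hc 1 u \<otimes> hc (i - 1) v"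
        using that v by (intro lowest_component_mult u u') auto
      moreover have "hc (i - 1) v = \<zero>" using v(2)[of "i - 1"] that by simp
      ultimately show ?thesis using u(1) by simp
    qed
    then show ?case using u v by simp
  next
    case (sum u v)
    then show ?case by (simp add: RG.hcomp_add)
  qed
qed

lemma pow_ideal_power: "y \<in> \<mm> \<Longrightarrow> y [^] k \<in> (ideal_prod R \<mm> ^^ k) (carrier R)"
proof (induction k)
  case (Suc k)
  then have y: "y \<in> carrier R" using irrelevant_ideal_iff by blast
  have "y \<otimes> y [^] k \<in> ideal_prod R \<mm> ((ideal_prod R \<mm> ^^ k) (carrier R))"
    by (rule ideal_prod.prod[OF Suc.prems Suc.IH[OF Suc.prems]])
  then show ?case using y by (simp add: m_comm)
qed simp

text \<open>The powers of the irrelevant ideal and of the parameters give the same torsion because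
  the ideal of the parameters contains all large degrees.\<close>

lemma torsion_part_J: "torsion_part R \<mm> (I j) = J d j"
proof (intro equalityI subsetI)
  fix v assume "v \<in> torsion_part R \<mm> (I j)"
  then obtain k where v: "v \<in> carrier (I j)"
    "\<forall>r\<in>(ideal_prod R \<mm> ^^ k) (carrier R). smI j r v = \<zero>\<^bsub>I j\<^esub>" by (auto simp: torsion_part_def)
  have "x i \<in> \<mm>" if "i < d" for i
    using grade_irrelevant[OF x_grade[OF that]] system that by (auto simp: hsys_def)
  then have "smI j (x i [^] k) v = \<zero>\<^bsub>I j\<^esub>" if "i < d" for i using v(2) pow_ideal_power that by blast
  then show "v \<in> J d j" using v(1) by (auto simp: J_def)
next
  fix v assume v: "v \<in> J d j"
  then have vC: "v \<in> carrier (I j)" by (rule J_carrier)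
  define a where "a = {r \<in> carrier R. smI j r v = \<zero>\<^bsub>I j\<^esub>}"
  have a: "ideal a R"
  proof (rule idealI[OF ring_axioms])
    show "subgroup a (add_monoid R)"
    proof (rule add.subgroupI)
      have "\<zero> \<in> a" using vC by (simp add: a_def)
      then show "a \<noteq> {}" by blast
    qed (use vC in \<open>auto simp: a_def I.smult_l_minus I.smult_l_distr\<close>)
    fix r s assume r: "r \<in> a" and s: "s \<in> carrier R"
    then show "s \<otimes> r \<in> a" using vC by (simp add: a_def I.smult_assoc1)
    then show "r \<otimes> s \<in> a" using r s by (simp add: a_def m_comm)
  qed
  interpret a: ideal a R by (rule a)
  have "\<exists>k::nat. x i [^] k \<in> a" if i: "i < d" for i
  proof -
    obtain k :: nat where "smI j (x i [^] k) v = \<zero>\<^bsub>I j\<^esub>" using v i unfolding J_def by blast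
    then show ?thesis using x_carrier[OF i] unfolding a_def by blast
  qed
  \<comment> \<open>The annihilator of \<open>v\<close> contains every degree from \<open>K\<close>
    on, and the \<open>K\<close>-th power of the irrelevant ideal has all its components
    there.\<close>
  then obtain K where K: "\<forall>e\<ge>K. rgrade R (int e) \<subseteq> a"
    using system_primary[of x D d N0 a] system primary a by blast
  have "r \<in> a" if r: "r \<in> (ideal_prod R \<mm> ^^ K) (carrier R)" for r
  proof -
    have rC: "r \<in> carrier R" and low: "\<And>i. i < int K \<Longrightarrow> hc i r = \<zero>" using ideal_power_low[OF r] by auto
    have comp: "hc i r \<in> a" for i
    proof (cases "i < int K")
      case False
      then have "K \<le> nat i" by simp
      then have "rgrade R (int (nat i)) \<subseteq> a" using K by blast
      then show ?thesis using False RG.hcomp_gr[OF rC, of i] by auto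
    qed (use low in simp)
    show ?thesis using rC
      by (induction rule: RG.graded_induct)
        (auto intro: comp additive_subgroup.a_closed[OF a.additive_subgroup_axioms])
  qed
  then have "\<forall>r\<in>(ideal_prod R \<mm> ^^ K) (carrier R). smI j r v = \<zero>\<^bsub>I j\<^esub>" unfolding a_def by blast
  then show "v \<in> torsion_part R \<mm> (I j)" using vC by (auto simp: torsion_part_def)
qed

section \<open>Local cohomology in degree \<open>d\<close> as cocycles modulo coboundaries\<close>

abbreviation "ZM \<equiv> graded_restrict (I d) (Z d)"

lemma Z_J: "z \<in> Z t \<Longrightarrow> z \<in> J t t"
  by (simp add: Z_def)

lemma Z_carrier: "z \<in> Z t \<Longrightarrow> z \<in> carrier (I t)"
  using Z_J J_carrier by blast

lemma Z_add: "z \<in> Z d \<Longrightarrow> z' \<in> Z d \<Longrightarrow> z \<oplus>\<^bsub>I d\<^esub> z' \<in> Z d"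
  using J_add[of d z d z'] by (auto simp: Z_def \<delta>_add J_carrier)

lemma Z_smult: "r \<in> carrier R \<Longrightarrow> z \<in> Z d \<Longrightarrow> smI d r z \<in> Z d"
  using J_smult[of d z d r] by (auto simp: Z_def \<delta>_smult J_carrier)

lemma Z_zero: "\<zero>\<^bsub>I d\<^esub> \<in> Z d"
  using J_zero[of d d] by (auto simp: Z_def \<delta>_zero)

lemma Z_neg: "z \<in> Z d \<Longrightarrow> \<ominus>\<^bsub>I d\<^esub> z \<in> Z d"
  using Z_smult[of "\<ominus> \<one>" z] Z_carrier[of z d] by (simp add: I.smult_l_minus)

lemma module_ZM: "module R ZM"
proof (rule moduleI[OF cring_axioms])
  show "abelian_group ZM"
  proof (rule abelian_groupI)
    fix z assume "z \<in> carrier ZM"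
    then have z: "z \<in> Z d" by (simp add: graded_restrict_def)
    have "\<ominus>\<^bsub>I d\<^esub> z \<oplus>\<^bsub>I d\<^esub> z = \<zero>\<^bsub>I d\<^esub>" using Z_carrier[OF z] by (simp add: I.M.l_neg)
    then show "\<exists>y\<in>carrier ZM. y \<oplus>\<^bsub>ZM\<^esub> z = \<zero>\<^bsub>ZM\<^esub>" using Z_neg[OF z] by (auto simp: graded_restrict_def)
  qed (auto simp: graded_restrict_def Z_add Z_zero Z_carrier I.M.a_ac)
qed (auto simp: graded_restrict_def Z_smult Z_carrier I.smult_l_distr I.smult_r_distr I.smult_assoc1)

lemma B_sub: "z \<in> B d \<Longrightarrow> z \<in> Z d"
proof (cases d)
  case 0
  then show "z \<in> B d \<Longrightarrow> z \<in> Z d" using Z_zero by (auto simp: B_def)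
next
  case (Suc s)
  assume "z \<in> B d"
  then obtain y where y: "y \<in> J d s" "z = \<delta> s y" using Suc by (auto simp: B_def)
  then show ?thesis using J_\<delta>[of d y s] \<delta>\<delta>[OF J_carrier[OF y(1)]] Suc by (simp add: Z_def)
qed

lemma B_submodule: "LinearCombinations.submodule R (B d) ZM"
proof (rule LinearCombinations.submodule.intro[OF module_ZM])
  show "B d \<subseteq> carrier ZM" using B_sub by (auto simp: graded_restrict_def)
  show "\<zero>\<^bsub>ZM\<^esub> \<in> B d"
  proof (cases d)
    case (Suc s)
    then show ?thesis using J_zero[of d s] \<delta>_zero[of s]
      by (auto simp: B_def graded_restrict_def intro!: image_eqI[of _ _ "\<zero>\<^bsub>I s\<^esub>"])
  qed (simp add: B_def graded_restrict_def)
  show "z \<oplus>\<^bsub>ZM\<^esub> z' \<in> B d" if "z \<in> B d" "z' \<in> B d" for z z'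
  proof (cases d)
    case (Suc s)
    then obtain y y' where "y \<in> J d s" "z = \<delta> s y" "y' \<in> J d s" "z' = \<delta> s y'" using \<open>z \<in> B d\<close> \<open>z' \<in> B d\<close> by (auto simp: B_def)
    then show ?thesis using Suc J_add[of d y s y'] \<delta>_add[of y s y'] J_carrier
      by (auto simp: B_def graded_restrict_def intro!: image_eqI[of _ _ "y \<oplus>\<^bsub>I s\<^esub> y'"])
  qed (use that in \<open>simp add: B_def graded_restrict_def\<close>)
  show "r \<odot>\<^bsub>ZM\<^esub> z \<in> B d" if "r \<in> carrier R" "z \<in> B d" for r z
  proof (cases d)
    case (Suc s)
    then obtain y where "y \<in> J d s" "z = \<delta> s y" using \<open>z \<in> B d\<close> by (auto simp: B_def)
    then show ?thesis using Suc J_smult[of d y s r] \<delta>_smult[of r y s] J_carrier \<open>r \<in> carrier R\<close>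
      by (auto simp: B_def graded_restrict_def intro!: image_eqI[of _ _ "smI s r y"])
  qed (use that in \<open>simp add: B_def graded_restrict_def\<close>)
qed

end

sublocale canonical_setup \<subseteq> Q: module_quotient R "graded_restrict (I d) (Z d)" "B d"
  using module_ZM B_submodule by (intro module_quotient.intro module_quotient_axioms.intro)

context canonical_setup
begin

abbreviation "H \<equiv> graded_quotient ZM (B d)"

lemma H_carrier: "carrier H = Q.cl ` Z d"
  using Q.quotient_carrier by (simp add: graded_restrict_def)

lemma H_add: "z \<in> Z d \<Longrightarrow> z' \<in> Z d \<Longrightarrow> Q.cl z \<oplus>\<^bsub>H\<^esub> Q.cl z' = Q.cl (z \<oplus>\<^bsub>I d\<^esub> z')"
  using Q.quotient_add[of z z'] by (simp add: graded_restrict_def)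

lemma H_smult: "z \<in> Z d \<Longrightarrow> r \<in> carrier R \<Longrightarrow> r \<odot>\<^bsub>H\<^esub> Q.cl z = Q.cl (smI d r z)"
  using Q.quotient_smult[of z r] by (simp add: graded_restrict_def)

lemma H_grade: "grade H i = Q.cl ` (grade (I d) i \<inter> Z d)"
  using Q.quotient_grade by (simp add: graded_restrict_def)

lemma local_cohomology_H: "graded_local_cohomology R I \<delta> d = H"
proof -
  have "(case d of 0 \<Rightarrow> {\<zero>\<^bsub>I 0\<^esub>} | Suc j \<Rightarrow> \<delta> j ` J d j) = B d"
    by (auto simp: B_def split: nat.split)
  then show ?thesis by (simp add: graded_local_cohomology_def Let_def torsion_part_J Z_def)
qed

lemma graded_module_E: "graded_module R E"
  using envelope by (simp add: graded_injective_envelope_def graded_injective_def)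

end

sublocale canonical_setup \<subseteq> E: graded_module R E
  by (rule graded_module_E)

sublocale canonical_setup \<subseteq> GH: graded_Hom_module R "graded_quotient (graded_restrict (I d) (Z d)) (B d)" E
proof
  show "u \<oplus>\<^bsub>H\<^esub> v \<in> carrier H" if "u \<in> carrier H" "v \<in> carrier H" for u v
    using that Z_add by (auto simp: H_carrier H_add)
  show "r \<odot>\<^bsub>H\<^esub> u \<in> carrier H" if "r \<in> carrier R" "u \<in> carrier H" for r u
    using that Z_smult by (auto simp: H_carrier H_smult)
  show "u \<in> carrier H" if "u \<in> grade H i" for u i
    using that by (auto simp: H_grade H_carrier)
qed

context canonical_setup
begin

lemma \<omega>_def: "\<omega> = graded_Hom R H E"
  using \<omega>_canonical dimension local_cohomology_H by (simp add: graded_canonical_module_def)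

lemma module_\<omega>: "module R \<omega>"
  using GH.module_W by (simp add: \<omega>_def)

end

sublocale canonical_setup \<subseteq> W: module R \<omega>
  by (rule module_\<omega>)

context canonical_setup
begin

lemma \<omega>_grade_carrier: "w \<in> grade \<omega> i \<Longrightarrow> w \<in> carrier \<omega>"
  unfolding \<omega>_def by (rule GH.grade_carrier)

lemma \<omega>_smult_grade: "r \<in> rgrade R i \<Longrightarrow> w \<in> grade \<omega> j \<Longrightarrow> r \<odot>\<^bsub>\<omega>\<^esub> w \<in> grade \<omega> (i + j)"
  unfolding \<omega>_def by (rule GH.W_smult_grade)

lemma \<omega>_add_grade: "w \<in> grade \<omega> i \<Longrightarrow> w' \<in> grade \<omega> i \<Longrightarrow> w \<oplus>\<^bsub>\<omega>\<^esub> w' \<in> grade \<omega> i"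
  unfolding \<omega>_def by (rule GH.W_add_grade)

lemma \<omega>_zero_grade: "\<zero>\<^bsub>\<omega>\<^esub> \<in> grade \<omega> i"
  unfolding \<omega>_def by (rule GH.zero_grade)

lemma \<omega>_induct [consumes 1, case_names zero add]:
  assumes "w \<in> carrier \<omega>" "P \<zero>\<^bsub>\<omega>\<^esub>"
    "\<And>f g n. \<lbrakk>f \<in> carrier \<omega>; P f; g \<in> grade \<omega> n\<rbrakk> \<Longrightarrow> P (f \<oplus>\<^bsub>\<omega>\<^esub> g)"
  shows "P w"
  using GH.W_induct[of w P] assms unfolding \<omega>_def by blast

text \<open>The value of \<open>w \<in> \<omega> = *Hom(H, E)\<close> on the fraction \<open>r / x\<^bsup>n\<^esup>\<close>.\<close>

definition \<Psi> :: "('i set \<Rightarrow> 'e) \<Rightarrow> (nat \<Rightarrow> nat) \<Rightarrow> 'a \<Rightarrow> 'e" where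
  "\<Psi> w n r = w (Q.cl (SOME z. Rel d n r z))"

section \<open>Calculus of the values on fractions\<close>

lemma Rel_Z: "r \<in> carrier R \<Longrightarrow> Rel d n r z \<Longrightarrow> z \<in> Z d"
  by (rule Rel_cocycle) simp_all

text \<open>The difference of two representatives of \<open>r / x^n\<close> represents the fraction
  with numerator \<open>r - r = \<zero>\<close>.\<close>

lemma Rel_class:
  assumes r: "r \<in> carrier R" and z: "Rel d n r z" and z': "Rel d n r z'"
  shows "Q.cl z = Q.cl z'"
proof (rule Q.cl_eq)
  have zz: "z \<in> Z d" "z' \<in> Z d" using Rel_Z r z z' by auto
  then show C: "z \<in> carrier ZM" "z' \<in> carrier ZM" by (auto simp: graded_restrict_def)
  have "Rel d n (\<ominus> \<one> \<otimes> r) (smI d (\<ominus> \<one>) z')" using Rel_smult[of d "\<ominus> \<one>" r n z'] r z' by simp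
  then have "Rel d n (r \<oplus> \<ominus> \<one> \<otimes> r) (z \<oplus>\<^bsub>I d\<^esub> smI d (\<ominus> \<one>) z')"
    using Rel_add[of d r "\<ominus> \<one> \<otimes> r" n z] r z by simp
  moreover have "r \<oplus> \<ominus> \<one> \<otimes> r = \<zero>" using r by (simp add: l_minus r_neg)
  ultimately have m: "z \<oplus>\<^bsub>I d\<^esub> smI d (\<ominus> \<one>) z' \<in> B d" using Rel_zero by simp
  have "\<ominus>\<^bsub>ZM\<^esub> z' = (\<ominus> \<one>) \<odot>\<^bsub>ZM\<^esub> z'"
    using Q.smult_l_minus[of \<one> z'] Q.smult_one[OF C(2)] C(2) by simp
  then show "z \<ominus>\<^bsub>ZM\<^esub> z' \<in> B d" using m by (simp add: a_minus_def graded_restrict_def)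
qed

lemma \<Psi>_eq:
  assumes "r \<in> carrier R" "Rel d n r z"
  shows "\<Psi> w n r = w (Q.cl z)"
  unfolding \<Psi>_def using Rel_class[OF assms(1) someI[of "Rel d n r", OF assms(2)] assms(2)] by simp

lemma Rel_obtain:
  assumes "r \<in> carrier R" obtains z where "Rel d n r z" "z \<in> Z d"
  using Rel_exists[of d r n] Rel_Z assms by blast

lemma \<omega>_closed: "w \<in> carrier \<omega> \<Longrightarrow> z \<in> Z d \<Longrightarrow> w (Q.cl z) \<in> carrier E"
  unfolding \<omega>_def by (rule GH.W_closed) (auto simp: H_carrier)

lemma \<omega>_hom: "w \<in> carrier \<omega> \<Longrightarrow> w \<in> module_hom R H E"
  unfolding \<omega>_def using GH.carrier_hom by blast

lemma \<omega>_value_add: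
  assumes "w \<in> carrier \<omega>" "z \<in> Z d" "z' \<in> Z d"
  shows "w (Q.cl (z \<oplus>\<^bsub>I d\<^esub> z')) = w (Q.cl z) \<oplus>\<^bsub>E\<^esub> w (Q.cl z')"
  using module_hom_add[OF \<omega>_hom[OF assms(1)], of "Q.cl z" "Q.cl z'"] assms by (simp add: H_carrier H_add)

lemma \<omega>_value_smult:
  assumes "w \<in> carrier \<omega>" "z \<in> Z d" "r \<in> carrier R"
  shows "w (Q.cl (smI d r z)) = r \<odot>\<^bsub>E\<^esub> w (Q.cl z)"
  using module_hom_smult[OF \<omega>_hom[OF assms(1)], of r "Q.cl z"] assms by (simp add: H_carrier H_smult)

lemma \<Psi>_closed:
  assumes "w \<in> carrier \<omega>" "r \<in> carrier R" shows "\<Psi> w n r \<in> carrier E"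
  using Rel_obtain[OF assms(2), of n] \<Psi>_eq[OF assms(2), of n] \<omega>_closed[OF assms(1)] by metis

lemma \<Psi>_add:
  assumes w: "w \<in> carrier \<omega>" and r: "r \<in> carrier R" "s \<in> carrier R"
  shows "\<Psi> w n (r \<oplus> s) = \<Psi> w n r \<oplus>\<^bsub>E\<^esub> \<Psi> w n s"
proof -
  obtain z where z: "Rel d n r z" "z \<in> Z d" using Rel_obtain[OF r(1)] by blast
  obtain z' where z': "Rel d n s z'" "z' \<in> Z d" using Rel_obtain[OF r(2)] by blast
  have "Rel d n (r \<oplus> s) (z \<oplus>\<^bsub>I d\<^esub> z')" using Rel_add[OF _ r z(1) z'(1)] by simp
  then show ?thesis
    using \<Psi>_eq[of "r \<oplus> s" n] \<Psi>_eq[OF r(1) z(1)] \<Psi>_eq[OF r(2) z'(1)] \<omega>_value_add[OF w z(2) z'(2)] r by simp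
qed

lemma \<Psi>_mult:
  assumes w: "w \<in> carrier \<omega>" and r: "r \<in> carrier R" "s \<in> carrier R"
  shows "\<Psi> w n (s \<otimes> r) = s \<odot>\<^bsub>E\<^esub> \<Psi> w n r"
proof -
  obtain z where z: "Rel d n r z" "z \<in> Z d" using Rel_obtain[OF r(1)] by blast
  have "Rel d n (s \<otimes> r) (smI d s z)" using Rel_smult[OF _ r(2,1) z(1)] by simp
  then show ?thesis using \<Psi>_eq[of "s \<otimes> r" n] \<Psi>_eq[OF r(1) z(1)] \<omega>_value_smult[OF w z(2) r(2)] r by simp
qed

lemma \<Psi>_zero: "w \<in> carrier \<omega> \<Longrightarrow> \<Psi> w n \<zero> = \<zero>\<^bsub>E\<^esub>"
  using \<Psi>_mult[of w \<zero> \<zero> n] \<Psi>_closed[of w \<zero> n] by simp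

lemma \<Psi>_smult:
  assumes w: "w \<in> carrier \<omega>" and r: "r \<in> carrier R" "s \<in> carrier R"
  shows "\<Psi> (s \<odot>\<^bsub>\<omega>\<^esub> w) n r = \<Psi> w n (s \<otimes> r)"
proof -
  obtain z where z: "Rel d n r z" "z \<in> Z d" using Rel_obtain[OF r(1)] by blast
  have "(s \<odot>\<^bsub>\<omega>\<^esub> w) (Q.cl z) = s \<odot>\<^bsub>E\<^esub> w (Q.cl z)"
    unfolding \<omega>_def using z(2) by (intro GH.W_smult_apply) (simp add: H_carrier)
  then show ?thesis using \<Psi>_mult[OF w r] \<Psi>_eq[OF r(1) z(1)] by simp
qed

lemma \<Psi>_plus:
  assumes r: "r \<in> carrier R"
  shows "\<Psi> (w \<oplus>\<^bsub>\<omega>\<^esub> w') n r = \<Psi> w n r \<oplus>\<^bsub>E\<^esub> \<Psi> w' n r"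
proof -
  obtain z where z: "Rel d n r z" "z \<in> Z d" using Rel_obtain[OF r] by blast
  have "(w \<oplus>\<^bsub>\<omega>\<^esub> w') (Q.cl z) = w (Q.cl z) \<oplus>\<^bsub>E\<^esub> w' (Q.cl z)"
    unfolding \<omega>_def using z(2) by (intro GH.W_add_apply) (simp add: H_carrier)
  then show ?thesis using \<Psi>_eq[OF r z(1)] by simp
qed

lemma \<Psi>_finsum:
  assumes w: "w \<in> carrier \<omega>" and f: "\<And>a. a \<in> A \<Longrightarrow> f a \<in> carrier R" and A: "finite A"
  shows "\<Psi> w n (\<Oplus>a\<in>A. f a) = (\<Oplus>\<^bsub>E\<^esub>a\<in>A. \<Psi> w n (f a))"
  using A f
proof (induction A rule: finite_induct)
  case empty
  then show ?case using \<Psi>_zero[OF w] by simp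
next
  case (insert a A)
  have C: "f a \<in> carrier R" "f \<in> A \<rightarrow> carrier R" "(\<lambda>a. \<Psi> w n (f a)) \<in> A \<rightarrow> carrier E" "\<Psi> w n (f a) \<in> carrier E"
    using insert.prems \<Psi>_closed[OF w] by auto
  have "\<Psi> w n (\<Oplus>a\<in>insert a A. f a) = \<Psi> w n (f a) \<oplus>\<^bsub>E\<^esub> \<Psi> w n (\<Oplus>a\<in>A. f a)"
    using insert.hyps C \<Psi>_add[OF w C(1) finsum_closed[OF C(2)]] by simp
  also have "\<dots> = (\<Oplus>\<^bsub>E\<^esub>a\<in>insert a A. \<Psi> w n (f a))"
    using insert C by simp
  finally show ?case .
qed

lemma \<Psi>_cong:
  assumes "r \<in> carrier R" "\<And>j. j < d \<Longrightarrow> n j = m j"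
  shows "\<Psi> w n r = \<Psi> w m r"
  using Rel_obtain[OF assms(1), of n] \<Psi>_eq[OF assms(1)] Rel_cong[of d n m r] assms(2) by metis

lemma B_value:
  assumes w: "w \<in> carrier \<omega>" and z: "z \<in> B d"
  shows "w (Q.cl z) = \<zero>\<^bsub>E\<^esub>"
proof -
  have "Q.cl z = Q.cl (smI d \<zero> \<zero>\<^bsub>I d\<^esub>)"
    using Q.cl_zero[OF z] Q.cl_zero[of "\<zero>\<^bsub>I d\<^esub>"] Q.N_zero by (simp add: graded_restrict_def)
  then show ?thesis using \<omega>_value_smult[OF w Z_zero zero_closed] \<omega>_closed[OF w Z_zero] by simp
qed

lemma \<Psi>_vanish:
  assumes w: "w \<in> carrier \<omega>" and r: "r \<in> carrier R" and j: "j < d" "n j = 0"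
  shows "\<Psi> w n r = \<zero>\<^bsub>E\<^esub>"
proof -
  obtain z where z: "Rel d n r z" "z \<in> Z d" using Rel_obtain[OF r] by blast
  have "z \<in> B d" using Rel_vanish[of d j n r z] j r z by simp
  then show ?thesis using \<Psi>_eq[OF r z(1)] B_value[OF w] by simp
qed

lemma \<Psi>_shift:
  assumes r: "r \<in> carrier R" and j: "j < d"
  shows "\<Psi> w (n(j := Suc (n j))) (x j \<otimes> r) = \<Psi> w n r"
proof -
  obtain z where z: "Rel d n r z" "z \<in> Z d" using Rel_obtain[OF r] by blast
  have "Rel d (n(j := Suc (n j))) (x j \<otimes> r) z" by (rule Rel_shift) (use j r z in auto)
  then show ?thesis using \<Psi>_eq[OF r z(1)] \<Psi>_eq[of "x j \<otimes> r"] r x_carrier[OF j] by simp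
qed

text \<open>Every class of the local cohomology is a fraction, by \<open>Rel_surjective\<close>, so
  an element of \<open>\<omega>\<close> is known once its values on fractions are.\<close>

lemma \<Psi>_ext:
  assumes w: "w \<in> carrier \<omega>" and zero: "\<And>n r. r \<in> carrier R \<Longrightarrow> \<Psi> w n r = \<zero>\<^bsub>E\<^esub>"
  shows "w = \<zero>\<^bsub>\<omega>\<^esub>"
proof -
  have "w u = \<zero>\<^bsub>E\<^esub>" if u: "u \<in> carrier H" for u
  proof -
    obtain z where z: "z \<in> Z d" "u = Q.cl z" using u by (auto simp: H_carrier)
    obtain n r where "r \<in> carrier R" "Rel d n r z" using Rel_surjective[OF _ z(1)] by blast
    then show ?thesis using zero \<Psi>_eq z(2) by metis
  qed
  moreover have "w \<in> extensional (carrier H)" using w GH.carrier_hom by (simp add: \<omega>_def)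
  ultimately show ?thesis
    unfolding \<omega>_def GH.W_zero by (intro GH.W_ext) (simp_all add: restrict_extensional)
qed

lemma \<Psi>_grade:
  assumes w: "w \<in> grade \<omega> i" and r: "r \<in> rgrade R e"
  shows "\<Psi> w n r \<in> grade E (i + e - int (wdeg D d n))"
proof -
  obtain z where z: "z \<in> grade (I d) (e - int (wdeg D d n))" "Rel d n r z"
    using Rel_exists_homogeneous[OF _ r, of d n] by blast
  have rC: "r \<in> carrier R" using r RG.gr_carrier by blast
  have "Q.cl z \<in> grade H (e - int (wdeg D d n))" using z Rel_Z[OF rC z(2)] by (auto simp: H_grade)
  moreover have "w \<in> hom_of_degree R H E i" using w by (simp add: \<omega>_def GH.W_grade)
  ultimately have "w (Q.cl z) \<in> grade E (e - int (wdeg D d n) + i)" unfolding hom_of_degree_def by blast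
  then show ?thesis using \<Psi>_eq[OF rC z(2)] by (simp add: algebra_simps)
qed

section \<open>The socle of the injective envelope\<close>

lemma module_graded_self: "module R (graded_self R)"
proof (rule moduleI[OF cring_axioms])
  show "abelian_group (graded_self R)"
  proof (rule abelian_groupI)
    fix z assume "z \<in> carrier (graded_self R)"
    then have "\<ominus> z \<in> carrier R" "\<ominus> z \<oplus> z = \<zero>" by (auto simp: graded_self_def l_neg)
    then show "\<exists>y\<in>carrier (graded_self R). y \<oplus>\<^bsub>graded_self R\<^esub> z = \<zero>\<^bsub>graded_self R\<^esub>"
      by (auto simp: graded_self_def)
  qed (auto simp: graded_self_def a_ac)
qed (auto simp: graded_self_def l_distr r_distr m_assoc)

end

sublocale canonical_setup \<subseteq> k: module_quotient R "graded_self R" "irrelevant_ideal R"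
proof (intro module_quotient.intro module_quotient_axioms.intro LinearCombinations.submodule.intro module_graded_self)
  interpret m: primeideal \<mm> R by (rule irrelevant_primeideal)
  show "\<mm> \<subseteq> carrier (graded_self R)" using m.a_subset by (simp add: graded_self_def)
  show "\<zero>\<^bsub>graded_self R\<^esub> \<in> \<mm>" by (simp add: graded_self_def)
  show "v \<oplus>\<^bsub>graded_self R\<^esub> w \<in> \<mm>" if "v \<in> \<mm>" "w \<in> \<mm>" for v w
    using additive_subgroup.a_closed[OF m.additive_subgroup_axioms that] by (simp add: graded_self_def)
  show "c \<odot>\<^bsub>graded_self R\<^esub> v \<in> \<mm>" if "c \<in> carrier R" "v \<in> \<mm>" for c v
    using m.I_l_closed[OF that(2,1)] by (simp add: graded_self_def)
qed

context canonical_setup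
begin

text \<open>The generator of the socle of \<open>E\<close>, that is of the embedded residue
  field.\<close>

definition e0 :: 'e where "e0 = \<iota> (k.cl \<one>)"

lemma residue_carrier: "carrier (residue_module R) = k.cl ` carrier R"
  using k.quotient_carrier by (simp add: residue_module_def graded_self_def)

lemma \<iota>_hom: "\<iota> \<in> hom_of_degree R (residue_module R) E 0"
  using envelope by (simp add: graded_injective_envelope_def)

lemma \<iota>_cl:
  assumes s: "s \<in> carrier R"
  shows "\<iota> (k.cl s) = hc 0 s \<odot>\<^bsub>E\<^esub> e0"
proof -
  have "hc 0 (s \<ominus> hc 0 s) = \<zero>"
    using s RG.hcomp_of_gr[OF RG.hcomp_gr[OF s, of 0], of 0]
    by (simp add: a_minus_def RG.hcomp_add RG.hcomp_neg r_neg)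
  then have "s \<ominus> hc 0 s \<in> \<mm>" using s irrelevant_ideal_iff by simp
  moreover have "s \<ominus>\<^bsub>graded_self R\<^esub> hc 0 s = s \<ominus> hc 0 s"
  proof -
    have "\<ominus>\<^bsub>graded_self R\<^esub> (hc 0 s) = \<ominus> hc 0 s"
      using s k.M.minus_equality[of "\<ominus> hc 0 s" "hc 0 s"] by (simp add: graded_self_def l_neg)
    then show ?thesis by (simp add: a_minus_def graded_self_def)
  qed
  ultimately have "k.cl s = k.cl (hc 0 s)" using s by (intro k.cl_eq) (auto simp: graded_self_def)
  also have "\<dots> = hc 0 s \<odot>\<^bsub>residue_module R\<^esub> k.cl \<one>"
    using k.quotient_smult[of \<one> "hc 0 s"] s by (simp add: residue_module_def graded_self_def)
  finally have "\<iota> (k.cl s) = \<iota> (hc 0 s \<odot>\<^bsub>residue_module R\<^esub> k.cl \<one>)" by simp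
  also have "\<dots> = hc 0 s \<odot>\<^bsub>E\<^esub> e0"
    unfolding e0_def using \<iota>_hom s residue_carrier
    by (intro module_hom_smult[of \<iota>]) (auto simp: hom_of_degree_def)
  finally show ?thesis .
qed

lemma e0_grade: "e0 \<in> grade E 0"
proof -
  have "\<one> \<in> grade (graded_self R) 0" using one_K by (simp add: graded_self_def)
  then have "k.cl \<one> \<in> grade (residue_module R) 0"
    unfolding residue_module_def k.quotient_grade by blast
  then have "\<iota> (k.cl \<one>) \<in> grade E (0 + 0)" using \<iota>_hom unfolding hom_of_degree_def by blast
  then show ?thesis by (simp add: e0_def)
qed

lemma e0_closed: "e0 \<in> carrier E"
  using e0_grade E.MG.gr_carrier by blast

text \<open>The graded submodule \<open>R e\<close> meets the embedded residue field, which lives in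
  degree 0. Comparing degree 0 components of a common nonzero element makes the multiplier
  homogeneous.\<close>

lemma essential:
  assumes e: "e \<in> grade E j" "e \<noteq> \<zero>\<^bsub>E\<^esub>"
  obtains r c where "r \<in> rgrade R (- j)" "c \<in> K" "r \<odot>\<^bsub>E\<^esub> e = c \<odot>\<^bsub>E\<^esub> e0" "r \<odot>\<^bsub>E\<^esub> e \<noteq> \<zero>\<^bsub>E\<^esub>"
proof -
  have eC: "e \<in> carrier E" using e E.MG.gr_carrier by blast
  define U where "U = {r \<odot>\<^bsub>E\<^esub> e | r. r \<in> carrier R}"
  have "LinearCombinations.submodule R U E"
  proof (rule LinearCombinations.submodule.intro[OF E.module_axioms])
    show "U \<subseteq> carrier E" using eC by (auto simp: U_def)
    have "\<zero>\<^bsub>E\<^esub> = \<zero> \<odot>\<^bsub>E\<^esub> e" using eC by simp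
    then show "\<zero>\<^bsub>E\<^esub> \<in> U" unfolding U_def by blast
    fix v w assume "v \<in> U" "w \<in> U"
    then obtain r s where rs: "v = r \<odot>\<^bsub>E\<^esub> e" "w = s \<odot>\<^bsub>E\<^esub> e" "r \<in> carrier R" "s \<in> carrier R" by (auto simp: U_def)
    then have "v \<oplus>\<^bsub>E\<^esub> w = (r \<oplus> s) \<odot>\<^bsub>E\<^esub> e" using eC by (simp add: E.smult_l_distr)
    then show "v \<oplus>\<^bsub>E\<^esub> w \<in> U" using rs unfolding U_def by blast
  next
    fix c v assume c: "c \<in> carrier R" and "v \<in> U"
    then obtain r where r: "v = r \<odot>\<^bsub>E\<^esub> e" "r \<in> carrier R" by (auto simp: U_def)
    then have "c \<odot>\<^bsub>E\<^esub> v = (c \<otimes> r) \<odot>\<^bsub>E\<^esub> e" using c eC by (simp add: E.smult_assoc1)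
    then show "c \<odot>\<^bsub>E\<^esub> v \<in> U" using c r unfolding U_def by blast
  qed
  moreover have "f i \<in> U" if v: "v \<in> U" and f: "homogeneous_decomposition E (grade E) f v" for v f i
  proof -
    obtain r where r: "v = r \<odot>\<^bsub>E\<^esub> e" "r \<in> carrier R" using v by (auto simp: U_def)
    have "f i = hcomp E (grade E) i v" using E.MG.decomposition_unique[OF _ f] r eC by simp
    also have "\<dots> = hc (i - j) r \<odot>\<^bsub>E\<^esub> e"
      using E.hcomp_smult_element[OF RG.graded_group_axioms r(2) e(1), of "i - j"] r by simp
    finally show ?thesis using r by (auto simp: U_def)
  qed
  ultimately have "graded_submodule R U E" by (auto simp: graded_submodule_def)
  moreover have "e \<in> U" using eC by (auto simp: U_def intro!: exI[of _ \<one>])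
  then have "U \<noteq> {\<zero>\<^bsub>E\<^esub>}" using e by auto
  ultimately have ne: "U \<inter> \<iota> ` carrier (residue_module R) \<noteq> {\<zero>\<^bsub>E\<^esub>}"
    using envelope by (simp add: graded_injective_envelope_def)
  have "\<iota> (k.cl \<zero>) = \<zero>\<^bsub>E\<^esub>" using \<iota>_cl[of \<zero>] e0_closed by simp
  then have "\<zero>\<^bsub>E\<^esub> \<in> \<iota> ` carrier (residue_module R)" unfolding residue_carrier by (metis imageI zero_closed)
  moreover have "\<zero>\<^bsub>E\<^esub> = \<zero> \<odot>\<^bsub>E\<^esub> e" using eC by simp
  then have "\<zero>\<^bsub>E\<^esub> \<in> U" unfolding U_def by blast
  ultimately obtain v where v: "v \<in> U" "v \<in> \<iota> ` carrier (residue_module R)" "v \<noteq> \<zero>\<^bsub>E\<^esub>" using ne by blast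
  obtain r where r: "v = r \<odot>\<^bsub>E\<^esub> e" "r \<in> carrier R" using v by (auto simp: U_def)
  obtain s where s: "v = hc 0 s \<odot>\<^bsub>E\<^esub> e0" "s \<in> carrier R" using v(2) \<iota>_cl unfolding residue_carrier by auto
  have vg: "v \<in> grade E 0" unfolding s(1) using E.smult_degree[OF RG.hcomp_gr[OF s(2), of 0] e0_grade] by simp
  have "v = hcomp E (grade E) 0 v" using E.MG.hcomp_of_gr[OF vg] by simp
  also have "\<dots> = hc (- j) r \<odot>\<^bsub>E\<^esub> e"
    using E.hcomp_smult_element[OF RG.graded_group_axioms r(2) e(1), of "- j"] r(1) by simp
  finally have ve: "v = hc (- j) r \<odot>\<^bsub>E\<^esub> e" .
  show thesis
    using that[OF RG.hcomp_gr[OF r(2)] RG.hcomp_gr[OF s(2)]] ve s(1) v(3) by simp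
qed

text \<open>In degree 0 the multiplier given by \<open>essential\<close> is a nonzero constant and
  can be inverted. Thus the degree 0 part of \<open>E\<close> is a line, and values of
  \<open>\<omega>\<close> in it become scalars.\<close>

lemma E_grade_zero:
  assumes "e \<in> grade E 0"
  obtains c where "c \<in> K" "e = c \<odot>\<^bsub>E\<^esub> e0"
proof (cases "e = \<zero>\<^bsub>E\<^esub>")
  case True
  then show ?thesis using that[of \<zero>] e0_closed zero_K by simp
next
  case False
  obtain r c where r: "r \<in> rgrade R (- 0)" "c \<in> K" "r \<odot>\<^bsub>E\<^esub> e = c \<odot>\<^bsub>E\<^esub> e0" "r \<odot>\<^bsub>E\<^esub> e \<noteq> \<zero>\<^bsub>E\<^esub>"
    using essential[OF assms False] by blast
  have eC: "e \<in> carrier E" using assms E.MG.gr_carrier by blast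
  have rK: "r \<in> K" using r by simp
  have "r \<noteq> \<zero>" using r(4) eC by auto
  then obtain s where s: "s \<in> K" "r \<otimes> s = \<one>" using inverse_K rK by blast
  have C: "r \<in> carrier R" "s \<in> carrier R" "c \<in> carrier R" using rK s r K_carrier by auto
  have "e = (s \<otimes> r) \<odot>\<^bsub>E\<^esub> e" using s eC C by (simp add: m_comm)
  also have "\<dots> = (s \<otimes> c) \<odot>\<^bsub>E\<^esub> e0" using C eC e0_closed r(3) by (simp add: E.smult_assoc1)
  finally show ?thesis using that[of "s \<otimes> c"] s r mult_K by blast
qed

text \<open>A nonzero value can be multiplied into the socle, and the multiplier can be absorbed by
  the numerator. So only fractions with values in degree 0 of \<open>E\<close> have to be tested,
  and numerators of negative degree are zero.\<close>

lemma \<Psi>_determines: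
  assumes w: "w \<in> grade \<omega> i"
    and zero: "\<And>n r e. \<lbrakk>r \<in> rgrade R (int e); i + int e = int (wdeg D d n)\<rbrakk> \<Longrightarrow> \<Psi> w n r = \<zero>\<^bsub>E\<^esub>"
  shows "w = \<zero>\<^bsub>\<omega>\<^esub>"
proof (rule \<Psi>_ext)
  show wC: "w \<in> carrier \<omega>" using w \<omega>_grade_carrier by blast
  have hom: "\<Psi> w n r = \<zero>\<^bsub>E\<^esub>" if r: "r \<in> rgrade R e" for n r e
  proof (rule ccontr)
    assume ne: "\<Psi> w n r \<noteq> \<zero>\<^bsub>E\<^esub>"
    let ?j = "i + e - int (wdeg D d n)"
    obtain s c where s: "s \<in> rgrade R (- ?j)" "s \<odot>\<^bsub>E\<^esub> \<Psi> w n r \<noteq> \<zero>\<^bsub>E\<^esub>"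
      using essential[OF \<Psi>_grade[OF w r] ne] by metis
    have C: "r \<in> carrier R" "s \<in> carrier R" using r s RG.gr_carrier by auto
    have ne': "\<Psi> w n (s \<otimes> r) \<noteq> \<zero>\<^bsub>E\<^esub>" using \<Psi>_mult[OF wC C] s(2) by simp
    have sr: "s \<otimes> r \<in> rgrade R (- ?j + e)" using mult_degree[OF s(1) r] .
    have "0 \<le> - ?j + e"
    proof (rule ccontr)
      assume "\<not> 0 \<le> - ?j + e"
      then have "s \<otimes> r = \<zero>" using sr negative_degree[of "- ?j + e"] by auto
      then show False using ne' \<Psi>_zero[OF wC] by simp
    qed
    then show False using zero[of "s \<otimes> r" "nat (- ?j + e)" n] sr ne' by simp
  qed
  fix n r assume r: "r \<in> carrier R"
  show "\<Psi> w n r = \<zero>\<^bsub>E\<^esub>"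
    using r
  proof (induction rule: RG.graded_induct)
    case zero
    then show ?case using \<Psi>_zero[OF wC] by simp
  next
    case (add l y)
    then show ?case using \<Psi>_add[OF wC] hom[OF RG.hcomp_gr[OF r]] r by simp
  qed
qed

section \<open>Homogeneous polynomials in the parameters act injectively\<close>

lemma mon_x_closed: "mon x d b \<in> carrier R"
  using mon_closed x_carrier by blast

text \<open>A monomial cancels against the denominator one variable at a time, and the fraction dies
  once an exponent would become negative: the action of polynomials on inverse polynomials.\<close>

lemma \<Psi>_mon:
  assumes w: "w \<in> carrier \<omega>" and r: "r \<in> carrier R"
  shows "\<Psi> w n (mon x d b \<otimes> r) = (if \<forall>j<d. b j \<le> n j then \<Psi> w (\<lambda>j. n j - b j) r else \<zero>\<^bsub>E\<^esub>)"
proof -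
  have "\<Psi> w n (mon x d b \<otimes> r) = (if \<forall>j<d. b j \<le> n j then \<Psi> w (\<lambda>j. n j - b j) r else \<zero>\<^bsub>E\<^esub>)"
    if "(\<Sum>j<d. b j) = k" for k
    using that
  proof (induction k arbitrary: b n)
    case 0
    then have b0: "\<And>j. j < d \<Longrightarrow> b j = 0" by simp
    then have "mon x d b = \<one>" using mon_cong[of d b "\<lambda>_. 0" x] mon_zero by simp
    moreover have "\<Psi> w n r = \<Psi> w (\<lambda>j. n j - b j) r" using b0 by (intro \<Psi>_cong[OF r]) simp
    ultimately show ?case using b0 r by simp
  next
    case (Suc k)
    then obtain j where j: "j < d" "b j \<noteq> 0" by (metis lessThan_iff sum.neutral nat.distinct(1))
    define b' where "b' = b(j := b j - 1)"
    have bb: "b = b'(j := Suc (b' j))" using j by (auto simp: b'_def)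
    have sum: "(\<Sum>i<d. b' i) = k"
    proof -
      have "(\<Sum>i<d. b i) = b j + (\<Sum>i\<in>{..<d} - {j}. b i)" using j by (intro sum.remove) auto
      moreover have "(\<Sum>i<d. b' i) = b' j + (\<Sum>i\<in>{..<d} - {j}. b' i)" using j by (intro sum.remove) auto
      moreover have "(\<Sum>i\<in>{..<d} - {j}. b' i) = (\<Sum>i\<in>{..<d} - {j}. b i)" by (intro sum.cong) (auto simp: b'_def)
      ultimately show ?thesis using Suc.prems j by (simp add: b'_def)
    qed
    have m: "mon x d b = x j \<otimes> mon x d b'"
      unfolding bb by (subst mon_upd[OF x_carrier j(1)]) (auto simp: b'_def)
    have rC: "mon x d b' \<otimes> r \<in> carrier R" using mon_x_closed r by simp
    have e: "mon x d b \<otimes> r = x j \<otimes> (mon x d b' \<otimes> r)"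
      unfolding m using mon_x_closed x_carrier[OF j(1)] r by (simp add: m_assoc)
    show ?case
    proof (cases "n j")
      case 0
      then have "\<Psi> w n (mon x d b \<otimes> r) = \<zero>\<^bsub>E\<^esub>"
        using \<Psi>_vanish[OF w _ j(1)] mon_x_closed r by simp
      then show ?thesis using 0 j by auto
    next
      case (Suc l)
      define n' where "n' = n(j := l)"
      have nn: "n = n'(j := Suc (n' j))" using Suc by (auto simp: n'_def)
      have "\<Psi> w n (mon x d b \<otimes> r) = \<Psi> w n' (mon x d b' \<otimes> r)"
        unfolding e by (subst nn) (rule \<Psi>_shift[OF rC j(1)])
      also have "\<dots> = (if \<forall>i<d. b' i \<le> n' i then \<Psi> w (\<lambda>i. n' i - b' i) r else \<zero>\<^bsub>E\<^esub>)"
        by (rule Suc.IH[OF sum])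
      also have "(\<lambda>i. n' i - b' i) = (\<lambda>i. n i - b i)"
        using Suc j by (auto simp: n'_def b'_def fun_eq_iff)
      also have "(\<forall>i<d. b' i \<le> n' i) \<longleftrightarrow> (\<forall>i<d. b i \<le> n i)"
      proof (intro iff_allI imp_cong refl)
        fix i show "b' i \<le> n' i \<longleftrightarrow> b i \<le> n i"
          using Suc j by (cases "i = j") (auto simp: n'_def b'_def)
      qed
      finally show ?thesis .
    qed
  qed
  then show ?thesis by blast
qed

end

text \<open>Weights \<open>L\<^sup>j\<close> with large \<open>L\<close> separate the exponents occurring in a polynomial, which replaces a
  monomial order.\<close>

lemma wdeg_Suc: "wdeg D (Suc t) b = wdeg D t b + b t * D t"
  by (simp add: wdeg_def)

lemma wdeg_base_less: "(\<And>j. j < t \<Longrightarrow> b j < L) \<Longrightarrow> wdeg (\<lambda>j. L ^ j) t b < L ^ t"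
proof (induction t)
  case (Suc t)
  then have "wdeg (\<lambda>j. L ^ j) t b + b t * L ^ t < L ^ t + b t * L ^ t" by simp
  also have "\<dots> = Suc (b t) * L ^ t" by simp
  also have "\<dots> \<le> L * L ^ t" using Suc.prems[of t] by (intro mult_right_mono) auto
  finally show ?case by (simp add: wdeg_Suc)
qed (simp add: wdeg_def)

lemma wdeg_base_inj:
  assumes "\<And>j. j < t \<Longrightarrow> b j < L" "\<And>j. j < t \<Longrightarrow> b' j < L"
    "wdeg (\<lambda>j. L ^ j) t b = wdeg (\<lambda>j. L ^ j) t b'" "j < t"
  shows "b j = b' j"
  using assms
proof (induction t)
  case (Suc t)
  have less: "wdeg (\<lambda>j. L ^ j) t b < L ^ t" "wdeg (\<lambda>j. L ^ j) t b' < L ^ t"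
    using Suc.prems by (intro wdeg_base_less; simp)+
  have eq: "wdeg (\<lambda>j. L ^ j) t b + b t * L ^ t = wdeg (\<lambda>j. L ^ j) t b' + b' t * L ^ t"
    using Suc.prems(3) by (simp add: wdeg_Suc)
  have "L ^ t \<noteq> 0" using less(1) by linarith
  then have "b t = (wdeg (\<lambda>j. L ^ j) t b + b t * L ^ t) div L ^ t" using less by simp
  also have "\<dots> = b' t" unfolding eq using less \<open>L ^ t \<noteq> 0\<close> by simp
  finally have bt: "b t = b' t" .
  then have "wdeg (\<lambda>j. L ^ j) t b = wdeg (\<lambda>j. L ^ j) t b'" using eq by simp
  then show ?case using Suc bt by (cases "j = t") auto
qed simp

context canonical_setup
begin

text \<open>Let \<open>\<beta>\<close> be the lightest exponent with nonzero coefficient. The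
  vanishing at \<open>n + \<beta>\<close> expresses \<open>c \<beta>\<close> times the value at
  \<open>n\<close> through the values at \<open>n + \<beta> - b\<close>, which are lighter than
  \<open>n\<close> and have the same degree because the polynomial is homogeneous. Hence induction
  on the weight of \<open>n\<close>.\<close>

lemma recurrence:
  assumes w: "w \<in> carrier \<omega>" and r: "r \<in> carrier R"
    and S: "finite S" "S \<subseteq> exps d" "\<And>b. b \<in> S \<Longrightarrow> wdeg D d b = p"
    and c: "\<And>b. b \<in> S \<Longrightarrow> c b \<in> K" "\<exists>b\<in>S. c b \<noteq> \<zero>"
    and zero: "\<And>n. wdeg D d n = q + p \<Longrightarrow> \<Psi> w n ((\<Oplus>b\<in>S. c b \<otimes> mon x d b) \<otimes> r) = \<zero>\<^bsub>E\<^esub>"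
    and n: "wdeg D d n = q"
  shows "\<Psi> w n r = \<zero>\<^bsub>E\<^esub>"
proof -
  have cC: "c b \<in> carrier R" if "b \<in> S" for b using c(1)[OF that] K_carrier by blast
  define S' where "S' = {b \<in> S. c b \<noteq> \<zero>}"
  have S': "finite S'" "S' \<noteq> {}" "S' \<subseteq> S" using S c(2) by (auto simp: S'_def)
  \<comment> \<open>Larger than every exponent occurring in \<open>S\<close>, so that exponent
    vectors are digit sequences in base \<open>L\<close> and their weights are distinct.\<close>
  define L where "L = (\<Sum>b\<in>S. \<Sum>j<d. b j) + 1"
  have bL: "b j < L" if "b \<in> S" "j < d" for b j
  proof -
    have "b j \<le> (\<Sum>j<d. b j)" using that by (intro member_le_sum) auto
    also have "\<dots> \<le> (\<Sum>b\<in>S. \<Sum>j<d. b j)" using that S by (intro member_le_sum) auto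
    finally show ?thesis by (simp add: L_def)
  qed
  define wt where "wt = wdeg (\<lambda>j. L ^ j) d"
  obtain \<beta> where \<beta>: "\<beta> \<in> S'" "\<And>b. b \<in> S' \<Longrightarrow> wt \<beta> \<le> wt b"
    using S' ex_min_if_finite[of "wt ` S'"] by (metis (no_types, lifting) finite_imageI image_iff image_is_empty not_le)
  have wt_less: "wt \<beta> < wt b" if "b \<in> S'" "b \<noteq> \<beta>" for b
  proof (rule ccontr)
    assume "\<not> wt \<beta> < wt b"
    then have "wt b = wt \<beta>" using \<beta>(2)[OF that(1)] by simp
    then have "b j = \<beta> j" if "j < d" for j
      using wdeg_base_inj[of d b L \<beta> j] bL \<beta>(1) \<open>b \<in> S'\<close> S' that by (auto simp: wt_def)
    moreover have "b j = \<beta> j" if "\<not> j < d" for j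
    proof -
      have "b \<in> exps d" "\<beta> \<in> exps d" using \<open>b \<in> S'\<close> \<beta>(1) S'(3) S(2) by blast+
      then show ?thesis using that by (simp add: exps_def)
    qed
    ultimately show False using \<open>b \<noteq> \<beta>\<close> by blast
  qed
  show ?thesis
    using n
  proof (induction "wt n" arbitrary: n rule: less_induct)
    case less
    define m where "m = (\<lambda>j. n j + \<beta> j)"
    have \<beta>S: "\<beta> \<in> S" using \<beta>(1) S'(3) by blast
    have wm: "wdeg D d m = q + p"
      using wdeg_add[of D d n \<beta>] less.prems S(3)[OF \<beta>S] by (simp add: m_def)
    define t where "t b = \<Psi> w m (mon x d b \<otimes> r)" for b
    have tC: "t b \<in> carrier E" for b unfolding t_def using \<Psi>_closed[OF w] mon_x_closed r by simp
    have t0: "t b = \<zero>\<^bsub>E\<^esub>" if b: "b \<in> S'" "b \<noteq> \<beta>" for b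
    proof (cases "\<forall>j<d. b j \<le> m j")
      case True
      have add: "wdeg D' d (\<lambda>j. m j - b j) + wdeg D' d b = wdeg D' d n + wdeg D' d \<beta>" for D'
      proof -
        have "wdeg D' d (\<lambda>j. m j - b j) + wdeg D' d b = wdeg D' d m"
          unfolding wdeg_add[symmetric] using True by (auto simp: wdeg_def intro!: sum.cong)
        then show ?thesis using wdeg_add[of D' d n \<beta>] by (simp add: m_def)
      qed
      have "wdeg D d b = p" "wdeg D d \<beta> = p" using S(3) subsetD[OF S'(3) b(1)] \<beta>S by auto
      then have "wdeg D d (\<lambda>j. m j - b j) = q" using add[of D] less.prems by simp
      moreover have "wt (\<lambda>j. m j - b j) < wt n" using add[of "\<lambda>j. L ^ j"] wt_less[OF b] by (simp add: wt_def)
      ultimately have "\<Psi> w (\<lambda>j. m j - b j) r = \<zero>\<^bsub>E\<^esub>" using less.hyps by blast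
      then show ?thesis unfolding t_def using \<Psi>_mon[OF w r, of m b] by simp
    next
      case False
      then show ?thesis unfolding t_def \<Psi>_mon[OF w r, of m b] by (simp only: if_False)
    qed
    have t\<beta>: "t \<beta> = \<Psi> w n r"
      unfolding t_def using \<Psi>_mon[OF w r, of m \<beta>] by (simp add: m_def)
    have "(\<Oplus>b\<in>S. c b \<otimes> mon x d b) \<otimes> r = (\<Oplus>b\<in>S. c b \<otimes> mon x d b \<otimes> r)"
      using S(1) r cC mon_x_closed by (intro finsum_ldistr) auto
    then have "\<zero>\<^bsub>E\<^esub> = \<Psi> w m (\<Oplus>b\<in>S. c b \<otimes> mon x d b \<otimes> r)" using zero[OF wm] by simp
    also have "\<dots> = (\<Oplus>\<^bsub>E\<^esub>b\<in>S. \<Psi> w m (c b \<otimes> mon x d b \<otimes> r))"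
      using S(1) r cC mon_x_closed by (intro \<Psi>_finsum[OF w]) auto
    also have "\<dots> = (\<Oplus>\<^bsub>E\<^esub>b\<in>S. if \<beta> = b then c b \<odot>\<^bsub>E\<^esub> t b else \<zero>\<^bsub>E\<^esub>)"
    proof (rule E.M.finsum_cong')
      fix b assume b: "b \<in> S"
      have "\<Psi> w m (c b \<otimes> mon x d b \<otimes> r) = c b \<odot>\<^bsub>E\<^esub> t b"
        unfolding t_def using cC[OF b] r mon_x_closed[of b] \<Psi>_mult[OF w, of "mon x d b \<otimes> r" "c b" m]
        by (simp add: m_assoc)
      moreover have "c b \<odot>\<^bsub>E\<^esub> t b = \<zero>\<^bsub>E\<^esub>" if "\<beta> \<noteq> b"
        using t0[of b] that tC[of b] b cC[OF b] by (cases "c b = \<zero>") (auto simp: S'_def)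
      ultimately show "\<Psi> w m (c b \<otimes> mon x d b \<otimes> r) = (if \<beta> = b then c b \<odot>\<^bsub>E\<^esub> t b else \<zero>\<^bsub>E\<^esub>)" by simp
    qed (use cC tC in auto)
    also have "\<dots> = c \<beta> \<odot>\<^bsub>E\<^esub> t \<beta>"
      using \<beta>S S(1) cC tC by (intro E.M.add.finprod_singleton) auto
    finally have ct: "c \<beta> \<odot>\<^bsub>E\<^esub> t \<beta> = \<zero>\<^bsub>E\<^esub>" by simp
    have "\<beta> \<in> S" "c \<beta> \<noteq> \<zero>" using \<beta>(1) unfolding S'_def by blast+
    then obtain s where s: "s \<in> K" "c \<beta> \<otimes> s = \<one>" using inverse_K c(1) by blast
    have sC: "s \<in> carrier R" "c \<beta> \<in> carrier R" using s K_carrier cC \<open>\<beta> \<in> S\<close> by auto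
    have "t \<beta> = (s \<otimes> c \<beta>) \<odot>\<^bsub>E\<^esub> t \<beta>" using s(2) sC tC by (simp add: m_comm)
    also have "\<dots> = s \<odot>\<^bsub>E\<^esub> (c \<beta> \<odot>\<^bsub>E\<^esub> t \<beta>)" using sC tC by (intro E.smult_assoc1) auto
    also have "\<dots> = \<zero>\<^bsub>E\<^esub>" using ct sC by simp
    finally show ?case using t\<beta> by simp
  qed
qed

text \<open>A nonzero homogeneous polynomial evaluated at the parameters; nonzero refers to its
  coefficients and not to its value in \<open>R\<close>.\<close>

definition hpoly :: "'a \<Rightarrow> bool" where
  "hpoly P \<longleftrightarrow> (\<exists>p c. (\<forall>b\<in>{b \<in> exps d. wdeg D d b = p}. c b \<in> K) \<and>
     (\<exists>b\<in>{b \<in> exps d. wdeg D d b = p}. c b \<noteq> \<zero>) \<and>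
     P = (\<Oplus>b\<in>{b \<in> exps d. wdeg D d b = p}. c b \<otimes> mon x d b))"

lemma finite_degree: "finite {b \<in> exps d. wdeg D d b = p}"
  by (rule finite_wdeg(2)[OF hsys_pos[OF system]])

lemma hpoly_closed: "hpoly P \<Longrightarrow> P \<in> carrier R"
  using mon_x_closed K_carrier by (auto simp: hpoly_def intro!: finsum_closed)

lemma hpoly_injective:
  assumes P: "hpoly P" and w: "w \<in> carrier \<omega>" and zero: "P \<odot>\<^bsub>\<omega>\<^esub> w = \<zero>\<^bsub>\<omega>\<^esub>"
  shows "w = \<zero>\<^bsub>\<omega>\<^esub>"
proof (rule \<Psi>_ext[OF w])
  fix n r assume r: "r \<in> carrier R"
  obtain p c where c: "\<And>b. b \<in> {b \<in> exps d. wdeg D d b = p} \<Longrightarrow> c b \<in> K"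
     "\<exists>b\<in>{b \<in> exps d. wdeg D d b = p}. c b \<noteq> \<zero>"
     "P = (\<Oplus>b\<in>{b \<in> exps d. wdeg D d b = p}. c b \<otimes> mon x d b)"
    using P unfolding hpoly_def by auto
  have PC: "P \<in> carrier R" using hpoly_closed[OF P] .
  have "\<Psi> w m (P \<otimes> r) = \<zero>\<^bsub>E\<^esub>" for m
  proof -
    have "\<Psi> w m (P \<otimes> r) = \<Psi> \<zero>\<^bsub>\<omega>\<^esub> m r" using \<Psi>_smult[OF w r PC, of m] zero by simp
    also have "\<zero>\<^bsub>\<omega>\<^esub> = \<zero> \<odot>\<^bsub>\<omega>\<^esub> w" using w by simp
    also have "\<Psi> (\<zero> \<odot>\<^bsub>\<omega>\<^esub> w) m r = \<zero>\<^bsub>E\<^esub>" using \<Psi>_smult[OF w r zero_closed, of m] \<Psi>_zero[OF w] r by simp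
    finally show ?thesis .
  qed
  then show "\<Psi> w n r = \<zero>\<^bsub>E\<^esub>"
    using c(3) by (intro recurrence[OF w r finite_degree _ _ c(1,2), where q = "wdeg D d n"]) auto
qed

end

section \<open>The rank of the canonical module\<close>

text \<open>Summing over the window \<open>{- C..M}\<close> absorbs any shift by at most
  \<open>C\<close> at the price of a longer range; the companion lemma pays with a shorter range
  instead.\<close>

lemma sum_int_shift_upper:
  fixes N :: "int \<Rightarrow> nat"
  assumes neg: "\<And>e. e < 0 \<Longrightarrow> N e = 0" and a: "\<bar>a\<bar> \<le> C"
  shows "(\<Sum>i\<in>{- C..M}. N (i - a)) \<le> (\<Sum>e\<in>{0..M + C}. N e)"
proof -
  have "(\<Sum>i\<in>{- C..M}. N (i - a)) = (\<Sum>e\<in>(\<lambda>i. i - a) ` {- C..M}. N e)"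
    by (subst sum.reindex) (auto simp: inj_on_def)
  also have "\<dots> = (\<Sum>e\<in>(\<lambda>i. i - a) ` {- C..M} \<inter> {0..}. N e)"
    using neg by (intro sum.mono_neutral_right) (auto simp: not_le)
  also have "\<dots> \<le> (\<Sum>e\<in>{0..M + C}. N e)" using a by (intro sum_mono2) auto
  finally show ?thesis .
qed

lemma sum_int_shift_lower:
  fixes N :: "int \<Rightarrow> nat"
  assumes a: "\<bar>a\<bar> \<le> C"
  shows "(\<Sum>e\<in>{0..M - C}. N e) \<le> (\<Sum>i\<in>{- C..M}. N (i - a))"
proof -
  have "(\<Sum>i\<in>{- C..M}. N (i - a)) = (\<Sum>e\<in>(\<lambda>i. i - a) ` {- C..M}. N e)"
    by (subst sum.reindex) (auto simp: inj_on_def)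
  moreover have "{0..M - C} \<subseteq> (\<lambda>i. i - a) ` {- C..M}"
  proof
    fix e assume "e \<in> {0..M - C}"
    then have "e = (e + a) - a" "e + a \<in> {- C..M}" using a by auto
    then show "e \<in> (\<lambda>i. i - a) ` {- C..M}" by blast
  qed
  ultimately show ?thesis by (simp add: sum_mono2)
qed

text \<open>A nonzero function of polynomial growth cannot satisfy \<open>(\<rho> + 1) S(M - C) \<le> \<rho> S(M + C)\<close> for all
  \<open>M\<close>.\<close>

lemma growth:
  fixes N :: "int \<Rightarrow> nat" and \<alpha> \<beta> :: "'g \<Rightarrow> int" and \<gamma> :: int
  assumes neg: "\<And>e. e < 0 \<Longrightarrow> N e = 0" and pos: "0 < N 0"
    and poly: "\<And>M::nat. (\<Sum>e\<in>{0..int M}. N e) \<le> (M + 1) ^ d" and G: "finite G"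
  shows "\<exists>i. (\<Sum>g\<in>G. N (i - \<beta> g)) < (\<Sum>g\<in>G. N (i - \<alpha> g)) + N (i - \<gamma>)"
proof (rule ccontr)
  assume "\<not> ?thesis"
  then have le: "(\<Sum>g\<in>G. N (i - \<alpha> g)) + N (i - \<gamma>) \<le> (\<Sum>g\<in>G. N (i - \<beta> g))" for i
    by (auto simp: not_less)
  \<comment> \<open>A common bound for all shifts that occur.\<close>
  define C where "C = \<bar>\<gamma>\<bar> + (\<Sum>g\<in>G. \<bar>\<alpha> g\<bar>) + (\<Sum>g\<in>G. \<bar>\<beta> g\<bar>)"
  have nonneg: "0 \<le> (\<Sum>g\<in>G. \<bar>\<alpha> g\<bar>)" "0 \<le> (\<Sum>g\<in>G. \<bar>\<beta> g\<bar>)" by (auto intro: sum_nonneg)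
  have \<alpha>: "\<bar>\<alpha> g\<bar> \<le> C" if "g \<in> G" for g
  proof -
    have "\<bar>\<alpha> g\<bar> \<le> (\<Sum>g\<in>G. \<bar>\<alpha> g\<bar>)" using that G by (intro member_le_sum) auto
    then show ?thesis using nonneg unfolding C_def by linarith
  qed
  have \<beta>: "\<bar>\<beta> g\<bar> \<le> C" if "g \<in> G" for g
  proof -
    have "\<bar>\<beta> g\<bar> \<le> (\<Sum>g\<in>G. \<bar>\<beta> g\<bar>)" using that G by (intro member_le_sum) auto
    then show ?thesis using nonneg unfolding C_def by linarith
  qed
  have \<gamma>: "\<bar>\<gamma>\<bar> \<le> C" using nonneg unfolding C_def by linarith
  have C: "0 \<le> C" using \<gamma> by linarith
  define S where "S M = (\<Sum>e\<in>{0..M}. N e)" for M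
  define \<rho> where "\<rho> = card G"
  have step: "(\<rho> + 1) * S (M - C) \<le> \<rho> * S (M + C)" for M
  proof -
    have "(\<rho> + 1) * S (M - C) = (\<Sum>g\<in>G. S (M - C)) + S (M - C)" by (simp add: \<rho>_def)
    also have "\<dots> \<le> (\<Sum>g\<in>G. \<Sum>i\<in>{- C..M}. N (i - \<alpha> g)) + (\<Sum>i\<in>{- C..M}. N (i - \<gamma>))"
      unfolding S_def using \<alpha> \<gamma> by (intro add_mono sum_mono sum_int_shift_lower)
    also have "\<dots> = (\<Sum>i\<in>{- C..M}. (\<Sum>g\<in>G. N (i - \<alpha> g)) + N (i - \<gamma>))"
      by (simp add: sum.distrib sum.swap[of _ G])
    also have "\<dots> \<le> (\<Sum>i\<in>{- C..M}. \<Sum>g\<in>G. N (i - \<beta> g))" by (intro sum_mono le)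
    also have "\<dots> = (\<Sum>g\<in>G. \<Sum>i\<in>{- C..M}. N (i - \<beta> g))" by (rule sum.swap)
    also have "\<dots> \<le> (\<Sum>g\<in>G. S (M + C))"
      unfolding S_def using \<beta> neg by (intro sum_mono sum_int_shift_upper)
    finally show ?thesis by (simp add: \<rho>_def)
  qed
  \<comment> \<open>\<open>step\<close> at \<open>M = 2 C k + C\<close> passes from
    \<open>S (2 C k)\<close> to \<open>S (2 C (k + 1))\<close> and gains the factor
    \<open>(\<rho> + 1) / \<rho>\<close> each time.\<close>
  have grow: "(\<rho> + 1) ^ k \<le> \<rho> ^ k * S (2 * C * int k)" for k
  proof (induction k)
    case 0
    then show ?case using pos by (simp add: S_def)
  next
    case (Suc k)
    have "(\<rho> + 1) ^ Suc k \<le> (\<rho> + 1) * (\<rho> ^ k * S (2 * C * int k))"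
      by (simp only: power_Suc) (rule mult_le_mono2[OF Suc])
    also have "\<dots> = \<rho> ^ k * ((\<rho> + 1) * S (2 * C * int k))" by (simp add: algebra_simps)
    also have "\<dots> \<le> \<rho> ^ k * (\<rho> * S (2 * C * int (Suc k)))"
      using step[of "2 * C * int k + C"] by (intro mult_left_mono) (simp_all add: algebra_simps)
    finally show ?case by (simp add: algebra_simps)
  qed
  have bound: "(\<rho> + 1) ^ k \<le> \<rho> ^ k * (2 * nat C * k + 1) ^ d" for k
  proof -
    have "2 * C * int k = int (2 * nat C * k)" using C by simp
    then have "S (2 * C * int k) \<le> (2 * nat C * k + 1) ^ d"
      using poly[of "2 * nat C * k"] unfolding S_def by (simp only:)
    then show ?thesis using grow[of k] by (meson le_trans mult_le_mono2)
  qed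
  have "\<rho> \<noteq> 0"
  proof
    assume "\<rho> = 0"
    then show False using bound[of 1] by simp
  qed
  define q where "q = (real \<rho> + 1) / real \<rho>"
  have q: "1 < q" using \<open>\<rho> \<noteq> 0\<close> by (simp add: q_def field_simps)
  have "q ^ k \<le> real ((2 * nat C * k + 1) ^ d)" for k
  proof -
    have "real ((\<rho> + 1) ^ k) \<le> real (\<rho> ^ k * (2 * nat C * k + 1) ^ d)" using bound by (simp only: of_nat_le_iff)
    then show ?thesis using \<open>\<rho> \<noteq> 0\<close> by (simp add: q_def power_divide field_simps)
  qed
  moreover have "\<exists>k. real ((2 * nat C * k + 1) ^ d) < q ^ k"
  proof (cases "d = 0")
    case True
    then show ?thesis using q by (intro exI[of _ 1]) simp
  next
    case False
    \<comment> \<open>Taking the \<open>d\<close>-th root reduces the comparison of a polynomial of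
      degree \<open>d\<close> with \<open>q^k\<close> to that of a linear function with
      \<open>p^k\<close>.\<close>
    define p where "p = root d q"
    define c where "c = real (2 * nat C)"
    have p: "1 < p" "p ^ d = q" using q False by (auto simp: p_def)
    have "(\<lambda>k. c * (real k / p ^ k) + (1 / p) ^ k) \<longlonglongrightarrow> c * 0 + 0"
      using p by (intro tendsto_intros lim_n_over_pown LIMSEQ_realpow_zero) auto
    then have "\<forall>\<^sub>F k in sequentially. c * (real k / p ^ k) + (1 / p) ^ k < 1"
      by (rule order_tendstoD(2)) simp
    then obtain k where "c * (real k / p ^ k) + (1 / p) ^ k < 1" by (auto simp: eventually_sequentially)
    then have "c * real k + 1 < p ^ k" using p by (simp add: power_divide field_simps)
    then have "(c * real k + 1) ^ d < (p ^ k) ^ d"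
      using False by (intro power_strict_mono) (auto simp: c_def)
    also have "\<dots> = q ^ k" using p(2) by (metis power_mult mult.commute)
    finally show ?thesis by (intro exI[of _ k]) (simp add: c_def add.commute)
  qed
  ultimately show False using not_less by blast
qed

lemma wdeg_diff:
  assumes "\<forall>j<t. b j \<le> m j"
  shows "wdeg D t (\<lambda>j. m j - b j) + wdeg D t b = wdeg D t m"
  unfolding wdeg_add[symmetric] using assms by (auto simp: wdeg_def intro!: sum.cong)

lemma (in module) finsum_smult_element:
  assumes "finite A" "\<And>a. a \<in> A \<Longrightarrow> f a \<in> carrier R" "u \<in> carrier M"
  shows "(\<Oplus>\<^bsub>R\<^esub>a\<in>A. f a) \<odot>\<^bsub>M\<^esub> u = (\<Oplus>\<^bsub>M\<^esub>a\<in>A. f a \<odot>\<^bsub>M\<^esub> u)"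
  using assms
proof (induction A rule: finite_induct)
  case (insert a A)
  then have C: "f a \<in> carrier R" "f \<in> A \<rightarrow> carrier R" "(\<lambda>a. f a \<odot>\<^bsub>M\<^esub> u) \<in> A \<rightarrow> carrier M"
    by auto
  have "(\<Oplus>\<^bsub>R\<^esub>a\<in>insert a A. f a) \<odot>\<^bsub>M\<^esub> u = (f a \<oplus>\<^bsub>R\<^esub> (\<Oplus>\<^bsub>R\<^esub>a\<in>A. f a)) \<odot>\<^bsub>M\<^esub> u"
    using insert.hyps C by simp
  also have "\<dots> = f a \<odot>\<^bsub>M\<^esub> u \<oplus>\<^bsub>M\<^esub> (\<Oplus>\<^bsub>R\<^esub>a\<in>A. f a) \<odot>\<^bsub>M\<^esub> u"
    using C insert.prems(2) by (intro smult_l_distr) auto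
  also have "\<dots> = (\<Oplus>\<^bsub>M\<^esub>a\<in>insert a A. f a \<odot>\<^bsub>M\<^esub> u)"
    using insert C by simp
  finally show ?case .
qed simp

context canonical_setup
begin

text \<open>Linear independence of \<open>G\<close> over the polynomial ring in the parameters,
  tested one degree at a time on the coefficients of all products of a monomial and a
  generator.\<close>

definition hindep :: "('a \<times> nat) set \<Rightarrow> bool" where
  "hindep G \<longleftrightarrow> (\<forall>e c. (\<forall>p\<in>gmons d D G e. c p \<in> K) \<and>
     (\<Oplus>p\<in>gmons d D G e. c p \<otimes> gmon x d p) = \<zero> \<longrightarrow> (\<forall>p\<in>gmons d D G e. c p = \<zero>))"

lemma gmon_vanish:
  assumes w: "w \<in> carrier \<omega>" and g: "fst g \<in> carrier R"
    and zero: "\<And>n. int (wdeg D d n) = i + int (snd g) \<Longrightarrow> \<Psi> w n (fst g) = \<zero>\<^bsub>E\<^esub>"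
    and deg: "int (wdeg D d m) = i + int (wdeg D d b + snd g)"
  shows "\<Psi> w m (gmon x d (b, g)) = \<zero>\<^bsub>E\<^esub>"
proof (cases "\<forall>j<d. b j \<le> m j")
  case True
  have "int (wdeg D d (\<lambda>j. m j - b j)) = i + int (snd g)" using wdeg_diff[OF True, of D] deg by simp
  from zero[OF this] show ?thesis using \<Psi>_mon[OF w g, of m b] True by (simp add: gmon_def)
next
  case False
  then show ?thesis unfolding gmon_def case_prod_conv \<Psi>_mon[OF w g, of m b] by (simp only: if_False)
qed

text \<open>A dependence reads \<open>P h + Q = \<zero>\<close> with \<open>Q\<close> a combination
  of \<open>G\<close>, on which \<open>w\<close> vanishes. Independence of \<open>G\<close> forces a
  nonzero coefficient in \<open>P\<close>, so \<open>recurrence\<close> cancels \<open>P\<close>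
  from the vanishing on \<open>P h\<close>.\<close>

lemma dependent_vanish:
  assumes w: "w \<in> carrier \<omega>" and G: "finite G" "\<And>g. g \<in> insert h G \<Longrightarrow> fst g \<in> carrier R"
    and h: "h \<notin> G" and ind: "hindep G" and dep: "\<not> hindep (insert h G)"
    and zero: "\<And>g n. \<lbrakk>g \<in> G; int (wdeg D d n) = i + int (snd g)\<rbrakk> \<Longrightarrow> \<Psi> w n (fst g) = \<zero>\<^bsub>E\<^esub>"
    and n: "int (wdeg D d n) = i + int (snd h)"
  shows "\<Psi> w n (fst h) = \<zero>\<^bsub>E\<^esub>"
proof -
  obtain e c where c: "\<And>p. p \<in> gmons d D (insert h G) e \<Longrightarrow> c p \<in> K"
    and sum0: "(\<Oplus>p\<in>gmons d D (insert h G) e. c p \<otimes> gmon x d p) = \<zero>"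
    and nz: "\<exists>p\<in>gmons d D (insert h G) e. c p \<noteq> \<zero>"
    using dep unfolding hindep_def by blast
  define S where "S = {b \<in> exps d. wdeg D d b + snd h = e}"
  let ?M = "(\<lambda>b. (b, h)) ` S"
  let ?G = "gmons d D G e"
  have split: "gmons d D (insert h G) e = ?M \<union> ?G" by (auto simp: gmons_def S_def)
  have disj: "?M \<inter> ?G = {}" using h by (auto simp: gmons_def)
  have S: "finite S" using finite_degree[of "e - snd h"] by (rule rev_finite_subset) (auto simp: S_def)
  have finG: "finite ?G" using finite_gmons[OF hsys_pos[OF system] G(1)] .
  have hC: "fst h \<in> carrier R" using G(2) by simp
  have gC: "gmon x d p \<in> carrier R" if "p \<in> ?M \<union> ?G" for p
  proof -
    obtain b g where p: "p = (b, g)" by (cases p)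
    then have "g \<in> insert h G" using that by (auto simp: gmons_def)
    with p show ?thesis using G(2)[of g] mon_x_closed by (simp add: gmon_def)
  qed
  have cC: "c p \<in> carrier R" if "p \<in> ?M \<union> ?G" for p using c that split K_carrier by auto
  define P where "P = (\<Oplus>b\<in>S. c (b, h) \<otimes> mon x d b)"
  define Q where "Q = (\<Oplus>p\<in>?G. c p \<otimes> gmon x d p)"
  have cS: "c (b, h) \<in> carrier R" if "b \<in> S" for b using cC that by auto
  have PC: "P \<in> carrier R" unfolding P_def using cS mon_x_closed by (intro finsum_closed) auto
  have QC: "Q \<in> carrier R" unfolding Q_def using cC gC by (intro finsum_closed) auto
  have "(\<Oplus>p\<in>?M. c p \<otimes> gmon x d p) = (\<Oplus>b\<in>S. c (b, h) \<otimes> gmon x d (b, h))"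
    using cC gC by (intro finsum_reindex) (auto simp: inj_on_def)
  also have "\<dots> = (\<Oplus>b\<in>S. c (b, h) \<otimes> mon x d b \<otimes> fst h)"
    using cS mon_x_closed hC by (intro finsum_cong') (auto simp: gmon_def m_assoc)
  also have "\<dots> = P \<otimes> fst h"
    unfolding P_def using S cS mon_x_closed hC by (intro finsum_ldistr[symmetric]) auto
  finally have M: "(\<Oplus>p\<in>?M. c p \<otimes> gmon x d p) = P \<otimes> fst h" .
  have "(\<Oplus>p\<in>?M \<union> ?G. c p \<otimes> gmon x d p) = (\<Oplus>p\<in>?M. c p \<otimes> gmon x d p) \<oplus> Q"
    unfolding Q_def using S finG disj cC gC by (intro finsum_Un_disjoint) auto
  then have PQ: "P \<otimes> fst h \<oplus> Q = \<zero>" using sum0 split M by simp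
  have "\<exists>b\<in>S. c (b, h) \<noteq> \<zero>"
  proof (rule ccontr)
    assume "\<not> (\<exists>b\<in>S. c (b, h) \<noteq> \<zero>)"
    then have z: "\<And>b. b \<in> S \<Longrightarrow> c (b, h) = \<zero>" by blast
    then have "P = (\<Oplus>b\<in>S. \<zero>)" unfolding P_def using mon_x_closed by (intro finsum_cong') auto
    then have "P = \<zero>" by simp
    then have "Q = \<zero>" using PQ hC QC by simp
    then have "\<forall>p\<in>?G. c p = \<zero>" using ind c split unfolding hindep_def Q_def by blast
    then show False using nz z split by auto
  qed
  then have nzS: "\<exists>b\<in>S. c (b, h) \<noteq> \<zero>" "snd h \<le> e" by (auto simp: S_def)
  have "\<Psi> w m (P \<otimes> fst h) = \<zero>\<^bsub>E\<^esub>" if m: "wdeg D d m = wdeg D d n + (e - snd h)" for m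
  proof -
    have "\<Psi> w m Q = (\<Oplus>\<^bsub>E\<^esub>p\<in>?G. \<Psi> w m (c p \<otimes> gmon x d p))"
      unfolding Q_def using finG cC gC by (intro \<Psi>_finsum[OF w]) auto
    also have "\<dots> = (\<Oplus>\<^bsub>E\<^esub>p\<in>?G. \<zero>\<^bsub>E\<^esub>)"
    proof (rule E.M.finsum_cong')
      fix p assume p: "p \<in> ?G"
      then obtain b g where bg: "p = (b, g)" "g \<in> G" "wdeg D d b + snd g = e" by (auto simp: gmons_def)
      have "\<Psi> w m (gmon x d p) = \<zero>\<^bsub>E\<^esub>"
        unfolding bg(1) using G(2) bg(2,3) m n nzS(2) zero
        by (intro gmon_vanish[OF w, where i = i]) (auto simp: of_nat_diff)
      then show "\<Psi> w m (c p \<otimes> gmon x d p) = \<zero>\<^bsub>E\<^esub>"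
        using \<Psi>_mult[OF w, of "gmon x d p" "c p" m] gC cC p by simp
    qed auto
    finally have "\<Psi> w m Q = \<zero>\<^bsub>E\<^esub>" by simp
    moreover have "\<Psi> w m (P \<otimes> fst h) \<oplus>\<^bsub>E\<^esub> \<Psi> w m Q = \<zero>\<^bsub>E\<^esub>"
      using \<Psi>_add[OF w, of "P \<otimes> fst h" Q m] PQ PC QC hC \<Psi>_zero[OF w] by simp
    ultimately show ?thesis using \<Psi>_closed[OF w, of "P \<otimes> fst h" m] PC hC by simp
  qed
  then show ?thesis
    unfolding P_def
    using S c split nzS
    by (intro recurrence[OF w hC S, where p = "e - snd h" and q = "wdeg D d n" and c = "\<lambda>b. c (b, h)"])
      (auto simp: S_def)
qed

text \<open>A maximal independent subset of a finite set of module generators: every other generator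
  depends on it, so it detects zero in \<open>\<omega>\<close>. It is a basis of \<open>R\<close>
  once the nonzero polynomials in the parameters are inverted. The condition on \<open>n\<close>
  selects the values in degree 0 of \<open>E\<close>.\<close>

lemma rank_basis:
  obtains G where "finite G" "\<And>g. g \<in> G \<Longrightarrow> fst g \<in> rgrade R (int (snd g))" "hindep G"
    "\<And>w i. \<lbrakk>w \<in> grade \<omega> i; \<And>g n. \<lbrakk>g \<in> G; int (wdeg D d n) = i + int (snd g)\<rbrakk> \<Longrightarrow> \<Psi> w n (fst g) = \<zero>\<^bsub>E\<^esub>\<rbrakk>
      \<Longrightarrow> w = \<zero>\<^bsub>\<omega>\<^esub>"
proof -
  from gmon_spanning[OF system primary] obtain G where G: "finite G"
    and GR: "\<And>g. g \<in> G \<Longrightarrow> fst g \<in> rgrade R (int (snd g))"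
    and span: "\<And>e. rgrade R (int e) \<subseteq> kspan (gmon x d ` gmons d D G e)" by blast
  have GC: "fst g \<in> carrier R" if "g \<in> G" for g using GR[OF that] RG.gr_carrier by blast
  have "hindep {}" by (simp add: hindep_def gmons_def)
  then have "{G'. G' \<subseteq> G \<and> hindep G'} \<noteq> {}" by auto
  moreover have "finite {G'. G' \<subseteq> G \<and> hindep G'}" using G by simp
  ultimately have "\<exists>G'\<in>{G'. G' \<subseteq> G \<and> hindep G'}. \<forall>G''\<in>{G'. G' \<subseteq> G \<and> hindep G'}. G' \<subseteq> G'' \<longrightarrow> G' = G''"
    by (intro finite_has_maximal)
  then obtain G' where G': "G' \<subseteq> G" "hindep G'"
    and max': "\<forall>G''\<in>{G'. G' \<subseteq> G \<and> hindep G'}. G' \<subseteq> G'' \<longrightarrow> G' = G''"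
    by (elim bexE CollectE conjE)
  have max: "G' = G''" if "G'' \<subseteq> G" "hindep G''" "G' \<subseteq> G''" for G''
    using max' that by simp
  have finG': "finite G'" using G G' finite_subset by blast
  show thesis
  proof (rule that[OF finG' _ G'(2)])
    show "fst g \<in> rgrade R (int (snd g))" if "g \<in> G'" for g using GR G' that by blast
    fix w i assume w: "w \<in> grade \<omega> i"
      and zero: "\<And>g n. \<lbrakk>g \<in> G'; int (wdeg D d n) = i + int (snd g)\<rbrakk> \<Longrightarrow> \<Psi> w n (fst g) = \<zero>\<^bsub>E\<^esub>"
    have wC: "w \<in> carrier \<omega>" using w \<omega>_grade_carrier by blast
    have zero_G: "\<Psi> w n (fst g) = \<zero>\<^bsub>E\<^esub>" if g: "g \<in> G" and n: "int (wdeg D d n) = i + int (snd g)" for g n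
    proof (cases "g \<in> G'")
      case False
      have "\<not> hindep (insert g G')" using max[of "insert g G'"] False g G' by auto
      from dependent_vanish[OF wC finG' _ False G'(2) this zero n] show ?thesis using G' GC g by blast
    qed (use zero n in blast)
    show "w = \<zero>\<^bsub>\<omega>\<^esub>"
    proof (rule \<Psi>_determines[OF w])
      fix n r e assume r: "r \<in> rgrade R (int e)" and n: "i + int e = int (wdeg D d n)"
      have SC: "gmon x d ` gmons d D G e \<subseteq> carrier R"
        using GC mon_x_closed by (auto simp: gmon_def gmons_def)
      have "r \<in> kspan (gmon x d ` gmons d D G e)" using span r by blast
      then show "\<Psi> w n r = \<zero>\<^bsub>E\<^esub>"
      proof (induction rule: kspan.induct)
        case zero
        then show ?case using \<Psi>_zero[OF wC] .
      next
        case (add s c y)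
        obtain b g where s: "s = gmon x d (b, g)" "g \<in> G" "wdeg D d b + snd g = e"
          using add(1) by (auto simp: gmons_def)
        have "\<Psi> w n s = \<zero>\<^bsub>E\<^esub>"
          unfolding s(1) using s(2,3) n zero_G GC by (intro gmon_vanish[OF wC, where i = i]) auto
        moreover have C: "s \<in> carrier R" "c \<in> carrier R" "y \<in> carrier R"
          using add SC K_carrier kspan_carrier[OF SC add(3)] by auto
        ultimately show ?case using \<Psi>_add[OF wC, of "c \<otimes> s" y n] \<Psi>_mult[OF wC, of s c n] add.IH by simp
      qed
    qed
  qed
qed

section \<open>Counting elements against linear conditions\<close>

lemma \<omega>_finsum_grade:
  "finite A \<Longrightarrow> (\<And>a. a \<in> A \<Longrightarrow> f a \<in> grade \<omega> i) \<Longrightarrow> (\<Oplus>\<^bsub>\<omega>\<^esub>a\<in>A. f a) \<in> grade \<omega> i"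
proof (induction A rule: finite_induct)
  case (insert a A)
  then have "f \<in> A \<rightarrow> carrier \<omega>" "f a \<in> carrier \<omega>" using \<omega>_grade_carrier by blast+
  then show ?case using insert by (simp add: \<omega>_add_grade)
qed (simp add: \<omega>_zero_grade)

lemma \<Psi>_finsum_left:
  assumes r: "r \<in> carrier R"
  shows "finite A \<Longrightarrow> (\<And>a. a \<in> A \<Longrightarrow> f a \<in> carrier \<omega>) \<Longrightarrow>
    \<Psi> (\<Oplus>\<^bsub>\<omega>\<^esub>a\<in>A. f a) n r = (\<Oplus>\<^bsub>E\<^esub>a\<in>A. \<Psi> (f a) n r)"
proof (induction A rule: finite_induct)
  case empty
  have "\<Psi> (\<zero> \<odot>\<^bsub>\<omega>\<^esub> \<zero>\<^bsub>\<omega>\<^esub>) n r = \<Psi> \<zero>\<^bsub>\<omega>\<^esub> n (\<zero> \<otimes> r)" using r by (intro \<Psi>_smult) auto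
  then show ?case using r \<Psi>_zero[of "\<zero>\<^bsub>\<omega>\<^esub>" n] by simp
next
  case (insert a A)
  then have "f \<in> A \<rightarrow> carrier \<omega>" "f a \<in> carrier \<omega>" "(\<lambda>a. \<Psi> (f a) n r) \<in> A \<rightarrow> carrier E"
    "\<Psi> (f a) n r \<in> carrier E" using \<Psi>_closed r by blast+
  then show ?case using insert \<Psi>_plus[OF r] by simp
qed

definition deg_exps :: "int \<Rightarrow> (nat \<Rightarrow> nat) set" where
  "deg_exps k = {b \<in> exps d. int (wdeg D d b) = k}"

lemma finite_deg_exps: "finite (deg_exps k)"
  by (rule finite_subset[OF _ finite_degree[of "nat k"]]) (auto simp: deg_exps_def)

lemma sum_card_deg_exps: "(\<Sum>k\<in>{0..int M}. card (deg_exps k)) \<le> (M + 1) ^ d"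
proof -
  have "(\<Sum>k\<in>{0..int M}. card (deg_exps k)) = card (\<Union>k\<in>{0..int M}. deg_exps k)"
    by (rule card_UN_disjoint[symmetric]) (auto simp: finite_deg_exps, auto simp: deg_exps_def)
  also have "(\<Union>k\<in>{0..int M}. deg_exps k) = {b \<in> exps d. wdeg D d b \<le> M}"
    by (auto simp: deg_exps_def)
  finally show ?thesis using card_wdeg[OF hsys_pos[OF system], of M] by simp
qed

text \<open>Lowering every exponent by one is injective on these. Fractions are zero unless all
  exponents of the denominator are positive, so only such denominators impose conditions.\<close>

lemma card_positive_exps:
  "finite {n \<in> deg_exps k. \<forall>j<d. 1 \<le> n j}"
  "card {n \<in> deg_exps k. \<forall>j<d. 1 \<le> n j} \<le> card (deg_exps (k - int (\<Sum>j<d. D j)))"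
proof -
  let ?A = "{n \<in> deg_exps k. \<forall>j<d. 1 \<le> n j}"
  show "finite ?A" using finite_deg_exps by simp
  show "card ?A \<le> card (deg_exps (k - int (\<Sum>j<d. D j)))"
  proof (rule card_inj_on_le[where f = "\<lambda>n j. n j - 1"])
    show "inj_on (\<lambda>n j. n j - 1) ?A"
    proof (rule inj_onI)
      fix n m assume n: "n \<in> ?A" and m: "m \<in> ?A" and eq: "(\<lambda>j. n j - 1) = (\<lambda>j. m j - 1)"
      show "n = m"
      proof
        fix j
        have "n j - 1 = m j - 1" using fun_cong[OF eq] .
        moreover have "j < d \<Longrightarrow> 1 \<le> n j \<and> 1 \<le> m j" using n m by blast
        moreover have "\<not> j < d \<Longrightarrow> n j = m j" using n m by (auto simp: deg_exps_def exps_def)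
        ultimately show "n j = m j" by (cases "j < d") auto
      qed
    qed
    show "(\<lambda>n j. n j - 1) ` ?A \<subseteq> deg_exps (k - int (\<Sum>j<d. D j))"
    proof (rule image_subsetI)
      fix n assume n: "n \<in> ?A"
      then have "wdeg D d (\<lambda>j. n j - 1) + wdeg D d (\<lambda>_. 1) = wdeg D d n"
        by (intro wdeg_diff) blast
      moreover have "wdeg D d (\<lambda>_. 1) = (\<Sum>j<d. D j)" by (simp add: wdeg_def)
      ultimately have "int (wdeg D d (\<lambda>j. n j - 1)) = int (wdeg D d n) - int (\<Sum>j<d. D j)"
        by linarith
      then show "(\<lambda>j. n j - 1) \<in> deg_exps (k - int (\<Sum>j<d. D j))"
        using n by (simp add: deg_exps_def exps_def)
    qed
  qed (rule finite_deg_exps)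
qed

text \<open>Both \<open>\<tau>\<close> and \<open>w\<close> generate rank one submodules over the polynomial ring in the parameters, so
  in large degrees the elements of \<open>R\<tau>\<close> and \<open>k[x]w\<close> are more numerous than the linear conditions
  that cut out the zero element of \<open>\<omega>\<close>.\<close>

lemma rank_one:
  assumes \<tau>: "\<tau> \<in> grade \<omega> t0" "torsion_free_element R \<omega> \<tau>" and w: "w \<in> grade \<omega> i0"
  shows "\<exists>P r. hpoly P \<and> r \<in> carrier R \<and> P \<odot>\<^bsub>\<omega>\<^esub> w = r \<odot>\<^bsub>\<omega>\<^esub> \<tau>"
proof -
  obtain G :: "('a \<times> nat) set" where G: "finite G" "\<And>g. g \<in> G \<Longrightarrow> fst g \<in> rgrade R (int (snd g))" "hindep G"
    and basis: "\<And>w i. \<lbrakk>w \<in> grade \<omega> i;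
        \<And>g n. \<lbrakk>g \<in> G; int (wdeg D d n) = i + int (snd g)\<rbrakk> \<Longrightarrow> \<Psi> w n (fst g) = \<zero>\<^bsub>E\<^esub>\<rbrakk> \<Longrightarrow> w = \<zero>\<^bsub>\<omega>\<^esub>"
    using rank_basis by metis
  \<comment> \<open>\<open>?\<Delta>\<close> is the degree of \<open>x 0 ... x (d - 1)\<close>, by
    which the degree drops when all exponents are lowered by one.\<close>
  let ?\<Delta> = "int (\<Sum>j<d. D j)" and ?N = "\<lambda>k. card (deg_exps k)"
  have "deg_exps k = {}" if "k < 0" for k using that by (auto simp: deg_exps_def)
  moreover have "(\<lambda>_. 0) \<in> deg_exps 0" by (simp add: deg_exps_def exps_def wdeg_def)
  then have "0 < ?N 0" using finite_deg_exps card_gt_0_iff by blast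
  \<comment> \<open>In this degree the elements \<open>x^b g \<tau>\<close> and \<open>x^b w\<close>
    outnumber the fractions \<open>g / x^n\<close> with positive exponents on which they have to be
    compared.\<close>
  ultimately obtain i where i: "(\<Sum>g\<in>G. ?N (i - (?\<Delta> - int (snd g)))) <
      (\<Sum>g\<in>G. ?N (i - (t0 + int (snd g)))) + ?N (i - i0)"
    using growth[of ?N d G "\<lambda>g. ?\<Delta> - int (snd g)" "\<lambda>g. t0 + int (snd g)" i0] sum_card_deg_exps G(1)
    by auto
  \<comment> \<open>\<open>A1\<close> indexes the elements \<open>x^b g \<tau>\<close>,
    \<open>A2\<close> the elements \<open>x^b w\<close>, both of degree \<open>i\<close>, and
    \<open>Q\<close> the conditions. The tagged sum keeps apart an exponent of \<open>w\<close> and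
    one belonging to \<open>\<tau>\<close>.\<close>
  define A1 where "A1 = (\<lambda>(g, b). (b, g)) ` (SIGMA g:G. deg_exps (i - (t0 + int (snd g))))"
  define A2 where "A2 = deg_exps (i - i0)"
  define A where "A = A1 <+> A2"
  define Q where "Q = (SIGMA g:G. {n \<in> deg_exps (i + int (snd g)). \<forall>j<d. 1 \<le> n j})"
  have A1: "b \<in> exps d" "g \<in> G" "int (wdeg D d b) + int (snd g) = i - t0" if "(b, g) \<in> A1" for b g
    using that by (auto simp: A1_def deg_exps_def)
  have A1I: "(b, g) \<in> A1" if "b \<in> exps d" "g \<in> G" "int (wdeg D d b) + int (snd g) = i - t0" for b g
    using that by (force simp: A1_def deg_exps_def)
  have finA1: "finite A1" unfolding A1_def using G(1) finite_deg_exps by simp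
  have finA2: "finite A2" unfolding A2_def by (rule finite_deg_exps)
  have finA: "finite A" unfolding A_def using finA1 finA2 by simp
  have finQ: "finite Q" unfolding Q_def using G(1) card_positive_exps(1) by (intro finite_SigmaI)
  have "card A1 = (\<Sum>g\<in>G. ?N (i - (t0 + int (snd g))))"
    unfolding A1_def using G(1) finite_deg_exps by (subst card_image) (auto simp: inj_on_def)
  then have "card A = (\<Sum>g\<in>G. ?N (i - (t0 + int (snd g)))) + ?N (i - i0)"
    unfolding A_def using finA1 finA2 by (simp add: card_Plus A2_def)
  moreover have "card Q \<le> (\<Sum>g\<in>G. ?N (i - (?\<Delta> - int (snd g))))"
  proof -
    have "card Q = (\<Sum>g\<in>G. card {n \<in> deg_exps (i + int (snd g)). \<forall>j<d. 1 \<le> n j})"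
      unfolding Q_def using G(1) card_positive_exps(1) by (intro card_SigmaI) auto
    also have "\<dots> \<le> (\<Sum>g\<in>G. ?N (i + int (snd g) - ?\<Delta>))" by (intro sum_mono card_positive_exps(2))
    finally show ?thesis by (simp add: algebra_simps)
  qed
  ultimately have less: "card Q < card A" using i by linarith
  have GC: "fst g \<in> carrier R" if "g \<in> G" for g using G(2)[OF that] RG.gr_carrier by blast
  have \<tau>C: "\<tau> \<in> carrier \<omega>" and wC: "w \<in> carrier \<omega>" using \<tau>(1) w \<omega>_grade_carrier by blast+
  define u where "u = case_sum (\<lambda>p. gmon x d p \<odot>\<^bsub>\<omega>\<^esub> \<tau>) (\<lambda>b. mon x d b \<odot>\<^bsub>\<omega>\<^esub> w)"
  have gC: "gmon x d p \<in> carrier R" if "p \<in> A1" for p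
    using that GC[of "snd p"] A1(2)[of "fst p" "snd p"] mon_x_closed by (simp add: gmon_def split_beta)
  have uG: "u a \<in> grade \<omega> i" if a: "a \<in> A" for a
  proof (cases a)
    case (Inl p)
    obtain b g where p: "p = (b, g)" by (cases p)
    then have bg: "(b, g) \<in> A1" using a Inl by (auto simp: A_def)
    have "gmon x d p \<in> rgrade R (int (wdeg D d b) + int (snd g))"
      using mult_degree[OF mon_grade[OF system] G(2)[OF A1(2)[OF bg]]] by (simp add: p gmon_def)
    from \<omega>_smult_grade[OF this \<tau>(1)] show ?thesis using A1(3)[OF bg] Inl by (simp add: u_def)
  next
    case (Inr b)
    then have "int (wdeg D d b) = i - i0" using a by (auto simp: A_def A2_def deg_exps_def)
    then show ?thesis using \<omega>_smult_grade[OF mon_grade[OF system] w, of b] Inr by (simp add: u_def)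
  qed
  have uC: "u a \<in> carrier \<omega>" if "a \<in> A" for a using uG[OF that] \<omega>_grade_carrier by blast
  \<comment> \<open>The value of \<open>u a\<close> on the fraction \<open>q\<close> lies in degree
    0 of \<open>E\<close>; \<open>\<kappa> a q\<close> is its coordinate with respect to
    \<open>e0\<close>.\<close>
  define \<kappa> where "\<kappa> a q = (SOME c. c \<in> K \<and> \<Psi> (u a) (snd q) (fst (fst q)) = c \<odot>\<^bsub>E\<^esub> e0)"
    for a and q :: "('a \<times> nat) \<times> (nat \<Rightarrow> nat)"
  have \<kappa>: "\<kappa> a q \<in> K" "\<Psi> (u a) (snd q) (fst (fst q)) = \<kappa> a q \<odot>\<^bsub>E\<^esub> e0"
    if a: "a \<in> A" and q: "q \<in> Q" for a q
  proof -
    obtain g n where gn: "q = (g, n)" by (cases q)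
    then have g: "g \<in> G" "int (wdeg D d n) = i + int (snd g)" using q by (auto simp: Q_def deg_exps_def)
    have "\<Psi> (u a) n (fst g) \<in> grade E 0"
      using \<Psi>_grade[OF uG[OF a] G(2)[OF g(1)], of n] g(2) by simp
    then obtain c where "c \<in> K" "\<Psi> (u a) n (fst g) = c \<odot>\<^bsub>E\<^esub> e0" by (rule E_grade_zero)
    then have "\<exists>c. c \<in> K \<and> \<Psi> (u a) (snd q) (fst (fst q)) = c \<odot>\<^bsub>E\<^esub> e0" using gn by auto
    from someI_ex[OF this] show "\<kappa> a q \<in> K" "\<Psi> (u a) (snd q) (fst (fst q)) = \<kappa> a q \<odot>\<^bsub>E\<^esub> e0"
      unfolding \<kappa>_def by blast+
  qed
  obtain c where c: "\<And>a. a \<in> A \<Longrightarrow> c a \<in> K" and nz: "\<exists>a\<in>A. c a \<noteq> \<zero>"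
    and sol: "\<And>q. q \<in> Q \<Longrightarrow> (\<Oplus>a\<in>A. c a \<otimes> \<kappa> a q) = \<zero>"
    using linear_system_nontrivial_solution[OF finQ finA less, of \<kappa>] \<kappa>(1) by blast
  have cC: "c a \<in> carrier R" if "a \<in> A" for a using c[OF that] K_carrier by blast
  define w' where "w' = (\<Oplus>\<^bsub>\<omega>\<^esub>a\<in>A. c a \<odot>\<^bsub>\<omega>\<^esub> u a)"
  have w'G: "w' \<in> grade \<omega> i"
  proof -
    have "c a \<odot>\<^bsub>\<omega>\<^esub> u a \<in> grade \<omega> i" if "a \<in> A" for a
      using \<omega>_smult_grade[OF c[OF that] uG[OF that]] by simp
    then show ?thesis unfolding w'_def using finA by (rule \<omega>_finsum_grade[rotated])
  qed
  have w'C: "w' \<in> carrier \<omega>" using w'G \<omega>_grade_carrier by blast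
  have on_Q: "\<Psi> w' n (fst g) = \<zero>\<^bsub>E\<^esub>" if q: "(g, n) \<in> Q" for g n
  proof -
    have g: "fst g \<in> carrier R" using q GC by (auto simp: Q_def)
    have \<kappa>C: "\<kappa> a (g, n) \<in> carrier R" if "a \<in> A" for a using \<kappa>(1)[OF that q] K_carrier by blast
    have "\<Psi> w' n (fst g) = (\<Oplus>\<^bsub>E\<^esub>a\<in>A. \<Psi> (c a \<odot>\<^bsub>\<omega>\<^esub> u a) n (fst g))"
      unfolding w'_def using finA uC cC by (intro \<Psi>_finsum_left[OF g]) auto
    also have "\<dots> = (\<Oplus>\<^bsub>E\<^esub>a\<in>A. (c a \<otimes> \<kappa> a (g, n)) \<odot>\<^bsub>E\<^esub> e0)"
    proof (rule E.M.finsum_cong')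
      fix a assume a: "a \<in> A"
      have "\<Psi> (c a \<odot>\<^bsub>\<omega>\<^esub> u a) n (fst g) = c a \<odot>\<^bsub>E\<^esub> \<Psi> (u a) n (fst g)"
        using \<Psi>_smult[OF uC[OF a] g cC[OF a]] \<Psi>_mult[OF uC[OF a] g cC[OF a]] by simp
      also have "\<dots> = (c a \<otimes> \<kappa> a (g, n)) \<odot>\<^bsub>E\<^esub> e0"
        using \<kappa>(2)[OF a q] E.smult_assoc1[OF cC[OF a] \<kappa>C[OF a] e0_closed] by simp
      finally show "\<Psi> (c a \<odot>\<^bsub>\<omega>\<^esub> u a) n (fst g) = (c a \<otimes> \<kappa> a (g, n)) \<odot>\<^bsub>E\<^esub> e0" .
    qed (use cC \<kappa>C e0_closed in auto)
    also have "\<dots> = (\<Oplus>a\<in>A. c a \<otimes> \<kappa> a (g, n)) \<odot>\<^bsub>E\<^esub> e0"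
      using finA cC \<kappa>C e0_closed by (intro E.finsum_smult_element[symmetric]) auto
    finally show ?thesis using sol[OF q] e0_closed by simp
  qed
  have w'0: "w' = \<zero>\<^bsub>\<omega>\<^esub>"
  proof (rule basis[OF w'G])
    fix g n assume g: "g \<in> G" and n: "int (wdeg D d n) = i + int (snd g)"
    show "\<Psi> w' n (fst g) = \<zero>\<^bsub>E\<^esub>"
    proof (cases "\<exists>j<d. n j = 0")
      case True
      then show ?thesis using \<Psi>_vanish[OF w'C GC[OF g]] by blast
    next
      case False
      \<comment> \<open>\<open>n\<close> is arbitrary from \<open>d\<close> on; cutting it off there
        gives a member of \<open>Q\<close> with the same value.\<close>
      define m where "m j = (if j < d then n j else 0)" for j
      have "wdeg D d m = wdeg D d n" by (simp add: wdeg_def m_def)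
      then have "(g, m) \<in> Q" using g n False by (auto simp: Q_def deg_exps_def exps_def m_def Suc_le_eq)
      then have "\<Psi> w' m (fst g) = \<zero>\<^bsub>E\<^esub>" by (rule on_Q)
      moreover have "\<Psi> w' n (fst g) = \<Psi> w' m (fst g)"
        by (rule \<Psi>_cong[OF GC[OF g]]) (simp add: m_def)
      ultimately show ?thesis by simp
    qed
  qed
  have c1: "c (Inl p) \<in> carrier R" if "p \<in> A1" for p using cC that by (auto simp: A_def)
  have c2: "c (Inr b) \<in> carrier R" if "b \<in> A2" for b using cC that by (auto simp: A_def)
  define r where "r = (\<Oplus>p\<in>A1. c (Inl p) \<otimes> gmon x d p)"
  define P where "P = (\<Oplus>b\<in>A2. c (Inr b) \<otimes> mon x d b)"
  have rC: "r \<in> carrier R" unfolding r_def using c1 gC by (intro finsum_closed) auto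
  have PC: "P \<in> carrier R" unfolding P_def using c2 mon_x_closed by (intro finsum_closed) auto
  have "w' = (\<Oplus>\<^bsub>\<omega>\<^esub>a\<in>Inl ` A1. c a \<odot>\<^bsub>\<omega>\<^esub> u a) \<oplus>\<^bsub>\<omega>\<^esub> (\<Oplus>\<^bsub>\<omega>\<^esub>a\<in>Inr ` A2. c a \<odot>\<^bsub>\<omega>\<^esub> u a)"
    unfolding w'_def A_def Plus_def using finA1 finA2 cC uC
    by (intro W.M.finsum_Un_disjoint) (auto simp: A_def)
  also have "(\<Oplus>\<^bsub>\<omega>\<^esub>a\<in>Inl ` A1. c a \<odot>\<^bsub>\<omega>\<^esub> u a) = (\<Oplus>\<^bsub>\<omega>\<^esub>p\<in>A1. c (Inl p) \<odot>\<^bsub>\<omega>\<^esub> u (Inl p))"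
    using cC uC by (intro W.M.finsum_reindex) (auto simp: A_def)
  also have "\<dots> = (\<Oplus>\<^bsub>\<omega>\<^esub>p\<in>A1. (c (Inl p) \<otimes> gmon x d p) \<odot>\<^bsub>\<omega>\<^esub> \<tau>)"
    using c1 gC \<tau>C by (intro W.M.finsum_cong') (auto simp: u_def W.smult_assoc1)
  also have "\<dots> = r \<odot>\<^bsub>\<omega>\<^esub> \<tau>"
    unfolding r_def using finA1 c1 gC \<tau>C by (intro W.finsum_smult_element[symmetric]) auto
  also have "(\<Oplus>\<^bsub>\<omega>\<^esub>a\<in>Inr ` A2. c a \<odot>\<^bsub>\<omega>\<^esub> u a) = (\<Oplus>\<^bsub>\<omega>\<^esub>b\<in>A2. c (Inr b) \<odot>\<^bsub>\<omega>\<^esub> u (Inr b))"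
    using cC uC by (intro W.M.finsum_reindex) (auto simp: A_def)
  also have "\<dots> = (\<Oplus>\<^bsub>\<omega>\<^esub>b\<in>A2. (c (Inr b) \<otimes> mon x d b) \<odot>\<^bsub>\<omega>\<^esub> w)"
    using c2 mon_x_closed wC by (intro W.M.finsum_cong') (auto simp: u_def W.smult_assoc1)
  also have "\<dots> = P \<odot>\<^bsub>\<omega>\<^esub> w"
    unfolding P_def using finA2 c2 mon_x_closed wC by (intro W.finsum_smult_element[symmetric]) auto
  finally have sum0: "r \<odot>\<^bsub>\<omega>\<^esub> \<tau> \<oplus>\<^bsub>\<omega>\<^esub> P \<odot>\<^bsub>\<omega>\<^esub> w = \<zero>\<^bsub>\<omega>\<^esub>" using w'0 by simp
  \<comment> \<open>A relation among the elements \<open>x^b g \<tau>\<close> alone would give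
    \<open>r = \<zero>\<close> because \<open>\<tau>\<close> is torsion-free, against the
    independence of \<open>G\<close>.\<close>
  have "\<exists>b\<in>A2. c (Inr b) \<noteq> \<zero>"
  proof (rule ccontr)
    assume "\<not> (\<exists>b\<in>A2. c (Inr b) \<noteq> \<zero>)"
    then have z: "\<And>b. b \<in> A2 \<Longrightarrow> c (Inr b) = \<zero>" by blast
    then have "P = (\<Oplus>b\<in>A2. \<zero>)" unfolding P_def using mon_x_closed by (intro finsum_cong') auto
    then have "P = \<zero>" by simp
    then have "r \<odot>\<^bsub>\<omega>\<^esub> \<tau> = \<zero>\<^bsub>\<omega>\<^esub>" using sum0 wC \<tau>C rC by simp
    then have r0: "r = \<zero>" using \<tau>(2) rC by (simp add: torsion_free_element_def)
    obtain p where p: "p \<in> A1" "c (Inl p) \<noteq> \<zero>" using nz z by (auto simp: A_def)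
    obtain b g where bg: "p = (b, g)" by (cases p)
    have A1_eq: "A1 = gmons d D G (nat (i - t0))"
    proof -
      have "0 \<le> i - t0" using A1(3)[of b g] p(1) bg by simp
      then have nat: "k = nat (i - t0) \<longleftrightarrow> int k = i - t0" for k by auto
      have "(b, g) \<in> A1 \<longleftrightarrow> (b, g) \<in> gmons d D G (nat (i - t0))" for b g
        using A1[of b g] A1I[of b g] unfolding gmons_def mem_Collect_eq case_prod_conv nat by auto
      then show ?thesis by (simp add: set_eq_iff split_paired_All)
    qed
    moreover have "\<forall>p\<in>A1. c (Inl p) \<in> K" using c by (auto simp: A_def)
    ultimately have "\<forall>p\<in>A1. c (Inl p) = \<zero>"
      using spec[OF spec[OF G(3)[unfolded hindep_def], of "nat (i - t0)"], of "\<lambda>p. c (Inl p)"] r0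
      unfolding A1_eq[symmetric] r_def by blast
    then show False using p by blast
  qed
  \<comment> \<open>A nonempty \<open>A2\<close> ensures \<open>0 \<le> i - i0\<close>, so that
    passing to \<open>nat\<close> loses nothing.\<close>
  moreover from this have "A2 = {b \<in> exps d. wdeg D d b = nat (i - i0)}"
    by (auto simp: A2_def deg_exps_def)
  ultimately have "hpoly P"
    unfolding hpoly_def using c P_def
    by (intro exI[of _ "nat (i - i0)"] exI[of _ "\<lambda>b. c (Inr b)"]) (auto simp: A_def)
  moreover have "P \<odot>\<^bsub>\<omega>\<^esub> w = (\<ominus> r) \<odot>\<^bsub>\<omega>\<^esub> \<tau>"
    using sum0 W.M.minus_equality[of "P \<odot>\<^bsub>\<omega>\<^esub> w" "r \<odot>\<^bsub>\<omega>\<^esub> \<tau>"] wC \<tau>C rC PC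
    by (simp add: W.smult_l_minus W.M.a_comm)
  ultimately show ?thesis using rC by blast
qed

text \<open>\<open>initial_degree\<close> is a \<open>LEAST\<close> over the integers and describes
  a minimum only once a lower bound is known. In very low degrees no fraction \<open>g / x^n\<close>
  has its value in degree 0 of \<open>E\<close>, so no condition is left and the piece is
  zero.\<close>

lemma bounded_below: "\<exists>l. \<forall>i<l. grade \<omega> i = {\<zero>\<^bsub>\<omega>\<^esub>}"
proof -
  obtain G :: "('a \<times> nat) set" where G: "finite G"
    and basis: "\<And>w i. \<lbrakk>w \<in> grade \<omega> i;
        \<And>g n. \<lbrakk>g \<in> G; int (wdeg D d n) = i + int (snd g)\<rbrakk> \<Longrightarrow> \<Psi> w n (fst g) = \<zero>\<^bsub>E\<^esub>\<rbrakk> \<Longrightarrow> w = \<zero>\<^bsub>\<omega>\<^esub>"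
    using rank_basis by metis
  have "grade \<omega> i = {\<zero>\<^bsub>\<omega>\<^esub>}" if i: "i < - int (\<Sum>g\<in>G. snd g)" for i
  proof -
    have "int (wdeg D d n) \<noteq> i + int (snd g)" if "g \<in> G" for g n
    proof -
      have "snd g \<le> (\<Sum>g\<in>G. snd g)" using that G by (intro member_le_sum) auto
      then show ?thesis using i by linarith
    qed
    then show ?thesis using basis \<omega>_zero_grade by blast
  qed
  then show ?thesis by blast
qed

end

section \<open>Canonical modules with a torsion-free generator in the initial degree\<close>

text \<open>Regularity of the second element modulo the first in the form of a divisibility
  statement; that \<open>\<theta>1\<close> is no unit comes from properness of the ideal of the
  sequence.\<close>

lemma (in graded_algebra) regular_pair:
  assumes "regular_sequence R [\<theta>1, \<theta>2]"
  shows "\<theta>1 \<in> carrier R" "\<theta>2 \<in> carrier R"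
    and "\<And>r. r \<in> carrier R \<Longrightarrow> \<theta>1 \<otimes> r = \<zero> \<Longrightarrow> r = \<zero>"
    and "\<And>r s. \<lbrakk>r \<in> carrier R; s \<in> carrier R; \<theta>2 \<otimes> r = \<theta>1 \<otimes> s\<rbrakk> \<Longrightarrow> \<exists>h\<in>carrier R. r = \<theta>1 \<otimes> h"
    and "\<theta>1 \<notin> Units R"
proof -
  from assms have C: "{\<theta>1, \<theta>2} \<subseteq> carrier R" and proper: "Idl {\<theta>1, \<theta>2} \<noteq> carrier R"
    and reg: "\<And>i r. \<lbrakk>i < 2; r \<in> carrier R; ([\<theta>1, \<theta>2] ! i) \<otimes> r \<in> Idl (set (take i [\<theta>1, \<theta>2]))\<rbrakk>
      \<Longrightarrow> r \<in> Idl (set (take i [\<theta>1, \<theta>2]))"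
    by (auto simp: regular_sequence_def)
  show C': "\<theta>1 \<in> carrier R" "\<theta>2 \<in> carrier R" using C by auto
  have "Idl {} \<subseteq> {\<zero>}" by (rule genideal_minimal[OF zeroideal]) simp
  moreover have "\<zero> \<in> Idl {}"
    using additive_subgroup.zero_closed[OF ideal.axioms(1)[OF genideal_ideal[of "{}"]]] by simp
  ultimately have empty: "Idl {} = {\<zero>}" by blast
  show "r = \<zero>" if "r \<in> carrier R" "\<theta>1 \<otimes> r = \<zero>" for r
    using reg[of 0 r] that empty by simp
  have principal: "Idl {\<theta>1} = {h \<otimes> \<theta>1 | h. h \<in> carrier R}"
    using cgenideal_eq_genideal[OF C'(1)] by (auto simp: cgenideal_def)
  show "\<exists>h\<in>carrier R. r = \<theta>1 \<otimes> h" if rs: "r \<in> carrier R" "s \<in> carrier R" "\<theta>2 \<otimes> r = \<theta>1 \<otimes> s" for r s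
  proof -
    have "\<theta>2 \<otimes> r \<in> Idl {\<theta>1}" unfolding principal using rs(2,3) C' by (auto intro!: exI[of _ s] simp: m_comm)
    then have "r \<in> Idl {\<theta>1}" using reg[of 1 r] rs(1) by simp
    then obtain h where h: "h \<in> carrier R" "r = h \<otimes> \<theta>1" unfolding principal by blast
    then show ?thesis using m_comm[OF h(1) C'(1)] by blast
  qed
  show "\<theta>1 \<notin> Units R"
  proof
    assume "\<theta>1 \<in> Units R"
    moreover have "\<theta>1 \<in> Idl {\<theta>1, \<theta>2}" using genideal_self[OF C] by blast
    ultimately show False
      using ideal.I_l_closed[OF genideal_ideal[OF C], of \<theta>1 "inv \<theta>1"] proper
        ideal.one_imp_carrier[OF genideal_ideal[OF C]] by simp
  qed
qed

text \<open>Subtracting the lower bound \<open>l\<close> transfers the least number principle from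
  the naturals.\<close>

lemma int_Least:
  fixes P :: "int \<Rightarrow> bool"
  assumes "P k" and bound: "\<And>i. i < l \<Longrightarrow> \<not> P i"
  shows "P (LEAST i. P i)" "i < (LEAST i. P i) \<Longrightarrow> \<not> P i"
proof -
  obtain m where m: "P m" "\<And>i. P i \<Longrightarrow> nat (m - l) \<le> nat (i - l)"
    using ex_has_least_nat[of P k "\<lambda>i. nat (i - l)"] assms(1) by blast
  have le: "m \<le> i" if "P i" for i
  proof -
    have "l \<le> m" "l \<le> i" using bound m(1) that by (meson not_less)+
    then show ?thesis using m(2)[OF that] by simp
  qed
  have least: "(LEAST i. P i) = m" using m(1) le by (rule Least_equality)
  show "P (LEAST i. P i)" using m(1) least by simp
  show "i < (LEAST i. P i) \<Longrightarrow> \<not> P i" using le least by force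
qed

text \<open>\<open>\<theta>1\<close> is nonzero and no unit, which excludes degree 0. Everything of
  positive degree lies in the irrelevant ideal, so \<open>R\<close> itself has a gap between 0 and
  \<open>b\<close>.\<close>

lemma (in graded_algebra) indeg_irrelevant:
  assumes \<theta>: "regular_sequence R [\<theta>1, \<theta>2]" "\<theta>1 \<in> rgrade R b"
    and b: "b = initial_degree R (\<lambda>i. rgrade R i \<inter> irrelevant_ideal R)"
  shows "0 < b" "\<And>i. 0 < i \<Longrightarrow> i < b \<Longrightarrow> rgrade R i = {\<zero>}"
proof -
  note reg = regular_pair[OF \<theta>(1)]
  have nz: "\<theta>1 \<noteq> \<zero>" using reg(3)[of \<one>] one_neq_zero by auto
  have "\<not> b < 0" using nz \<theta>(2) negative_degree[of b] by blast
  moreover have "b \<noteq> 0"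
  proof
    assume "b = 0"
    then obtain c where "c \<in> K" "\<theta>1 \<otimes> c = \<one>" using \<theta>(2) nz by (auto elim: inverse_K)
    then have "\<theta>1 \<in> Units R" using reg(1) K_carrier[of c] by (auto simp: Units_def m_comm intro!: bexI[of _ c])
    then show False using reg(5) by blast
  qed
  ultimately show pos: "0 < b" by linarith
  let ?P = "\<lambda>i. rgrade R i \<inter> irrelevant_ideal R \<noteq> {\<zero>}"
  have low: "\<not> ?P i" if i: "i < 1" for i
  proof -
    have "y = \<zero>" if y: "y \<in> rgrade R i" "hc 0 y = \<zero>" for y
      using y i RG.hcomp_of_gr[OF y(1), of 0] negative_degree[of i] by (cases "i = 0") auto
    then show ?thesis using irrelevant_ideal_iff by auto
  qed
  have "?P b" using grade_irrelevant[OF \<theta>(2)] \<theta>(2) nz pos by auto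
  from int_Least(2)[of ?P, OF this low] have "\<not> ?P i" if "i < b" for i
    using that b by (simp add: initial_degree_def)
  then show "rgrade R i = {\<zero>}" if "0 < i" "i < b" for i
    using that grade_irrelevant[of _ i] by blast
qed

section \<open>Homomorphisms from the canonical module to the ring\<close>

lemma graded_self_simps:
  "carrier (graded_self R) = carrier R" "add (graded_self R) = add R" "zero (graded_self R) = \<zero>\<^bsub>R\<^esub>"
  "smult (graded_self R) = monoid.mult R" "grade (graded_self R) = rgrade R"
  by (simp_all add: graded_self_def)

context canonical_setup
begin

lemma dual_hom:
  assumes "f \<in> module_hom R \<omega> (graded_self R)"
  shows "\<And>w. w \<in> carrier \<omega> \<Longrightarrow> f w \<in> carrier R"
    and "\<And>w v. w \<in> carrier \<omega> \<Longrightarrow> v \<in> carrier \<omega> \<Longrightarrow> f (w \<oplus>\<^bsub>\<omega>\<^esub> v) = f w \<oplus> f v"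
    and "\<And>r w. r \<in> carrier R \<Longrightarrow> w \<in> carrier \<omega> \<Longrightarrow> f (r \<odot>\<^bsub>\<omega>\<^esub> w) = r \<otimes> f w"
  using assms unfolding module_hom_def graded_self_simps by blast+

context
  fixes \<tau> :: "'i set \<Rightarrow> 'e" and t0 :: int
  assumes \<tau>: "\<tau> \<in> grade \<omega> t0" and torsion_free: "torsion_free_element R \<omega> \<tau>"
begin

lemma \<tau>_carrier: "\<tau> \<in> carrier \<omega>"
  using \<tau> \<omega>_grade_carrier by blast

lemma \<tau>_free: "r \<in> carrier R \<Longrightarrow> r \<odot>\<^bsub>\<omega>\<^esub> \<tau> = \<zero>\<^bsub>\<omega>\<^esub> \<Longrightarrow> r = \<zero>"
  using torsion_free by (simp add: torsion_free_element_def)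

lemma \<tau>_cancel:
  assumes "r \<in> carrier R" "s \<in> carrier R" "r \<odot>\<^bsub>\<omega>\<^esub> \<tau> = s \<odot>\<^bsub>\<omega>\<^esub> \<tau>"
  shows "r = s"
proof -
  have "(r \<ominus> s) \<odot>\<^bsub>\<omega>\<^esub> \<tau> = r \<odot>\<^bsub>\<omega>\<^esub> \<tau> \<oplus>\<^bsub>\<omega>\<^esub> \<ominus>\<^bsub>\<omega>\<^esub> (s \<odot>\<^bsub>\<omega>\<^esub> \<tau>)"
    using assms(1,2) \<tau>_carrier by (simp add: minus_eq W.smult_l_distr W.smult_l_minus)
  then have "(r \<ominus> s) \<odot>\<^bsub>\<omega>\<^esub> \<tau> = \<zero>\<^bsub>\<omega>\<^esub>" using assms \<tau>_carrier by (simp add: W.M.r_neg)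
  then have "r \<ominus> s = \<zero>" using \<tau>_free assms(1,2) by simp
  then show ?thesis using assms(1,2) by simp
qed

text \<open>Takes the place of \<open>hpoly\<close> for inhomogeneous elements: this property passes
  to products, so the multipliers of the homogeneous summands of \<open>w\<close> can be multiplied
  together.\<close>

definition injective_on_\<omega> :: "'a \<Rightarrow> bool" where
  "injective_on_\<omega> P \<longleftrightarrow> P \<in> carrier R \<and> (\<forall>v\<in>carrier \<omega>. P \<odot>\<^bsub>\<omega>\<^esub> v = \<zero>\<^bsub>\<omega>\<^esub> \<longrightarrow> v = \<zero>\<^bsub>\<omega>\<^esub>)"

lemma injective_on_\<omega>_cancel:
  assumes P: "injective_on_\<omega> P" and C: "v \<in> carrier \<omega>" "w \<in> carrier \<omega>"
    and eq: "P \<odot>\<^bsub>\<omega>\<^esub> v = P \<odot>\<^bsub>\<omega>\<^esub> w"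
  shows "v = w"
proof -
  have PC: "P \<in> carrier R" using P by (simp add: injective_on_\<omega>_def)
  have "P \<odot>\<^bsub>\<omega>\<^esub> (v \<oplus>\<^bsub>\<omega>\<^esub> \<ominus>\<^bsub>\<omega>\<^esub> w) = P \<odot>\<^bsub>\<omega>\<^esub> v \<oplus>\<^bsub>\<omega>\<^esub> \<ominus>\<^bsub>\<omega>\<^esub> (P \<odot>\<^bsub>\<omega>\<^esub> w)"
    using PC C by (simp add: W.smult_r_distr W.smult_r_minus)
  then have "P \<odot>\<^bsub>\<omega>\<^esub> (v \<oplus>\<^bsub>\<omega>\<^esub> \<ominus>\<^bsub>\<omega>\<^esub> w) = \<zero>\<^bsub>\<omega>\<^esub>" using eq PC C by (simp add: W.M.r_neg)
  then have "v \<oplus>\<^bsub>\<omega>\<^esub> \<ominus>\<^bsub>\<omega>\<^esub> w = \<zero>\<^bsub>\<omega>\<^esub>" using P C by (simp add: injective_on_\<omega>_def)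
  then show ?thesis using C W.M.minus_equality[of v "\<ominus>\<^bsub>\<omega>\<^esub> w"] W.M.minus_minus by simp
qed

lemma injective_on_\<omega>_mult:
  assumes "injective_on_\<omega> P" "injective_on_\<omega> Q" shows "injective_on_\<omega> (P \<otimes> Q)"
  unfolding injective_on_\<omega>_def
proof (intro conjI ballI impI)
  have C: "P \<in> carrier R" "Q \<in> carrier R" using assms by (simp_all add: injective_on_\<omega>_def)
  then show "P \<otimes> Q \<in> carrier R" by simp
  fix v assume v: "v \<in> carrier \<omega>" "(P \<otimes> Q) \<odot>\<^bsub>\<omega>\<^esub> v = \<zero>\<^bsub>\<omega>\<^esub>"
  then have "P \<odot>\<^bsub>\<omega>\<^esub> (Q \<odot>\<^bsub>\<omega>\<^esub> v) = \<zero>\<^bsub>\<omega>\<^esub>" using C by (simp add: W.smult_assoc1)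
  then have "Q \<odot>\<^bsub>\<omega>\<^esub> v = \<zero>\<^bsub>\<omega>\<^esub>"
    using assms(1) W.smult_closed[OF C(2) v(1)] unfolding injective_on_\<omega>_def by blast
  then show "v = \<zero>\<^bsub>\<omega>\<^esub>" using assms(2) v(1) unfolding injective_on_\<omega>_def by blast
qed

lemma rank_one_all:
  assumes "w \<in> carrier \<omega>"
  shows "\<exists>P r. injective_on_\<omega> P \<and> r \<in> carrier R \<and> P \<odot>\<^bsub>\<omega>\<^esub> w = r \<odot>\<^bsub>\<omega>\<^esub> \<tau>"
  using assms
proof (induction rule: \<omega>_induct)
  case zero
  have "injective_on_\<omega> \<one>" by (simp add: injective_on_\<omega>_def)
  then show ?case using \<tau>_carrier by (intro exI[of _ \<one>] exI[of _ \<zero>]) simp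
next
  case (add f g n)
  then obtain P r where P: "injective_on_\<omega> P" "r \<in> carrier R" "P \<odot>\<^bsub>\<omega>\<^esub> f = r \<odot>\<^bsub>\<omega>\<^esub> \<tau>" by blast
  obtain Q s where Q: "hpoly Q" "s \<in> carrier R" "Q \<odot>\<^bsub>\<omega>\<^esub> g = s \<odot>\<^bsub>\<omega>\<^esub> \<tau>"
    using rank_one[OF \<tau> torsion_free add.hyps(2)] by blast
  have Q': "injective_on_\<omega> Q" using hpoly_closed hpoly_injective Q(1) by (simp add: injective_on_\<omega>_def)
  have "P \<in> carrier R" "Q \<in> carrier R" using P(1) Q' by (simp_all add: injective_on_\<omega>_def)
  moreover have "f \<in> carrier \<omega>" "g \<in> carrier \<omega>" using add.hyps \<omega>_grade_carrier by blast+
  ultimately have C: "P \<in> carrier R" "Q \<in> carrier R" "f \<in> carrier \<omega>" "g \<in> carrier \<omega>" .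
  have "(P \<otimes> Q) \<odot>\<^bsub>\<omega>\<^esub> f = Q \<odot>\<^bsub>\<omega>\<^esub> (P \<odot>\<^bsub>\<omega>\<^esub> f)" using C W.smult_assoc1[of Q P f] by (simp add: m_comm)
  moreover have "(P \<otimes> Q) \<odot>\<^bsub>\<omega>\<^esub> g = P \<odot>\<^bsub>\<omega>\<^esub> (Q \<odot>\<^bsub>\<omega>\<^esub> g)" using C by (simp add: W.smult_assoc1)
  ultimately have eq: "(P \<otimes> Q) \<odot>\<^bsub>\<omega>\<^esub> (f \<oplus>\<^bsub>\<omega>\<^esub> g) = (Q \<otimes> r \<oplus> P \<otimes> s) \<odot>\<^bsub>\<omega>\<^esub> \<tau>"
    using C P Q \<tau>_carrier by (simp add: W.smult_r_distr W.smult_l_distr W.smult_assoc1)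
  show ?case
    using C P(2) Q(2) by (intro exI[of _ "P \<otimes> Q"] exI[of _ "Q \<otimes> r \<oplus> P \<otimes> s"] conjI
      injective_on_\<omega>_mult[OF P(1) Q'] eq) simp
qed

text \<open>Through \<open>P w = r \<tau>\<close> the equation \<open>\<theta> w = \<zero>\<close>
  becomes \<open>\<theta> r = \<zero>\<close> in \<open>R\<close>, hence \<open>r = \<zero>\<close>,
  and \<open>P\<close> can be cancelled.\<close>

lemma regular_injective_on_\<omega>:
  assumes \<theta>: "\<theta> \<in> carrier R" and reg: "\<And>r. r \<in> carrier R \<Longrightarrow> \<theta> \<otimes> r = \<zero> \<Longrightarrow> r = \<zero>"
  shows "injective_on_\<omega> \<theta>"
  unfolding injective_on_\<omega>_def
proof (intro conjI ballI impI \<theta>)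
  fix w assume w: "w \<in> carrier \<omega>" and zero: "\<theta> \<odot>\<^bsub>\<omega>\<^esub> w = \<zero>\<^bsub>\<omega>\<^esub>"
  obtain P r where P: "injective_on_\<omega> P" "r \<in> carrier R" "P \<odot>\<^bsub>\<omega>\<^esub> w = r \<odot>\<^bsub>\<omega>\<^esub> \<tau>"
    using rank_one_all[OF w] by blast
  have PC: "P \<in> carrier R" using P(1) by (simp add: injective_on_\<omega>_def)
  have "(\<theta> \<otimes> r) \<odot>\<^bsub>\<omega>\<^esub> \<tau> = \<theta> \<odot>\<^bsub>\<omega>\<^esub> (P \<odot>\<^bsub>\<omega>\<^esub> w)" using \<theta> P \<tau>_carrier by (simp add: W.smult_assoc1)
  also have "\<dots> = P \<odot>\<^bsub>\<omega>\<^esub> (\<theta> \<odot>\<^bsub>\<omega>\<^esub> w)"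
    using \<theta> PC w W.smult_assoc1[of \<theta> P w] W.smult_assoc1[of P \<theta> w] by (simp add: m_comm)
  also have "\<dots> = \<zero>\<^bsub>\<omega>\<^esub>" using zero PC by simp
  finally have "r = \<zero>" using \<tau>_free reg P(2) \<theta> by simp
  then have "P \<odot>\<^bsub>\<omega>\<^esub> w = \<zero>\<^bsub>\<omega>\<^esub>" using P(3) \<tau>_carrier by simp
  then show "w = \<zero>\<^bsub>\<omega>\<^esub>" using P(1) w by (simp add: injective_on_\<omega>_def)
qed

text \<open>With \<open>P w = r \<tau>\<close>, both sides become \<open>r f(\<tau>) \<tau>\<close>
  after multiplication by \<open>P\<close>, and \<open>P\<close> acts injectively.\<close>

lemma dual_hom_swap:
  assumes f: "f \<in> module_hom R \<omega> (graded_self R)" and w: "w \<in> carrier \<omega>"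
  shows "f w \<odot>\<^bsub>\<omega>\<^esub> \<tau> = f \<tau> \<odot>\<^bsub>\<omega>\<^esub> w"
proof -
  obtain P r where P: "injective_on_\<omega> P" "r \<in> carrier R" "P \<odot>\<^bsub>\<omega>\<^esub> w = r \<odot>\<^bsub>\<omega>\<^esub> \<tau>"
    using rank_one_all[OF w] by blast
  have C: "P \<in> carrier R" "f w \<in> carrier R" "f \<tau> \<in> carrier R"
    using P(1) dual_hom(1)[OF f] w \<tau>_carrier by (auto simp: injective_on_\<omega>_def)
  have "P \<odot>\<^bsub>\<omega>\<^esub> (f w \<odot>\<^bsub>\<omega>\<^esub> \<tau>) = f (P \<odot>\<^bsub>\<omega>\<^esub> w) \<odot>\<^bsub>\<omega>\<^esub> \<tau>"
    using C w \<tau>_carrier dual_hom(3)[OF f] by (simp add: W.smult_assoc1)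
  also have "\<dots> = (r \<otimes> f \<tau>) \<odot>\<^bsub>\<omega>\<^esub> \<tau>" using P \<tau>_carrier dual_hom(3)[OF f] by simp
  also have "\<dots> = f \<tau> \<odot>\<^bsub>\<omega>\<^esub> (P \<odot>\<^bsub>\<omega>\<^esub> w)"
    using P C \<tau>_carrier W.smult_assoc1[of "f \<tau>" r \<tau>] by (simp add: m_comm)
  also have "\<dots> = P \<odot>\<^bsub>\<omega>\<^esub> (f \<tau> \<odot>\<^bsub>\<omega>\<^esub> w)"
    using C w W.smult_assoc1[of "f \<tau>" P w] W.smult_assoc1[of P "f \<tau>" w] by (simp add: m_comm)
  finally have eq: "P \<odot>\<^bsub>\<omega>\<^esub> (f w \<odot>\<^bsub>\<omega>\<^esub> \<tau>) = P \<odot>\<^bsub>\<omega>\<^esub> (f \<tau> \<odot>\<^bsub>\<omega>\<^esub> w)" .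
  show ?thesis by (rule injective_on_\<omega>_cancel[OF P(1) _ _ eq]) (use C w \<tau>_carrier in simp_all)
qed

lemma dual_hom_zero:
  assumes "f \<in> module_hom R \<omega> (graded_self R)" "f \<tau> = \<zero>" "w \<in> carrier \<omega>"
  shows "f w = \<zero>"
proof (rule \<tau>_free)
  show "f w \<in> carrier R" using dual_hom(1)[OF assms(1,3)] .
  show "f w \<odot>\<^bsub>\<omega>\<^esub> \<tau> = \<zero>\<^bsub>\<omega>\<^esub>" using dual_hom_swap[OF assms(1,3)] assms(2,3) by simp
qed

text \<open>If \<open>c\<close> is the inverse of \<open>f \<tau>\<close>, then
  \<open>w = c f(w) \<tau>\<close> gives injectivity of \<open>f\<close>, and
  \<open>r c \<tau>\<close> is a preimage of \<open>r\<close>.\<close>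

lemma quasi_gorenstein_unit:
  assumes f: "f \<in> hom_of_degree R \<omega> (graded_self R) n" and unit: "f \<tau> \<in> K" "f \<tau> \<noteq> \<zero>"
  shows "quasi_gorenstein R \<omega>"
proof -
  have fh: "f \<in> module_hom R \<omega> (graded_self R)" using f by (simp add: hom_of_degree_def)
  note hom = dual_hom[OF fh]
  obtain c where c: "c \<in> K" "f \<tau> \<otimes> c = \<one>" using unit by (rule inverse_K)
  have cC: "c \<in> carrier R" "f \<tau> \<in> carrier R" using c(1) unit(1) K_carrier by blast+
  have expand: "w = (c \<otimes> f w) \<odot>\<^bsub>\<omega>\<^esub> \<tau>" if w: "w \<in> carrier \<omega>" for w
  proof -
    have "(c \<otimes> f w) \<odot>\<^bsub>\<omega>\<^esub> \<tau> = c \<odot>\<^bsub>\<omega>\<^esub> (f \<tau> \<odot>\<^bsub>\<omega>\<^esub> w)"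
      using dual_hom_swap[OF fh w] cC hom(1)[OF w] \<tau>_carrier by (simp add: W.smult_assoc1)
    also have "\<dots> = (f \<tau> \<otimes> c) \<odot>\<^bsub>\<omega>\<^esub> w" using cC w by (simp add: W.smult_assoc1[symmetric] m_comm)
    finally show ?thesis using c(2) w by simp
  qed
  have "bij_betw f (carrier \<omega>) (carrier (graded_self R))"
    unfolding bij_betw_def graded_self_simps
  proof (intro conjI equalityI subsetI)
    show "inj_on f (carrier \<omega>)" using expand by (metis inj_onI)
    show "r \<in> carrier R" if "r \<in> f ` carrier \<omega>" for r using that hom(1) by auto
    show "r \<in> f ` carrier \<omega>" if r: "r \<in> carrier R" for r
    proof
      have "f ((r \<otimes> c) \<odot>\<^bsub>\<omega>\<^esub> \<tau>) = (r \<otimes> c) \<otimes> f \<tau>" using hom(3) r cC \<tau>_carrier by simp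
      also have "\<dots> = r \<otimes> (f \<tau> \<otimes> c)" using r cC by (simp add: m_ac)
      finally show "r = f ((r \<otimes> c) \<odot>\<^bsub>\<omega>\<^esub> \<tau>)" using c(2) r by simp
      show "(r \<otimes> c) \<odot>\<^bsub>\<omega>\<^esub> \<tau> \<in> carrier \<omega>" using r cC \<tau>_carrier by simp
    qed
  qed
  then show ?thesis using f by (auto simp: quasi_gorenstein_def isomorphic_up_to_shift_def)
qed

lemma quasi_gorenstein_pair:
  assumes reg: "regular_sequence R [\<theta>1, \<theta>2]" and \<theta>1: "\<theta>1 \<in> rgrade R b"
    and g1: "g1 \<in> hom_of_degree R \<omega> (graded_self R) (b - t0)" "g1 \<tau> = \<theta>1"
    and g2: "g2 \<in> hom_of_degree R \<omega> (graded_self R) (b - t0)" "g2 \<tau> = \<theta>2"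
  shows "quasi_gorenstein R \<omega>"
proof -
  note \<theta> = regular_pair[OF reg]
  have g1h: "g1 \<in> module_hom R \<omega> (graded_self R)" and g2h: "g2 \<in> module_hom R \<omega> (graded_self R)"
    using g1 g2 by (auto simp: hom_of_degree_def)
  have inj: "injective_on_\<omega> \<theta>1" by (rule regular_injective_on_\<omega>[OF \<theta>(1,3)])
  have divide: "\<exists>h. h \<in> carrier R \<and> w = h \<odot>\<^bsub>\<omega>\<^esub> \<tau> \<and> g1 w = \<theta>1 \<otimes> h" if w: "w \<in> carrier \<omega>" for w
  proof -
    have C: "g1 w \<in> carrier R" "g2 w \<in> carrier R" using dual_hom(1) g1h g2h w by blast+
    have e: "g1 w \<odot>\<^bsub>\<omega>\<^esub> \<tau> = \<theta>1 \<odot>\<^bsub>\<omega>\<^esub> w" "g2 w \<odot>\<^bsub>\<omega>\<^esub> \<tau> = \<theta>2 \<odot>\<^bsub>\<omega>\<^esub> w"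
      using dual_hom_swap[OF g1h w] dual_hom_swap[OF g2h w] g1(2) g2(2) by auto
    have "\<theta>2 \<otimes> g1 w = \<theta>1 \<otimes> g2 w"
    proof (rule \<tau>_cancel)
      have "(\<theta>2 \<otimes> g1 w) \<odot>\<^bsub>\<omega>\<^esub> \<tau> = (\<theta>2 \<otimes> \<theta>1) \<odot>\<^bsub>\<omega>\<^esub> w"
        using C e \<theta> \<tau>_carrier w by (simp add: W.smult_assoc1)
      moreover have "(\<theta>1 \<otimes> g2 w) \<odot>\<^bsub>\<omega>\<^esub> \<tau> = (\<theta>1 \<otimes> \<theta>2) \<odot>\<^bsub>\<omega>\<^esub> w"
        using C e \<theta> \<tau>_carrier w by (simp add: W.smult_assoc1)
      ultimately show "(\<theta>2 \<otimes> g1 w) \<odot>\<^bsub>\<omega>\<^esub> \<tau> = (\<theta>1 \<otimes> g2 w) \<odot>\<^bsub>\<omega>\<^esub> \<tau>"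
        using m_comm[OF \<theta>(1,2)] by simp
    qed (use C \<theta> in auto)
    then obtain h where h: "h \<in> carrier R" "g1 w = \<theta>1 \<otimes> h" using \<theta>(4)[OF C] by blast
    have eq: "\<theta>1 \<odot>\<^bsub>\<omega>\<^esub> w = \<theta>1 \<odot>\<^bsub>\<omega>\<^esub> (h \<odot>\<^bsub>\<omega>\<^esub> \<tau>)"
      using e(1) h \<theta>(1) \<tau>_carrier by (simp add: W.smult_assoc1)
    have "w = h \<odot>\<^bsub>\<omega>\<^esub> \<tau>"
      by (rule injective_on_\<omega>_cancel[OF inj w _ eq]) (use h \<tau>_carrier in simp)
    then show ?thesis using h by blast
  qed
  \<comment> \<open>The coordinate along \<open>\<tau>\<close>. It is unique because
    \<open>\<tau>\<close> is torsion-free, and linearity of \<open>F\<close> follows from this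
    uniqueness alone.\<close>
  define F where "F w = (SOME h. h \<in> carrier R \<and> w = h \<odot>\<^bsub>\<omega>\<^esub> \<tau> \<and> g1 w = \<theta>1 \<otimes> h)" for w
  have F: "F w \<in> carrier R" "w = F w \<odot>\<^bsub>\<omega>\<^esub> \<tau>" "g1 w = \<theta>1 \<otimes> F w" if "w \<in> carrier \<omega>" for w
    using someI_ex[OF divide[OF that]] unfolding F_def by blast+
  have F_eq: "F w = h" if "h \<in> carrier R" "w = h \<odot>\<^bsub>\<omega>\<^esub> \<tau>" for w h
  proof (rule \<tau>_cancel)
    have wC: "w \<in> carrier \<omega>" using that \<tau>_carrier by simp
    show "F w \<in> carrier R" using F(1)[OF wC] .
    show "F w \<odot>\<^bsub>\<omega>\<^esub> \<tau> = h \<odot>\<^bsub>\<omega>\<^esub> \<tau>" using F(2)[OF wC] that(2) by simp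
  qed (rule that(1))
  \<comment> \<open>The degree of \<open>F w\<close> is read off from
    \<open>g1 w = \<theta>1 F(w)\<close>: the regular homogeneous element \<open>\<theta>1\<close>
    can be cancelled in each component.\<close>
  have grade: "F w \<in> rgrade R (i + - t0)" if w: "w \<in> grade \<omega> i" for w i
  proof -
    have wC: "w \<in> carrier \<omega>" using w \<omega>_grade_carrier by blast
    have "g1 w \<in> rgrade R (i + (b - t0))"
      using g1(1) w by (auto simp: hom_of_degree_def graded_self_simps)
    then have deg: "\<theta>1 \<otimes> F w \<in> rgrade R (i + (b - t0))" using F(3)[OF wC] by simp
    have "hc k (F w) = \<zero>" if "k \<noteq> i - t0" for k
    proof -
      have "\<theta>1 \<otimes> hc k (F w) = hc (k + b) (\<theta>1 \<otimes> F w)" using hc_mult[OF \<theta>1 F(1)[OF wC], of "k + b"] by simp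
      also have "\<dots> = \<zero>" using RG.hcomp_of_gr[OF deg, of "k + b"] that by simp
      finally show ?thesis using \<theta>(3) F(1)[OF wC] by simp
    qed
    then have "{k. hc k (F w) \<noteq> \<zero>} \<subseteq> {i - t0}" by blast
    from RG.finsum_hcomp[OF F(1)[OF wC] _ this] have "F w = hc (i - t0) (F w)" using F(1)[OF wC] by simp
    then show ?thesis using RG.hcomp_gr[OF F(1)[OF wC], of "i - t0"] by simp
  qed
  have "F \<in> hom_of_degree R \<omega> (graded_self R) (- t0)"
    unfolding hom_of_degree_def module_hom_def graded_self_simps
  proof (intro CollectI conjI allI impI image_subsetI)
    show "F \<in> carrier \<omega> \<rightarrow> carrier R" using F(1) by auto
    show "F w \<in> rgrade R (i + - t0)" if "w \<in> grade \<omega> i" for i w using that by (rule grade)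
    fix v w assume "v \<in> carrier \<omega> \<and> w \<in> carrier \<omega>"
    then have v: "v \<in> carrier \<omega>" and w: "w \<in> carrier \<omega>" by auto
    have "v \<oplus>\<^bsub>\<omega>\<^esub> w = (F v \<oplus> F w) \<odot>\<^bsub>\<omega>\<^esub> \<tau>"
      using F(1,2)[OF v] F(1,2)[OF w] \<tau>_carrier by (simp add: W.smult_l_distr)
    then show "F (v \<oplus>\<^bsub>\<omega>\<^esub> w) = F v \<oplus> F w" using F(1)[OF v] F(1)[OF w] by (intro F_eq) auto
  next
    fix r w assume "r \<in> carrier R \<and> w \<in> carrier \<omega>"
    then have r: "r \<in> carrier R" and w: "w \<in> carrier \<omega>" by auto
    have "r \<odot>\<^bsub>\<omega>\<^esub> w = (r \<otimes> F w) \<odot>\<^bsub>\<omega>\<^esub> \<tau>"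
      using F(1,2)[OF w] r \<tau>_carrier by (simp add: W.smult_assoc1)
    then show "F (r \<odot>\<^bsub>\<omega>\<^esub> w) = r \<otimes> F w" using F(1)[OF w] r by (intro F_eq) auto
  qed
  moreover have "bij_betw F (carrier \<omega>) (carrier (graded_self R))"
    unfolding bij_betw_def graded_self_simps
  proof (intro conjI equalityI subsetI)
    show "inj_on F (carrier \<omega>)" using F(2) by (metis inj_onI)
    show "r \<in> carrier R" if "r \<in> F ` carrier \<omega>" for r using that F(1) by auto
    show "r \<in> F ` carrier \<omega>" if r: "r \<in> carrier R" for r
      using F_eq[OF r refl] r \<tau>_carrier by (intro image_eqI[of _ _ "r \<odot>\<^bsub>\<omega>\<^esub> \<tau>"]) auto
  qed
  ultimately show ?thesis by (auto simp: quasi_gorenstein_def isomorphic_up_to_shift_def)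
qed

text \<open>The set \<open>V\<close> of values at \<open>\<tau>\<close> of homomorphisms of degree
  \<open>b - t0\<close> is closed under addition, so it suffices that the component of degree
  \<open>b\<close> of each single value \<open>f w\<close> lies in \<open>V\<close>; multiples of
  values are values again, as \<open>r f(w) = f(r w)\<close>.\<close>

lemma trace_component:
  assumes low: "\<And>i. i < t0 \<Longrightarrow> grade \<omega> i = {\<zero>\<^bsub>\<omega>\<^esub>}"
    and span: "\<And>w. w \<in> grade \<omega> t0 \<Longrightarrow> \<exists>c\<in>K. w = c \<odot>\<^bsub>\<omega>\<^esub> \<tau>"
    and gap: "\<And>i. 0 < i \<Longrightarrow> i < b \<Longrightarrow> rgrade R i = {\<zero>}"
    and no_unit: "\<And>f n. f \<in> hom_of_degree R \<omega> (graded_self R) n \<Longrightarrow> f \<tau> \<in> K \<Longrightarrow> f \<tau> = \<zero>"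
    and \<theta>: "\<theta> \<in> trace_ideal R \<omega>" "\<theta> \<in> rgrade R b"
  shows "\<exists>g\<in>hom_of_degree R \<omega> (graded_self R) (b - t0). g \<tau> = \<theta>"
proof -
  let ?H = "hom_of_degree R \<omega> (graded_self R)"
  define V where "V = (\<lambda>g. g \<tau>) ` ?H (b - t0)"
  have hom: "f \<in> module_hom R \<omega> (graded_self R)" if "f \<in> ?H n" for f n
    using that by (simp add: hom_of_degree_def)
  have deg: "f w \<in> rgrade R (i + n)" if "f \<in> ?H n" "w \<in> grade \<omega> i" for f n i w
    using that by (auto simp: hom_of_degree_def graded_self_simps)
  have V_zero: "\<zero> \<in> V"
  proof -
    have "(\<lambda>_. \<zero>) \<in> ?H (b - t0)"
      by (auto simp: hom_of_degree_def module_hom_def graded_self_simps)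
    then show ?thesis by (auto simp: V_def)
  qed
  have V_add: "r \<oplus> s \<in> V" if rs: "r \<in> V" "s \<in> V" for r s
  proof -
    obtain f g where f: "f \<in> ?H (b - t0)" "r = f \<tau>" and g: "g \<in> ?H (b - t0)" "s = g \<tau>"
      using rs unfolding V_def by blast
    note F = dual_hom[OF hom[OF f(1)]] and G = dual_hom[OF hom[OF g(1)]]
    have "(\<lambda>w. f w \<oplus> g w) \<in> ?H (b - t0)"
      unfolding hom_of_degree_def module_hom_def graded_self_simps
    proof (intro CollectI conjI allI impI image_subsetI)
      show "(\<lambda>w. f w \<oplus> g w) \<in> carrier \<omega> \<rightarrow> carrier R" using F(1) G(1) by auto
      show "f v \<oplus> g v \<in> rgrade R (i + (b - t0))" if "v \<in> grade \<omega> i" for i v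
        using RG.add_gr[OF deg[OF f(1) that] deg[OF g(1) that]] .
    qed (use F G in \<open>auto simp: r_distr a_ac\<close>)
    then show ?thesis using f(2) g(2) by (auto simp: V_def)
  qed
  have V_value: "f w \<in> V" if f: "f \<in> ?H n" and w: "w \<in> grade \<omega> j" and b: "j + n = b" for f n w j
  proof (cases "f \<tau> = \<zero> \<or> w = \<zero>\<^bsub>\<omega>\<^esub>")
    case True
    have wC: "w \<in> carrier \<omega>" using w \<omega>_grade_carrier by blast
    have "f \<zero>\<^bsub>\<omega>\<^esub> = \<zero>"
      using dual_hom(3)[OF hom[OF f] zero_closed W.M.zero_closed] dual_hom(1)[OF hom[OF f] W.M.zero_closed] by simp
    then show ?thesis using True dual_hom_zero[OF hom[OF f] _ wC] V_zero by auto
  next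
    case False
    \<comment> \<open>The nonzero element \<open>f \<tau>\<close> has degree \<open>t0 + n\<close>,
      which is not 0, not negative and not in the gap below \<open>b = j + n\<close>. So
      \<open>j \<le> t0\<close>, while \<open>\<omega>\<close> has nothing below
      \<open>t0\<close>.\<close>
    have "f \<tau> \<in> rgrade R (t0 + n)" using deg[OF f \<tau>] .
    moreover have "t0 + n \<noteq> 0" using no_unit[OF f] False calculation by auto
    moreover have "\<not> t0 + n < 0" using negative_degree[of "t0 + n"] False calculation(1) by auto
    ultimately have "\<not> t0 + n < b" using gap[of "t0 + n"] False by auto
    moreover have "\<not> j < t0" using low[of j] w False by auto
    ultimately have j: "j = t0" "n = b - t0" using b by auto
    obtain c where c: "c \<in> K" "w = c \<odot>\<^bsub>\<omega>\<^esub> \<tau>" using span w j by blast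
    have cC: "c \<in> carrier R" using c(1) K_carrier by blast
    note F = dual_hom[OF hom[OF f]]
    \<comment> \<open>As \<open>w\<close> is the multiple of \<open>\<tau>\<close> by
      \<open>c\<close>, the value \<open>f w\<close> is the value at \<open>\<tau>\<close> of the
      homomorphism \<open>c f\<close>.\<close>
    have "(\<lambda>w. c \<otimes> f w) \<in> ?H (b - t0)"
      unfolding hom_of_degree_def module_hom_def graded_self_simps
    proof (intro CollectI conjI allI impI image_subsetI)
      show "(\<lambda>w. c \<otimes> f w) \<in> carrier \<omega> \<rightarrow> carrier R" using F(1) cC by auto
      show "c \<otimes> f v \<in> rgrade R (i + (b - t0))" if "v \<in> grade \<omega> i" for i v
        using smult_K[OF c(1) deg[OF f that]] j by simp
    qed (use F cC in \<open>auto simp: r_distr m_lcomm\<close>)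
    moreover have "f w = c \<otimes> f \<tau>" using c F(3) cC \<tau>_carrier by simp
    ultimately show ?thesis by (auto simp: V_def)
  qed
  have V_hc: "hc b (f w) \<in> V" if f: "f \<in> ?H n" and w: "w \<in> carrier \<omega>" for f n w
    using w
  proof (induction rule: \<omega>_induct)
    case zero
    have "f \<zero>\<^bsub>\<omega>\<^esub> = \<zero>"
      using dual_hom(3)[OF hom[OF f] zero_closed W.M.zero_closed] dual_hom(1)[OF hom[OF f] W.M.zero_closed] by simp
    then show ?case using V_zero by simp
  next
    case (add v g j)
    have gC: "g \<in> carrier \<omega>" using add.hyps(2) \<omega>_grade_carrier by blast
    note F = dual_hom[OF hom[OF f]]
    have "hc b (f g) \<in> V"
      using RG.hcomp_of_gr[OF deg[OF f add.hyps(2)], of b] V_zero V_value[OF f add.hyps(2)] by auto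
    then show ?case using F gC add.hyps(1) V_add[OF add.IH] by (simp add: RG.hcomp_add)
  qed
  let ?S = "\<Union>n. \<Union>f\<in>?H n. f ` carrier \<omega>"
  have SC: "?S \<subseteq> carrier R" using dual_hom(1) hom by blast
  have "\<theta> \<in> Idl ?S" using \<theta>(1) by (simp add: trace_ideal_def)
  with SC have "hc b \<theta> \<in> V"
  proof (induction rule: genideal_induct)
    case zero
    then show ?case using V_zero by simp
  next
    case (add r s y)
    obtain f n w where f: "f \<in> ?H n" "w \<in> carrier \<omega>" "s = f w" using add(2) by blast
    have "r \<otimes> s = f (r \<odot>\<^bsub>\<omega>\<^esub> w)" using dual_hom(3)[OF hom[OF f(1)]] f add(1) by simp
    then have "hc b (r \<otimes> s) \<in> V" using V_hc[OF f(1), of "r \<odot>\<^bsub>\<omega>\<^esub> w"] f add(1) by simp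
    moreover have "s \<in> carrier R" using SC add(2) by blast
    then have "r \<otimes> s \<in> carrier R" "y \<in> carrier R"
      using add(1) ideal.Icarr[OF genideal_ideal[OF SC] add(3)] by auto
    ultimately show ?case using V_add add.IH by (simp add: RG.hcomp_add)
  qed
  moreover have "hc b \<theta> = \<theta>" using RG.hcomp_of_gr[OF \<theta>(2), of b] by simp
  ultimately have "\<theta> \<in> V" by simp
  then obtain g where "g \<in> ?H (b - t0)" "\<theta> = g \<tau>" unfolding V_def by blast
  then show ?thesis by (intro bexI[of _ g]) simp_all
qed

lemma quasi_gorenstein_of_trace:
  assumes low: "\<And>i. i < t0 \<Longrightarrow> grade \<omega> i = {\<zero>\<^bsub>\<omega>\<^esub>}"
    and span: "\<And>w. w \<in> grade \<omega> t0 \<Longrightarrow> \<exists>c\<in>K. w = c \<odot>\<^bsub>\<omega>\<^esub> \<tau>"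
    and reg: "regular_sequence R [\<theta>1, \<theta>2]"
    and b: "b = initial_degree R (\<lambda>i. rgrade R i \<inter> \<mm>)"
    and \<theta>: "\<theta>1 \<in> trace_ideal R \<omega>" "\<theta>2 \<in> trace_ideal R \<omega>" "\<theta>1 \<in> rgrade R b" "\<theta>2 \<in> rgrade R b"
  shows "quasi_gorenstein R \<omega>"
proof (cases "\<exists>n. \<exists>f\<in>hom_of_degree R \<omega> (graded_self R) n. f \<tau> \<in> K \<and> f \<tau> \<noteq> \<zero>")
  case True
  then show ?thesis using quasi_gorenstein_unit by blast
next
  case False
  then have no_unit: "\<forall>n. \<forall>f\<in>hom_of_degree R \<omega> (graded_self R) n. f \<tau> \<in> K \<longrightarrow> f \<tau> = \<zero>" by blast
  note gap = indeg_irrelevant(2)[OF reg \<theta>(3) b]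
  have ex: "\<exists>g\<in>hom_of_degree R \<omega> (graded_self R) (b - t0). g \<tau> = \<theta>"
    if "\<theta> \<in> trace_ideal R \<omega>" "\<theta> \<in> rgrade R b" for \<theta>
    by (rule trace_component[OF low span gap _ that]) (use no_unit in blast)+
  obtain g1 where "g1 \<in> hom_of_degree R \<omega> (graded_self R) (b - t0)" "g1 \<tau> = \<theta>1"
    using ex[OF \<theta>(1,3)] by blast
  moreover obtain g2 where "g2 \<in> hom_of_degree R \<omega> (graded_self R) (b - t0)" "g2 \<tau> = \<theta>2"
    using ex[OF \<theta>(2,4)] by blast
  ultimately show ?thesis using quasi_gorenstein_pair[OF reg \<theta>(3)] by blast
qed

end

text \<open>A torsion-free element is linearly independent over \<open>K\<close>, hence a basis of a
  one-dimensional piece.\<close>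

lemma initial_span:
  assumes \<tau>: "\<tau> \<in> grade \<omega> t0" "torsion_free_element R \<omega> \<tau>"
    and fin: "vectorspace.fin_dim (R\<lparr>carrier := K\<rparr>) (\<omega>\<lparr>carrier := grade \<omega> t0\<rparr>)"
    and dim: "vectorspace.dim (R\<lparr>carrier := K\<rparr>) (\<omega>\<lparr>carrier := grade \<omega> t0\<rparr>) = 1"
    and w: "w \<in> grade \<omega> t0"
  shows "\<exists>c\<in>K. w = c \<odot>\<^bsub>\<omega>\<^esub> \<tau>"
proof -
  let ?K = "R\<lparr>carrier := K\<rparr>" and ?V = "\<omega>\<lparr>carrier := grade \<omega> t0\<rparr>"
  interpret F: field ?K by (rule field_R0)
  have "module ?K ?V"
  proof (rule moduleI)
    show "cring ?K" by (rule F.cring_axioms)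
    show "abelian_group ?V"
    proof (rule abelian_groupI)
      fix v assume v: "v \<in> carrier ?V"
      then have vC: "v \<in> carrier \<omega>" using \<omega>_grade_carrier by simp
      have "(\<ominus> \<one>) \<odot>\<^bsub>\<omega>\<^esub> v \<in> grade \<omega> t0" using \<omega>_smult_grade[OF neg_K[OF one_K], of v t0] v by simp
      moreover have "(\<ominus> \<one>) \<odot>\<^bsub>\<omega>\<^esub> v \<oplus>\<^bsub>\<omega>\<^esub> v = \<zero>\<^bsub>\<omega>\<^esub>" using vC by (simp add: W.smult_l_minus W.M.l_neg)
      ultimately show "\<exists>y\<in>carrier ?V. y \<oplus>\<^bsub>?V\<^esub> v = \<zero>\<^bsub>?V\<^esub>" by auto
    qed (use \<omega>_grade_carrier in \<open>auto simp: W.M.a_ac \<omega>_add_grade \<omega>_zero_grade\<close>)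
    show "r \<odot>\<^bsub>?V\<^esub> v \<in> carrier ?V" if "r \<in> carrier ?K" "v \<in> carrier ?V" for r v
      using \<omega>_smult_grade[of r 0 v t0] that by simp
  qed (use \<omega>_grade_carrier K_carrier in \<open>auto simp: W.smult_l_distr W.smult_r_distr W.smult_assoc1\<close>)
  then interpret V: vectorspace ?K ?V by (intro vectorspace.intro F.field_axioms)
  have single: "V.lincomb a {\<tau>} = a \<tau> \<odot>\<^bsub>\<omega>\<^esub> \<tau>" if "a \<tau> \<in> K" for a
  proof -
    have "a \<tau> \<odot>\<^bsub>?V\<^esub> \<tau> \<in> carrier ?V" using that \<tau>(1) V.smult_closed[of "a \<tau>" \<tau>] by simp
    then have "(\<Oplus>\<^bsub>?V\<^esub>v\<in>{\<tau>}. a v \<odot>\<^bsub>?V\<^esub> v) = a \<tau> \<odot>\<^bsub>?V\<^esub> \<tau>"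
      using V.M.finsum_insert[of "{}" \<tau> "\<lambda>v. a v \<odot>\<^bsub>?V\<^esub> v"] V.M.r_zero by simp
    then show ?thesis by (simp add: V.lincomb_def)
  qed
  have "V.basis {\<tau>}"
  proof (rule V.dim_li_is_basis)
    show "V.fin_dim" by (rule fin)
    show "V.dim \<le> card {\<tau>}" using dim by simp
    show "V.lin_indpt {\<tau>}"
    proof
      assume "V.lin_dep {\<tau>}"
      from V.finite_lin_dep[OF _ this] obtain a where a: "a \<tau> \<in> K" "V.lincomb a {\<tau>} = \<zero>\<^bsub>?V\<^esub>" "a \<tau> \<noteq> \<zero>"
        using \<tau>(1) by auto
      then show False using single[of a, OF a(1)] \<tau>_free[OF \<tau> K_carrier[OF a(1)]] by simp
    qed
  qed (use \<tau>(1) in auto)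
  then have "w \<in> V.span {\<tau>}" using w by (simp add: V.basis_def)
  then obtain a A where a: "w = V.lincomb a A" "A \<subseteq> {\<tau>}" "a \<in> A \<rightarrow> K" by (auto simp: V.span_def)
  show ?thesis
  proof (cases "A = {}")
    case True
    then have "w = \<zero> \<odot>\<^bsub>\<omega>\<^esub> \<tau>" using a(1) \<tau>_carrier[OF \<tau>] by (simp add: V.lincomb_def)
    then show ?thesis using zero_K by blast
  next
    case False
    then have "A = {\<tau>}" using a(2) by blast
    then show ?thesis using a single[of a] by auto
  qed
qed

lemma below_initial_degree:
  assumes \<tau>: "\<tau> \<in> grade \<omega> (initial_degree \<omega> (grade \<omega>))" "torsion_free_element R \<omega> \<tau>"
    and i: "i < initial_degree \<omega> (grade \<omega>)"
  shows "grade \<omega> i = {\<zero>\<^bsub>\<omega>\<^esub>}"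
proof -
  obtain l where l: "\<And>i. i < l \<Longrightarrow> grade \<omega> i = {\<zero>\<^bsub>\<omega>\<^esub>}" using bounded_below by blast
  have "\<tau> \<noteq> \<zero>\<^bsub>\<omega>\<^esub>" using \<tau>_free[OF \<tau>, of \<one>] one_neq_zero by auto
  then have "grade \<omega> (initial_degree \<omega> (grade \<omega>)) \<noteq> {\<zero>\<^bsub>\<omega>\<^esub>}" using \<tau>(1) by auto
  from int_Least(2)[of "\<lambda>i. grade \<omega> i \<noteq> {\<zero>\<^bsub>\<omega>\<^esub>}", OF this, of l i] l i show ?thesis
    by (auto simp: initial_degree_def)
qed

end

theorem theorem3p7:
  fixes R :: "'a graded_ring"
    and I :: "nat \<Rightarrow> ('a, 'i) graded_module"
    and \<epsilon> :: "'a \<Rightarrow> 'i" and \<delta> :: "nat \<Rightarrow> 'i \<Rightarrow> 'i"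
    and E :: "('a, 'e) graded_module" and \<iota> :: "'a set \<Rightarrow> 'e"
    and \<omega> :: "('a, 'i set \<Rightarrow> 'e) graded_module"
  assumes "nonneg_graded_ring R"
    and "noetherian_ring R"
    and "field (R\<lparr>carrier := rgrade R 0\<rparr>)"
    and "graded_injective_resolution R (graded_self R) I \<epsilon> \<delta>"
    and "graded_injective_envelope R (residue_module R) E \<iota>"
    and "\<omega> = graded_canonical_module R I \<delta> E"
    and "generically_gorenstein TYPE('g) R"
    and "\<exists>x \<in> grade \<omega> (- a_invariant \<omega>). torsion_free_element R \<omega> x"
    and "\<exists>\<theta>1 \<theta>2. regular_sequence R [\<theta>1, \<theta>2] \<and>
           {\<theta>1, \<theta>2} \<subseteq> trace_ideal R \<omega> \<inter>
             rgrade R (initial_degree R (\<lambda>i. rgrade R i \<inter> irrelevant_ideal R))"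
    and "vectorspace.fin_dim (R\<lparr>carrier := rgrade R 0\<rparr>)
           (\<omega>\<lparr>carrier := grade \<omega> (- a_invariant \<omega>)\<rparr>)"
    and "vectorspace.dim (R\<lparr>carrier := rgrade R 0\<rparr>)
           (\<omega>\<lparr>carrier := grade \<omega> (- a_invariant \<omega>)\<rparr>) = 1"
  shows "quasi_gorenstein R \<omega>"
proof -
  interpret graded_algebra R
    using assms(1-3) by (simp add: graded_algebra_def graded_algebra_axioms_def)
  show ?thesis
  proof (rule krull_dim_finite)
    fix d assume d: "krull_dim R = enat d"
      "\<And>n p. \<lbrakk>\<forall>i\<le>n. primeideal (p i) R; \<forall>i<n. p i \<subset> p (Suc i)\<rbrakk> \<Longrightarrow> n \<le> d"
    show ?thesis
    proof (rule parameters)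
      show "n \<le> d" if "\<forall>i\<le>n. primeideal (p i) R" "\<forall>i<n. p i \<subset> p (Suc i)" for n and p :: "nat \<Rightarrow> 'a set"
        using that by (rule d(2))
      \<comment> \<open>There are exactly \<open>d = dim R\<close> parameters, so that iterated
        torsion computes the local cohomology in the very degree that defines
        \<open>\<omega>\<close>.\<close>
      fix x D N assume system: "hsys x D d" "\<And>e. N \<le> e \<Longrightarrow> rgrade R (int e) \<subseteq> Idl\<^bsub>R\<^esub> (x ` {..<d})"
      interpret canonical_setup R I \<epsilon> \<delta> x D d N E \<iota> \<omega>
        by unfold_locales (use assms(4-6) d(1) system in auto)
      let ?t0 = "initial_degree \<omega> (grade \<omega>)"
      have a: "- a_invariant \<omega> = ?t0" by (simp add: a_invariant_def)
      obtain \<tau> where \<tau>: "\<tau> \<in> grade \<omega> ?t0" "torsion_free_element R \<omega> \<tau>" using assms(8) a by auto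
      obtain \<theta>1 \<theta>2 where \<theta>: "regular_sequence R [\<theta>1, \<theta>2]"
        "\<theta>1 \<in> trace_ideal R \<omega>" "\<theta>2 \<in> trace_ideal R \<omega>"
        "\<theta>1 \<in> rgrade R (initial_degree R (\<lambda>i. rgrade R i \<inter> irrelevant_ideal R))"
        "\<theta>2 \<in> rgrade R (initial_degree R (\<lambda>i. rgrade R i \<inter> irrelevant_ideal R))"
        using assms(9) by auto
      show ?thesis
        by (rule quasi_gorenstein_of_trace[OF \<tau> below_initial_degree[OF \<tau>]
              initial_span[OF \<tau> assms(10,11)[unfolded a]] \<theta>(1) refl \<theta>(2-5)])
    qed
  qed
qed

end
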